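(* Let $\mathbb{B}$ be the weighted adjacency matrix of the line graph of a countable, simple, locally finite, weighted directed graph with edge index set $J$, and let $X=L^{\infty}([0,1],\ell^1)$. Let $(c_j)_{j\in J}$ be real numbers such that $0<c_{\min}\le c_j\le c_{\max}<\infty$ for all $j\in J$ (for some constants $c_{\min},c_{\max}$), and assume there exists $0<c\in\mathbb{R}$ such that $\frac{c}{c_j}\in\mathbb{N}$ for all $j\in J$. Let $C=\mathrm{diag}(c_j)_{j\in J}$, $\mathbb{B}^C=C^{-1}\mathbb{B}C$, and let $q=(q_j)_{j\in J}\in L^{\infty}([0,1],\ell^{\infty})$. Then the operator $(A,D(A))$ on $X$ given by $$A:=\mathrm{diag}\left(c_j\cdot\frac{d}{dx}+M_{q_j}\right),\qquad D(A):=\left\{f\in W^{1,\infty}([0,1],\ell^1)\mid f(1)=\mathbb{B}^Cf(0)\right\},$$ where $M_{q_j}$ denotes multiplication by the function $q_j$, generates a bi-continuous semigroup on $X$ with respect to the weak$^*$-topology.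
   Context: **Graph.** $G=(V,E)$ is a directed graph with vertices $V=\{v_i\mid i\in I\}$ and edges $E=\{e_j\mid j\in J\}\subseteq V\times V$, where $I,J\subseteq\mathbb{N}$. For an edge $(v_i,v_k)$, $v_i$ is its tail and $v_k$ its head. $G$ is simple (no loops or multiple edges) and locally finite (each vertex is incident with only finitely many edges). It carries weights $0\le w_{ij}\le 1$ ($i,j\in J$), with $w_{ij}\ne 0$ only if the head of $e_j$ is the tail of $e_i$, such that $\sum_{i\in J}w_{ij}=1$ for all $j\in J$. The matrix $\mathbb{B}=(\mathbb{B}_{ij})_{i,j\in J}$ is defined by $\mathbb{B}_{ij}=w_{ij}$ if the head of $e_j$ is the tail of $e_i$, and $\mathbb{B}_{ij}=0$ otherwise. It acts as a (column-)stochastic operator on $\ell^1=\ell^1(J)$; also $\ell^\infty=\ell^\infty(J)$. **Space.** $X=L^\infty([0,1],\ell^1)$ (Bochner space) has norm $\|f\|_X=\operatorname{ess\,sup}_{s\in[0,1]}\|f(s)\|_{\ell^1}$. It is identified with the dual of $L^1([0,1],c_0)$, $c_0=c_0(J)$, via $\langle f,g\rangle=\int_0^1\langle f(s),g(s)\rangle\,ds$; the weak$^*$-topology on $X$ is the one induced by this duality. $W^{1,\infty}([0,1],\ell^1)$ is the Sobolev space of functions in $X$ with weak derivative in $X$, evaluated at points through continuous representatives. The operator $A$ maps $(f_j)_{j\in J}$ to $(c_jf_j'+q_jf_j)_{j\in J}$. **Bi-continuous semigroups.** Let $X$ be a Banach space and $\tau$ a locally convex Hausdorff topology on $X$, coarser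 than the norm topology, sequentially complete on norm-bounded sets, and such that $(X,\tau)'$ is norming for $X$. A family $(T(t))_{t\ge0}$ of bounded linear operators is a bi-continuous semigroup (with respect to $\tau$) if: (i) $T(0)=I$ and $T(t+s)=T(t)T(s)$ for all $s,t\ge0$; (ii) $t\mapsto T(t)f$ is continuous from $[0,\infty)$ to $(X,\tau)$ for every $f\in X$; (iii) there are $M\ge1$, $\omega\in\mathbb{R}$ with $\|T(t)\|\le Me^{\omega t}$ for all $t\ge0$; (iv) for every norm-bounded sequence $(f_n)$ that is $\tau$-convergent to $0$, $T(s)f_n\to0$ in $\tau$ uniformly for $s\in[0,t_0]$, for each $t_0\ge0$. Its generator is $Af:=\tau\text{-}\lim_{t\to0}\frac{T(t)f-f}{t}$ with domain consisting of all $f\in X$ for which this limit exists and $\sup_{t\in(0,1]}\frac{\|T(t)f-f\|}{t}<\infty$. *)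

theory Defs
  imports
    "HOL-Analysis.Analysis"
    "HOL-Probability.Essential_Supremum"
    "Graph_Theory.Digraph"
begin

text \<open>
  All sequence spaces are taken over the index set \<open>\<nat>\<close>; for \<open>J \<subseteq> \<nat>\<close> the spaces
  \<open>\<ell>\<^sup>1(J)\<close>, \<open>\<ell>\<^sup>\<infinity>(J)\<close> and \<open>c\<^sub>0(J)\<close> are the closed subspaces of sequences vanishing off \<open>J\<close>
  (see \<open>l1_space\<close>, \<open>linf_space\<close>, \<open>c0_space\<close> below).  The scalar type \<open>'k\<close> is later constrained
  to \<open>{real_normed_field, euclidean_space}\<close>, which covers \<open>\<real>\<close> and \<open>\<complex>\<close>.
\<close>

typedef (overloaded) 'k l1 = "{x :: nat \<Rightarrow> 'k::real_normed_vector. summable (\<lambda>n. norm (x n))}"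
  morphisms l1_nth Abs_l1
  by (rule exI[of _ "\<lambda>_. 0"]) simp

setup_lifting type_definition_l1

lemma summable_norm_plus_minus:
  fixes x y :: "nat \<Rightarrow> 'k::real_normed_vector"
  assumes "summable (\<lambda>n. norm (x n))" "summable (\<lambda>n. norm (y n))"
  shows "summable (\<lambda>n. norm (x n + y n))" "summable (\<lambda>n. norm (x n - y n))"
proof -
  note s = summable_add[OF assms]
  show "summable (\<lambda>n. norm (x n + y n))"
    by (rule summable_comparison_test'[OF s, of 0]) (simp add: norm_triangle_ineq)
  show "summable (\<lambda>n. norm (x n - y n))"
    by (rule summable_comparison_test'[OF s, of 0]) (simp add: norm_triangle_ineq4)
qed

lemma summable_l1_nth: "summable (\<lambda>n. norm (l1_nth x n))"
  using l1_nth[of x] by simp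

lemma l1_eqI: "(\<And>n. l1_nth x n = l1_nth y n) \<Longrightarrow> x = y"
  by (simp add: l1_nth_inject[symmetric] fun_eq_iff)

instantiation l1 :: (real_normed_vector) real_normed_vector
begin

lift_definition zero_l1 :: "'a l1" is "\<lambda>_. 0" by simp

lift_definition plus_l1 :: "'a l1 \<Rightarrow> 'a l1 \<Rightarrow> 'a l1" is "\<lambda>x y n. x n + y n"
  by (rule summable_norm_plus_minus)

lift_definition minus_l1 :: "'a l1 \<Rightarrow> 'a l1 \<Rightarrow> 'a l1" is "\<lambda>x y n. x n - y n"
  by (rule summable_norm_plus_minus)

lift_definition uminus_l1 :: "'a l1 \<Rightarrow> 'a l1" is "\<lambda>x n. - x n" by simp

lift_definition scaleR_l1 :: "real \<Rightarrow> 'a l1 \<Rightarrow> 'a l1" is "\<lambda>r x n. r *\<^sub>R x n"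
  by (simp add: summable_mult)

lift_definition norm_l1 :: "'a l1 \<Rightarrow> real" is "\<lambda>x. \<Sum>n. norm (x n)" .

definition "dist_l1 (x::'a l1) y = norm (x - y)"
definition "sgn_l1 (x::'a l1) = scaleR (inverse (norm x)) x"
definition "(uniformity :: ('a l1 \<times> 'a l1) filter) = (INF e\<in>{0<..}. principal {(x, y). dist x y < e})"
definition "open (U :: 'a l1 set) = (\<forall>x\<in>U. \<forall>\<^sub>F (x', y) in uniformity. x' = x \<longrightarrow> y \<in> U)"

instance
proof
  fix x y z :: "'a l1" and a b :: real and U :: "'a l1 set"
  show "dist x y = norm (x - y)" by (rule dist_l1_def)
  show "sgn x = scaleR (inverse (norm x)) x" by (rule sgn_l1_def)
  show "uniformity = (INF e\<in>{0<..}. principal {(x::'a l1, y). dist x y < e})"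
    by (rule uniformity_l1_def)
  show "open U = (\<forall>x\<in>U. \<forall>\<^sub>F (x', y) in uniformity. x' = x \<longrightarrow> y \<in> U)"
    by (rule open_l1_def)
  show "x + y + z = x + (y + z)" "x + y = y + x" "0 + x = x" "- x + x = 0" "x - y = x + - y"
    by (transfer; simp add: fun_eq_iff)+
  show "a *\<^sub>R (x + y) = a *\<^sub>R x + a *\<^sub>R y" "(a + b) *\<^sub>R x = a *\<^sub>R x + b *\<^sub>R x"
    "a *\<^sub>R b *\<^sub>R x = (a * b) *\<^sub>R x" "1 *\<^sub>R x = x"
    by (transfer; simp add: fun_eq_iff algebra_simps)+
  show "norm x = 0 \<longleftrightarrow> x = 0"
    by transfer (auto simp: suminf_eq_zero_iff)
  show "norm (x + y) \<le> norm x + norm y"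
  proof transfer
    fix x y :: "nat \<Rightarrow> 'a"
    assume s: "summable (\<lambda>n. norm (x n))" "summable (\<lambda>n. norm (y n))"
    have t: "summable (\<lambda>n. norm (x n + y n))" by (rule summable_norm_plus_minus[OF s])
    have "(\<Sum>n. norm (x n + y n)) \<le> (\<Sum>n. norm (x n) + norm (y n))"
      by (rule suminf_le[OF norm_triangle_ineq t summable_add[OF s]])
    then show "(\<Sum>n. norm (x n + y n)) \<le> (\<Sum>n. norm (x n)) + (\<Sum>n. norm (y n))"
      by (simp add: suminf_add[OF s])
  qed
  show "norm (a *\<^sub>R x) = \<bar>a\<bar> * norm x"
    by transfer (simp add: suminf_mult)
qed

end

lemma l1_nth_simps [simp]:
  "l1_nth 0 n = 0" "l1_nth (x + y) n = l1_nth x n + l1_nth y n"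
  "l1_nth (x - y) n = l1_nth x n - l1_nth y n" "l1_nth (r *\<^sub>R x) n = r *\<^sub>R l1_nth x n"
  "l1_nth (- x) n = - l1_nth x n"
  by (simp_all add: zero_l1.rep_eq plus_l1.rep_eq minus_l1.rep_eq scaleR_l1.rep_eq uminus_l1.rep_eq)

lemma sum_norm_l1_le: "(\<Sum>n<N. norm (l1_nth x n)) \<le> norm x"
  unfolding norm_l1.rep_eq by (rule sum_le_suminf) (auto simp: summable_l1_nth)

lemma norm_l1_nth_le: "norm (l1_nth x n) \<le> norm x"
proof -
  have "norm (l1_nth x n) \<le> (\<Sum>n<Suc n. norm (l1_nth x n))"
    by (simp add: sum_nonneg)
  also have "\<dots> \<le> norm x" by (rule sum_norm_l1_le)
  finally show ?thesis .
qed

lemma l1_boundedI: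
  assumes "\<And>N. (\<Sum>n<N. norm (x n)) \<le> C"
  shows "summable (\<lambda>n. norm (x n))" "(\<Sum>n. norm (x n)) \<le> C"
proof -
  show s: "summable (\<lambda>n. norm (x n))"
    by (rule bounded_imp_summable[where B = C])
       (use assms[of "Suc _"] in \<open>auto simp: lessThan_Suc_atMost\<close>)
  show "(\<Sum>n. norm (x n)) \<le> C" by (rule suminf_le_const[OF s assms])
qed

instance l1 :: (banach) banach
proof
  fix X :: "nat \<Rightarrow> 'a l1"
  assume X: "Cauchy X"
  have "Cauchy (\<lambda>m. l1_nth (X m) n)" for n
  proof (rule CauchyI)
    fix e :: real assume "0 < e"
    then obtain M where M: "\<And>m k. m \<ge> M \<Longrightarrow> k \<ge> M \<Longrightarrow> norm (X m - X k) < e"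
      using CauchyD[OF X] by blast
    have "norm (l1_nth (X m) n - l1_nth (X k) n) < e" if "m \<ge> M" "k \<ge> M" for m k
      using norm_l1_nth_le[of "X m - X k" n] M[OF that] by simp
    then show "\<exists>M. \<forall>m\<ge>M. \<forall>k\<ge>M. norm (l1_nth (X m) n - l1_nth (X k) n) < e" by blast
  qed
  then have "\<forall>n. \<exists>L. (\<lambda>m. l1_nth (X m) n) \<longlonglongrightarrow> L"
    unfolding Cauchy_convergent_iff convergent_def by simp
  then obtain y where y: "\<And>n. (\<lambda>m. l1_nth (X m) n) \<longlonglongrightarrow> y n"
    using choice[of "\<lambda>n L. (\<lambda>m. l1_nth (X m) n) \<longlonglongrightarrow> L"] by blast
  have *: "\<exists>M. \<forall>m\<ge>M. \<forall>N. (\<Sum>n<N. norm (l1_nth (X m) n - y n)) \<le> e" if e: "e > 0" for e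
  proof -
    obtain M where M: "\<And>m k. m \<ge> M \<Longrightarrow> k \<ge> M \<Longrightarrow> norm (X m - X k) < e"
      using CauchyD[OF X e] by blast
    have "(\<Sum>n<N. norm (l1_nth (X m) n - y n)) \<le> e" if m: "m \<ge> M" for m N
    proof (rule LIMSEQ_le_const2)
      show "(\<lambda>k. \<Sum>n<N. norm (l1_nth (X m) n - l1_nth (X k) n))
              \<longlonglongrightarrow> (\<Sum>n<N. norm (l1_nth (X m) n - y n))"
        by (intro tendsto_intros y)
      have "(\<Sum>n<N. norm (l1_nth (X m) n - l1_nth (X k) n)) \<le> e" if "k \<ge> M" for k
        using sum_norm_l1_le[of "X m - X k" N] M[OF m that] by simp
      then show "\<exists>K. \<forall>k\<ge>K. (\<Sum>n<N. norm (l1_nth (X m) n - l1_nth (X k) n)) \<le> e" by blast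
    qed
    then show ?thesis by blast
  qed
  from *[of 1] obtain M where M: "\<And>N. (\<Sum>n<N. norm (l1_nth (X M) n - y n)) \<le> 1"
    by auto
  have "(\<Sum>n<N. norm (y n)) \<le> norm (X M) + 1" for N
  proof -
    have "(\<Sum>n<N. norm (y n)) \<le> (\<Sum>n<N. norm (l1_nth (X M) n) + norm (l1_nth (X M) n - y n))"
      by (rule sum_mono) (simp add: norm_triangle_sub norm_minus_commute)
    also have "\<dots> \<le> norm (X M) + 1"
      using M[of N] sum_norm_l1_le[of "X M" N] by (simp add: sum.distrib)
    finally show ?thesis .
  qed
  then have sy: "summable (\<lambda>n. norm (y n))" by (rule l1_boundedI)
  define Y where "Y = Abs_l1 y"
  have Y: "l1_nth Y = y" unfolding Y_def by (rule Abs_l1_inverse) (simp add: sy)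
  have "X \<longlonglongrightarrow> Y"
  proof (rule LIMSEQ_I)
    fix r :: real assume "0 < r"
    then obtain M where M: "\<And>m N. m \<ge> M \<Longrightarrow> (\<Sum>n<N. norm (l1_nth (X m) n - y n)) \<le> r / 2"
      using *[of "r / 2"] by auto
    have "norm (X m - Y) \<le> r / 2" if "m \<ge> M" for m
      unfolding norm_l1.rep_eq by (rule l1_boundedI(2)) (use M[OF that] in \<open>simp add: Y\<close>)
    with \<open>0 < r\<close> show "\<exists>M. \<forall>m\<ge>M. norm (X m - Y) < r" by fastforce
  qed
  then show "convergent X" by (auto simp: convergent_def)
qed

instance l1 :: ("{real_normed_vector, second_countable_topology}") second_countable_topology
proof
  obtain D :: "'a set" where D: "countable D" "\<And>U. open U \<Longrightarrow> U \<noteq> {} \<Longrightarrow> \<exists>d\<in>D. d \<in> U"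
    using countable_dense_setE by blast
  define F where "F = (\<lambda>xs. Abs_l1 (\<lambda>n. if n < length xs then xs ! n else (0::'a)))"
  have F: "l1_nth (F xs) n = (if n < length xs then xs ! n else 0)" for xs n
    unfolding F_def
    by (subst Abs_l1_inverse)
       (auto intro!: summable_finite[of "{..<length xs}"] split: if_splits)
  define E where "E = F ` lists D"
  have cE: "countable E" unfolding E_def by (intro countable_image countable_lists D)
  have dense: "\<exists>z\<in>E. norm (x - z) < e" if e: "e > 0" for x e
  proof -
    obtain N where N: "norm (\<Sum>n. norm (l1_nth x (n + N))) < e / 2"
      using suminf_exist_split[OF _ summable_l1_nth[of x], of "e / 2"] e by auto
    have "\<exists>d\<in>D. norm (l1_nth x n - d) < e / (2 * (real N + 1))" for n
    proof -
      have "l1_nth x n \<in> ball (l1_nth x n) (e / (2 * (real N + 1)))" using e by simp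
      then show ?thesis
        using D(2)[of "ball (l1_nth x n) (e / (2 * (real N + 1)))"]
        by (metis empty_iff open_ball mem_ball dist_norm)
    qed
    then obtain d where d: "\<And>n. d n \<in> D" "\<And>n. norm (l1_nth x n - d n) < e / (2 * (real N + 1))"
      by metis
    let ?z = "F (map d [0..<N])"
    have z: "?z \<in> E" unfolding E_def using d(1) by (intro imageI) auto
    have zn: "l1_nth ?z n = (if n < N then d n else 0)" for n by (simp add: F)
    have "norm (x - ?z) = (\<Sum>n. norm (l1_nth (x - ?z) (n + N))) + (\<Sum>n<N. norm (l1_nth (x - ?z) n))"
      unfolding norm_l1.rep_eq by (rule suminf_split_initial_segment[OF summable_l1_nth])
    moreover have "(\<Sum>n. norm (l1_nth (x - ?z) (n + N))) = (\<Sum>n. norm (l1_nth x (n + N)))"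
      by (simp add: zn)
    moreover have "(\<Sum>n<N. norm (l1_nth (x - ?z) n)) \<le> (\<Sum>n<N. e / (2 * (real N + 1)))"
      using d(2) by (intro sum_mono) (auto simp: zn less_imp_le)
    moreover have "(\<Sum>n<N. e / (2 * (real N + 1))) \<le> e / 2" using e by (simp add: field_simps)
    moreover have "(\<Sum>n. norm (l1_nth x (n + N))) < e / 2"
      using N unfolding real_norm_def by linarith
    ultimately have "norm (x - ?z) < e" by linarith
    with z show ?thesis by blast
  qed
  define B where "B = (\<lambda>(z, k). ball z (1 / real (Suc k))) ` (E \<times> (UNIV :: nat set))"
  have cB: "countable B" unfolding B_def by (intro countable_image countable_SIGMA cE) auto
  have "topological_basis B"
  proof (rule topological_basisI)
    fix b assume "b \<in> B" then show "open b" by (auto simp: B_def)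
  next
    fix U and x :: "'a l1" assume U: "open U" "x \<in> U"
    then obtain e where e: "e > 0" "ball x e \<subseteq> U" using open_contains_ball by blast
    then obtain k where k: "1 / real (Suc k) < e / 2"
      by (metis half_gt_zero nat_approx_posE)
    obtain z where z: "z \<in> E" "norm (x - z) < 1 / real (Suc k)" using dense[of "1 / real (Suc k)"] by auto
    have "ball z (1 / real (Suc k)) \<subseteq> ball x e"
    proof
      fix w assume "w \<in> ball z (1 / real (Suc k))"
      then have "dist z w < 1 / real (Suc k)" by simp
      moreover have "dist x z < 1 / real (Suc k)" using z by (simp add: dist_norm)
      ultimately show "w \<in> ball x e" using k dist_triangle[of x w z] by simp
    qed
    with e z show "\<exists>b\<in>B. x \<in> b \<and> b \<subseteq> U"
      by (intro bexI[of _ "ball z (1 / real (Suc k))"]) (auto simp: B_def dist_norm norm_minus_commute)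
  qed
  with cB show "\<exists>B :: 'a l1 set set. countable B \<and> open = generate_topology B"
    using topological_basis_imp_subbasis by blast
qed

text \<open>
  Bochner measurability: an almost everywhere limit of simple functions.  For a non-separable
  range such as \<open>\<ell>\<^sup>\<infinity>\<close> this is stronger than Borel measurability.
\<close>

definition strongly_measurable :: "'a measure \<Rightarrow> ('a \<Rightarrow> 'b::topological_space) \<Rightarrow> bool" where
  "strongly_measurable M f \<longleftrightarrow>
     (\<exists>s. (\<forall>n. simple_function M (s n)) \<and> (AE x in M. (\<lambda>n. s n x) \<longlonglongrightarrow> f x))"

abbreviation unit_interval_measure :: "real measure" where
  "unit_interval_measure \<equiv> lebesgue_on {0..1}"

lemma strongly_measurable_compose2:
  fixes f g :: "'a \<Rightarrow> 'b::t2_space" and h :: "'b \<Rightarrow> 'b \<Rightarrow> 'c::topological_space"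
  assumes "strongly_measurable M f" "strongly_measurable M g"
    and "continuous_on UNIV (\<lambda>(x, y). h x y)"
  shows "strongly_measurable M (\<lambda>x. h (f x) (g x))"
proof -
  obtain s t where s: "\<And>n. simple_function M (s n)" "AE x in M. (\<lambda>n. s n x) \<longlonglongrightarrow> f x"
    and t: "\<And>n. simple_function M (t n)" "AE x in M. (\<lambda>n. t n x) \<longlonglongrightarrow> g x"
    using assms unfolding strongly_measurable_def by blast
  have "AE x in M. (\<lambda>n. h (s n x) (t n x)) \<longlonglongrightarrow> h (f x) (g x)"
    using s(2) t(2)
  proof eventually_elim
    case (elim x)
    have "(\<lambda>n. (s n x, t n x)) \<longlonglongrightarrow> (f x, g x)" using elim by (rule tendsto_Pair)
    moreover have "isCont (\<lambda>(x, y). h x y) (f x, g x)"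
      using assms(3) by (simp add: continuous_on_eq_continuous_at)
    ultimately show ?case using isCont_tendsto_compose by fastforce
  qed
  with s(1) t(1) show ?thesis unfolding strongly_measurable_def
    by (intro exI[of _ "\<lambda>n x. h (s n x) (t n x)"]) (auto intro: simple_function_compose2)
qed

lemma borel_measurable_LIMSEQ_AE_lebesgue_on:
  fixes f :: "'a::euclidean_space \<Rightarrow> real"
  assumes S: "S \<in> sets lebesgue"
    and u: "\<And>n. u n \<in> borel_measurable (lebesgue_on S)"
    and lim: "AE x in lebesgue_on S. (\<lambda>n. u n x) \<longlonglongrightarrow> f x"
  shows "f \<in> borel_measurable (lebesgue_on S)"
proof -
  obtain N where N: "N \<in> null_sets (lebesgue_on S)"
      "{x \<in> space (lebesgue_on S). \<not> (\<lambda>n. u n x) \<longlonglongrightarrow> f x} \<subseteq> N"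
    using lim unfolding eventually_ae_filter by blast
  have "f \<in> borel_measurable (lebesgue_on (S - N))"
  proof (rule borel_measurable_LIMSEQ_real)
    show "u n \<in> borel_measurable (lebesgue_on (S - N))" for n
      using u borel_measurable_diff_null[OF N(1) S] by blast
    show "(\<lambda>n. u n x) \<longlonglongrightarrow> f x" if "x \<in> space (lebesgue_on (S - N))" for x
      using that N(2) by auto
  qed
  then show ?thesis using borel_measurable_diff_null[OF N(1) S] by blast
qed

lemma strongly_measurable_norm:
  fixes f :: "real \<Rightarrow> 'b::real_normed_vector"
  assumes "strongly_measurable unit_interval_measure f"
  shows "(\<lambda>s. norm (f s)) \<in> borel_measurable unit_interval_measure"
proof -
  obtain s where s: "\<And>n. simple_function unit_interval_measure (s n)"
      "AE x in unit_interval_measure. (\<lambda>n. s n x) \<longlonglongrightarrow> f x"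
    using assms unfolding strongly_measurable_def by blast
  show ?thesis
  proof (rule borel_measurable_LIMSEQ_AE_lebesgue_on)
    show "(\<lambda>x. norm (s n x)) \<in> borel_measurable unit_interval_measure" for n
      by (rule borel_measurable_simple_function) (rule simple_function_compose1[OF s(1)])
    show "AE x in unit_interval_measure. (\<lambda>n. norm (s n x)) \<longlonglongrightarrow> norm (f x)"
      using s(2) by eventually_elim (rule tendsto_norm)
  qed simp
qed


definition Linf_functions :: "(real \<Rightarrow> 'b::real_normed_vector) set" where
  "Linf_functions = {f. strongly_measurable unit_interval_measure f \<and>
     (\<exists>C. AE s in unit_interval_measure. norm (f s) \<le> C)}"

definition ess_norm :: "(real \<Rightarrow> 'b::real_normed_vector) \<Rightarrow> real" where
  "ess_norm f = real_of_ereal (esssup unit_interval_measure (\<lambda>s. ereal (norm (f s))))"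

definition Linf_rel :: "(real \<Rightarrow> 'b::real_normed_vector) \<Rightarrow> (real \<Rightarrow> 'b) \<Rightarrow> bool" where
  "Linf_rel f g \<longleftrightarrow> f \<in> Linf_functions \<and> g \<in> Linf_functions \<and>
     (AE s in unit_interval_measure. f s = g s)"

lemma emeasure_unit_interval: "emeasure unit_interval_measure (space unit_interval_measure) \<noteq> 0"
  by (simp add: emeasure_restrict_space)

lemma AE_unit_interval_const [simp]: "(AE s in unit_interval_measure. P) \<longleftrightarrow> P"
  using emeasure_unit_interval by (simp add: eventually_const_iff ae_filter_eq_bot_iff)

lemma
  assumes "f \<in> Linf_functions"
  shows AE_norm_le_ess_norm: "AE s in unit_interval_measure. norm (f s) \<le> ess_norm f" (is ?A)
    and ess_norm_le: "(AE s in unit_interval_measure. norm (f s) \<le> C) \<Longrightarrow> ess_norm f \<le> C" (is "_ \<Longrightarrow> ?B")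
    and ess_norm_nonneg: "ess_norm f \<ge> 0" (is ?C)
proof -
  let ?e = "esssup unit_interval_measure (\<lambda>s. ereal (norm (f s)))"
  have m: "(\<lambda>s. ereal (norm (f s))) \<in> borel_measurable unit_interval_measure"
    using assms by (intro borel_measurable_ereal strongly_measurable_norm) (simp add: Linf_functions_def)
  obtain K where K: "AE s in unit_interval_measure. norm (f s) \<le> K"
    using assms by (auto simp: Linf_functions_def)
  have up: "?e \<le> ereal C" if "AE s in unit_interval_measure. norm (f s) \<le> C" for C
    using that by (intro esssup_I m) simp
  have ae: "AE s in unit_interval_measure. ereal (norm (f s)) \<le> ?e" by (rule esssup_AE)
  then have "AE s in unit_interval_measure. 0 \<le> ?e"
    by eventually_elim (meson ereal_less_eq(5) norm_ge_zero order_trans)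
  then have e0: "0 \<le> ?e" by simp
  with up[OF K] have e: "?e = ereal (ess_norm f)"
    unfolding ess_norm_def by (cases ?e) auto
  show ?A using ae unfolding e by simp
  show ?C using e0 unfolding e by simp
  show ?B if "AE s in unit_interval_measure. norm (f s) \<le> C" using up[OF that] unfolding e by simp
qed

lemma Linf_functions_compose2:
  fixes f g :: "real \<Rightarrow> 'b::real_normed_vector" and h :: "'b \<Rightarrow> 'b \<Rightarrow> 'c::real_normed_vector"
  assumes "f \<in> Linf_functions" "g \<in> Linf_functions"
    and "continuous_on UNIV (\<lambda>(x, y). h x y)"
    and bound: "\<And>x y. norm (h x y) \<le> a * norm x + b * norm y" "a \<ge> 0" "b \<ge> 0"
  shows "(\<lambda>s. h (f s) (g s)) \<in> Linf_functions"
proof -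
  obtain C D where C: "AE s in unit_interval_measure. norm (f s) \<le> C"
    and D: "AE s in unit_interval_measure. norm (g s) \<le> D"
    using assms by (auto simp: Linf_functions_def)
  from C D have "AE s in unit_interval_measure. norm (h (f s) (g s)) \<le> a * C + b * D"
  proof eventually_elim
    case (elim s)
    show ?case using bound(1)[of "f s" "g s"] mult_left_mono[OF elim(1) \<open>a \<ge> 0\<close>]
        mult_left_mono[OF elim(2) \<open>b \<ge> 0\<close>] by linarith
  qed
  with assms strongly_measurable_compose2[OF _ _ assms(3)] show ?thesis
    by (auto simp: Linf_functions_def)
qed

lemma Linf_functions_zero: "(\<lambda>_. 0) \<in> Linf_functions"
  unfolding Linf_functions_def strongly_measurable_def
  by (auto intro!: exI[of _ "\<lambda>_ _. 0"] exI[of _ 0])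

lemma Linf_functions_compose1:
  fixes f :: "real \<Rightarrow> 'b::real_normed_vector" and h :: "'b \<Rightarrow> 'c::real_normed_vector"
  assumes "f \<in> Linf_functions" "continuous_on UNIV h" "\<And>x. norm (h x) \<le> a * norm x" "a \<ge> 0"
  shows "(\<lambda>s. h (f s)) \<in> Linf_functions"
proof -
  have "continuous_on UNIV (\<lambda>(x, y::'b). h x)"
    unfolding case_prod_beta by (rule continuous_on_compose2[OF assms(2)]) (auto intro: continuous_intros)
  from Linf_functions_compose2[OF assms(1) Linf_functions_zero this, of a 0] assms show ?thesis by simp
qed

lemma Linf_functions_plus: "f \<in> Linf_functions \<Longrightarrow> g \<in> Linf_functions \<Longrightarrow> (\<lambda>s. f s + g s) \<in> Linf_functions"
  by (rule Linf_functions_compose2[where a = 1 and b = 1])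
     (auto intro!: continuous_intros simp: case_prod_beta norm_triangle_ineq)

lemma Linf_functions_minus: "f \<in> Linf_functions \<Longrightarrow> g \<in> Linf_functions \<Longrightarrow> (\<lambda>s. f s - g s) \<in> Linf_functions"
  by (rule Linf_functions_compose2[where a = 1 and b = 1])
     (auto intro!: continuous_intros simp: case_prod_beta norm_triangle_ineq4)

lemma Linf_functions_uminus: "f \<in> Linf_functions \<Longrightarrow> (\<lambda>s. - f s) \<in> Linf_functions"
  by (rule Linf_functions_compose1[where a = 1]) (auto intro!: continuous_intros)

lemma Linf_functions_scaleR: "f \<in> Linf_functions \<Longrightarrow> (\<lambda>s. r *\<^sub>R f s) \<in> Linf_functions"
  by (rule Linf_functions_compose1[where a = "\<bar>r\<bar>"]) (auto intro!: continuous_intros)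

text \<open>The Bochner space \<open>L\<^sup>\<infinity>([0,1], 'b)\<close>; functions are identified if they agree almost everywhere.\<close>

quotient_type (overloaded) 'b Linf = "real \<Rightarrow> 'b::real_normed_vector" / partial: Linf_rel
proof (rule part_equivpI)
  show "\<exists>f :: real \<Rightarrow> 'b. Linf_rel f f" using Linf_functions_zero by (auto simp: Linf_rel_def)
  show "symp (Linf_rel :: (real \<Rightarrow> 'b) \<Rightarrow> _)" by (rule sympI) (auto simp: Linf_rel_def)
  show "transp (Linf_rel :: (real \<Rightarrow> 'b) \<Rightarrow> _)"
    by (rule transpI) (auto simp: Linf_rel_def elim: eventually_elim2)
qed

lemma ess_norm_cong: "Linf_rel f g \<Longrightarrow> ess_norm f = ess_norm g"
proof -
  have le: "ess_norm f \<le> ess_norm g" if r: "Linf_rel f g" for f g :: "real \<Rightarrow> 'b::real_normed_vector"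
  proof (rule ess_norm_le)
    show "f \<in> Linf_functions" using r by (simp add: Linf_rel_def)
    have "AE s in unit_interval_measure. norm (g s) \<le> ess_norm g"
      using r by (intro AE_norm_le_ess_norm) (simp add: Linf_rel_def)
    moreover have "AE s in unit_interval_measure. f s = g s" using r by (simp add: Linf_rel_def)
    ultimately show "AE s in unit_interval_measure. norm (f s) \<le> ess_norm g"
      by eventually_elim simp
  qed
  assume r: "Linf_rel f g"
  moreover have "Linf_rel g f" using r by (auto simp: Linf_rel_def)
  ultimately show ?thesis using le by (intro antisym)
qed

instantiation Linf :: (real_normed_vector) real_normed_vector
begin

lift_definition zero_Linf :: "'a Linf" is "\<lambda>_. 0"
  by (simp add: Linf_rel_def Linf_functions_zero)

lift_definition plus_Linf :: "'a Linf \<Rightarrow> 'a Linf \<Rightarrow> 'a Linf" is "\<lambda>f g s. f s + g s"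
  by (auto simp: Linf_rel_def Linf_functions_plus elim: eventually_elim2)

lift_definition minus_Linf :: "'a Linf \<Rightarrow> 'a Linf \<Rightarrow> 'a Linf" is "\<lambda>f g s. f s - g s"
  by (auto simp: Linf_rel_def Linf_functions_minus elim: eventually_elim2)

lift_definition uminus_Linf :: "'a Linf \<Rightarrow> 'a Linf" is "\<lambda>f s. - f s"
  by (auto simp: Linf_rel_def Linf_functions_uminus elim: eventually_mono)

lift_definition scaleR_Linf :: "real \<Rightarrow> 'a Linf \<Rightarrow> 'a Linf" is "\<lambda>r f s. r *\<^sub>R f s"
  by (auto simp: Linf_rel_def Linf_functions_scaleR elim: eventually_mono)

lift_definition norm_Linf :: "'a Linf \<Rightarrow> real" is ess_norm
  by (rule ess_norm_cong)

definition "dist_Linf (x::'a Linf) y = norm (x - y)"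
definition "sgn_Linf (x::'a Linf) = scaleR (inverse (norm x)) x"
definition "(uniformity :: ('a Linf \<times> 'a Linf) filter) = (INF e\<in>{0<..}. principal {(x, y). dist x y < e})"
definition "open (U :: 'a Linf set) = (\<forall>x\<in>U. \<forall>\<^sub>F (x', y) in uniformity. x' = x \<longrightarrow> y \<in> U)"

instance
proof
  fix x y z :: "'a Linf" and a b :: real and U :: "'a Linf set"
  show "dist x y = norm (x - y)" by (rule dist_Linf_def)
  show "sgn x = scaleR (inverse (norm x)) x" by (rule sgn_Linf_def)
  show "uniformity = (INF e\<in>{0<..}. principal {(x::'a Linf, y). dist x y < e})"
    by (rule uniformity_Linf_def)
  show "open U = (\<forall>x\<in>U. \<forall>\<^sub>F (x', y) in uniformity. x' = x \<longrightarrow> y \<in> U)"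
    by (rule open_Linf_def)
  show "x + y + z = x + (y + z)" "x + y = y + x" "0 + x = x" "- x + x = 0" "x - y = x + - y"
    by (transfer; auto simp: Linf_rel_def algebra_simps Linf_functions_zero Linf_functions_plus
          Linf_functions_minus Linf_functions_uminus)+
  show "a *\<^sub>R (x + y) = a *\<^sub>R x + a *\<^sub>R y" "(a + b) *\<^sub>R x = a *\<^sub>R x + b *\<^sub>R x"
    "a *\<^sub>R b *\<^sub>R x = (a * b) *\<^sub>R x" "1 *\<^sub>R x = x"
    by (transfer; auto simp: Linf_rel_def algebra_simps Linf_functions_plus Linf_functions_scaleR)+
  show "norm x = 0 \<longleftrightarrow> x = 0"
  proof transfer
    fix f :: "real \<Rightarrow> 'a" assume "Linf_rel f f"
    then have f: "f \<in> Linf_functions" by (simp add: Linf_rel_def)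
    show "ess_norm f = 0 \<longleftrightarrow> Linf_rel f (\<lambda>_. 0)"
    proof
      assume "ess_norm f = 0"
      then show "Linf_rel f (\<lambda>_. 0)" using AE_norm_le_ess_norm[OF f] f Linf_functions_zero
        by (simp add: Linf_rel_def)
    next
      assume "Linf_rel f (\<lambda>_. 0)"
      then have "AE s in unit_interval_measure. norm (f s) \<le> 0" by (simp add: Linf_rel_def)
      then show "ess_norm f = 0" using ess_norm_le[OF f] ess_norm_nonneg[OF f] by (intro antisym)
    qed
  qed
  show "norm (x + y) \<le> norm x + norm y"
  proof transfer
    fix f g :: "real \<Rightarrow> 'a" assume "Linf_rel f f" "Linf_rel g g"
    then have f: "f \<in> Linf_functions" and g: "g \<in> Linf_functions" by (simp_all add: Linf_rel_def)
    show "ess_norm (\<lambda>s. f s + g s) \<le> ess_norm f + ess_norm g"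
    proof (rule ess_norm_le[OF Linf_functions_plus[OF f g]])
      show "AE s in unit_interval_measure. norm (f s + g s) \<le> ess_norm f + ess_norm g"
        using AE_norm_le_ess_norm[OF f] AE_norm_le_ess_norm[OF g]
        by eventually_elim (rule norm_triangle_le, simp)
    qed
  qed
  show "norm (a *\<^sub>R x) = \<bar>a\<bar> * norm x"
  proof transfer
    fix f :: "real \<Rightarrow> 'a" and a :: real assume "Linf_rel f f"
    then have f: "f \<in> Linf_functions" by (simp add: Linf_rel_def)
    have le: "ess_norm (\<lambda>s. a *\<^sub>R f s) \<le> \<bar>a\<bar> * ess_norm f" if f: "f \<in> Linf_functions"
      for a and f :: "real \<Rightarrow> 'a"
    proof (rule ess_norm_le[OF Linf_functions_scaleR[OF f]])
      show "AE s in unit_interval_measure. norm (a *\<^sub>R f s) \<le> \<bar>a\<bar> * ess_norm f"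
        using AE_norm_le_ess_norm[OF f] by eventually_elim (simp add: mult_left_mono)
    qed
    show "ess_norm (\<lambda>s. a *\<^sub>R f s) = \<bar>a\<bar> * ess_norm f"
    proof (cases "a = 0")
      case True
      then show ?thesis using le[OF f, of 0] ess_norm_nonneg[OF Linf_functions_scaleR[OF f, of 0]]
        by simp
    next
      case False
      have "ess_norm f \<le> \<bar>inverse a\<bar> * ess_norm (\<lambda>s. a *\<^sub>R f s)"
        using le[OF Linf_functions_scaleR[OF f], of "inverse a" a] False by simp
      with False have "\<bar>a\<bar> * ess_norm f \<le> ess_norm (\<lambda>s. a *\<^sub>R f s)"
        by (simp add: field_simps)
      with le[OF f] show ?thesis by (intro antisym)
    qed
  qed
qed

end



lift_definition l1_scale :: "'k::real_normed_field \<Rightarrow> 'k l1 \<Rightarrow> 'k l1" is "\<lambda>a x n. a * x n"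
  by (simp add: norm_mult summable_mult)

lemma norm_l1_scale: "norm (l1_scale a x) = norm a * norm x"
  by transfer (simp add: norm_mult suminf_mult)

lemma bounded_linear_l1_scale: "bounded_linear (l1_scale a)"
proof (rule bounded_linear_intro[of _ "norm a"])
  show "l1_scale a (x + y) = l1_scale a x + l1_scale a y" for x y
    by transfer (simp add: algebra_simps)
  show "l1_scale a (r *\<^sub>R x) = r *\<^sub>R l1_scale a x" for r x
    by transfer simp
qed (simp add: norm_l1_scale)

lift_definition Linf_scale :: "'k::real_normed_field \<Rightarrow> 'k l1 Linf \<Rightarrow> 'k l1 Linf"
  is "\<lambda>a f s. l1_scale a (f s)"
proof -
  fix a :: 'k and f g :: "real \<Rightarrow> 'k l1"
  assume "Linf_rel f g"
  moreover have "(\<lambda>s. l1_scale a (h s)) \<in> Linf_functions"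
    if "h \<in> Linf_functions" for h :: "real \<Rightarrow> 'k l1"
    using that
    by (rule Linf_functions_compose1[where a = "norm a"])
       (auto intro: linear_continuous_on bounded_linear_l1_scale simp: norm_l1_scale)
  ultimately show "Linf_rel (\<lambda>s. l1_scale a (f s)) (\<lambda>s. l1_scale a (g s))"
    by (auto simp: Linf_rel_def elim: eventually_mono)
qed

definition Linf_space :: "'b::real_normed_vector set \<Rightarrow> 'b Linf set" where
  "Linf_space S = {f. AE s in unit_interval_measure. rep_Linf f s \<in> S}"

definition l1_space :: "nat set \<Rightarrow> 'k::real_normed_vector l1 set" where
  "l1_space J = {x. \<forall>j. j \<notin> J \<longrightarrow> l1_nth x j = 0}"

text \<open>Since \<open>nat\<close> is discrete, \<open>nat \<Rightarrow>\<^sub>C 'k\<close> is \<open>\<ell>\<^sup>\<infinity>(\<nat>)\<close> with the supremum norm.\<close>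

definition linf_space :: "nat set \<Rightarrow> (nat \<Rightarrow>\<^sub>C 'k::real_normed_vector) set" where
  "linf_space J = {y. \<forall>j. j \<notin> J \<longrightarrow> apply_bcontfun y j = 0}"

definition c0_space :: "nat set \<Rightarrow> (nat \<Rightarrow>\<^sub>C 'k::real_normed_vector) set" where
  "c0_space J = {y \<in> linf_space J. apply_bcontfun y \<longlonglongrightarrow> 0}"

definition L1_functions :: "'b::real_normed_vector set \<Rightarrow> (real \<Rightarrow> 'b) set" where
  "L1_functions S = {g. strongly_measurable unit_interval_measure g \<and>
     (AE s in unit_interval_measure. g s \<in> S) \<and>
     integrable unit_interval_measure (\<lambda>s. norm (g s))}"

definition pairing ::
    "'k::{real_normed_field, euclidean_space} l1 Linf \<Rightarrow> (real \<Rightarrow> (nat \<Rightarrow>\<^sub>C 'k)) \<Rightarrow> 'k" where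
  "pairing f g = (LINT s|unit_interval_measure. (\<Sum>j. l1_nth (rep_Linf f s) j * apply_bcontfun (g s) j))"

text \<open>
  The topology on \<open>L\<^sup>\<infinity>([0,1], \<ell>\<^sup>1(J))\<close> induced by its duality with \<open>L\<^sup>1([0,1], c\<^sub>0(J))\<close>.  The
  functions \<open>g\<close> need not be identified almost everywhere, as \<open>pairing\<close> respects this relation.
\<close>

definition weak_star :: "nat set \<Rightarrow> 'k::{real_normed_field, euclidean_space} l1 Linf topology" where
  "weak_star J = topology_generated_by
     {{f \<in> Linf_space (l1_space J). pairing f g \<in> U} | g U. g \<in> L1_functions (c0_space J) \<and> open U}"

text \<open>Smooth functions with compact support in the open interval \<open>(0,1)\<close>.\<close>

definition test_functions :: "(real \<Rightarrow> real) set" where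
  "test_functions = {\<phi>. (\<forall>n. (deriv ^^ n) \<phi> differentiable_on UNIV) \<and>
     (\<exists>a b. 0 < a \<and> b < 1 \<and> (\<forall>x. x \<notin> {a..b} \<longrightarrow> \<phi> x = 0))}"

definition has_weak_derivative ::
    "'b::{banach, second_countable_topology} Linf \<Rightarrow> 'b Linf \<Rightarrow> bool" where
  "has_weak_derivative f g \<longleftrightarrow> (\<forall>\<phi>\<in>test_functions.
     (LINT s|unit_interval_measure. deriv \<phi> s *\<^sub>R rep_Linf f s) =
     - (LINT s|unit_interval_measure. \<phi> s *\<^sub>R rep_Linf g s))"

definition weak_derivative :: "'b::{banach, second_countable_topology} Linf \<Rightarrow> 'b Linf" where
  "weak_derivative f = (THE g. has_weak_derivative f g)"

definition W1inf_space :: "'b::{banach, second_countable_topology} set \<Rightarrow> 'b Linf set" where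
  "W1inf_space S = {f \<in> Linf_space S. \<exists>g\<in>Linf_space S. has_weak_derivative f g}"

text \<open>A continuous representative is unique on \<open>[0,1]\<close>, and only its values there are used.\<close>

definition continuous_rep :: "'b::real_normed_vector Linf \<Rightarrow> real \<Rightarrow> 'b" where
  "continuous_rep f = (SOME h. continuous_on {0..1} h \<and>
     (AE s in unit_interval_measure. h s = rep_Linf f s))"

definition topological_dual ::
    "('k::real_normed_field \<Rightarrow> 'a \<Rightarrow> 'a) \<Rightarrow> 'a::real_normed_vector set \<Rightarrow> 'a topology \<Rightarrow> ('a \<Rightarrow> 'k) set" where
  "topological_dual sm X \<tau> = {\<phi>.
     (\<forall>x\<in>X. \<forall>y\<in>X. \<phi> (x + y) = \<phi> x + \<phi> y) \<and>
     (\<forall>a. \<forall>x\<in>X. \<phi> (sm a x) = a * \<phi> x) \<and>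
     continuous_map \<tau> euclidean \<phi>}"

text \<open>
  A Banach space \<open>X\<close> over \<open>'k\<close>, given as a subspace of an ambient normed space with the scalar
  multiplication \<open>sm\<close>, together with an admissible locally convex topology \<open>\<tau>\<close> on it.
\<close>

locale bi_admissible_space = vector_space sm
  for sm :: "'k::real_normed_field \<Rightarrow> 'a::real_normed_vector \<Rightarrow> 'a" +
  fixes X :: "'a set" and \<tau> :: "'a topology"
  assumes scale_of_real: "sm (of_real r) x = r *\<^sub>R x"
    and norm_scale: "norm (sm a x) = norm a * norm x"
    and subspace_X: "subspace X"
    and complete_X: "complete X"
    and topspace_tau: "topspace \<tau> = X"
    and continuous_add: "continuous_map (prod_topology \<tau> \<tau>) \<tau> (\<lambda>(x, y). x + y)"
    and continuous_scale: "continuous_map (prod_topology euclidean \<tau>) \<tau> (\<lambda>(a, x). sm a x)"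
    and locally_convex: "\<And>U. openin \<tau> U \<Longrightarrow> 0 \<in> U \<Longrightarrow> \<exists>V. openin \<tau> V \<and> 0 \<in> V \<and> convex V \<and> V \<subseteq> U"
    and Hausdorff: "Hausdorff_space \<tau>"
    and coarser_than_norm: "\<And>U. openin \<tau> U \<Longrightarrow> openin (top_of_set X) U"
    and sequentially_complete_on_bounded:
      "\<And>f :: nat \<Rightarrow> 'a. range f \<subseteq> X \<Longrightarrow> bounded (range f) \<Longrightarrow>
         (\<And>U. openin \<tau> U \<Longrightarrow> 0 \<in> U \<Longrightarrow> \<exists>N. \<forall>m\<ge>N. \<forall>n\<ge>N. f m - f n \<in> U) \<Longrightarrow>
         \<exists>l. limitin \<tau> f l sequentially"
    and norming: "\<And>x. x \<in> X \<Longrightarrow>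
      norm x = (SUP \<phi>\<in>{\<phi> \<in> topological_dual sm X \<tau>. \<forall>y\<in>X. norm (\<phi> y) \<le> norm y}. norm (\<phi> x))"

locale bi_continuous_semigroup = bi_admissible_space sm X \<tau>
  for sm :: "'k::real_normed_field \<Rightarrow> 'a::real_normed_vector \<Rightarrow> 'a"
    and X :: "'a set" and \<tau> :: "'a topology" +
  fixes T :: "real \<Rightarrow> 'a \<Rightarrow> 'a"
  assumes maps_to: "\<And>t x. t \<ge> 0 \<Longrightarrow> x \<in> X \<Longrightarrow> T t x \<in> X"
    and linear_add: "\<And>t x y. t \<ge> 0 \<Longrightarrow> x \<in> X \<Longrightarrow> y \<in> X \<Longrightarrow> T t (x + y) = T t x + T t y"
    and linear_scale: "\<And>t a x. t \<ge> 0 \<Longrightarrow> x \<in> X \<Longrightarrow> T t (sm a x) = sm a (T t x)"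
    and at_zero: "\<And>x. x \<in> X \<Longrightarrow> T 0 x = x"
    and semigroup: "\<And>s t x. s \<ge> 0 \<Longrightarrow> t \<ge> 0 \<Longrightarrow> x \<in> X \<Longrightarrow> T (t + s) x = T t (T s x)"
    and strongly_continuous: "\<And>x. x \<in> X \<Longrightarrow> continuous_map (top_of_set {0..}) \<tau> (\<lambda>t. T t x)"
    and exponentially_bounded:
      "\<exists>M \<omega>. M \<ge> 1 \<and> (\<forall>t\<ge>0. \<forall>x\<in>X. norm (T t x) \<le> M * exp (\<omega> * t) * norm x)"
    and locally_bi_equicontinuous:
      "\<And>(f :: nat \<Rightarrow> 'a) t0 U. range f \<subseteq> X \<Longrightarrow> bounded (range f) \<Longrightarrow> limitin \<tau> f 0 sequentially \<Longrightarrow>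
         t0 \<ge> 0 \<Longrightarrow> openin \<tau> U \<Longrightarrow> 0 \<in> U \<Longrightarrow> \<forall>\<^sub>F n in sequentially. \<forall>s\<in>{0..t0}. T s (f n) \<in> U"

definition generator_domain ::
    "'a::real_normed_vector set \<Rightarrow> 'a topology \<Rightarrow> (real \<Rightarrow> 'a \<Rightarrow> 'a) \<Rightarrow> 'a set" where
  "generator_domain X \<tau> T = {f \<in> X.
     (\<exists>h. limitin \<tau> (\<lambda>t. (T t f - f) /\<^sub>R t) h (at_right 0)) \<and>
     bdd_above ((\<lambda>t. norm (T t f - f) / t) ` {0<..1})}"

definition generator :: "'a::real_normed_vector topology \<Rightarrow> (real \<Rightarrow> 'a \<Rightarrow> 'a) \<Rightarrow> 'a \<Rightarrow> 'a" where
  "generator \<tau> T f = (THE h. limitin \<tau> (\<lambda>t. (T t f - f) /\<^sub>R t) h (at_right 0))"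

definition generates_bi_continuous_semigroup ::
    "('k::real_normed_field \<Rightarrow> 'a::real_normed_vector \<Rightarrow> 'a) \<Rightarrow> 'a set \<Rightarrow> 'a topology \<Rightarrow>
     ('a \<Rightarrow> 'a) \<Rightarrow> 'a set \<Rightarrow> bool" where
  "generates_bi_continuous_semigroup sm X \<tau> A D \<longleftrightarrow>
     (\<exists>T. bi_continuous_semigroup sm X \<tau> T \<and>
          generator_domain X \<tau> T = D \<and> (\<forall>f\<in>D. generator \<tau> T f = A f))"

text \<open>
  The edge \<open>e\<^sub>j\<close> is the arc \<open>j\<close>; the edge index set \<open>J\<close> is \<open>arcs G\<close>.  The underlying locales exclude
  loops and parallel arcs but impose no finiteness.
\<close>

locale weighted_graph = loopfree_digraph G + nomulti_digraph G
  for G :: "('v, nat) pre_digraph" +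
  fixes w :: "nat \<Rightarrow> nat \<Rightarrow> real"
  assumes countable_verts: "countable (verts G)"
    and locally_finite: "\<And>v. v \<in> verts G \<Longrightarrow> finite (in_arcs G v \<union> out_arcs G v)"
    and weight_bounds: "\<And>i j. i \<in> arcs G \<Longrightarrow> j \<in> arcs G \<Longrightarrow> 0 \<le> w i j \<and> w i j \<le> 1"
    and weight_support: "\<And>i j. i \<in> arcs G \<Longrightarrow> j \<in> arcs G \<Longrightarrow> w i j \<noteq> 0 \<Longrightarrow> head G j = tail G i"
    and weight_sum: "\<And>j. j \<in> arcs G \<Longrightarrow> ((\<lambda>i. w i j) has_sum 1) (arcs G)"

definition line_graph_matrix :: "('v, nat) pre_digraph \<Rightarrow> (nat \<Rightarrow> nat \<Rightarrow> real) \<Rightarrow> nat \<Rightarrow> nat \<Rightarrow> real" where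
  "line_graph_matrix G w i j = (if head G j = tail G i then w i j else 0)"

text \<open>The entries of \<open>C\<^sup>-\<^sup>1 B C\<close> for \<open>C = diag(c\<^sub>j)\<close>.\<close>

definition diag_conjugate :: "(nat \<Rightarrow> real) \<Rightarrow> (nat \<Rightarrow> nat \<Rightarrow> real) \<Rightarrow> nat \<Rightarrow> nat \<Rightarrow> real" where
  "diag_conjugate c B i j = inverse (c i) * B i j * c j"

definition matrix_apply ::
    "nat set \<Rightarrow> (nat \<Rightarrow> nat \<Rightarrow> real) \<Rightarrow> (nat \<Rightarrow> 'k::real_normed_field) \<Rightarrow> nat \<Rightarrow> 'k" where
  "matrix_apply J B x i = (if i \<in> J then (\<Sum>\<^sub>\<infinity>j\<in>J. of_real (B i j) * x j) else 0)"

definition flow_domain ::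
    "('v, nat) pre_digraph \<Rightarrow> (nat \<Rightarrow> nat \<Rightarrow> real) \<Rightarrow> (nat \<Rightarrow> real) \<Rightarrow>
     'k::{real_normed_field, euclidean_space} l1 Linf set" where
  "flow_domain G w c = {f \<in> W1inf_space (l1_space (arcs G)).
     l1_nth (continuous_rep f 1) =
       matrix_apply (arcs G) (diag_conjugate c (line_graph_matrix G w)) (l1_nth (continuous_rep f 0))}"

text \<open>
  \<open>f \<mapsto> (c\<^sub>j f\<^sub>j' + q\<^sub>j f\<^sub>j)\<^sub>j\<close>.  For \<open>f\<close> in \<open>flow_domain\<close>, \<open>q\<close> in \<open>L\<^sup>\<infinity>([0,1], \<ell>\<^sup>\<infinity>(J))\<close> and bounded
  \<open>c\<close> the argument of \<open>Abs_l1\<close> is summable and that of \<open>abs_Linf\<close> lies in \<open>Linf_functions\<close>.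
\<close>

definition flow_operator ::
    "nat set \<Rightarrow> (nat \<Rightarrow> real) \<Rightarrow> (nat \<Rightarrow>\<^sub>C 'k) Linf \<Rightarrow>
     'k::{real_normed_field, euclidean_space} l1 Linf \<Rightarrow> 'k l1 Linf" where
  "flow_operator J c q f = abs_Linf (\<lambda>s. Abs_l1 (\<lambda>j. if j \<in> J
     then of_real (c j) * l1_nth (rep_Linf (weak_derivative f) s) j
            + apply_bcontfun (rep_Linf q s) j * l1_nth (rep_Linf f s) j
     else 0))"

end

theory Submission
  imports Defs
begin

text \<open>
  A function \<open>f\<close> in \<open>L\<^sup>\<infinity>([0,1], \<ell>\<^sup>1)\<close> is determined by the primitives \<open>x \<mapsto> \<integral>\<^sub>0\<^sup>x f\<^sub>j\<close> of its coordinates.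
  The space \<open>\<ell>\<^sup>1\<close> has the Radon--Nikodym property, so these families of primitives are exactly the
  Lipschitz functions into \<open>\<ell>\<^sup>1\<close> that vanish at \<open>0\<close>, and the norm of \<open>f\<close> is the Lipschitz constant
  (\<open>lipschitz_is_prim\<close>, \<open>norm_Linf_le_if_prim_increment_le\<close>).  On bounded sets, weak-star convergence is
  pointwise convergence of all primitives (\<open>limitin_weak_star_if_prim_tendsto\<close>,
  \<open>prim_tendsto_if_limitin\<close>).  Hence elements of the space can be constructed, compared and approximated
  by means of continuous functions, and the weak-star topology is admissible (\<open>weak_star_admissible\<close>).

  First let \<open>q = 0\<close>.  The solution of \<open>\<partial>\<^sub>t f\<^sub>j = c\<^sub>j \<partial>\<^sub>x f\<^sub>j\<close> moves along the edge \<open>j\<close> with speed \<open>c\<^sub>j\<close> from \<open>1\<close>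
  to \<open>0\<close>, so it is known once the density that leaves each edge at \<open>0\<close> is known.  The coupling conditions
  at the vertices say that the integral of this density over time, the flux, solves a delay equation
  with delays \<open>1 / c\<^sub>j\<close>.  It is solved by recursion, since the delays are bounded from below.  The
  numbers \<open>d / c\<^sub>j\<close> are natural and at most \<open>d / c\<^sub>m\<^sub>i\<^sub>n\<close>, so there are only finitely many speeds.
  Therefore the \<open>\<ell>\<^sup>1\<close>-estimate \<open>flux_lipschitz\<close> can be proved for one speed at a time: edges with
  the same speed look at the flux at the same time, and the column sums of the matrix are bounded.
  Shifting the flux in time defines the semigroup.  Its generator is found by integrating the
  delay equation (\<open>shift_generator\<close>); conversely, averaging difference quotients shows that every
  element of the domain of the generator is a Lipschitz function satisfying the coupling conditions
  (\<open>shift_generator_converse\<close>).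

  In general let \<open>E\<^sub>j(x) = exp ((\<integral>\<^sub>0\<^sup>x q\<^sub>j) / c\<^sub>j)\<close>.  Multiplication by \<open>E\<close> is an isomorphism which is weak-star
  continuous on bounded sets, and it turns \<open>c\<^sub>j f\<^sub>j' + q\<^sub>j f\<^sub>j\<close> into \<open>c\<^sub>j (E\<^sub>j f\<^sub>j)'\<close>.  Since \<open>E\<^sub>j(0) = 1\<close>, the
  coupling conditions keep their form, with \<open>E\<^sub>j(1)\<close> as an additional factor in row \<open>j\<close> of the matrix.
  So the semigroup is the conjugate by \<open>E\<close> of a semigroup with \<open>q = 0\<close> (\<open>generates_flow\<close>).
\<close>

section \<open>Bounded measurable functions on the unit interval\<close>

lemma AE_unit_interval_iff:
  "(AE s in unit_interval_measure. P s) \<longleftrightarrow> (AE s in lebesgue. s \<in> {0..1} \<longrightarrow> P s)"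
  by (subst AE_restrict_space_iff) auto

lemma AE_unit_interval_mem: "AE s in unit_interval_measure. s \<in> {0..1}"
  by (rule AE_I2) simp

interpretation unit_interval: finite_measure unit_interval_measure
  by (rule finite_measureI) (simp add: emeasure_restrict_space)

lemma borel_measurable_unit_interval:
  "f \<in> borel_measurable borel \<Longrightarrow> f \<in> borel_measurable unit_interval_measure"
  by (intro measurable_restrict_space1 measurable_completion) simp

lemma sets_unit_interval_Int: "A \<in> sets borel \<Longrightarrow> A \<inter> {0..1} \<in> sets unit_interval_measure"
  by (subst sets_restrict_space_iff) (auto intro!: sets_completionI_sets)

lemma integrable_unit_interval_bounded:
  fixes f :: "real \<Rightarrow> 'b::{banach, second_countable_topology}"
  assumes "f \<in> borel_measurable unit_interval_measure" "AE s in unit_interval_measure. norm (f s) \<le> K"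
  shows "integrable unit_interval_measure f"
  using assms by (intro unit_interval.integrable_const_bound[where B=K])

lemma integrable_mult_ess_bounded:
  fixes u \<phi> :: "real \<Rightarrow> 'k::{real_normed_field, euclidean_space}"
  assumes "u \<in> borel_measurable M" "AE s in M. norm (u s) \<le> K" "integrable M \<phi>"
  shows "integrable M (\<lambda>s. \<phi> s * u s)"
proof (rule Bochner_Integration.integrable_bound)
  show "integrable M (\<lambda>s. K * norm (\<phi> s))" using assms(3) by simp
  show "(\<lambda>s. \<phi> s * u s) \<in> borel_measurable M" using assms by measurable
  show "AE s in M. norm (\<phi> s * u s) \<le> norm (K * norm (\<phi> s))"
    using assms(2)
  proof eventually_elim
    case (elim s)
    have "norm (u s) * norm (\<phi> s) \<le> \<bar>K\<bar> * norm (\<phi> s)" using elim by (intro mult_right_mono) auto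
    then show ?case by (simp add: norm_mult mult.commute abs_mult)
  qed
qed

lemma integrable_mult_indicator':
  fixes f :: "'a \<Rightarrow> 'b::{banach, second_countable_topology}"
  assumes "(indicator A :: 'a \<Rightarrow> real) \<in> borel_measurable M" "integrable M f"
  shows "integrable M (\<lambda>x. indicator A x *\<^sub>R f x)"
  by (rule Bochner_Integration.integrable_bound[OF assms(2)])
    (use assms in \<open>auto intro!: borel_measurable_scaleR simp: indicator_le_1 mult_left_le_one_le\<close>)

lemma norm_integral_le_AE:
  fixes f :: "'a \<Rightarrow> 'b::{banach, second_countable_topology}"
  assumes "integrable M f" "integrable M g" "AE s in M. norm (f s) \<le> g s"
  shows "norm (integral\<^sup>L M f) \<le> integral\<^sup>L M g"
  using assms by (intro order_trans[OF integral_norm_bound integral_mono_AE]) auto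

lemma norm_integral_mult_ess_bounded_le:
  fixes u \<phi> :: "real \<Rightarrow> 'k::{real_normed_field, euclidean_space}"
  assumes "u \<in> borel_measurable M" "AE s in M. norm (u s) \<le> K" "integrable M \<phi>"
  shows "norm (LINT s|M. \<phi> s * u s) \<le> K * (LINT s|M. norm (\<phi> s))"
proof -
  have "norm (LINT s|M. \<phi> s * u s) \<le> (LINT s|M. K * norm (\<phi> s))"
  proof (rule norm_integral_le_AE)
    show "integrable M (\<lambda>s. \<phi> s * u s)" by (rule integrable_mult_ess_bounded[OF assms])
    show "integrable M (\<lambda>s. K * norm (\<phi> s))" using assms(3) by simp
  next
    show "AE s in M. norm (\<phi> s * u s) \<le> K * norm (\<phi> s)"
      using assms(2) by eventually_elim (auto simp: norm_mult mult.commute[of K] intro!: mult_left_mono)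
  qed
  then show ?thesis by simp
qed

text \<open>
  For uniformly bounded functions, convergence of the integrals over all initial intervals \<open>{..x}\<close> implies
  convergence against every integrable function: the sets over which the integrals converge form a
  Dynkin system, and the simple functions are dense in \<open>L\<^sup>1\<close>.
\<close>

lemma tendsto_integral_of_intervals:
  fixes u :: "'i \<Rightarrow> real \<Rightarrow> 'k::{real_normed_field, euclidean_space}"
  assumes meas: "\<And>i. u i \<in> borel_measurable unit_interval_measure"
    and bd: "\<And>i. AE s in unit_interval_measure. norm (u i s) \<le> K"
    and lim: "\<And>x. x \<in> {0..1} \<Longrightarrow>
      ((\<lambda>i. LINT s|unit_interval_measure. indicator {..x} s *\<^sub>R u i s) \<longlongrightarrow> 0) F"
    and \<phi>: "integrable unit_interval_measure \<phi>"
  shows "((\<lambda>i. LINT s|unit_interval_measure. \<phi> s * u i s) \<longlongrightarrow> 0) F"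
proof -
  let ?\<mu> = unit_interval_measure
  let ?I = "\<lambda>A i. LINT s|?\<mu>. indicator A s *\<^sub>R u i s"
  have int: "integrable ?\<mu> (u i)" for i
    by (rule integrable_unit_interval_bounded[OF meas bd])
  have intA: "integrable ?\<mu> (\<lambda>s. indicator A s *\<^sub>R u i s)" if "A \<in> sets borel" for A i
    by (rule integrable_mult_indicator'[OF _ int]) (use borel_measurable_unit_interval[OF borel_measurable_indicator[OF that]] in simp)
  have whole: "(?I UNIV \<longlongrightarrow> 0) F"
  proof -
    have "?I UNIV i = ?I {..1} i" for i by (rule Bochner_Integration.integral_cong) (auto simp: indicator_def)
    with lim[of 1] show ?thesis by simp
  qed
  have smul: "norm (?I A i) \<le> \<bar>K\<bar> * measure ?\<mu> (A \<inter> {0..1})" if A: "A \<in> sets borel" for A i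
  proof -
    have A01: "A \<inter> {0..1} \<in> sets ?\<mu>" using A by (rule sets_unit_interval_Int)
    have "norm (?I A i) \<le> (LINT s|?\<mu>. \<bar>K\<bar> * indicator (A \<inter> {0..1}) s)"
    proof (rule norm_integral_le_AE[OF intA[OF A]])
      show "integrable ?\<mu> (\<lambda>s. \<bar>K\<bar> * indicator (A \<inter> {0..1}) s)"
        using A01 by (intro integrable_mult_right integrable_real_indicator)
          (simp_all add: unit_interval.emeasure_finite less_top[symmetric])
      show "AE s in ?\<mu>. norm (indicator A s *\<^sub>R u i s) \<le> \<bar>K\<bar> * indicator (A \<inter> {0..1}) s"
        using bd[of i] AE_unit_interval_mem by eventually_elim (auto simp: indicator_def)
    qed
    also have "\<dots> = \<bar>K\<bar> * measure ?\<mu> (A \<inter> {0..1})" using A01 by simp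
    finally show ?thesis .
  qed
  have borel: "(?I A \<longlongrightarrow> 0) F" if A: "A \<in> sets borel" for A
  proof -
    have A': "A \<in> sigma_sets UNIV (range atMost)"
      using A by (simp add: borel_eq_atMost)
    from _ _ A' show ?thesis
    proof (rule sigma_sets_induct_disjoint)
      show "Int_stable (range atMost :: real set set)" by (auto simp: Int_stable_def)
      show "(?I B \<longlongrightarrow> 0) F" if B0: "B \<in> range atMost" for B
      proof -
        obtain x where B: "B = {..x}" using B0 by auto
        consider "x < 0" | "x \<in> {0..1}" | "x > 1" by fastforce
        then show ?thesis
        proof cases
          case 1
          then have "?I B i = 0" for i
            unfolding B by (intro integral_eq_zero_AE AE_I2) (auto simp: indicator_def)
          then show ?thesis by simp
        next
          case 2
          then show ?thesis unfolding B by (rule lim)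
        next
          case 3
          have "?I B i = ?I UNIV i" for i
            unfolding B using 3 by (intro Bochner_Integration.integral_cong) (auto simp: indicator_def)
          with whole show ?thesis by simp
        qed
      qed
      show "(?I {} \<longlongrightarrow> 0) F" by simp
      show "(?I (UNIV - B) \<longlongrightarrow> 0) F"
        if "B \<in> sigma_sets UNIV (range atMost)" "(?I B \<longlongrightarrow> 0) F" for B
      proof -
        have B: "B \<in> sets borel" using that(1) by (simp add: borel_eq_atMost)
        have "?I (UNIV - B) i = ?I UNIV i - ?I B i" for i
          by (subst Bochner_Integration.integral_diff[OF intA intA, symmetric])
            (auto intro!: B Bochner_Integration.integral_cong simp: indicator_def)
        with tendsto_diff[OF whole that(2)] show ?thesis by (simp del: indicator_UNIV)
      qed
      show "(?I (\<Union>k. A k) \<longlongrightarrow> 0) F"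
        if dis: "disjoint_family A" and A: "range A \<subseteq> sigma_sets UNIV (range atMost)"
          and IH: "\<And>k. (?I (A k) \<longlongrightarrow> 0) F" for A :: "nat \<Rightarrow> real set"
      proof (rule tendstoI)
        fix e :: real assume e: "e > 0"
        have Ak: "A k \<in> sets borel" for k using A by (auto simp: borel_eq_atMost)
        \<comment> \<open>the uniform bound makes the integrals over the tails \<open>B n\<close> small, uniformly in \<open>i\<close>\<close>
        define B where "B = (\<lambda>n. (\<Union>k. A k) - (\<Union>k<n. A k))"
        have Bn: "B n \<in> sets borel" for n unfolding B_def using Ak by auto
        have "(\<lambda>n. measure ?\<mu> (B n \<inter> {0..1})) \<longlonglongrightarrow> measure ?\<mu> (\<Inter>n. B n \<inter> {0..1})"
          using sets_unit_interval_Int[OF Bn]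
          by (intro unit_interval.finite_Lim_measure_decseq) (auto simp: decseq_def B_def)
        moreover have "(\<Inter>n. B n \<inter> {0..1}) = {}" by (auto simp: B_def)
        ultimately have "(\<lambda>n. \<bar>K\<bar> * measure ?\<mu> (B n \<inter> {0..1})) \<longlonglongrightarrow> 0"
          by (auto intro!: tendsto_eq_intros)
        then have "\<forall>\<^sub>F n in sequentially. \<bar>K\<bar> * measure ?\<mu> (B n \<inter> {0..1}) < e / 2"
          using e by (intro order_tendstoD(2)[of _ 0]) auto
        then obtain n where n: "\<bar>K\<bar> * measure ?\<mu> (B n \<inter> {0..1}) < e / 2"
          by (meson eventually_sequentially order_refl)
        have split: "?I (\<Union>k. A k) i = (\<Sum>k<n. ?I (A k) i) + ?I (B n) i" for i
        proof -
          have "indicator (\<Union>k. A k) s *\<^sub>R u i s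
                = (\<Sum>k<n. indicator (A k) s *\<^sub>R u i s) + indicator (B n) s *\<^sub>R u i s" for s
          proof -
            have "indicator (\<Union>k<n. A k) s = (\<Sum>k<n. indicator (A k) s :: real)"
              using dis by (intro indicator_UN_disjoint) (auto simp: disjoint_family_on_def)
            moreover have "indicator (\<Union>k. A k) s = indicator (\<Union>k<n. A k) s + (indicator (B n) s :: real)"
              by (auto simp: B_def indicator_def)
            ultimately show ?thesis by (simp add: scaleR_add_left scaleR_sum_left)
          qed
          then show ?thesis
            by (simp only: Bochner_Integration.integral_add Bochner_Integration.integral_sum intA Ak Bn
                Bochner_Integration.integrable_sum)
        qed
        have "((\<lambda>i. \<Sum>k<n. ?I (A k) i) \<longlongrightarrow> 0) F" using IH by (auto intro!: tendsto_eq_intros)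
        then have "\<forall>\<^sub>F i in F. norm (\<Sum>k<n. ?I (A k) i) < e / 2"
          by (rule order_tendstoD(2)[OF tendsto_norm_zero]) (use e in simp)
        then show "\<forall>\<^sub>F i in F. dist (?I (\<Union>k. A k) i) 0 < e"
        proof eventually_elim
          case (elim i)
          then show ?case using smul[OF Bn, of n i] n
            norm_triangle_ineq[of "\<Sum>k<n. ?I (A k) i" "?I (B n) i"] by (simp add: split)
        qed
      qed
    qed auto
  qed
  from \<phi> show ?thesis
  proof (induction rule: integrable_induct)
    case (base A c)
    then have "A \<in> sets lebesgue" by (auto simp: sets_restrict_space)
    \<comment> \<open>up to a null set, every Lebesgue measurable set is a Borel set\<close>
    then obtain S T where ST: "fsigma S" "T \<in> null_sets lebesgue" "S \<union> T = A"
      by (rule lebesgue_set_almost_fsigma)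
    have S: "S \<in> sets borel" using ST(1) by (auto elim!: fsigma.cases)
    have "AE s in lebesgue. s \<notin> T" using ST(2) by (rule AE_not_in)
    then have ae: "AE s in ?\<mu>. (indicator A s :: real) = indicator S s"
      unfolding AE_unit_interval_iff by eventually_elim (use ST(3) in \<open>auto simp: indicator_def\<close>)
    have "(LINT s|?\<mu>. indicator A s *\<^sub>R c * u i s) = c * ?I S i" for i
    proof -
      have "(LINT s|?\<mu>. indicator A s *\<^sub>R c * u i s) = (LINT s|?\<mu>. c * (indicator S s *\<^sub>R u i s))"
      proof (rule integral_cong_AE)
        show "(\<lambda>s. indicator A s *\<^sub>R c * u i s) \<in> borel_measurable ?\<mu>"
          using base(1) meas[of i] by measurable
        show "(\<lambda>s. c * (indicator S s *\<^sub>R u i s)) \<in> borel_measurable ?\<mu>"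
          using intA[OF S, of i] by (intro borel_measurable_times) auto
        show "AE s in ?\<mu>. indicator A s *\<^sub>R c * u i s = c * (indicator S s *\<^sub>R u i s)"
          using ae by eventually_elim simp
      qed
      also have "\<dots> = c * ?I S i"
        by (rule Bochner_Integration.integral_mult_right) (rule intA[OF S])
      finally show ?thesis .
    qed
    then show ?case using tendsto_mult_left[OF borel[OF S], of c] by simp
  next
    case (add f g)
    have "(LINT s|?\<mu>. (f s + g s) * u i s) = (LINT s|?\<mu>. f s * u i s) + (LINT s|?\<mu>. g s * u i s)" for i
      using Bochner_Integration.integral_add[OF integrable_mult_ess_bounded[OF meas bd add(1)]
          integrable_mult_ess_bounded[OF meas bd add(2)], of i i] by (simp only: distrib_right)
    then show ?case using tendsto_add[OF add(3,4)] by simp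
  next
    case (lim f s)
    show ?case
    proof (rule tendstoI)
      fix e :: real assume e: "e > 0"
      have "(\<lambda>n. LINT x|?\<mu>. norm (f x - s n x)) \<longlonglongrightarrow> (LINT x|?\<mu>. 0)"
      proof (rule integral_dominated_convergence[where w="\<lambda>x. 3 * norm (f x)"])
        show "AE x in ?\<mu>. (\<lambda>n. norm (f x - s n x)) \<longlonglongrightarrow> 0"
        proof (rule AE_I2)
          fix x assume "x \<in> space ?\<mu>"
          from tendsto_norm[OF tendsto_diff[OF tendsto_const lim(2)[OF this], of "f x"]]
          show "(\<lambda>n. norm (f x - s n x)) \<longlonglongrightarrow> 0" by simp
        qed
        show "AE x in ?\<mu>. norm (norm (f x - s n x)) \<le> 3 * norm (f x)" for n
        proof (rule AE_I2)
          fix x assume "x \<in> space ?\<mu>"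
          then show "norm (norm (f x - s n x)) \<le> 3 * norm (f x)"
            using lim(3)[of x n] norm_triangle_ineq4[of "f x" "s n x"] by simp
        qed
      qed (use lim(1,4) in auto)
      then have "(\<lambda>n. \<bar>K\<bar> * (LINT x|?\<mu>. norm (f x - s n x))) \<longlonglongrightarrow> 0"
        by (auto intro!: tendsto_eq_intros)
      then have "\<forall>\<^sub>F n in sequentially. \<bar>K\<bar> * (LINT x|?\<mu>. norm (f x - s n x)) < e / 2"
        using e by (intro order_tendstoD(2)[of _ 0]) auto
      then obtain n where n: "\<bar>K\<bar> * (LINT x|?\<mu>. norm (f x - s n x)) < e / 2"
        by (meson eventually_sequentially order_refl)
      have i1: "integrable ?\<mu> (\<lambda>x. f x - s n x)" using lim by simp
      have split: "(LINT x|?\<mu>. f x * u i x) = (LINT x|?\<mu>. s n x * u i x) + (LINT x|?\<mu>. (f x - s n x) * u i x)" for i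
        using Bochner_Integration.integral_add[OF integrable_mult_ess_bounded[OF meas bd lim(1)]
            integrable_mult_ess_bounded[OF meas bd i1], of n i i]
        by (simp only: distrib_right[symmetric]) simp
      have bK: "AE x in ?\<mu>. norm (u i x) \<le> \<bar>K\<bar>" for i using bd[of i] by eventually_elim simp
      have "\<forall>\<^sub>F i in F. norm (LINT x|?\<mu>. s n x * u i x) < e / 2"
        using tendstoD[OF lim(5)[of n], of "e/2"] e by simp
      then show "\<forall>\<^sub>F i in F. dist (LINT x|?\<mu>. f x * u i x) 0 < e"
      proof eventually_elim
        case (elim i)
        show ?case
          using elim n norm_integral_mult_ess_bounded_le[OF meas bK i1, of i]
            norm_triangle_ineq[of "LINT x|?\<mu>. s n x * u i x" "LINT x|?\<mu>. (f x - s n x) * u i x"]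
          by (simp add: split)
      qed
    qed
  qed
qed

section \<open>Densities of Lipschitz functions\<close>

lemma measure_of_sum:
  assumes "sets M = sets borel" "sets N = sets borel"
    and "A \<in> sets borel"
  shows "emeasure (measure_of UNIV (sets borel) (\<lambda>A. emeasure M A + emeasure N A)) A
    = emeasure M A + emeasure N (A :: real set)"
proof (rule emeasure_measure_of_sigma)
  show "sigma_algebra UNIV (sets borel :: real set set)"
    using sets.sigma_algebra_axioms[of "borel :: real measure"] by simp
  show "positive (sets borel) (\<lambda>A. emeasure M A + emeasure N A)"
    by (simp add: positive_def)
  show "countably_additive (sets borel) (\<lambda>A. emeasure M A + emeasure N A)"
  proof (rule countably_additiveI)
    fix A :: "nat \<Rightarrow> real set"
    assume A: "range A \<subseteq> sets borel" "disjoint_family A"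
    have "(\<Sum>i. emeasure M (A i) + emeasure N (A i)) = (\<Sum>i. emeasure M (A i)) + (\<Sum>i. emeasure N (A i))"
      by (rule suminf_add[symmetric]) auto
    also have "\<dots> = emeasure M (\<Union>i. A i) + emeasure N (\<Union>i. A i)"
      using A assms by (simp add: suminf_emeasure)
    finally show "(\<Sum>i. emeasure M (A i) + emeasure N (A i)) = emeasure M (\<Union>i. A i) + emeasure N (\<Union>i. A i)" .
  qed
qed fact

text \<open>
  A nondecreasing function whose increments are at most those of the identity is the distribution
  function of a measure dominated by Lebesgue measure, and so it has a density.
\<close>

lemma mono_lipschitz_has_density:
  fixes p :: "real \<Rightarrow> real"
  assumes mono: "\<And>x y. x \<le> y \<Longrightarrow> p x \<le> p y" and lip: "\<And>x y. x \<le> y \<Longrightarrow> p y - p x \<le> y - x"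
  obtains \<phi> where "\<phi> \<in> borel_measurable borel" "\<And>s. 0 \<le> \<phi> s" "\<And>s. \<phi> s \<le> 1"
    "\<And>a b. a \<le> b \<Longrightarrow> (LINT s|lborel. indicator {a<..b} s * \<phi> s) = p b - p a"
proof -
  have cont: "continuous_on UNIV p"
  proof (rule continuous_on_iff[THEN iffD2], intro ballI allI impI)
    fix x e :: real assume "0 < e"
    have "dist (p y) (p x) < e" if "dist y x < e" for y
      using that mono[of x y] mono[of y x] lip[of x y] lip[of y x] by (cases "x \<le> y") (auto simp: dist_real_def)
    with \<open>0 < e\<close> show "\<exists>d>0. \<forall>x'\<in>UNIV. dist x' x < d \<longrightarrow> dist (p x') (p x) < e" by auto
  qed
  \<comment> \<open>the Stieltjes measures of \<open>p\<close> and of \<open>x - p x\<close> add up to Lebesgue measure\<close>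
  define p' where "p' = (\<lambda>x. x - p x)"
  have mono': "p' x \<le> p' y" if "x \<le> y" for x y using lip[OF that] by (simp add: p'_def)
  have cont': "continuous_on UNIV p'" unfolding p'_def by (intro continuous_intros cont)
  define \<nu> where "\<nu> = interval_measure p"
  define \<nu>' where "\<nu>' = interval_measure p'"
  have r: "continuous (at_right a) p" "continuous (at_right a) p'" for a
    using cont cont' by (auto simp: continuous_on_eq_continuous_at intro: continuous_at_imp_continuous_within)
  have Ioc: "emeasure \<nu> {a<..b} = p b - p a" "emeasure \<nu>' {a<..b} = p' b - p' a" if "a \<le> b" for a b
    unfolding \<nu>_def \<nu>'_def using that mono mono' r by (auto intro!: emeasure_interval_measure_Ioc)
  have Icc: "emeasure \<nu> {a..b} = p b - p a" "emeasure \<nu>' {a..b} = p' b - p' a" if "a \<le> b" for a b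
    unfolding \<nu>_def \<nu>'_def using that mono mono' continuous_on_subset[OF cont] continuous_on_subset[OF cont']
    by (auto intro!: emeasure_interval_measure_Icc)
  have sets: "sets \<nu> = sets borel" "sets \<nu>' = sets borel" by (simp_all add: \<nu>_def \<nu>'_def)
  define S where "S = measure_of UNIV (sets borel) (\<lambda>A. emeasure \<nu> A + emeasure \<nu>' A)"
  have S: "emeasure S A = emeasure \<nu> A + emeasure \<nu>' A" if "A \<in> sets borel" for A
    unfolding S_def by (rule measure_of_sum[OF sets that])
  have setsS: "sets S = sets borel"
    unfolding S_def by (metis sets.sigma_sets_eq sets_measure_of space_borel sets.space_closed)
  have "lborel = S"
  proof (rule lborel_eqI)
    fix l u :: real assume "\<And>b. b \<in> Basis \<Longrightarrow> l \<bullet> b \<le> u \<bullet> b"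
    then have lu: "l \<le> u" by simp
    show "emeasure S (box l u) = (\<Prod>b\<in>Basis. (u - l) \<bullet> b)"
    proof (cases "l = u")
      case True then show ?thesis by simp
    next
      case False
      with lu have "l < u" by simp
      then have eq: "{l<..u} = {l<..<u} \<union> {u..u}" by auto
      have "emeasure S {l<..u} = emeasure S {l<..<u} + emeasure S {u..u}"
        unfolding eq by (intro plus_emeasure[symmetric]) (auto simp: setsS)
      moreover have "emeasure S {u..u} = 0" using Icc[of u u] by (simp add: S)
      moreover have "emeasure S {l<..u} = ennreal (u - l)"
        using Ioc[OF lu] mono[OF lu] mono'[OF lu] by (simp add: S p'_def flip: ennreal_plus)
      ultimately show ?thesis by simp
    qed
  qed (simp add: setsS)
  then have sum: "emeasure lborel A = emeasure \<nu> A + emeasure \<nu>' A" if "A \<in> sets borel" for A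
    using S[OF that] by simp
  have ac: "absolutely_continuous lborel \<nu>" "absolutely_continuous lborel \<nu>'"
    unfolding absolutely_continuous_def using sets by (auto simp: null_sets_def sum)
  obtain f where f: "f \<in> borel_measurable lborel" "density lborel f = \<nu>"
    using sigma_finite_measure.Radon_Nikodym[OF sigma_finite_lborel ac(1)] sets by auto
  obtain f' where f': "f' \<in> borel_measurable lborel" "density lborel f' = \<nu>'"
    using sigma_finite_measure.Radon_Nikodym[OF sigma_finite_lborel ac(2)] sets by auto
  have "density lborel (\<lambda>s. f s + f' s) = density lborel (\<lambda>_. 1)"
  proof (rule measure_eqI)
    fix A assume "A \<in> sets (density lborel (\<lambda>s. f s + f' s))"
    then have A: "A \<in> sets borel" by simp
    have "emeasure (density lborel (\<lambda>s. f s + f' s)) A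
        = (\<integral>\<^sup>+ s. f s * indicator A s + f' s * indicator A s \<partial>lborel)"
      using A f(1) f'(1) by (simp add: emeasure_density distrib_right)
    also have "\<dots> = emeasure \<nu> A + emeasure \<nu>' A"
      using A f f'(1) by (subst nn_integral_add) (auto simp: emeasure_density f'(2)[symmetric] f(2)[symmetric])
    also have "\<dots> = emeasure (density lborel (\<lambda>_. 1)) A" using sum[OF A] A by (simp add: emeasure_density)
    finally show "emeasure (density lborel (\<lambda>s. f s + f' s)) A = emeasure (density lborel (\<lambda>_. 1)) A" .
  qed simp
  then have "AE s in lborel. f s + f' s = 1"
    using f(1) f'(1) by (subst (asm) sigma_finite_measure.density_unique_iff[OF sigma_finite_lborel]) auto
  then have f1: "AE s in lborel. f s \<le> 1" by eventually_elim (metis add_increasing2 order_refl zero_le)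
  define \<phi> where "\<phi> s = enn2real (min 1 (f s))" for s
  have m: "\<phi> \<in> borel_measurable borel" unfolding \<phi>_def using f(1) by simp
  have e\<phi>: "ennreal (\<phi> s) = min 1 (f s)" for s
    unfolding \<phi>_def by (rule ennreal_enn2real) (auto simp: min_def less_top[symmetric] top_unique)
  have \<phi>01: "0 \<le> \<phi> s" "\<phi> s \<le> 1" for s
    using e\<phi>[of s] by (auto simp: \<phi>_def enn2real_leI)
  show ?thesis
  proof (rule that[OF m \<phi>01])
    fix a b :: real assume ab: "a \<le> b"
    have "(\<integral>\<^sup>+ s. ennreal (indicator {a<..b} s * \<phi> s) \<partial>lborel) = (\<integral>\<^sup>+ s. f s * indicator {a<..b} s \<partial>lborel)"
      by (rule nn_integral_cong_AE) (use f1 in \<open>eventually_elim, auto simp: e\<phi> indicator_def min_def\<close>)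
    also have "\<dots> = emeasure \<nu> {a<..b}" using f by (simp add: emeasure_density flip: f(2))
    finally have "(\<integral>\<^sup>+ s. ennreal (indicator {a<..b} s * \<phi> s) \<partial>lborel) = ennreal (p b - p a)"
      using Ioc(1)[OF ab] by simp
    then show "(LINT s|lborel. indicator {a<..b} s * \<phi> s) = p b - p a"
      using \<phi>01 mono[OF ab] m by (subst integral_eq_nn_integral) auto
  qed
qed

lemma LINT_unit_interval_lborel:
  fixes g :: "real \<Rightarrow> 'b::{banach, second_countable_topology}"
  assumes "g \<in> borel_measurable borel"
  shows "(LINT s|unit_interval_measure. g s) = (LINT s|lborel. indicator {0..1} s *\<^sub>R g s)"
  by (subst integral_restrict_space) (use assms in \<open>auto intro!: integral_completion\<close>)

text \<open>The indefinite integral on the unit interval, extended by constants to the whole line.\<close>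

definition primitive :: "(real \<Rightarrow> 'b::{banach, second_countable_topology}) \<Rightarrow> real \<Rightarrow> 'b" where
  "primitive u x = (LINT s|unit_interval_measure. indicator {..x} s *\<^sub>R u s)"

lemma borel_measurable_indicator_unit_interval:
  "A \<in> sets borel \<Longrightarrow> (indicator A :: real \<Rightarrow> real) \<in> borel_measurable unit_interval_measure"
  by (intro borel_measurable_unit_interval borel_measurable_indicator)

lemma integrable_indicator_unit_interval:
  fixes u :: "real \<Rightarrow> 'b::{banach, second_countable_topology}"
  assumes "integrable unit_interval_measure u" "A \<in> sets borel"
  shows "integrable unit_interval_measure (\<lambda>s. indicator A s *\<^sub>R u s)"
  by (rule integrable_mult_indicator'[OF borel_measurable_indicator_unit_interval assms(1)]) fact

lemma primitive_eq_0: "x \<le> 0 \<Longrightarrow> primitive u x = 0"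
  unfolding primitive_def
proof (rule integral_eq_zero_AE)
  assume "x \<le> 0"
  have "AE s in lebesgue. s \<notin> {0::real}" by (intro AE_not_in) auto
  then show "AE s in unit_interval_measure. indicator {..x} s *\<^sub>R u s = 0"
    unfolding AE_unit_interval_iff by eventually_elim (use \<open>x \<le> 0\<close> in \<open>auto simp: indicator_def\<close>)
qed

lemma primitive_ge_1: "x \<ge> 1 \<Longrightarrow> primitive u x = primitive u 1"
  unfolding primitive_def by (rule Bochner_Integration.integral_cong) (auto simp: indicator_def)

lemma primitive_clamp: "primitive u (max 0 (min 1 x)) = primitive u x"
  using primitive_eq_0[of x u] primitive_eq_0[of 0 u] primitive_ge_1[of x u]
  by (cases "x \<le> 0"; cases "x \<le> 1") (auto simp: max_def min_def)

lemma primitive_cong_AE: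
  assumes "u \<in> borel_measurable unit_interval_measure" "v \<in> borel_measurable unit_interval_measure"
    "AE s in unit_interval_measure. u s = v s"
  shows "primitive u x = primitive v x"
  unfolding primitive_def
  by (rule integral_cong_AE)
    (use assms in \<open>auto intro!: borel_measurable_scaleR borel_measurable_indicator_unit_interval elim: eventually_mono\<close>)

lemma primitive_add:
  assumes "integrable unit_interval_measure u" "integrable unit_interval_measure v"
  shows "primitive (\<lambda>s. u s + v s) x = primitive u x + primitive v x"
  using Bochner_Integration.integral_add[OF integrable_indicator_unit_interval[OF assms(1), of "{..x}"]
      integrable_indicator_unit_interval[OF assms(2), of "{..x}"]]
  unfolding primitive_def by (simp add: scaleR_add_right)

lemma primitive_linear:
  assumes "bounded_linear h" "integrable unit_interval_measure u"
  shows "primitive (\<lambda>s. h (u s)) x = h (primitive u x)"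
proof -
  interpret bounded_linear h by fact
  show ?thesis
    using integral_bounded_linear[OF assms(1) integrable_indicator_unit_interval[OF assms(2), of "{..x}"]]
    unfolding primitive_def by (simp add: scaleR)
qed

lemma primitive_diff:
  assumes "integrable unit_interval_measure u" "integrable unit_interval_measure v"
  shows "primitive (\<lambda>s. u s - v s) x = primitive u x - primitive v x"
  using Bochner_Integration.integral_diff[OF integrable_indicator_unit_interval[OF assms(1), of "{..x}"]
      integrable_indicator_unit_interval[OF assms(2), of "{..x}"]]
  unfolding primitive_def by (simp add: scaleR_diff_right)

lemma primitive_sum:
  assumes "\<And>i. i \<in> I \<Longrightarrow> integrable unit_interval_measure (u i)"
  shows "primitive (\<lambda>s. \<Sum>i\<in>I. u i s) x = (\<Sum>i\<in>I. primitive (u i) x)"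
  using Bochner_Integration.integral_sum[OF integrable_indicator_unit_interval[OF assms, of _ "{..x}"], of I "\<lambda>i. i"]
  unfolding primitive_def by (simp add: scaleR_sum_right)

lemma primitive_increment:
  assumes "integrable unit_interval_measure u" "x \<le> y"
  shows "primitive u y - primitive u x = (LINT s|unit_interval_measure. indicator {x<..y} s *\<^sub>R u s)"
proof -
  have "primitive u y - primitive u x
      = (LINT s|unit_interval_measure. indicator {..y} s *\<^sub>R u s - indicator {..x} s *\<^sub>R u s)"
    unfolding primitive_def
    by (subst Bochner_Integration.integral_diff) (auto intro: integrable_indicator_unit_interval assms)
  also have "\<dots> = (LINT s|unit_interval_measure. indicator {x<..y} s *\<^sub>R u s)"
    using assms(2) by (intro Bochner_Integration.integral_cong) (auto simp: indicator_def)
  finally show ?thesis .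
qed

lemma LINT_indicator_Ioc:
  assumes "x \<in> {0..1}" "y \<in> {0..1}" "x \<le> y"
  shows "(LINT s|unit_interval_measure. indicator {x<..y} s) = y - x"
proof -
  have "(LINT s|unit_interval_measure. indicator {x<..y} s) = (LINT s|lborel. indicator {x<..y} s :: real)"
  proof (subst LINT_unit_interval_lborel)
    have "indicator {0..1} s *\<^sub>R indicator {x<..y} s = (indicator {x<..y} s :: real)" for s
      using assms by (auto simp: indicator_def)
    then show "(LINT s|lborel. indicator {0..1} s *\<^sub>R indicator {x<..y} s) = (LINT s|lborel. indicator {x<..y} s :: real)"
      by (simp only:)
  qed simp
  then show ?thesis using assms by simp
qed

lemma primitive_const: "x \<in> {0..1} \<Longrightarrow> primitive (\<lambda>_. c) x = x *\<^sub>R c"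
  using primitive_increment[of "\<lambda>_. c" 0 x] primitive_eq_0[of 0 "\<lambda>_. c"] LINT_indicator_Ioc[of 0 x]
    integral_scaleR_left[of c unit_interval_measure "indicator {0<..x}"]
    integrable_indicator_unit_interval[of "\<lambda>_. 1 :: real" "{0<..x}"]
  by (simp del: integral_scaleR_left)

lemma norm_primitive_increment_le:
  assumes "u \<in> borel_measurable unit_interval_measure" "AE s in unit_interval_measure. norm (u s) \<le> K"
    and "x \<in> {0..1}" "y \<in> {0..1}"
  shows "norm (primitive u y - primitive u x) \<le> K * \<bar>y - x\<bar>"
proof -
  have *: "norm (primitive u y - primitive u x) \<le> K * \<bar>y - x\<bar>"
    if xy: "x \<in> {0..1}" "y \<in> {0..1}" "x \<le> y" for x y
  proof -
    have i: "integrable unit_interval_measure u" by (rule integrable_unit_interval_bounded[OF assms(1,2)])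
    have "norm (primitive u y - primitive u x) \<le> (LINT s|unit_interval_measure. K * indicator {x<..y} s)"
      unfolding primitive_increment[OF i xy(3)]
    proof (rule norm_integral_le_AE)
      show "integrable unit_interval_measure (\<lambda>s. indicator {x<..y} s *\<^sub>R u s)"
        by (rule integrable_indicator_unit_interval[OF i]) simp
      show "integrable unit_interval_measure (\<lambda>s. K * indicator {x<..y} s)"
        using integrable_indicator_unit_interval[of "\<lambda>_. K" "{x<..y}"] by (simp add: mult.commute)
      show "AE s in unit_interval_measure. norm (indicator {x<..y} s *\<^sub>R u s) \<le> K * indicator {x<..y} s"
        using assms(2) by eventually_elim (auto simp: indicator_def)
    qed
    also have "\<dots> = K * (y - x)" using LINT_indicator_Ioc[OF xy] by simp
    finally show ?thesis using xy by simp
  qed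
  show ?thesis
    using *[OF assms(3,4)] *[OF assms(4,3)] by (cases "x \<le> y") (auto simp: norm_minus_commute abs_minus_commute)
qed

text \<open>
  If all integrals of \<open>u\<close> over initial intervals vanish, then so does its integral against
  \<open>norm u / u\<close>, which is the integral of \<open>norm u\<close>.
\<close>

lemma AE_eq_0_if_primitive_eq_0:
  fixes u :: "real \<Rightarrow> 'k::{real_normed_field, euclidean_space}"
  assumes "u \<in> borel_measurable unit_interval_measure" "AE s in unit_interval_measure. norm (u s) \<le> K"
    and "\<And>x. x \<in> {0..1} \<Longrightarrow> primitive u x = 0"
  shows "AE s in unit_interval_measure. u s = 0"
proof -
  have sgn: "(\<lambda>s. of_real (norm (u s)) / u s) \<in> borel_measurable unit_interval_measure"
    using assms(1) by (intro borel_measurable_divide) (auto intro: borel_measurable_of_real)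
  have int: "integrable unit_interval_measure (\<lambda>s. of_real (norm (u s)) / u s)"
    by (rule integrable_unit_interval_bounded[where K=1, OF sgn]) (auto simp: norm_divide)
  have "(\<lambda>i::nat. LINT s|unit_interval_measure. (of_real (norm (u s)) / u s) * u s) \<longlonglongrightarrow> 0"
    by (rule tendsto_integral_of_intervals[OF assms(1,2) _ int])
      (use assms(3) in \<open>simp add: primitive_def\<close>)
  moreover have "(LINT s|unit_interval_measure. (of_real (norm (u s)) / u s) * u s)
      = of_real (LINT s|unit_interval_measure. norm (u s))"
    by (subst integral_of_real[symmetric])
      (auto intro!: Bochner_Integration.integral_cong integrable_norm integrable_unit_interval_bounded[OF assms(1,2)])
  ultimately have "(LINT s|unit_interval_measure. norm (u s)) = 0"
    by (simp only: LIMSEQ_const_iff of_real_eq_0_iff)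
  then have "AE s in unit_interval_measure. norm (u s) = 0"
    using integrable_unit_interval_bounded[OF assms(1,2)]
    by (subst (asm) integral_nonneg_eq_0_iff_AE) auto
  then show ?thesis by simp
qed

lemma lipschitz_has_density_real:
  fixes P :: "real \<Rightarrow> real"
  assumes lip: "\<And>x y. x \<in> {0..1} \<Longrightarrow> y \<in> {0..1} \<Longrightarrow> \<bar>P y - P x\<bar> \<le> K * \<bar>y - x\<bar>"
  obtains u where "u \<in> borel_measurable borel" "\<And>s. \<bar>u s\<bar> \<le> K"
    "\<And>x. x \<in> {0..1} \<Longrightarrow> primitive u x = P x - P 0"
proof (cases "K = 0")
  case True
  have const: "P x = P 0" if "x \<in> {0..1}" for x using lip[of 0 x] that True by simp
  have "primitive (\<lambda>_. 0) x = P x - P 0" if "x \<in> {0..1}" for x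
    unfolding const[OF that] by (simp add: primitive_def)
  with True show ?thesis by (intro that[of "\<lambda>_. 0"]) simp_all
next
  case False
  have "\<bar>P 1 - P 0\<bar> \<le> K * \<bar>1 - 0\<bar>" by (rule lip) auto
  then have "0 \<le> K" by simp
  with False have K: "K > 0" by simp
  \<comment> \<open>\<open>P\<close> is extended to the line, and \<open>K * x\<close> is added to make it nondecreasing\<close>
  define cl where "cl x = max 0 (min 1 x)" for x :: real
  have cl: "cl x \<in> {0..1}" "x \<le> y \<Longrightarrow> cl x \<le> cl y" "x \<le> y \<Longrightarrow> cl y - cl x \<le> y - x" for x y
    by (auto simp: cl_def)
  define p where "p x = (P (cl x) + K * cl x) / (2 * K)" for x
  have incr: "p y - p x = (P (cl y) - P (cl x) + K * (cl y - cl x)) / (2 * K)" for x y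
    by (simp add: p_def diff_divide_distrib[symmetric] right_diff_distrib)
  have P: "\<bar>P (cl y) - P (cl x)\<bar> \<le> K * (cl y - cl x)" if "x \<le> y" for x y
    using lip[OF cl(1) cl(1), of y x] cl(2)[OF that] by simp
  have mono: "p x \<le> p y" if "x \<le> y" for x y
  proof -
    have "0 \<le> p y - p x" unfolding incr using P[OF that] K by (intro divide_nonneg_pos) auto
    then show ?thesis by simp
  qed
  have up: "p y - p x \<le> y - x" if "x \<le> y" for x y
  proof -
    have "P (cl y) - P (cl x) + K * (cl y - cl x) \<le> (2 * K) * (cl y - cl x)"
      using P[OF that] by simp
    also have "\<dots> \<le> (2 * K) * (y - x)" using cl(3)[OF that] K by (intro mult_left_mono) auto
    finally show ?thesis unfolding incr using K by (simp add: divide_le_eq mult.commute)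
  qed
  obtain \<phi> where \<phi>: "\<phi> \<in> borel_measurable borel" "\<And>s. 0 \<le> \<phi> s" "\<And>s. \<phi> s \<le> 1"
    "\<And>a b. a \<le> b \<Longrightarrow> (LINT s|lborel. indicator {a<..b} s * \<phi> s) = p b - p a"
    using mono_lipschitz_has_density[of p] mono up by blast
  define u where "u s = 2 * K * \<phi> s - K" for s
  show ?thesis
  proof (rule that[of u])
    show "u \<in> borel_measurable borel" unfolding u_def using \<phi>(1) by simp
    show "\<bar>u s\<bar> \<le> K" for s
    proof -
      have "K * \<phi> s \<le> K * 1" "0 \<le> K * \<phi> s" using \<phi>(2,3)[of s] K by (auto intro!: mult_left_mono)
      then show ?thesis unfolding u_def by (simp add: abs_le_iff)
    qed
    fix x :: real assume x: "x \<in> {0..1}"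
    have i\<phi>: "integrable unit_interval_measure \<phi>"
      by (rule integrable_unit_interval_bounded[where K=1, OF borel_measurable_unit_interval[OF \<phi>(1)]])
        (use \<phi>(2,3) in \<open>auto simp: abs_of_nonneg\<close>)
    have "primitive \<phi> x = primitive \<phi> x - primitive \<phi> 0" by (simp add: primitive_eq_0)
    also have "\<dots> = (LINT s|unit_interval_measure. indicator {0<..x} s *\<^sub>R \<phi> s)"
      by (rule primitive_increment[OF i\<phi>]) (use x in simp)
    also have "\<dots> = (LINT s|lborel. indicator {0<..x} s * \<phi> s)"
      by (subst LINT_unit_interval_lborel)
        (use x \<phi>(1) in \<open>auto intro!: Bochner_Integration.integral_cong simp: indicator_def\<close>)
    also have "\<dots> = p x - p 0" using x by (intro \<phi>(4)) simp
    also have "\<dots> = (P x - P 0 + K * x) / (2 * K)" unfolding incr using x by (simp add: cl_def)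
    finally have "2 * K * primitive \<phi> x = P x - P 0 + K * x" using K by simp
    moreover have "primitive u x = primitive (\<lambda>s. 2 * K * \<phi> s) x - primitive (\<lambda>_. K) x"
      unfolding u_def by (rule primitive_diff) (use i\<phi> in auto)
    moreover have "primitive (\<lambda>s. 2 * K * \<phi> s) x = 2 * K * primitive \<phi> x"
      by (rule primitive_linear[OF bounded_linear_mult_right i\<phi>])
    ultimately show "primitive u x = P x - P 0" using x by (simp add: primitive_const mult.commute)
  qed
qed

text \<open>
  No differentiation theorem is needed here: the function \<open>K * x - primitive \<psi> x - h * x\<close> is Lipschitz
  continuous with constant \<open>h\<close>, so it has a density \<open>u\<close> with \<open>\<bar>u\<bar> \<le> h\<close>, and \<open>u = K - h - \<psi>\<close> almost everywhere.
\<close>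

lemma AE_le_if_primitive_increment_le:
  fixes \<psi> :: "real \<Rightarrow> real"
  assumes m: "\<psi> \<in> borel_measurable unit_interval_measure" and bd: "AE s in unit_interval_measure. \<bar>\<psi> s\<bar> \<le> L"
    and le: "\<And>x y. x \<in> {0..1} \<Longrightarrow> y \<in> {0..1} \<Longrightarrow> x \<le> y \<Longrightarrow> primitive \<psi> y - primitive \<psi> x \<le> K * (y - x)"
  shows "AE s in unit_interval_measure. \<psi> s \<le> K"
proof -
  have iL: "integrable unit_interval_measure \<psi>"
    by (rule integrable_unit_interval_bounded[OF m]) (use bd in simp)
  define h where "h = (\<bar>K\<bar> + \<bar>L\<bar>) / 2"
  define P where "P x = (K * x - primitive \<psi> x) - h * x" for x
  have "\<bar>P y - P x\<bar> \<le> h * \<bar>y - x\<bar>" if xy: "x \<in> {0..1}" "y \<in> {0..1}" "x \<le> y" for x y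
  proof -
    have 1: "0 \<le> K * (y - x) - (primitive \<psi> y - primitive \<psi> x)" using le[OF xy] by simp
    have "AE s in unit_interval_measure. norm (\<psi> s) \<le> L" using bd by simp
    from norm_primitive_increment_le[OF m this xy(1,2)] xy(3)
    have 2: "- (primitive \<psi> y - primitive \<psi> x) \<le> L * (y - x)" by simp
    have "(K + L) * (y - x) \<le> (2 * h) * (y - x)"
      using xy(3) unfolding h_def by (intro mult_right_mono) auto
    with 2 have 3: "K * (y - x) - (primitive \<psi> y - primitive \<psi> x) \<le> 2 * (h * (y - x))"
      by (simp add: distrib_right)
    have "P y - P x = (K * (y - x) - (primitive \<psi> y - primitive \<psi> x)) - h * (y - x)"
      by (simp add: P_def algebra_simps)
    moreover have "\<bar>y - x\<bar> = y - x" using xy(3) by simp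
    ultimately show ?thesis using 1 3 by (simp only: abs_le_iff) linarith
  qed
  then have lip: "\<bar>P y - P x\<bar> \<le> h * \<bar>y - x\<bar>" if "x \<in> {0..1}" "y \<in> {0..1}" for x y
    using that by (cases "x \<le> y") (force simp: abs_minus_commute)+
  obtain u where u: "u \<in> borel_measurable borel" "\<And>s. \<bar>u s\<bar> \<le> h"
    "\<And>x. x \<in> {0..1} \<Longrightarrow> primitive u x = P x - P 0"
    using lipschitz_has_density_real[of P "h"] lip by blast
  have iu: "integrable unit_interval_measure u"
    by (rule integrable_unit_interval_bounded[OF borel_measurable_unit_interval[OF u(1)], of h]) (use u(2) in auto)
  have "AE s in unit_interval_measure. u s - ((K - h) - \<psi> s) = 0"
  proof (rule AE_eq_0_if_primitive_eq_0)
    show "(\<lambda>s. u s - ((K - h) - \<psi> s)) \<in> borel_measurable unit_interval_measure"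
      using m borel_measurable_unit_interval[OF u(1)] by auto
    show "AE s in unit_interval_measure. norm (u s - ((K - h) - \<psi> s)) \<le> 2 * h + \<bar>K\<bar> + \<bar>L\<bar>"
      using bd
    proof eventually_elim
      case (elim s)
      show ?case using u(2)[of s] elim unfolding real_norm_def by arith
    qed
    fix x :: real assume x: "x \<in> {0..1}"
    have "primitive (\<lambda>s. u s - ((K - h) - \<psi> s)) x
        = primitive u x - (primitive (\<lambda>_. K - h) x - primitive \<psi> x)"
      using iu iL by (simp add: primitive_diff)
    then show "primitive (\<lambda>s. u s - ((K - h) - \<psi> s)) x = 0"
      using x by (simp add: primitive_const u(3) P_def primitive_eq_0 algebra_simps)
  qed
  then show ?thesis
  proof eventually_elim
    case (elim s)
    show ?case using u(2)[of s] elim by arith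
  qed
qed

lemma lipschitz_has_density:
  fixes P :: "real \<Rightarrow> 'k::euclidean_space"
  assumes lip: "\<And>x y. x \<in> {0..1} \<Longrightarrow> y \<in> {0..1} \<Longrightarrow> norm (P y - P x) \<le> K * \<bar>y - x\<bar>"
  obtains u L where "u \<in> borel_measurable borel" "\<And>s. norm (u s) \<le> L"
    "\<And>x. x \<in> {0..1} \<Longrightarrow> primitive u x = P x - P 0"
proof -
  have "\<exists>u. u \<in> borel_measurable borel \<and> (\<forall>s. \<bar>u s\<bar> \<le> K) \<and>
      (\<forall>x\<in>{0..1}. primitive u x = P x \<bullet> b - P 0 \<bullet> b)" if "b \<in> Basis" for b
  proof -
    have "\<bar>P y \<bullet> b - P x \<bullet> b\<bar> \<le> K * \<bar>y - x\<bar>" if "x \<in> {0..1}" "y \<in> {0..1}" for x y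
      using lip[OF that] Basis_le_norm[OF \<open>b \<in> Basis\<close>, of "P y - P x"] by (simp add: inner_diff_left)
    from lipschitz_has_density_real[of "\<lambda>x. P x \<bullet> b" K, OF this] show ?thesis by metis
  qed
  then obtain U where U: "\<And>b. b \<in> Basis \<Longrightarrow> U b \<in> borel_measurable borel"
    "\<And>b s. b \<in> Basis \<Longrightarrow> \<bar>U b s\<bar> \<le> K"
    "\<And>b x. b \<in> Basis \<Longrightarrow> x \<in> {0..1} \<Longrightarrow> primitive (U b) x = P x \<bullet> b - P 0 \<bullet> b"
    by metis
  define u where "u s = (\<Sum>b\<in>Basis. U b s *\<^sub>R b)" for s
  have i: "integrable unit_interval_measure (U b)" if "b \<in> Basis" for b
    by (rule integrable_unit_interval_bounded[OF borel_measurable_unit_interval[OF U(1)[OF that]], of K])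
      (use U(2)[OF that] in auto)
  show ?thesis
  proof (rule that[of u "\<Sum>b\<in>(Basis::'k set). K"])
    show "u \<in> borel_measurable borel" unfolding u_def using U(1) by (intro borel_measurable_sum borel_measurable_scaleR) auto
    show "norm (u s) \<le> (\<Sum>b\<in>(Basis::'k set). K)" for s
      unfolding u_def using U(2) by (intro order_trans[OF norm_sum] sum_mono) auto
    fix x :: real assume x: "x \<in> {0..1}"
    have "primitive u x = (\<Sum>b\<in>Basis. primitive (\<lambda>s. U b s *\<^sub>R b) x)"
      unfolding u_def by (rule primitive_sum) (use i in auto)
    also have "\<dots> = (\<Sum>b\<in>Basis. (P x \<bullet> b - P 0 \<bullet> b) *\<^sub>R b)"
      using x by (intro sum.cong refl) (simp add: primitive_linear[OF bounded_linear_scaleR_left i] U(3))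
    also have "\<dots> = P x - P 0"
      using euclidean_representation[of "P x - P 0"] by (simp add: inner_diff_left)
    finally show "primitive u x = P x - P 0" .
  qed
qed

text \<open>
  A bound for the increments of finitely many primitives bounds the densities: for each choice of
  directions from a countable dense set, the corresponding real combination is bounded almost
  everywhere, and densely many directions determine the sum of the norms.
\<close>

lemma AE_sum_norm_le_if_primitive_increment_le:
  fixes u :: "nat \<Rightarrow> real \<Rightarrow> 'k::{real_normed_field, euclidean_space}"
  assumes m: "\<And>j. u j \<in> borel_measurable unit_interval_measure"
    and bd: "\<And>j. AE s in unit_interval_measure. norm (u j s) \<le> L j"
    and le: "\<And>x y. x \<in> {0..1} \<Longrightarrow> y \<in> {0..1} \<Longrightarrow> x \<le> y \<Longrightarrow>
      (\<Sum>j<N. norm (primitive (u j) y - primitive (u j) x)) \<le> K * (y - x)"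
  shows "AE s in unit_interval_measure. (\<Sum>j<N. norm (u j s)) \<le> K"
proof -
  have K0: "0 \<le> K"
    using le[of 0 1] sum_nonneg[of "{..<N}" "\<lambda>j. norm (primitive (u j) 1 - primitive (u j) 0)"] by simp
  obtain D :: "'k set" where D: "countable D" "\<And>U. open U \<Longrightarrow> U \<noteq> {} \<Longrightarrow> \<exists>d\<in>D. d \<in> U"
    using countable_dense_setE by blast
  have i: "integrable unit_interval_measure (u j)" for j
    by (rule integrable_unit_interval_bounded[OF m bd])
  define W where "W = (\<lambda>w::'k list. Max (insert 0 (norm ` set w)))"
  have W: "norm (w ! j) \<le> W w" if "j < N" "length w = N" for w j
    unfolding W_def using that by (intro Max_ge) auto
  have AE1: "AE s in unit_interval_measure. (\<Sum>j<N. (w ! j * u j s) \<bullet> 1) \<le> W w * K"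
    if w: "length w = N" for w
  proof (rule AE_le_if_primitive_increment_le)
    have bl: "bounded_linear (\<lambda>z. (w ! j * z) \<bullet> 1)" for j
      using bounded_linear_compose[OF bounded_linear_inner_left bounded_linear_mult_right] .
    show "(\<lambda>s. \<Sum>j<N. (w ! j * u j s) \<bullet> 1) \<in> borel_measurable unit_interval_measure"
      using m by (intro borel_measurable_sum borel_measurable_inner borel_measurable_times) auto
    have "AE s in unit_interval_measure. \<forall>j<N. norm (u j s) \<le> L j"
      using bd by (simp add: AE_ball_countable' AE_all_countable)
    then show "AE s in unit_interval_measure. \<bar>\<Sum>j<N. (w ! j * u j s) \<bullet> 1\<bar> \<le> (\<Sum>j<N. norm (w ! j) * L j)"
    proof eventually_elim
      case (elim s)
      have "\<bar>(w ! j * u j s) \<bullet> 1\<bar> \<le> norm (w ! j) * L j" if "j < N" for j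
        using Cauchy_Schwarz_ineq2[of "w ! j * u j s" 1] elim that
          mult_left_mono[of "norm (u j s)" "L j" "norm (w ! j)"] by (simp add: norm_mult)
      then show ?case by (intro order_trans[OF sum_abs] sum_mono) auto
    qed
    fix x y :: real assume xy: "x \<in> {0..1}" "y \<in> {0..1}" "x \<le> y"
    have prim: "primitive (\<lambda>s. \<Sum>j<N. (w ! j * u j s) \<bullet> 1) z = (\<Sum>j<N. (w ! j * primitive (u j) z) \<bullet> 1)" for z
      by (subst primitive_sum) (auto intro!: integrable_bounded_linear[OF bl i] sum.cong primitive_linear[OF bl i])
    have "primitive (\<lambda>s. \<Sum>j<N. (w ! j * u j s) \<bullet> 1) y - primitive (\<lambda>s. \<Sum>j<N. (w ! j * u j s) \<bullet> 1) x
        = (\<Sum>j<N. (w ! j * (primitive (u j) y - primitive (u j) x)) \<bullet> 1)"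
      unfolding prim by (simp add: sum_subtractf inner_diff_left right_diff_distrib)
    also have "\<dots> \<le> (\<Sum>j<N. W w * norm (primitive (u j) y - primitive (u j) x))"
    proof (rule sum_mono)
      fix j assume "j \<in> {..<N}"
      then show "(w ! j * (primitive (u j) y - primitive (u j) x)) \<bullet> 1 \<le> W w * norm (primitive (u j) y - primitive (u j) x)"
        using norm_cauchy_schwarz[of "w ! j * (primitive (u j) y - primitive (u j) x)" 1] W[of j w] w
          mult_right_mono[of "norm (w ! j)" "W w" "norm (primitive (u j) y - primitive (u j) x)"]
        by (simp add: norm_mult)
    qed
    also have "\<dots> \<le> W w * (K * (y - x))"
      unfolding sum_distrib_left[symmetric]
      by (rule mult_left_mono[OF le[OF xy]]) (simp add: W_def)
    finally show "primitive (\<lambda>s. \<Sum>j<N. (w ! j * u j s) \<bullet> 1) y - primitive (\<lambda>s. \<Sum>j<N. (w ! j * u j s) \<bullet> 1) x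
       \<le> W w * K * (y - x)" by simp
  qed
  have "countable {w \<in> lists D. length w = N}"
    by (rule countable_subset[OF _ countable_lists[OF D(1)]]) auto
  then have "AE s in unit_interval_measure. \<forall>w\<in>{w \<in> lists D. length w = N}. (\<Sum>j<N. (w ! j * u j s) \<bullet> 1) \<le> W w * K"
    by (simp only: AE_ball_countable) (use AE1 in blast)
  then show ?thesis
  proof eventually_elim
    case (elim s)
    let ?S = "\<Sum>j<N. norm (u j s)"
    have S0: "0 \<le> ?S" by (simp add: sum_nonneg)
    have *: "?S \<le> K + \<eta> * (K + ?S)" if \<eta>: "\<eta> > 0" for \<eta>
    proof -
      define z where "z j = of_real (norm (u j s)) / u j s" for j
      have "\<exists>d\<in>D. norm (d - z j) < \<eta>" for j
        using D(2)[of "ball (z j) \<eta>"] \<eta> by (auto simp: dist_norm norm_minus_commute)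
      then obtain d where d: "\<And>j. d j \<in> D" "\<And>j. norm (d j - z j) < \<eta>" by metis
      define w where "w = map d [0..<N]"
      have w: "w \<in> lists D" "length w = N" unfolding w_def using d(1) by auto
      have nz: "norm (z j) \<le> 1" for j by (simp add: z_def norm_divide)
      have "norm (d j) \<le> 1 + \<eta>" for j
        using nz[of j] d(2)[of j] norm_triangle_sub[of "d j" "z j"] by linarith
      then have "W w \<le> 1 + \<eta>" unfolding W_def w_def using \<eta> by (subst Max_le_iff) auto
      then have "W w * K \<le> (1 + \<eta>) * K" by (rule mult_right_mono[OF _ K0])
      moreover have "(\<Sum>j<N. (w ! j * u j s) \<bullet> 1) \<le> W w * K" using elim w by auto
      moreover have "?S - \<eta> * ?S \<le> (\<Sum>j<N. (w ! j * u j s) \<bullet> 1)"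
        unfolding sum_distrib_left sum_subtractf[symmetric]
      proof (rule sum_mono)
        fix j assume j: "j \<in> {..<N}"
        have "(z j * u j s) \<bullet> 1 = norm (u j s)"
          by (simp add: z_def)
        moreover have "\<bar>((d j - z j) * u j s) \<bullet> 1\<bar> \<le> \<eta> * norm (u j s)"
          using Cauchy_Schwarz_ineq2[of "(d j - z j) * u j s" 1] d(2)[of j]
            mult_right_mono[of "norm (d j - z j)" \<eta> "norm (u j s)"] by (simp add: norm_mult)
        ultimately show "norm (u j s) - \<eta> * norm (u j s) \<le> (w ! j * u j s) \<bullet> 1"
          using j by (simp add: w_def left_diff_distrib inner_diff_left abs_le_iff)
      qed
      ultimately show ?thesis by (simp add: algebra_simps)
    qed
    show ?case
    proof (rule field_le_epsilon)
      fix e :: real assume e: "e > 0"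
      have "?S \<le> K + e / (K + ?S + 1) * (K + ?S)" by (rule *) (use e K0 S0 in simp)
      also have "\<dots> \<le> K + e"
        using e K0 S0 by (simp add: divide_le_eq mult_left_mono)
      finally show "?S \<le> K + e" .
    qed
  qed
qed

section \<open>Measurability of functions into \<open>\<ell>\<^sup>1\<close>\<close>

lemma bounded_linear_l1_nth: "bounded_linear (\<lambda>x. l1_nth x j)"
  by (rule bounded_linear_intro[where K = 1]) (auto simp: norm_l1_nth_le)

text \<open>
  The sequence with the entry \<open>z\<close> at \<open>j\<close> and zeros elsewhere.
\<close>

definition l1_unit :: "nat \<Rightarrow> 'k::real_normed_vector \<Rightarrow> 'k l1" where
  "l1_unit j z = Abs_l1 (\<lambda>n. if n = j then z else 0)"

lemma l1_nth_l1_unit [simp]: "l1_nth (l1_unit j z) n = (if n = j then z else 0)"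
proof -
  have "summable (\<lambda>n. norm (if n = j then z else 0))" by (rule summable_finite[of "{j}"]) auto
  then show ?thesis unfolding l1_unit_def by (simp add: Abs_l1_inverse)
qed

lemma norm_l1_unit: "norm (l1_unit j z) = norm z"
  unfolding norm_l1.rep_eq by (subst suminf_finite[of "{j}"]) auto

lemma bounded_linear_l1_unit: "bounded_linear (l1_unit j)"
  by (rule bounded_linear_intro[where K = 1]) (auto simp: norm_l1_unit intro!: l1_eqI)

lemma l1_nth_sum: "l1_nth (sum f A) n = (\<Sum>i\<in>A. l1_nth (f i) n)"
  by (induction A rule: infinite_finite_induct) auto

lemma l1_truncation_tendsto: "(\<lambda>N. \<Sum>j<N. l1_unit j (l1_nth x j)) \<longlonglongrightarrow> x"
proof -
  have n: "norm (x - (\<Sum>j<N. l1_unit j (l1_nth x j))) = (\<Sum>i. norm (l1_nth x (i + N)))" for N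
  proof -
    let ?y = "x - (\<Sum>j<N. l1_unit j (l1_nth x j))"
    have y: "l1_nth ?y n = (if n < N then 0 else l1_nth x n)" for n
      by (simp add: l1_nth_sum)
    have "norm ?y = (\<Sum>i. norm (l1_nth ?y (i + N))) + (\<Sum>i<N. norm (l1_nth ?y i))"
      unfolding norm_l1.rep_eq by (rule suminf_split_initial_segment[OF summable_l1_nth])
    then show ?thesis by (simp add: y del: l1_nth_simps)
  qed
  have "(\<lambda>N. norm (x - (\<Sum>j<N. l1_unit j (l1_nth x j)))) \<longlonglongrightarrow> 0"
    unfolding n by (rule suminf_exist_split2[OF summable_l1_nth])
  then have "(\<lambda>N. x - (x - (\<Sum>j<N. l1_unit j (l1_nth x j)))) \<longlonglongrightarrow> x - 0"
    by (intro tendsto_diff tendsto_const) (simp add: tendsto_norm_zero_iff)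
  then show ?thesis by simp
qed

lemma borel_measurable_l1I:
  fixes f :: "'a \<Rightarrow> 'k::{real_normed_vector, second_countable_topology} l1"
  assumes "\<And>j. (\<lambda>s. l1_nth (f s) j) \<in> borel_measurable M"
  shows "f \<in> borel_measurable M"
proof (rule borel_measurable_LIMSEQ_metric)
  show "(\<lambda>s. \<Sum>j<N. l1_unit j (l1_nth (f s) j)) \<in> borel_measurable M" for N
    by (intro borel_measurable_sum measurable_compose[OF assms] borel_measurable_continuous_onI
        linear_continuous_on bounded_linear_l1_unit)
qed (rule l1_truncation_tendsto)

lemma borel_measurable_LIMSEQ_AE_unit_interval:
  fixes f :: "real \<Rightarrow> 'k::euclidean_space"
  assumes "\<And>n. u n \<in> borel_measurable unit_interval_measure"
    and "AE s in unit_interval_measure. (\<lambda>n. u n s) \<longlonglongrightarrow> f s"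
  shows "f \<in> borel_measurable unit_interval_measure"
proof (rule borel_measurable_euclidean_space[THEN iffD2], rule ballI)
  fix b :: 'k assume "b \<in> Basis"
  show "(\<lambda>s. f s \<bullet> b) \<in> borel_measurable unit_interval_measure"
  proof (rule borel_measurable_LIMSEQ_AE_lebesgue_on)
    show "(\<lambda>s. u n s \<bullet> b) \<in> borel_measurable unit_interval_measure" for n
      using assms(1) by (intro borel_measurable_inner) auto
    show "AE s in unit_interval_measure. (\<lambda>n. u n s \<bullet> b) \<longlonglongrightarrow> f s \<bullet> b"
      using assms(2) by eventually_elim (intro tendsto_intros)
  qed simp
qed

lemma strongly_measurable_imp_measurable:
  fixes h :: "'b::topological_space \<Rightarrow> 'k::euclidean_space"
  assumes f: "strongly_measurable unit_interval_measure f" and h: "continuous_on UNIV h"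
  shows "(\<lambda>s. h (f s)) \<in> borel_measurable unit_interval_measure"
proof -
  obtain u where u: "\<And>n. simple_function unit_interval_measure (u n)"
    "AE s in unit_interval_measure. (\<lambda>n. u n s) \<longlonglongrightarrow> f s"
    using f unfolding strongly_measurable_def by blast
  show ?thesis
  proof (rule borel_measurable_LIMSEQ_AE_unit_interval)
    show "(\<lambda>s. h (u n s)) \<in> borel_measurable unit_interval_measure" for n
      by (intro borel_measurable_simple_function simple_function_compose1[OF u(1)])
    show "AE s in unit_interval_measure. (\<lambda>n. h (u n s)) \<longlonglongrightarrow> h (f s)"
      using u(2)
    proof eventually_elim
      case (elim s)
      show ?case by (rule continuous_on_tendsto_compose[OF h elim]) auto
    qed
  qed
qed

lemma strongly_measurable_borel:
  fixes f :: "'a \<Rightarrow> 'b::{metric_space, second_countable_topology}"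
  assumes "f \<in> borel_measurable M"
  shows "strongly_measurable M f"
proof -
  obtain F where "\<And>i. simple_function M (F i)" "\<And>x. x \<in> space M \<Longrightarrow> (\<lambda>i. F i x) \<longlonglongrightarrow> f x"
    using borel_measurable_implies_sequence_metric[OF assms, of undefined] by blast
  then show ?thesis unfolding strongly_measurable_def by (intro exI[of _ F]) auto
qed

section \<open>Coordinates and primitives of essentially bounded functions\<close>

lemma rep_Linf_in: "rep_Linf f \<in> Linf_functions"
  using Quotient_rep_reflp[OF Quotient_Linf, of f] by (simp add: Linf_rel_def)

lemma abs_rep_Linf [simp]: "abs_Linf (rep_Linf f) = f"
  by (rule Quotient_abs_rep[OF Quotient_Linf])

lemma rep_abs_Linf:
  assumes "f \<in> Linf_functions"
  shows "AE s in unit_interval_measure. rep_Linf (abs_Linf f) s = f s"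
  using Quotient_rep_abs[OF Quotient_Linf, of f] assms by (simp add: Linf_rel_def)

lemma abs_Linf_eqI:
  assumes "f \<in> Linf_functions" "g \<in> Linf_functions" "AE s in unit_interval_measure. f s = g s"
  shows "abs_Linf f = abs_Linf g"
  using Quotient_rel_abs[OF Quotient_Linf, of f g] assms by (simp add: Linf_rel_def)

lemma norm_Linf_eq: "norm f = ess_norm (rep_Linf f)"
  using norm_Linf.abs_eq[of "rep_Linf f"] rep_Linf_in[of f] by (simp add: Linf_rel_def)

lemma AE_norm_rep_le: "AE s in unit_interval_measure. norm (rep_Linf f s) \<le> norm f"
  unfolding norm_Linf_eq by (rule AE_norm_le_ess_norm[OF rep_Linf_in])

lemma rep_Linf_plus: "AE s in unit_interval_measure. rep_Linf (f + g) s = rep_Linf f s + rep_Linf g s"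
  using rep_abs_Linf[OF Linf_functions_plus[OF rep_Linf_in[of f] rep_Linf_in[of g]]]
    plus_Linf.abs_eq[of "rep_Linf f" "rep_Linf g"] rep_Linf_in[of f] rep_Linf_in[of g]
  by (simp add: Linf_rel_def)

lemma rep_Linf_scaleR: "AE s in unit_interval_measure. rep_Linf (r *\<^sub>R f) s = r *\<^sub>R rep_Linf f s"
  using rep_abs_Linf[OF Linf_functions_scaleR[OF rep_Linf_in[of f]]]
    scaleR_Linf.abs_eq[of "rep_Linf f" r] rep_Linf_in[of f]
  by (simp add: Linf_rel_def)

lemma Linf_functions_l1_scale: "f \<in> Linf_functions \<Longrightarrow> (\<lambda>s. l1_scale a (f s)) \<in> Linf_functions"
  by (rule Linf_functions_compose1[where a = "norm a"])
    (auto intro: linear_continuous_on bounded_linear_l1_scale simp: norm_l1_scale)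

lemma rep_Linf_scale: "AE s in unit_interval_measure. rep_Linf (Linf_scale a f) s = l1_scale a (rep_Linf f s)"
  using rep_abs_Linf[OF Linf_functions_l1_scale[OF rep_Linf_in[of f]]]
    Linf_scale.abs_eq[of "rep_Linf f" a] rep_Linf_in[of f]
  by (simp add: Linf_rel_def)

lemma l1_nth_l1_scale [simp]: "l1_nth (l1_scale a x) n = a * l1_nth x n"
  by (simp add: l1_scale.rep_eq)

text \<open>
  The coordinate \<open>f\<^sub>j\<close>; it depends on the representative chosen for \<open>f\<close>.
\<close>

definition coord :: "'k::real_normed_vector l1 Linf \<Rightarrow> nat \<Rightarrow> real \<Rightarrow> 'k" where
  "coord f j s = l1_nth (rep_Linf f s) j"

lemma borel_measurable_coord [measurable]:
  fixes f :: "'k::euclidean_space l1 Linf"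
  shows "coord f j \<in> borel_measurable unit_interval_measure"
  unfolding coord_def
  using strongly_measurable_imp_measurable[OF _ linear_continuous_on[OF bounded_linear_l1_nth], of "rep_Linf f" j]
    rep_Linf_in[of f] by (simp add: Linf_functions_def)

lemma AE_norm_coord_le: "AE s in unit_interval_measure. norm (coord f j s) \<le> norm f"
  using AE_norm_rep_le[of f]
  by eventually_elim (simp add: coord_def order_trans[OF norm_l1_nth_le])

lemma AE_sum_norm_coord_le: "AE s in unit_interval_measure. (\<Sum>j<N. norm (coord f j s)) \<le> norm f"
  using AE_norm_rep_le[of f]
  by eventually_elim (simp add: coord_def order_trans[OF sum_norm_l1_le])

lemma integrable_coord:
  fixes f :: "'k::euclidean_space l1 Linf"
  shows "integrable unit_interval_measure (coord f j)"
  by (rule integrable_unit_interval_bounded[OF borel_measurable_coord AE_norm_coord_le])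

lemma Linf_functions_l1I:
  fixes f :: "real \<Rightarrow> 'k::euclidean_space l1"
  assumes "\<And>j. (\<lambda>s. l1_nth (f s) j) \<in> borel_measurable unit_interval_measure"
    and "AE s in unit_interval_measure. norm (f s) \<le> C"
  shows "f \<in> Linf_functions"
  unfolding Linf_functions_def
  using strongly_measurable_borel[OF borel_measurable_l1I[OF assms(1)]] assms(2) by auto

text \<open>
  The primitive \<open>x \<mapsto> \<integral>\<^sub>0\<^sup>x f\<^sub>j\<close>, which does not depend on the representative of \<open>f\<close>.
\<close>

definition prim :: "'k::euclidean_space l1 Linf \<Rightarrow> nat \<Rightarrow> real \<Rightarrow> 'k" where
  "prim f j = primitive (coord f j)"

lemma prim_eq_0: "x \<le> 0 \<Longrightarrow> prim f j x = 0"
  unfolding prim_def by (rule primitive_eq_0)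

lemma prim_ge_1: "x \<ge> 1 \<Longrightarrow> prim f j x = prim f j 1"
  unfolding prim_def by (rule primitive_ge_1)

lemma prim_add: "prim (f + g) j x = prim f j x + prim g j x"
proof -
  have "prim (f + g) j x = primitive (\<lambda>s. coord f j s + coord g j s) x"
    unfolding prim_def
    by (rule primitive_cong_AE) (use rep_Linf_plus[of f g] in \<open>auto simp: coord_def elim: eventually_mono
      intro!: borel_measurable_add borel_measurable_coord[unfolded coord_def[abs_def]]\<close>)
  then show ?thesis by (simp add: primitive_add integrable_coord prim_def)
qed

lemma prim_diff: "prim (f - g) j x = prim f j x - prim g j x"
  using prim_add[of "f - g" g j x] by simp

lemma prim_zero [simp]: "prim 0 j x = 0"
  using prim_diff[of 0 0 j x] by simp

lemma prim_scale: "prim (Linf_scale a f) j x = a * prim f j x"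
proof -
  have "prim (Linf_scale a f) j x = primitive (\<lambda>s. a * coord f j s) x"
    unfolding prim_def
    by (rule primitive_cong_AE) (use rep_Linf_scale[of a f] in \<open>auto simp: coord_def elim: eventually_mono
      intro!: borel_measurable_times borel_measurable_coord[unfolded coord_def[abs_def]]\<close>)
  then show ?thesis
    by (simp add: primitive_linear[OF bounded_linear_mult_right] integrable_coord prim_def)
qed

lemma prim_scaleR: "prim (r *\<^sub>R f) j x = r *\<^sub>R prim f j x"
proof -
  have "prim (r *\<^sub>R f) j x = primitive (\<lambda>s. r *\<^sub>R coord f j s) x"
    unfolding prim_def
    by (rule primitive_cong_AE) (use rep_Linf_scaleR[of r f] in \<open>auto simp: coord_def elim: eventually_mono
      intro!: borel_measurable_scaleR borel_measurable_coord[unfolded coord_def[abs_def]]\<close>)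
  then show ?thesis
    by (simp add: primitive_linear[OF bounded_linear_scaleR_right] integrable_coord prim_def)
qed

lemma sum_norm_prim_increment_le:
  "(\<Sum>j<N. norm (prim f j y - prim f j x)) \<le> norm f * \<bar>y - x\<bar>"
proof -
  have *: "(\<Sum>j<N. norm (prim f j y - prim f j x)) \<le> norm f * (y - x)"
    if xy: "x \<in> {0..1}" "y \<in> {0..1}" "x \<le> y" for x y
  proof -
    let ?I = "\<lambda>g. LINT s|unit_interval_measure. indicator {x<..y} s *\<^sub>R g s"
    have i: "integrable unit_interval_measure (\<lambda>s. indicator {x<..y} s *\<^sub>R norm (coord f j s))" for j
      by (rule integrable_indicator_unit_interval[OF integrable_norm[OF integrable_coord]]) simp
    have "(\<Sum>j<N. norm (prim f j y - prim f j x)) \<le> (\<Sum>j<N. ?I (\<lambda>s. norm (coord f j s)))"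
    proof (rule sum_mono)
      fix j
      show "norm (prim f j y - prim f j x) \<le> ?I (\<lambda>s. norm (coord f j s))"
        unfolding prim_def primitive_increment[OF integrable_coord xy(3)]
        by (rule order_trans[OF integral_norm_bound]) simp
    qed
    also have "\<dots> = (LINT s|unit_interval_measure. (\<Sum>j<N. indicator {x<..y} s *\<^sub>R norm (coord f j s)))"
      by (rule Bochner_Integration.integral_sum[symmetric]) (rule i)
    also have "\<dots> \<le> (LINT s|unit_interval_measure. norm f * indicator {x<..y} s)"
    proof (rule integral_mono_AE)
      show "integrable unit_interval_measure (\<lambda>s. \<Sum>j<N. indicator {x<..y} s *\<^sub>R norm (coord f j s))"
        by (rule Bochner_Integration.integrable_sum) (rule i)
      show "integrable unit_interval_measure (\<lambda>s. norm f * indicator {x<..y} s)"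
        using integrable_indicator_unit_interval[of "\<lambda>_. norm f" "{x<..y}"] by (simp add: mult.commute)
      show "AE s in unit_interval_measure. (\<Sum>j<N. indicator {x<..y} s *\<^sub>R norm (coord f j s)) \<le> norm f * indicator {x<..y} s"
        using AE_sum_norm_coord_le[of f N] by eventually_elim (auto simp: indicator_def)
    qed
    also have "\<dots> = norm f * (y - x)" using LINT_indicator_Ioc[OF xy] by simp
    finally show ?thesis .
  qed
  define cl where "cl x = max 0 (min 1 x)" for x :: real
  have cl: "cl x \<in> {0..1}" "x \<le> y \<Longrightarrow> cl x \<le> cl y" "x \<le> y \<Longrightarrow> cl y - cl x \<le> y - x" for x y
    by (auto simp: cl_def)
  have prim_cl: "prim f j (cl x) = prim f j x" for j x
    unfolding prim_def cl_def by (rule primitive_clamp)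
  have le: "(\<Sum>j<N. norm (prim f j y - prim f j x)) \<le> norm f * (y - x)" if "x \<le> y" for x y
  proof -
    have "(\<Sum>j<N. norm (prim f j y - prim f j x)) \<le> norm f * (cl y - cl x)"
      using *[OF cl(1) cl(1) cl(2)[OF that]] by (simp add: prim_cl)
    also have "\<dots> \<le> norm f * (y - x)" using cl(3)[OF that] by (intro mult_left_mono) auto
    finally show ?thesis .
  qed
  show ?thesis
    using le[of x y] le[of y x] by (cases "x \<le> y") (auto simp: norm_minus_commute)
qed

lemma norm_prim_increment_le: "norm (prim f j y - prim f j x) \<le> norm f * \<bar>y - x\<bar>"
proof -
  have "norm (prim f j y - prim f j x) \<le> (\<Sum>i<Suc j. norm (prim f i y - prim f i x))"
    by (simp add: sum_nonneg)
  then show ?thesis using sum_norm_prim_increment_le order_trans by blast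
qed

lemma norm_prim_le: "x \<in> {0..1} \<Longrightarrow> norm (prim f j x) \<le> norm f"
  using norm_prim_increment_le[of f j x 0] mult_left_le[of x "norm f"] by (simp add: prim_eq_0)

lemma norm_Linf_le_if_prim_increment_le:
  fixes f :: "'k::{real_normed_field, euclidean_space} l1 Linf"
  assumes "\<And>N x y. x \<in> {0..1} \<Longrightarrow> y \<in> {0..1} \<Longrightarrow> x \<le> y \<Longrightarrow>
      (\<Sum>j<N. norm (prim f j y - prim f j x)) \<le> K * (y - x)"
  shows "norm f \<le> K"
  unfolding norm_Linf_eq
proof (rule ess_norm_le[OF rep_Linf_in])
  have "AE s in unit_interval_measure. \<forall>N. (\<Sum>j<N. norm (coord f j s)) \<le> K"
    unfolding AE_all_countable
    by (intro allI AE_sum_norm_le_if_primitive_increment_le[OF borel_measurable_coord AE_norm_coord_le])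
      (use assms in \<open>simp add: prim_def\<close>)
  then show "AE s in unit_interval_measure. norm (rep_Linf f s) \<le> K"
    by eventually_elim (simp add: norm_l1.rep_eq coord_def l1_boundedI(2))
qed

lemma Linf_eqI_prim:
  fixes f g :: "'k::{real_normed_field, euclidean_space} l1 Linf"
  assumes "\<And>j x. x \<in> {0..1} \<Longrightarrow> prim f j x = prim g j x"
  shows "f = g"
proof -
  have "norm (f - g) \<le> 0"
    by (rule norm_Linf_le_if_prim_increment_le) (use assms in \<open>simp add: prim_diff\<close>)
  then show ?thesis by simp
qed

lemma Linf_space_l1_iff:
  fixes f :: "'k::{real_normed_field, euclidean_space} l1 Linf"
  shows "f \<in> Linf_space (l1_space J) \<longleftrightarrow> (\<forall>j. j \<notin> J \<longrightarrow> (\<forall>x\<in>{0..1}. prim f j x = 0))"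
proof -
  have "f \<in> Linf_space (l1_space J) \<longleftrightarrow> (\<forall>j. AE s in unit_interval_measure. j \<notin> J \<longrightarrow> coord f j s = 0)"
    by (simp add: Linf_space_def l1_space_def coord_def AE_all_countable)
  also have "\<dots> \<longleftrightarrow> (\<forall>j. j \<notin> J \<longrightarrow> (\<forall>x\<in>{0..1}. prim f j x = 0))"
  proof (intro all_cong1 iffI impI ballI)
    fix j x assume A: "AE s in unit_interval_measure. j \<notin> J \<longrightarrow> coord f j s = 0" and "j \<notin> J"
    from A have "AE s in unit_interval_measure. indicator {..x} s *\<^sub>R coord f j s = 0"
      by eventually_elim (use \<open>j \<notin> J\<close> in simp)
    then show "prim f j x = 0" unfolding prim_def primitive_def by (rule integral_eq_zero_AE)
  next
    fix j assume *: "j \<notin> J \<longrightarrow> (\<forall>x\<in>{0..1}. prim f j x = 0)"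
    show "AE s in unit_interval_measure. j \<notin> J \<longrightarrow> coord f j s = 0"
    proof (cases "j \<in> J")
      case False
      have "AE s in unit_interval_measure. coord f j s = 0"
        by (rule AE_eq_0_if_primitive_eq_0[OF borel_measurable_coord AE_norm_coord_le])
          (use * False in \<open>simp add: prim_def\<close>)
      then show ?thesis by simp
    qed simp
  qed
  finally show ?thesis .
qed

text \<open>
  The Radon--Nikodym property of \<open>\<ell>\<^sup>1\<close>: Lipschitz functions into \<open>\<ell>\<^sup>1\<close>, given by their coordinates,
  are primitives of essentially bounded functions.
\<close>

lemma lipschitz_is_prim:
  fixes P :: "nat \<Rightarrow> real \<Rightarrow> 'k::{real_normed_field, euclidean_space}"
  assumes lip: "\<And>N x y. x \<in> {0..1} \<Longrightarrow> y \<in> {0..1} \<Longrightarrow> x \<le> y \<Longrightarrow>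
      (\<Sum>j<N. norm (P j y - P j x)) \<le> K * (y - x)"
  obtains f where "\<And>j x. x \<in> {0..1} \<Longrightarrow> prim f j x = P j x - P j 0" "norm f \<le> K"
proof -
  have lipj: "norm (P j y - P j x) \<le> K * \<bar>y - x\<bar>" if xy: "x \<in> {0..1}" "y \<in> {0..1}" for j x y
  proof -
    have *: "norm (P j y - P j x) \<le> K * (y - x)" if "x \<in> {0..1}" "y \<in> {0..1}" "x \<le> y" for x y
    proof -
      have "norm (P j y - P j x) \<le> (\<Sum>i<Suc j. norm (P i y - P i x))" by (simp add: sum_nonneg)
      then show ?thesis using lip[OF that, of "Suc j"] by simp
    qed
    show ?thesis using *[OF xy] *[OF xy(2,1)]
      by (cases "x \<le> y") (auto simp: norm_minus_commute)
  qed
  have "\<exists>u L. u \<in> borel_measurable borel \<and> (\<forall>s. norm (u s) \<le> L) \<and>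
      (\<forall>x\<in>{0..1}. primitive u x = P j x - P j 0)" for j
    using lipschitz_has_density[of "P j" K, OF lipj] by metis
  then obtain u L where u: "\<And>j. u j \<in> borel_measurable borel" "\<And>j s. norm (u j s) \<le> L j"
    "\<And>j x. x \<in> {0..1} \<Longrightarrow> primitive (u j) x = P j x - P j 0"
    by metis
  have um: "u j \<in> borel_measurable unit_interval_measure" for j
    by (rule borel_measurable_unit_interval[OF u(1)])
  have AE: "AE s in unit_interval_measure. \<forall>N. (\<Sum>j<N. norm (u j s)) \<le> K"
    unfolding AE_all_countable
    by (intro allI AE_sum_norm_le_if_primitive_increment_le[OF um AE_I2[OF u(2)]])
      (use lip in \<open>simp add: u(3)\<close>)
  define S where "S = {s. \<forall>N. (\<Sum>j<N. norm (u j s)) \<le> K}"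
  define g where "g s = Abs_l1 (\<lambda>j. if s \<in> S then u j s else 0)" for s
  have g: "l1_nth (g s) = (\<lambda>j. if s \<in> S then u j s else 0)" for s
  proof (cases "s \<in> S")
    case True
    then have "summable (\<lambda>j. norm (u j s))" by (auto simp: S_def intro: l1_boundedI(1))
    with True show ?thesis unfolding g_def by (subst Abs_l1_inverse) auto
  next
    case False
    then show ?thesis unfolding g_def by (subst Abs_l1_inverse) auto
  qed
  have "S \<in> sets borel"
  proof -
    have "{s \<in> space borel. \<forall>N. (\<Sum>j<N. norm (u j s)) \<le> K} \<in> sets borel"
      using u(1) by measurable
    then show ?thesis by (simp add: S_def)
  qed
  have gm: "(\<lambda>s. l1_nth (g s) j) \<in> borel_measurable unit_interval_measure" for j
    unfolding g using \<open>S \<in> sets borel\<close>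
    by (intro borel_measurable_unit_interval measurable_If u(1)) auto
  have AE_S: "AE s in unit_interval_measure. s \<in> S"
    using AE by eventually_elim (simp add: S_def)
  have gK: "AE s in unit_interval_measure. norm (g s) \<le> K"
    using AE_S by eventually_elim (simp add: norm_l1.rep_eq g S_def l1_boundedI(2))
  have gL: "g \<in> Linf_functions" by (rule Linf_functions_l1I[OF gm gK])
  show ?thesis
  proof (rule that[of "abs_Linf g"])
    fix j and x :: real assume x: "x \<in> {0..1}"
    have "prim (abs_Linf g) j x = primitive (u j) x"
      unfolding prim_def
    proof (rule primitive_cong_AE[OF borel_measurable_coord um])
      show "AE s in unit_interval_measure. coord (abs_Linf g) j s = u j s"
        using rep_abs_Linf[OF gL] AE_S by eventually_elim (simp add: coord_def g)
    qed
    then show "prim (abs_Linf g) j x = P j x - P j 0" using u(3)[OF x] by simp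
  next
    have "norm (abs_Linf g) = ess_norm g"
      using norm_Linf.abs_eq[of g] gL by (simp add: Linf_rel_def)
    also have "\<dots> \<le> K" by (rule ess_norm_le[OF gL gK])
    finally show "norm (abs_Linf g) \<le> K" .
  qed
qed

section \<open>The weak-star topology on bounded sets\<close>

lemma bounded_linear_apply_bcontfun: "bounded_linear (\<lambda>y::'a::topological_space \<Rightarrow>\<^sub>C 'b::real_normed_vector. apply_bcontfun y j)"
  by (rule bounded_linear_intro[where K = 1]) (auto simp: norm_bounded)

text \<open>
  The sequence with the entry \<open>z\<close> at \<open>j\<close> and zeros elsewhere, as an element of \<open>\<ell>\<^sup>\<infinity>\<close>.
\<close>

definition c0_unit :: "nat \<Rightarrow> 'k::real_normed_vector \<Rightarrow> nat \<Rightarrow>\<^sub>C 'k" where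
  "c0_unit j z = Bcontfun (\<lambda>n. if n = j then z else 0)"

lemma apply_c0_unit [simp]: "apply_bcontfun (c0_unit j z) n = (if n = j then z else 0)"
proof -
  have "(\<lambda>n. if n = j then z else 0) \<in> bcontfun"
    by (rule bcontfun_normI[where b = "norm z"]) auto
  then show ?thesis unfolding c0_unit_def by (simp add: Bcontfun_inverse)
qed

lemma norm_c0_unit_le: "norm (c0_unit j z) \<le> norm z"
  by (rule norm_bound) simp

lemma bounded_linear_c0_unit: "bounded_linear (c0_unit j)"
  by (rule bounded_linear_intro[where K = 1]) (auto simp: norm_c0_unit_le intro!: bcontfun_eqI)

lemma apply_bcontfun_sum: "apply_bcontfun (sum f A) n = (\<Sum>i\<in>A. apply_bcontfun (f i) n)"
  for f :: "'i \<Rightarrow> ('a::topological_space \<Rightarrow>\<^sub>C 'b::real_normed_vector)"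
  by (induction A rule: infinite_finite_induct) auto

lemma strongly_measurable_c0_unit:
  fixes \<phi> :: "real \<Rightarrow> 'k::euclidean_space"
  assumes "\<phi> \<in> borel_measurable unit_interval_measure"
  shows "strongly_measurable unit_interval_measure (\<lambda>s. c0_unit j (\<phi> s))"
proof -
  have "strongly_measurable unit_interval_measure \<phi>" by (rule strongly_measurable_borel[OF assms])
  then obtain u where u: "\<And>n. simple_function unit_interval_measure (u n)"
    "AE s in unit_interval_measure. (\<lambda>n. u n s) \<longlonglongrightarrow> \<phi> s"
    unfolding strongly_measurable_def by blast
  show ?thesis unfolding strongly_measurable_def
  proof (intro exI[of _ "\<lambda>n s. c0_unit j (u n s)"] conjI allI)
    show "simple_function unit_interval_measure (\<lambda>s. c0_unit j (u n s))" for n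
      by (rule simple_function_compose1[OF u(1)])
    show "AE s in unit_interval_measure. (\<lambda>n. c0_unit j (u n s)) \<longlonglongrightarrow> c0_unit j (\<phi> s)"
      using u(2) by eventually_elim (rule bounded_linear.tendsto[OF bounded_linear_c0_unit])
  qed
qed

lemma strongly_measurable_sum_c0_unit:
  fixes \<phi> :: "nat \<Rightarrow> real \<Rightarrow> 'k::euclidean_space"
  assumes "\<And>j. \<phi> j \<in> borel_measurable unit_interval_measure"
  shows "strongly_measurable unit_interval_measure (\<lambda>s. \<Sum>j<N. c0_unit j (\<phi> j s))"
proof (induction N)
  case 0
  then show ?case unfolding strongly_measurable_def by (auto intro!: exI[of _ "\<lambda>_ _. 0"])
next
  case (Suc N)
  have "continuous_on UNIV (\<lambda>(x, y). x + y :: nat \<Rightarrow>\<^sub>C 'k)"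
    by (auto simp: case_prod_beta intro!: continuous_intros)
  from strongly_measurable_compose2[OF Suc strongly_measurable_c0_unit[OF assms] this]
  show ?case by simp
qed

lemma c0_unit_sum_in_c0_space:
  assumes "\<And>j. j < N \<Longrightarrow> j \<notin> J \<Longrightarrow> v j = 0"
  shows "(\<Sum>j<N. c0_unit j (v j)) \<in> c0_space J"
proof -
  have v: "apply_bcontfun (\<Sum>j<N. c0_unit j (v j)) = (\<lambda>n. if n < N then v n else 0)"
    by (rule ext) (simp add: apply_bcontfun_sum)
  have "(\<lambda>n. if n < N then v n else 0) \<longlonglongrightarrow> 0"
    by (rule tendsto_eventually) (auto simp: eventually_sequentially intro!: exI[of _ N])
  then show ?thesis using assms by (auto simp: c0_space_def linf_space_def v)
qed

lemma L1_functions_sum_c0_unit: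
  fixes \<phi> :: "nat \<Rightarrow> real \<Rightarrow> 'k::euclidean_space"
  assumes "\<And>j. integrable unit_interval_measure (\<phi> j)"
    and "\<And>j s. j < N \<Longrightarrow> j \<notin> J \<Longrightarrow> \<phi> j s = 0"
  shows "(\<lambda>s. \<Sum>j<N. c0_unit j (\<phi> j s)) \<in> L1_functions (c0_space J)"
  unfolding L1_functions_def
proof (intro CollectI conjI)
  have m: "\<phi> j \<in> borel_measurable unit_interval_measure" for j using assms(1) by auto
  show sm: "strongly_measurable unit_interval_measure (\<lambda>s. \<Sum>j<N. c0_unit j (\<phi> j s))"
    by (rule strongly_measurable_sum_c0_unit[OF m])
  show "AE s in unit_interval_measure. (\<Sum>j<N. c0_unit j (\<phi> j s)) \<in> c0_space J"
    by (intro AE_I2 c0_unit_sum_in_c0_space assms(2))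
  show "integrable unit_interval_measure (\<lambda>s. norm (\<Sum>j<N. c0_unit j (\<phi> j s)))"
  proof (rule Bochner_Integration.integrable_bound)
    show "integrable unit_interval_measure (\<lambda>s. \<Sum>j<N. norm (\<phi> j s))"
      using assms(1) by (intro Bochner_Integration.integrable_sum integrable_norm)
    show "(\<lambda>s. norm (\<Sum>j<N. c0_unit j (\<phi> j s))) \<in> borel_measurable unit_interval_measure"
      by (rule strongly_measurable_norm[OF sm])
    have "norm (\<Sum>j<N. c0_unit j (\<phi> j s)) \<le> (\<Sum>j<N. norm (\<phi> j s))" for s
      by (intro order_trans[OF norm_sum] sum_mono norm_c0_unit_le)
    then show "AE s in unit_interval_measure.
        norm (norm (\<Sum>j<N. c0_unit j (\<phi> j s))) \<le> norm (\<Sum>j<N. norm (\<phi> j s))"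
      by (intro AE_I2) (simp add: sum_nonneg)
  qed
qed

lemma L1_functions_c0_unit:
  fixes \<phi> :: "real \<Rightarrow> 'k::euclidean_space"
  assumes "integrable unit_interval_measure \<phi>" "j \<in> J"
  shows "(\<lambda>s. c0_unit j (\<phi> s)) \<in> L1_functions (c0_space J)"
proof -
  have "(\<Sum>i<Suc j. c0_unit i (if i = j then \<phi> s else 0)) = c0_unit j (\<phi> s)" for s
    by (rule bcontfun_eqI) (simp add: apply_bcontfun_sum)
  moreover have "(\<lambda>s. \<Sum>i<Suc j. c0_unit i (if i = j then \<phi> s else 0)) \<in> L1_functions (c0_space J)"
  proof (rule L1_functions_sum_c0_unit)
    show "integrable unit_interval_measure (\<lambda>s. if i = j then \<phi> s else 0)" for i
      by (cases "i = j") (use assms in auto)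
  qed (use assms in auto)
  ultimately show ?thesis by simp
qed

lemma summable_norm_pairing:
  "summable (\<lambda>j. norm (l1_nth x j * apply_bcontfun y j))"
  for x :: "'k::real_normed_field l1"
proof (rule summable_comparison_test'[where N = 0 and g = "\<lambda>j. norm (l1_nth x j) * norm y"])
  show "summable (\<lambda>j. norm (l1_nth x j) * norm y)"
    by (rule summable_mult2[OF summable_l1_nth])
qed (auto simp: norm_mult intro!: mult_left_mono norm_bounded)

lemma summable_pairing:
  "summable (\<lambda>j. l1_nth x j * apply_bcontfun y j)"
  for x :: "'k::{real_normed_field, euclidean_space} l1"
  by (rule summable_norm_cancel[OF summable_norm_pairing])

lemma norm_pairing_pointwise_le:
  "norm (\<Sum>j. l1_nth x j * apply_bcontfun y j) \<le> norm x * norm y"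
  for x :: "'k::{real_normed_field, euclidean_space} l1"
proof -
  have "norm (\<Sum>j. l1_nth x j * apply_bcontfun y j) \<le> (\<Sum>j. norm (l1_nth x j * apply_bcontfun y j))"
    by (rule summable_norm[OF summable_norm_pairing])
  also have "\<dots> \<le> (\<Sum>j. norm (l1_nth x j) * norm y)"
    by (rule suminf_le[OF _ summable_norm_pairing summable_mult2[OF summable_l1_nth]])
      (auto simp: norm_mult intro!: mult_left_mono norm_bounded)
  also have "\<dots> = norm x * norm y" by (simp add: norm_l1.rep_eq suminf_mult2[OF summable_l1_nth])
  finally show ?thesis .
qed

lemma measurable_apply_bcontfun_L1:
  fixes g :: "real \<Rightarrow> (nat \<Rightarrow>\<^sub>C 'k::euclidean_space)"
  assumes "g \<in> L1_functions S"
  shows "(\<lambda>s. apply_bcontfun (g s) j) \<in> borel_measurable unit_interval_measure"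
  using assms
  by (intro strongly_measurable_imp_measurable linear_continuous_on bounded_linear_apply_bcontfun)
    (simp add: L1_functions_def)

lemma integrable_apply_bcontfun_L1:
  fixes g :: "real \<Rightarrow> (nat \<Rightarrow>\<^sub>C 'k::euclidean_space)"
  assumes "g \<in> L1_functions S"
  shows "integrable unit_interval_measure (\<lambda>s. apply_bcontfun (g s) j)"
proof (rule Bochner_Integration.integrable_bound)
  show "integrable unit_interval_measure (\<lambda>s. norm (g s))" using assms by (simp add: L1_functions_def)
qed (use measurable_apply_bcontfun_L1[OF assms] in \<open>auto simp: norm_bounded\<close>)

lemma pairing_coord: "pairing f g = (LINT s|unit_interval_measure. (\<Sum>j. coord f j s * apply_bcontfun (g s) j))"
  by (simp add: pairing_def coord_def)

context
  fixes g :: "real \<Rightarrow> (nat \<Rightarrow>\<^sub>C 'k::{real_normed_field, euclidean_space})" and S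
  assumes g: "g \<in> L1_functions S"
begin

lemma AE_norm_pairing_le:
  "AE s in unit_interval_measure. norm (\<Sum>j. coord f j s * apply_bcontfun (g s) j) \<le> norm f * norm (g s)"
  using AE_norm_rep_le[of f]
proof eventually_elim
  case (elim s)
  show ?case
    unfolding coord_def
    by (rule order_trans[OF norm_pairing_pointwise_le mult_right_mono[OF elim]]) simp
qed

lemma integrable_pairing:
  "integrable unit_interval_measure (\<lambda>s. \<Sum>j. coord f j s * apply_bcontfun (g s) j)"
proof (rule Bochner_Integration.integrable_bound)
  show "integrable unit_interval_measure (\<lambda>s. norm f * norm (g s))"
    using g by (simp add: L1_functions_def)
  show "(\<lambda>s. \<Sum>j. coord f j s * apply_bcontfun (g s) j) \<in> borel_measurable unit_interval_measure"
    by (intro borel_measurable_suminf borel_measurable_times borel_measurable_coord measurable_apply_bcontfun_L1[OF g])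
  show "AE s in unit_interval_measure. norm (\<Sum>j. coord f j s * apply_bcontfun (g s) j) \<le> norm (norm f * norm (g s))"
    using AE_norm_pairing_le[of f] by simp
qed

lemma norm_pairing_le: "norm (pairing f g) \<le> norm f * (LINT s|unit_interval_measure. norm (g s))"
proof -
  have "norm (pairing f g) \<le> (LINT s|unit_interval_measure. norm f * norm (g s))"
    unfolding pairing_coord
    by (rule norm_integral_le_AE[OF integrable_pairing _ AE_norm_pairing_le])
      (use g in \<open>simp add: L1_functions_def\<close>)
  then show ?thesis by simp
qed

lemma pairing_add: "pairing (f + h) g = pairing f g + pairing h g"
proof -
  have "pairing (f + h) g = (LINT s|unit_interval_measure.
      (\<Sum>j. coord f j s * apply_bcontfun (g s) j) + (\<Sum>j. coord h j s * apply_bcontfun (g s) j))"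
    unfolding pairing_coord
  proof (rule integral_cong_AE)
    show "AE s in unit_interval_measure. (\<Sum>j. coord (f + h) j s * apply_bcontfun (g s) j) =
      (\<Sum>j. coord f j s * apply_bcontfun (g s) j) + (\<Sum>j. coord h j s * apply_bcontfun (g s) j)"
      using rep_Linf_plus[of f h]
      by eventually_elim (simp add: coord_def distrib_right suminf_add[OF summable_pairing summable_pairing])
  qed (use integrable_pairing in auto)
  then show ?thesis by (simp add: pairing_coord Bochner_Integration.integral_add integrable_pairing)
qed

lemma pairing_scale: "pairing (Linf_scale a f) g = a * pairing f g"
proof -
  have "pairing (Linf_scale a f) g = (LINT s|unit_interval_measure.
      a * (\<Sum>j. coord f j s * apply_bcontfun (g s) j))"
    unfolding pairing_coord
  proof (rule integral_cong_AE)
    show "AE s in unit_interval_measure. (\<Sum>j. coord (Linf_scale a f) j s * apply_bcontfun (g s) j) =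
      a * (\<Sum>j. coord f j s * apply_bcontfun (g s) j)"
      using rep_Linf_scale[of a f]
      by eventually_elim (simp add: coord_def mult.assoc suminf_mult[OF summable_pairing])
  qed (use integrable_pairing in auto)
  then show ?thesis by (simp add: pairing_coord)
qed

lemma pairing_diff: "pairing (f - h) g = pairing f g - pairing h g"
  using pairing_add[of "f - h" h] by simp

lemma pairing_zero: "pairing 0 g = 0"
  using pairing_diff[of 0 0] by simp

lemma continuous_on_pairing: "continuous_on A (\<lambda>f. pairing f g)"
proof -
  define C where "C = (LINT s|unit_interval_measure. norm (g s))"
  have C: "C \<ge> 0" unfolding C_def by simp
  show ?thesis
  proof (rule continuous_on_iff[THEN iffD2], intro ballI allI impI)
    fix f :: "'k l1 Linf" and e :: real assume e: "e > 0"
    have "dist (pairing h g) (pairing f g) < e" if "dist h f < e / (C + 1)" for h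
    proof -
      have "dist (pairing h g) (pairing f g) \<le> norm (h - f) * C"
        using norm_pairing_le[of "h - f"] by (simp add: pairing_diff dist_norm C_def)
      also have "\<dots> \<le> e / (C + 1) * C"
        using that C by (intro mult_right_mono) (auto simp: dist_norm)
      also have "\<dots> < e" using e C by (simp add: field_simps)
      finally show ?thesis .
    qed
    moreover have "e / (C + 1) > 0" using e C by simp
    ultimately show "\<exists>d>0. \<forall>x'\<in>A. dist x' f < d \<longrightarrow> dist (pairing x' g) (pairing f g) < e" by blast
  qed
qed

end

lemma pairing_sum_c0_unit:
  assumes "\<And>j. integrable unit_interval_measure (\<phi> j)"
  shows "pairing f (\<lambda>s. \<Sum>j<N. c0_unit j (\<phi> j s)) = (\<Sum>j<N. (LINT s|unit_interval_measure. \<phi> j s * coord f j s))"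
proof -
  have "pairing f (\<lambda>s. \<Sum>j<N. c0_unit j (\<phi> j s)) = (LINT s|unit_interval_measure. (\<Sum>j<N. \<phi> j s * coord f j s))"
    unfolding pairing_coord
  proof (rule Bochner_Integration.integral_cong[OF refl])
    fix s
    have "(\<Sum>j. coord f j s * apply_bcontfun (\<Sum>j<N. c0_unit j (\<phi> j s)) j)
        = (\<Sum>j<N. coord f j s * apply_bcontfun (\<Sum>j<N. c0_unit j (\<phi> j s)) j)"
      by (rule suminf_finite) (auto simp: apply_bcontfun_sum)
    then show "(\<Sum>j. coord f j s * apply_bcontfun (\<Sum>j<N. c0_unit j (\<phi> j s)) j) = (\<Sum>j<N. \<phi> j s * coord f j s)"
      by (simp add: apply_bcontfun_sum mult.commute)
  qed
  also have "\<dots> = (\<Sum>j<N. (LINT s|unit_interval_measure. \<phi> j s * coord f j s))"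
    by (rule Bochner_Integration.integral_sum)
      (rule integrable_mult_ess_bounded[OF borel_measurable_coord AE_norm_coord_le assms])
  finally show ?thesis .
qed

lemma pairing_c0_unit:
  assumes "integrable unit_interval_measure \<phi>"
  shows "pairing f (\<lambda>s. c0_unit j (\<phi> s)) = (LINT s|unit_interval_measure. \<phi> s * coord f j s)"
proof -
  have "(\<Sum>i<Suc j. c0_unit i (if i = j then \<phi> s else 0)) = c0_unit j (\<phi> s)" for s
    by (rule bcontfun_eqI) (simp add: apply_bcontfun_sum)
  moreover have "pairing f (\<lambda>s. \<Sum>i<Suc j. c0_unit i (if i = j then \<phi> s else 0))
      = (\<Sum>i<Suc j. (LINT s|unit_interval_measure. (if i = j then \<phi> s else 0) * coord f i s))"
  proof (rule pairing_sum_c0_unit)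
    show "integrable unit_interval_measure (\<lambda>s. if i = j then \<phi> s else 0)" for i
      by (cases "i = j") (use assms in auto)
  qed
  ultimately show ?thesis by simp
qed

lemma integrable_of_real_indicator:
  assumes "A \<in> sets borel"
  shows "integrable unit_interval_measure (\<lambda>s. of_real (indicator A s) :: 'k::{real_normed_field, euclidean_space})"
  using integrable_of_real[OF integrable_indicator_unit_interval[of "\<lambda>_. 1 :: real", OF _ assms]] by simp

lemma prim_eq_pairing: "prim f j x = pairing f (\<lambda>s. c0_unit j (of_real (indicator {..x} s)))"
  by (simp add: pairing_c0_unit integrable_of_real_indicator prim_def primitive_def scaleR_conv_of_real)

lemma prim_test_in_L1:
  "j \<in> J \<Longrightarrow> (\<lambda>s. c0_unit j (of_real (indicator {..x} s) :: 'k::{real_normed_field, euclidean_space})) \<in> L1_functions (c0_space J)"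
  by (intro L1_functions_c0_unit integrable_of_real_indicator) auto

text \<open>
  Step functions with finitely many coordinates are total in the predual, so that on bounded sets the
  convergence of all primitives implies weak-star convergence.
\<close>

lemma tendsto_pairing_if_prim_tendsto:
  fixes u :: "'i \<Rightarrow> 'k::{real_normed_field, euclidean_space} l1 Linf"
  assumes bd: "\<And>i. norm (u i) \<le> K"
    and lim: "\<And>j x. j \<in> J \<Longrightarrow> x \<in> {0..1} \<Longrightarrow> ((\<lambda>i. prim (u i) j x) \<longlongrightarrow> 0) F"
    and g: "g \<in> L1_functions (c0_space J)"
  shows "((\<lambda>i. pairing (u i) g) \<longlongrightarrow> 0) F"
proof (cases "F = bot")
  case False
  have K0: "0 \<le> K" using bd norm_ge_zero order_trans by blast
  let ?\<mu> = unit_interval_measure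
  define gt where "gt = (\<lambda>N s. \<Sum>j<N. c0_unit j (apply_bcontfun (g s) j))"
  have gi: "integrable ?\<mu> (\<lambda>s. apply_bcontfun (g s) j)" for j
    by (rule integrable_apply_bcontfun_L1[OF g])
  have AEc0: "AE s in ?\<mu>. g s \<in> c0_space J" using g by (simp add: L1_functions_def)
  have gt_app: "apply_bcontfun (gt N s) n = (if n < N then apply_bcontfun (g s) n else 0)" for N s n
    by (simp add: gt_def apply_bcontfun_sum)
  have gtL: "gt N \<in> L1_functions UNIV" for N
    using L1_functions_sum_c0_unit[of "\<lambda>j s. apply_bcontfun (g s) j" N UNIV, OF gi]
    by (simp add: gt_def L1_functions_def)
  have gL: "g \<in> L1_functions UNIV" using g by (simp add: L1_functions_def)
  have dm: "strongly_measurable ?\<mu> (\<lambda>s. g s - gt N s)" for N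
    by (rule strongly_measurable_compose2[where h="\<lambda>x y. x - y"])
      (use gL gtL[of N] in \<open>auto simp: L1_functions_def case_prod_beta intro!: continuous_intros\<close>)
  have nle: "norm (g s - gt N s) \<le> norm (g s)" for N s
    by (rule norm_bound) (auto simp: gt_app norm_bounded)
  have dL: "(\<lambda>s. g s - gt N s) \<in> L1_functions UNIV" for N
  proof -
    have "integrable ?\<mu> (\<lambda>s. norm (g s - gt N s))"
      by (rule Bochner_Integration.integrable_bound[of _ "\<lambda>s. norm (g s)"])
        (use gL nle strongly_measurable_norm[OF dm] in \<open>auto simp: L1_functions_def\<close>)
    with dm show ?thesis by (simp add: L1_functions_def)
  qed
  have small: "(\<lambda>N. LINT s|?\<mu>. norm (g s - gt N s)) \<longlonglongrightarrow> (LINT s|?\<mu>. 0)"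
  proof (rule integral_dominated_convergence[where w = "\<lambda>s. norm (g s)"])
    show "integrable ?\<mu> (\<lambda>s. norm (g s))" using gL by (simp add: L1_functions_def)
    show "(\<lambda>s. norm (g s - gt N s)) \<in> borel_measurable ?\<mu>" for N by (rule strongly_measurable_norm[OF dm])
    show "AE s in ?\<mu>. norm (norm (g s - gt N s)) \<le> norm (g s)" for N using nle by auto
    show "AE s in ?\<mu>. (\<lambda>N. norm (g s - gt N s)) \<longlonglongrightarrow> 0"
      using AEc0
    proof eventually_elim
      case (elim s)
      then have "apply_bcontfun (g s) \<longlonglongrightarrow> 0" by (simp add: c0_space_def)
      show ?case
      proof (rule LIMSEQ_I)
        fix e :: real assume e: "e > 0"
        from LIMSEQ_D[OF \<open>apply_bcontfun (g s) \<longlonglongrightarrow> 0\<close>, of "e / 2"] e obtain N0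
          where N0: "\<And>n. n \<ge> N0 \<Longrightarrow> norm (apply_bcontfun (g s) n) < e / 2" by auto
        have "norm (g s - gt N s) \<le> e / 2" if "N \<ge> N0" for N
          by (rule norm_bound) (use e N0 that in \<open>auto simp: gt_app less_imp_le\<close>)
        then show "\<exists>no. \<forall>N\<ge>no. norm (norm (g s - gt N s) - 0) < e" using e by (intro exI[of _ N0]) force
      qed
    qed
  qed simp
  have fin: "((\<lambda>i. pairing (u i) (gt N)) \<longlongrightarrow> 0) F" for N
  proof -
    have cK: "AE s in ?\<mu>. norm (coord (u i) j s) \<le> K" for i j
      using AE_norm_coord_le[of "u i" j] by eventually_elim (rule order_trans[OF _ bd])
    have "((\<lambda>i. LINT s|?\<mu>. apply_bcontfun (g s) j * coord (u i) j s) \<longlongrightarrow> 0) F" for j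
    proof (cases "j \<in> J")
      case True
      show ?thesis
        by (rule tendsto_integral_of_intervals[OF borel_measurable_coord _ _ gi, where K = K])
          (use cK lim[OF True] in \<open>auto simp: prim_def primitive_def\<close>)
    next
      case False
      have "(LINT s|?\<mu>. apply_bcontfun (g s) j * coord (u i) j s) = 0" for i
      proof (rule integral_eq_zero_AE)
        show "AE s in ?\<mu>. apply_bcontfun (g s) j * coord (u i) j s = 0"
          using AEc0 by eventually_elim (use False in \<open>simp add: c0_space_def linf_space_def\<close>)
      qed
      then show ?thesis by simp
    qed
    then have "((\<lambda>i. \<Sum>j<N. (LINT s|?\<mu>. apply_bcontfun (g s) j * coord (u i) j s)) \<longlongrightarrow> (\<Sum>j<N. 0)) F"
      by (intro tendsto_sum)
    then show ?thesis unfolding gt_def by (simp add: pairing_sum_c0_unit[OF gi])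
  qed
  have split: "pairing f g = pairing f (gt N) + pairing f (\<lambda>s. g s - gt N s)" for f :: "'k l1 Linf" and N
  proof -
    have "pairing f g = (LINT s|?\<mu>. (\<Sum>j. coord f j s * apply_bcontfun (gt N s) j)
        + (\<Sum>j. coord f j s * apply_bcontfun (g s - gt N s) j))"
      unfolding pairing_coord
    proof (rule Bochner_Integration.integral_cong[OF refl])
      fix s
      have "(\<Sum>j. coord f j s * apply_bcontfun (gt N s) j) + (\<Sum>j. coord f j s * apply_bcontfun (g s - gt N s) j)
        = (\<Sum>j. coord f j s * apply_bcontfun (gt N s) j + coord f j s * apply_bcontfun (g s - gt N s) j)"
        unfolding coord_def by (rule suminf_add[OF summable_pairing summable_pairing])
      then show "(\<Sum>j. coord f j s * apply_bcontfun (g s) j) = (\<Sum>j. coord f j s * apply_bcontfun (gt N s) j)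
        + (\<Sum>j. coord f j s * apply_bcontfun (g s - gt N s) j)"
        by (simp add: right_diff_distrib)
    qed
    then show ?thesis
      using Bochner_Integration.integral_add[OF integrable_pairing[OF gtL, of f N] integrable_pairing[OF dL, of f N]]
      by (simp only: pairing_coord)
  qed
  show ?thesis
  proof (rule tendstoI)
    fix e :: real assume e: "e > 0"
    have "(\<lambda>N. K * (LINT s|?\<mu>. norm (g s - gt N s))) \<longlonglongrightarrow> 0"
      using tendsto_mult_left[OF small, of K] by simp
    then have "\<forall>\<^sub>F N in sequentially. K * (LINT s|?\<mu>. norm (g s - gt N s)) < e / 2"
      using e by (intro order_tendstoD(2)[of _ 0]) auto
    then obtain N where N: "K * (LINT s|?\<mu>. norm (g s - gt N s)) < e / 2"
      by (meson eventually_sequentially order_refl)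
    have "\<forall>\<^sub>F i in F. norm (pairing (u i) (gt N)) < e / 2"
      using tendstoD[OF fin[of N], of "e / 2"] e by simp
    then show "\<forall>\<^sub>F i in F. dist (pairing (u i) g) 0 < e"
    proof eventually_elim
      case (elim i)
      have "norm (pairing (u i) (\<lambda>s. g s - gt N s)) \<le> K * (LINT s|?\<mu>. norm (g s - gt N s))"
        by (rule order_trans[OF norm_pairing_le[OF dL] mult_right_mono[OF bd]]) simp
      then show ?case
        using elim N norm_triangle_ineq[of "pairing (u i) (gt N)" "pairing (u i) (\<lambda>s. g s - gt N s)"]
        by (simp add: split[of "u i" N])
    qed
  qed
qed simp

lemma zero_in_L1_functions:
  "(\<lambda>_. 0 :: nat \<Rightarrow>\<^sub>C 'k::{real_normed_field, euclidean_space}) \<in> L1_functions (c0_space J)"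
  using L1_functions_sum_c0_unit[of "\<lambda>_ _. 0 :: 'k" 0 J] by simp

lemma topspace_weak_star [simp]:
  "topspace (weak_star J :: 'k::{real_normed_field, euclidean_space} l1 Linf topology) = Linf_space (l1_space J)"
  unfolding weak_star_def topology_generated_by_topspace
  using zero_in_L1_functions[where J = J and 'k = 'k] by (auto intro!: exI[of _ "\<lambda>_. 0"] exI[of _ UNIV])

lemma continuous_map_pairing:
  fixes g :: "real \<Rightarrow> (nat \<Rightarrow>\<^sub>C 'k::{real_normed_field, euclidean_space})"
  assumes "g \<in> L1_functions (c0_space J)"
  shows "continuous_map (weak_star J) euclidean (\<lambda>f. pairing f g)"
  unfolding continuous_map_def
proof (intro conjI allI impI)
  fix U :: "'k set" assume "openin euclidean U"
  then show "openin (weak_star J) {f \<in> topspace (weak_star J). pairing f g \<in> U}"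
    unfolding topspace_weak_star unfolding weak_star_def
    using assms by (intro topology_generated_by_Basis) auto
qed auto

lemma continuous_map_into_weak_star:
  fixes h :: "'a \<Rightarrow> 'k::{real_normed_field, euclidean_space} l1 Linf"
  shows "continuous_map Z (weak_star J) h \<longleftrightarrow> h ` topspace Z \<subseteq> Linf_space (l1_space J) \<and>
    (\<forall>g\<in>L1_functions (c0_space J). continuous_map Z euclidean (\<lambda>z. pairing (h z) g))"
proof (intro iffI conjI ballI)
  assume h: "continuous_map Z (weak_star J) h"
  then show "h ` topspace Z \<subseteq> Linf_space (l1_space J)"
    using continuous_map_image_subset_topspace by fastforce
  show "continuous_map Z euclidean (\<lambda>z. pairing (h z) g)" if "g \<in> L1_functions (c0_space J)" for g
    using continuous_map_compose[OF h continuous_map_pairing[OF that]] by (simp add: o_def)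
next
  assume *: "h ` topspace Z \<subseteq> Linf_space (l1_space J) \<and>
    (\<forall>g\<in>L1_functions (c0_space J). continuous_map Z euclidean (\<lambda>z. pairing (h z) g))"
  show "continuous_map Z (weak_star J) h"
    unfolding weak_star_def continuous_on_generated_topo_iff
  proof (intro conjI allI impI)
    fix U :: "'k l1 Linf set" assume "U \<in> {{f \<in> Linf_space (l1_space J). pairing f g \<in> U} |g U. g \<in> L1_functions (c0_space J) \<and> open U}"
    then obtain g W where U: "U = {f \<in> Linf_space (l1_space J). pairing f g \<in> W}"
      and g: "g \<in> L1_functions (c0_space J)" and W: "open W" by blast
    have "h -` U \<inter> topspace Z = {z \<in> topspace Z. pairing (h z) g \<in> W}" using * U by auto
    also have "openin Z \<dots>"
      using * g W by (intro openin_continuous_map_preimage[where Y=euclidean]) auto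
    finally show "openin Z (h -` U \<inter> topspace Z)" .
  next
    show "h ` topspace Z \<subseteq> \<Union> {{f \<in> Linf_space (l1_space J). pairing f g \<in> U} |g U. g \<in> L1_functions (c0_space J) \<and> open U}"
      using * topspace_weak_star[of J, where 'k = 'k] unfolding weak_star_def topology_generated_by_topspace by simp
  qed
qed

lemma limitin_weak_star_iff:
  fixes u :: "'i \<Rightarrow> 'k::{real_normed_field, euclidean_space} l1 Linf"
  shows "limitin (weak_star J) u l F \<longleftrightarrow> l \<in> Linf_space (l1_space J) \<and>
    (\<forall>\<^sub>F i in F. u i \<in> Linf_space (l1_space J)) \<and>
    (\<forall>g\<in>L1_functions (c0_space J). ((\<lambda>i. pairing (u i) g) \<longlongrightarrow> pairing l g) F)"
proof (intro iffI conjI ballI)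
  assume l: "limitin (weak_star J) u l F"
  show "l \<in> Linf_space (l1_space J)" using limitin_topspace[OF l] by simp
  have "eventually (\<lambda>i. u i \<in> topspace (weak_star J)) F"
    using l unfolding limitin_def by blast
  then show "\<forall>\<^sub>F i in F. u i \<in> Linf_space (l1_space J)" by simp
  show "((\<lambda>i. pairing (u i) g) \<longlongrightarrow> pairing l g) F" if "g \<in> L1_functions (c0_space J)" for g
    using continuous_map_limit[OF continuous_map_pairing[OF that] l] by (simp add: o_def)
next
  assume *: "l \<in> Linf_space (l1_space J) \<and> (\<forall>\<^sub>F i in F. u i \<in> Linf_space (l1_space J)) \<and>
    (\<forall>g\<in>L1_functions (c0_space J). ((\<lambda>i. pairing (u i) g) \<longlongrightarrow> pairing l g) F)"
  have "generate_topology_on {{f \<in> Linf_space (l1_space J). pairing f g \<in> U} |g U.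
      g \<in> L1_functions (c0_space J) \<and> open U} U \<Longrightarrow> l \<in> U \<Longrightarrow> \<forall>\<^sub>F i in F. u i \<in> U" for U
  proof (induction U rule: generate_topology_on.induct)
    case (Int a b)
    then show ?case by (auto intro: eventually_conj)
  next
    case (UN K)
    then obtain k where "k \<in> K" "l \<in> k" by auto
    then have "\<forall>\<^sub>F i in F. u i \<in> k" using UN by blast
    then show ?case by eventually_elim (use \<open>k \<in> K\<close> in auto)
  next
    case (Basis s)
    then obtain g W where s: "s = {f \<in> Linf_space (l1_space J). pairing f g \<in> W}"
      and g: "g \<in> L1_functions (c0_space J)" and W: "open W" by blast
    have "\<forall>\<^sub>F i in F. pairing (u i) g \<in> W"
      using * g W Basis(2) s topological_tendstoD by blast
    moreover have "\<forall>\<^sub>F i in F. u i \<in> Linf_space (l1_space J)" using * by blast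
    ultimately show ?case by eventually_elim (simp add: s)
  qed simp
  then show "limitin (weak_star J) u l F"
    using * unfolding limitin_def weak_star_def[symmetric] topspace_weak_star
    by (auto simp: weak_star_def openin_topology_generated_by_iff)
qed

lemma Linf_space_l1_diff:
  fixes f g :: "'k::{real_normed_field, euclidean_space} l1 Linf"
  shows "f \<in> Linf_space (l1_space J) \<Longrightarrow> g \<in> Linf_space (l1_space J) \<Longrightarrow> f - g \<in> Linf_space (l1_space J)"
  by (simp add: Linf_space_l1_iff prim_diff)

lemma limitin_weak_star_if_prim_tendsto:
  fixes u :: "'i \<Rightarrow> 'k::{real_normed_field, euclidean_space} l1 Linf"
  assumes l: "l \<in> Linf_space (l1_space J)"
    and bd: "\<forall>\<^sub>F i in F. u i \<in> Linf_space (l1_space J) \<and> norm (u i) \<le> K"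
    and lim: "\<And>j x. j \<in> J \<Longrightarrow> x \<in> {0..1} \<Longrightarrow> ((\<lambda>i. prim (u i) j x) \<longlongrightarrow> prim l j x) F"
  shows "limitin (weak_star J) u l F"
  unfolding limitin_weak_star_iff
proof (intro conjI ballI)
  show "l \<in> Linf_space (l1_space J)" by fact
  show "\<forall>\<^sub>F i in F. u i \<in> Linf_space (l1_space J)" using bd by eventually_elim simp
  fix g :: "real \<Rightarrow> (nat \<Rightarrow>\<^sub>C 'k)" assume g: "g \<in> L1_functions (c0_space J)"
  define v where "v i = (if norm (u i) \<le> K then u i - l else 0)" for i
  have ev: "\<forall>\<^sub>F i in F. v i = u i - l" using bd by eventually_elim (simp add: v_def)
  have "((\<lambda>i. pairing (v i) g) \<longlongrightarrow> 0) F"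
  proof (rule tendsto_pairing_if_prim_tendsto[OF _ _ g])
    show "norm (v i) \<le> \<bar>K\<bar> + norm l" for i
      unfolding v_def using norm_triangle_ineq4[of "u i" l] by auto
    fix j x assume jx: "j \<in> J" "x \<in> {0..1::real}"
    have "((\<lambda>i. prim (u i) j x - prim l j x) \<longlongrightarrow> 0) F"
      using tendsto_diff[OF lim[OF jx] tendsto_const, of "prim l j x"] by simp
    then show "((\<lambda>i. prim (v i) j x) \<longlongrightarrow> 0) F"
      by (rule Lim_transform_eventually) (use ev in \<open>eventually_elim, simp add: prim_diff\<close>)
  qed
  then have "((\<lambda>i. pairing (v i) g + pairing l g) \<longlongrightarrow> 0 + pairing l g) F" by (intro tendsto_intros)
  then have "((\<lambda>i. pairing (v i) g + pairing l g) \<longlongrightarrow> pairing l g) F" by simp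
  then show "((\<lambda>i. pairing (u i) g) \<longlongrightarrow> pairing l g) F"
    by (rule Lim_transform_eventually)
      (use ev in \<open>eventually_elim, simp add: pairing_diff[OF g]\<close>)
qed

lemma prim_tendsto_if_limitin:
  fixes u :: "'i \<Rightarrow> 'k::{real_normed_field, euclidean_space} l1 Linf"
  assumes "limitin (weak_star J) u l F" "j \<in> J"
  shows "((\<lambda>i. prim (u i) j x) \<longlongrightarrow> prim l j x) F"
  using assms prim_test_in_L1[OF assms(2), of x] unfolding limitin_weak_star_iff prim_eq_pairing by blast

section \<open>The weak-star topology is admissible\<close>

lemma subspace_Linf_space_l1: "subspace (Linf_space (l1_space J) :: 'k::{real_normed_field, euclidean_space} l1 Linf set)"
  by (simp add: subspace_def Linf_space_l1_iff prim_add prim_scaleR)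

lemma Linf_scale_in_space:
  "x \<in> Linf_space (l1_space J) \<Longrightarrow> Linf_scale a x \<in> Linf_space (l1_space J)"
  for x :: "'k::{real_normed_field, euclidean_space} l1 Linf"
  by (simp add: Linf_space_l1_iff prim_scale)

lemma Linf_space_l1_add:
  "x \<in> Linf_space (l1_space J) \<Longrightarrow> y \<in> Linf_space (l1_space J) \<Longrightarrow> x + y \<in> Linf_space (l1_space J)"
  for x :: "'k::{real_normed_field, euclidean_space} l1 Linf"
  by (simp add: Linf_space_l1_iff prim_add)

lemma vector_space_Linf_scale:
  "vector_space (Linf_scale :: 'k::{real_normed_field, euclidean_space} \<Rightarrow> 'k l1 Linf \<Rightarrow> 'k l1 Linf)"
  by unfold_locales (auto intro!: Linf_eqI_prim simp: prim_add prim_scale algebra_simps)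

lemma norm_Linf_scale_le: "norm (Linf_scale a f) \<le> norm a * norm f"
  for f :: "'k::{real_normed_field, euclidean_space} l1 Linf"
proof (rule norm_Linf_le_if_prim_increment_le)
  fix N and x y :: real assume "x \<le> y"
  then have "(\<Sum>j<N. norm (prim f j y - prim f j x)) \<le> norm f * (y - x)"
    using sum_norm_prim_increment_le[of f y x N] by simp
  then have "norm a * (\<Sum>j<N. norm (prim f j y - prim f j x)) \<le> norm a * (norm f * (y - x))"
    by (rule mult_left_mono) simp
  moreover have "(\<Sum>j<N. norm (prim (Linf_scale a f) j y - prim (Linf_scale a f) j x))
    = norm a * (\<Sum>j<N. norm (prim f j y - prim f j x))"
    by (simp add: prim_scale sum_distrib_left norm_mult flip: right_diff_distrib)
  ultimately show "(\<Sum>j<N. norm (prim (Linf_scale a f) j y - prim (Linf_scale a f) j x)) \<le> norm a * norm f * (y - x)"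
    by simp
qed

lemma norm_Linf_scale: "norm (Linf_scale a f) = norm a * norm f"
  for f :: "'k::{real_normed_field, euclidean_space} l1 Linf"
proof (cases "a = 0")
  case True
  then show ?thesis using norm_Linf_scale_le[of a f] by simp
next
  case False
  have "f = Linf_scale (inverse a) (Linf_scale a f)"
    by (rule Linf_eqI_prim) (simp add: prim_scale False flip: mult.assoc)
  then have "norm f \<le> norm (inverse a) * norm (Linf_scale a f)"
    using norm_Linf_scale_le[of "inverse a" "Linf_scale a f"] by simp
  then have "norm a * norm f \<le> norm a * (norm (inverse a) * norm (Linf_scale a f))"
    by (rule mult_left_mono) simp
  also have "\<dots> = norm (Linf_scale a f)" using False by (simp add: norm_inverse)
  finally show ?thesis using norm_Linf_scale_le[of a f] by simp
qed

text \<open>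
  Closedness of bounded sets under pointwise limits of primitives: a pointwise limit of Lipschitz
  functions with a common constant is Lipschitz continuous, hence a primitive.
\<close>

lemma Linf_limit_if_prims_converge:
  fixes f :: "nat \<Rightarrow> 'k::{real_normed_field, euclidean_space} l1 Linf"
  assumes X: "\<And>n. f n \<in> Linf_space (l1_space J)" and bd: "\<And>n. norm (f n) \<le> K"
    and conv: "\<And>j x. j \<in> J \<Longrightarrow> x \<in> {0..1} \<Longrightarrow> convergent (\<lambda>n. prim (f n) j x)"
  obtains l where "l \<in> Linf_space (l1_space J)" "\<And>j x. x \<in> {0..1} \<Longrightarrow> (\<lambda>n. prim (f n) j x) \<longlonglongrightarrow> prim l j x"
proof -
  have conv': "convergent (\<lambda>n. prim (f n) j x)" if "x \<in> {0..1}" for j x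
  proof (cases "j \<in> J")
    case False
    then have "prim (f n) j x = 0" for n using X[of n] that by (simp add: Linf_space_l1_iff)
    then show ?thesis by (simp add: convergent_const)
  qed (use conv that in blast)
  define P where "P j x = lim (\<lambda>n. prim (f n) j x)" for j x
  have P: "(\<lambda>n. prim (f n) j x) \<longlonglongrightarrow> P j x" if "x \<in> {0..1}" for j x
    using conv'[OF that] unfolding P_def by (simp add: convergent_LIMSEQ_iff)
  have lip: "(\<Sum>j<N. norm (P j y - P j x)) \<le> K * (y - x)"
    if xy: "x \<in> {0..1}" "y \<in> {0..1}" "x \<le> y" for N x y
  proof (rule LIMSEQ_le_const2)
    show "(\<lambda>n. \<Sum>j<N. norm (prim (f n) j y - prim (f n) j x)) \<longlonglongrightarrow> (\<Sum>j<N. norm (P j y - P j x))"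
      by (intro tendsto_intros P xy)
    have "(\<Sum>j<N. norm (prim (f n) j y - prim (f n) j x)) \<le> K * (y - x)" for n
    proof -
      have "(\<Sum>j<N. norm (prim (f n) j y - prim (f n) j x)) \<le> norm (f n) * (y - x)"
        using sum_norm_prim_increment_le[of "f n" y x N] xy by simp
      also have "\<dots> \<le> K * (y - x)" using bd xy by (intro mult_right_mono) auto
      finally show ?thesis .
    qed
    then show "\<exists>N'. \<forall>n\<ge>N'. (\<Sum>j<N. norm (prim (f n) j y - prim (f n) j x)) \<le> K * (y - x)" by blast
  qed
  obtain l where l: "\<And>j x. x \<in> {0..1} \<Longrightarrow> prim l j x = P j x - P j 0" "norm l \<le> K"
    using lipschitz_is_prim[of P K] lip by blast
  have P0: "P j 0 = 0" for j
    using P[of 0 j] by (simp add: prim_eq_0 LIMSEQ_const_iff)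
  have lim: "(\<lambda>n. prim (f n) j x) \<longlonglongrightarrow> prim l j x" if "x \<in> {0..1}" for j x
    using P[OF that] l(1)[OF that] P0 by simp
  have "prim l j x = 0" if "j \<notin> J" "x \<in> {0..1}" for j x
  proof -
    have "prim (f n) j x = 0" for n using X[of n] that by (simp add: Linf_space_l1_iff)
    then show ?thesis using lim[OF that(2), of j] by (simp add: LIMSEQ_const_iff)
  qed
  then have "l \<in> Linf_space (l1_space J)" by (simp add: Linf_space_l1_iff)
  with lim show ?thesis by (intro that)
qed

lemma complete_Linf_space_l1:
  "complete (Linf_space (l1_space J) :: 'k::{real_normed_field, euclidean_space} l1 Linf set)"
  unfolding complete_def
proof (intro allI impI)
  fix f :: "nat \<Rightarrow> 'k l1 Linf"
  assume "(\<forall>n. f n \<in> Linf_space (l1_space J)) \<and> Cauchy f"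
  then have X: "\<And>n. f n \<in> Linf_space (l1_space J)" and C: "Cauchy f" by auto
  obtain K where K: "\<And>n. norm (f n) \<le> K"
    using cauchy_imp_bounded[OF C] by (auto simp: bounded_iff)
  have "Cauchy (\<lambda>n. prim (f n) j x)" if "x \<in> {0..1}" for j x
  proof (rule CauchyI)
    fix e :: real assume "e > 0"
    from CauchyD[OF C this] obtain M where M: "\<And>m n. m \<ge> M \<Longrightarrow> n \<ge> M \<Longrightarrow> norm (f m - f n) < e" by blast
    have "norm (prim (f m) j x - prim (f n) j x) < e" if "m \<ge> M" "n \<ge> M" for m n
      using norm_prim_le[OF \<open>x \<in> {0..1}\<close>, of "f m - f n" j] M[OF that] by (simp add: prim_diff)
    then show "\<exists>M. \<forall>m\<ge>M. \<forall>n\<ge>M. norm (prim (f m) j x - prim (f n) j x) < e" by blast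
  qed
  then obtain l where l: "l \<in> Linf_space (l1_space J)"
    "\<And>j x. x \<in> {0..1} \<Longrightarrow> (\<lambda>n. prim (f n) j x) \<longlonglongrightarrow> prim l j x"
    using Linf_limit_if_prims_converge[of f J K] X K by (metis Cauchy_convergent)
  have "f \<longlonglongrightarrow> l"
  proof (rule LIMSEQ_I)
    fix e :: real assume e: "e > 0"
    then obtain M where M: "\<And>m n. m \<ge> M \<Longrightarrow> n \<ge> M \<Longrightarrow> norm (f m - f n) < e / 2"
      using CauchyD[OF C, of "e / 2"] by (metis half_gt_zero)
    have "norm (f m - l) \<le> e / 2" if m: "m \<ge> M" for m
    proof (rule norm_Linf_le_if_prim_increment_le)
      fix N and x y :: real assume xy: "x \<in> {0..1}" "y \<in> {0..1}" "x \<le> y"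
      show "(\<Sum>j<N. norm (prim (f m - l) j y - prim (f m - l) j x)) \<le> e / 2 * (y - x)"
      proof (rule LIMSEQ_le_const2)
        show "(\<lambda>n. \<Sum>j<N. norm (prim (f m - f n) j y - prim (f m - f n) j x))
            \<longlonglongrightarrow> (\<Sum>j<N. norm (prim (f m - l) j y - prim (f m - l) j x))"
          unfolding prim_diff by (intro tendsto_intros l(2) xy)
        have "(\<Sum>j<N. norm (prim (f m - f n) j y - prim (f m - f n) j x)) \<le> e / 2 * (y - x)" if "n \<ge> M" for n
        proof -
          have "(\<Sum>j<N. norm (prim (f m - f n) j y - prim (f m - f n) j x)) \<le> norm (f m - f n) * (y - x)"
            using sum_norm_prim_increment_le[of "f m - f n" y x N] xy by simp
          also have "\<dots> \<le> e / 2 * (y - x)" using M[OF m that] xy by (intro mult_right_mono) auto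
          finally show ?thesis .
        qed
        then show "\<exists>N'. \<forall>n\<ge>N'. (\<Sum>j<N. norm (prim (f m - f n) j y - prim (f m - f n) j x)) \<le> e / 2 * (y - x)" by blast
      qed
    qed
    then show "\<exists>no. \<forall>n\<ge>no. norm (f n - l) < e" using e by (intro exI[of _ M]) force
  qed
  with l(1) show "\<exists>l\<in>Linf_space (l1_space J). f \<longlonglongrightarrow> l" by blast
qed

lemma weak_star_neighbourhood:
  fixes l :: "'k::{real_normed_field, euclidean_space} l1 Linf"
  assumes "openin (weak_star J) U" "l \<in> U"
  obtains G e where "finite G" "G \<subseteq> L1_functions (c0_space J)" "e > 0"
    "{f \<in> Linf_space (l1_space J). \<forall>g\<in>G. norm (pairing f g - pairing l g) < e} \<subseteq> U"
proof -
  let ?V = "\<lambda>G e. {f \<in> Linf_space (l1_space J). \<forall>g\<in>G. norm (pairing f g - pairing l g) < e}"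
  have "generate_topology_on {{f \<in> Linf_space (l1_space J). pairing f g \<in> U} |g U.
      g \<in> L1_functions (c0_space J) \<and> open U} U"
    using assms(1) unfolding weak_star_def openin_topology_generated_by_iff .
  then have "\<exists>G e. finite G \<and> G \<subseteq> L1_functions (c0_space J) \<and> e > 0 \<and> ?V G e \<subseteq> U" using assms(2)
  proof (induction U rule: generate_topology_on.induct)
    case (Int a b)
    then obtain G e G' e' where "finite G" "G \<subseteq> L1_functions (c0_space J)" "e > 0" "?V G e \<subseteq> a"
      "finite G'" "G' \<subseteq> L1_functions (c0_space J)" "e' > 0" "?V G' e' \<subseteq> b" by auto
    moreover have "?V (G \<union> G') (min e e') \<subseteq> ?V G e \<inter> ?V G' e'" by auto
    ultimately show ?case by (intro exI[of _ "G \<union> G'"] exI[of _ "min e e'"]) auto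
  next
    case (UN K)
    then obtain k where "k \<in> K" "l \<in> k" by auto
    with UN(2)[OF this] show ?case by (meson Union_upper subset_trans)
  next
    case (Basis s)
    then obtain g W where s: "s = {f \<in> Linf_space (l1_space J). pairing f g \<in> W}"
      and g: "g \<in> L1_functions (c0_space J)" and W: "open W" by blast
    have "pairing l g \<in> W" using Basis(2) s by simp
    then obtain e where e: "e > 0" "ball (pairing l g) e \<subseteq> W" using W open_contains_ball by blast
    have "?V {g} e \<subseteq> s" using e(2) by (auto simp: s dist_norm norm_minus_commute subset_iff)
    with e g show ?case by (intro exI[of _ "{g}"] exI[of _ e]) auto
  qed simp
  then show ?thesis using that by blast
qed

lemma openin_weak_star_neighbourhood:
  assumes "finite G" "G \<subseteq> L1_functions (c0_space J)"
  shows "openin (weak_star J) {f \<in> Linf_space (l1_space J). \<forall>g\<in>G. norm (pairing f g) < e}"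
  using assms
proof (induction G rule: finite_induct)
  case empty
  then show ?case using openin_topspace[of "weak_star J :: 'a l1 Linf topology"] by simp
next
  case (insert g G)
  have "openin (weak_star J) {f \<in> topspace (weak_star J). pairing f g \<in> ball 0 e}"
    using insert by (intro openin_continuous_map_preimage[OF continuous_map_pairing]) auto
  from openin_Int[OF this insert.IH] insert.prems
  show ?case by (auto simp: Collect_conj_eq[symmetric] elim!: back_subst[of "openin _"])
qed

lemma prim_differ:
  fixes f h :: "'k::{real_normed_field, euclidean_space} l1 Linf"
  assumes "f \<in> Linf_space (l1_space J)" "h \<in> Linf_space (l1_space J)" "f \<noteq> h"
  obtains j x where "j \<in> J" "prim f j x \<noteq> prim h j x"
  using assms Linf_eqI_prim[of f h] unfolding Linf_space_l1_iff by metis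

lemma norm_sum_c0_unit_le:
  assumes "0 \<le> B" "\<And>j. j < N \<Longrightarrow> norm (v j) \<le> B"
  shows "norm (\<Sum>j<N. c0_unit j (v j)) \<le> B"
  by (rule norm_bound) (use assms in \<open>auto simp: apply_bcontfun_sum\<close>)

lemma pairing_in_dual:
  assumes "g \<in> L1_functions (c0_space J)"
  shows "(\<lambda>f. pairing f g) \<in> topological_dual Linf_scale (Linf_space (l1_space J)) (weak_star J)"
  unfolding topological_dual_def
  using assms by (simp add: pairing_add pairing_scale continuous_map_pairing)

text \<open>
  Step functions on a single interval \<open>{x<..y}\<close>, divided by its length, suffice as norming functionals,
  because the norm is the Lipschitz constant of the primitives.
\<close>

lemma norm_le_SUP_dual:
  fixes f :: "'k::{real_normed_field, euclidean_space} l1 Linf"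
  assumes f: "f \<in> Linf_space (l1_space J)"
  shows "norm f = (SUP \<phi>\<in>{\<phi> \<in> topological_dual Linf_scale (Linf_space (l1_space J)) (weak_star J).
    \<forall>y\<in>Linf_space (l1_space J). norm (\<phi> y) \<le> norm y}. norm (\<phi> f))"
proof (rule antisym)
  let ?D = "{\<phi> \<in> topological_dual Linf_scale (Linf_space (l1_space J)) (weak_star J).
    \<forall>y\<in>Linf_space (l1_space J). norm (\<phi> y) \<le> norm y}"
  let ?S = "SUP \<phi>\<in>?D. norm (\<phi> f)"
  have bdd: "bdd_above ((\<lambda>\<phi>. norm (\<phi> f)) ` ?D)" using f by (intro bdd_aboveI[of _ "norm f"]) auto
  have pz: "pairing h (\<lambda>_. 0) = 0" for h :: "'k l1 Linf" by (simp add: pairing_def)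
  have zero: "(\<lambda>f :: 'k l1 Linf. pairing f (\<lambda>_. 0)) \<in> ?D"
    by (intro CollectI conjI ballI pairing_in_dual zero_in_L1_functions) (simp add: pz)
  show "?S \<le> norm f" using f zero by (intro cSUP_least) auto
  have upper: "norm (\<phi> f) \<le> ?S" if "\<phi> \<in> ?D" for \<phi> using that bdd by (intro cSUP_upper) auto
  show "norm f \<le> ?S"
  proof (rule norm_Linf_le_if_prim_increment_le)
    fix N and x y :: real assume xy: "x \<in> {0..1}" "y \<in> {0..1}" "x \<le> y"
    show "(\<Sum>j<N. norm (prim f j y - prim f j x)) \<le> ?S * (y - x)"
    proof (cases "x = y")
      case False
      with xy have lt: "x < y" by simp
      let ?d = "\<lambda>j. prim f j y - prim f j x"
      \<comment> \<open>\<open>z j\<close> rotates the increment \<open>?d j\<close> to the positive real axis\<close>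
      define z where "z j = (if j \<in> J then of_real (norm (?d j)) / ?d j else 0)" for j
      have z1: "norm (z j) \<le> 1" for j by (simp add: z_def norm_divide)
      have zd: "z j * ?d j = of_real (norm (?d j))" for j
        using f xy by (cases "j \<in> J") (auto simp: z_def Linf_space_l1_iff)
      define \<phi> where "\<phi> j s = z j * of_real (indicator {x<..y} s)" for j s
      define g where "g s = (\<Sum>j<N. c0_unit j (\<phi> j s))" for s
      have \<phi>i: "integrable unit_interval_measure (\<phi> j)" for j
        unfolding \<phi>_def by (intro integrable_mult_right integrable_of_real_indicator) simp
      have gL: "g \<in> L1_functions (c0_space J)"
        unfolding g_def by (rule L1_functions_sum_c0_unit[OF \<phi>i]) (simp add: \<phi>_def z_def)
      have ng: "norm (g s) \<le> indicator {x<..y} s" for s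
        unfolding g_def
        by (rule norm_sum_c0_unit_le) (use z1 in \<open>auto simp: \<phi>_def norm_mult indicator_def\<close>)
      have "(LINT s|unit_interval_measure. norm (g s)) \<le> (LINT s|unit_interval_measure. indicator {x<..y} s)"
        using gL ng integrable_indicator_unit_interval[of "\<lambda>_. 1::real" "{x<..y}"]
        by (intro integral_mono) (auto simp: L1_functions_def)
      also have "\<dots> = y - x" by (rule LINT_indicator_Ioc[OF xy])
      finally have gint: "(LINT s|unit_interval_measure. norm (g s)) \<le> y - x" .
      have pg: "norm (pairing h g) \<le> (y - x) * norm h" for h
        using norm_pairing_le[OF gL, of h] mult_left_mono[OF gint, of "norm h"] by (simp add: mult.commute)
      have pf: "pairing f g = of_real (\<Sum>j<N. norm (?d j))"
      proof -
        have "(LINT s|unit_interval_measure. \<phi> j s * coord f j s) = z j * ?d j" for j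
        proof -
          have "(LINT s|unit_interval_measure. \<phi> j s * coord f j s)
              = (LINT s|unit_interval_measure. z j * (indicator {x<..y} s *\<^sub>R coord f j s))"
            by (simp add: \<phi>_def scaleR_conv_of_real mult.assoc)
          also have "\<dots> = z j * (LINT s|unit_interval_measure. indicator {x<..y} s *\<^sub>R coord f j s)"
            by (rule Bochner_Integration.integral_mult_right)
              (rule integrable_indicator_unit_interval[OF integrable_coord], simp)
          also have "\<dots> = z j * ?d j"
            unfolding prim_def primitive_increment[OF integrable_coord xy(3)] ..
          finally show ?thesis .
        qed
        then show ?thesis unfolding g_def by (simp add: pairing_sum_c0_unit[OF \<phi>i] zd)
      qed
      define \<psi> where "\<psi> h = pairing h (\<lambda>s. (1 / (y - x)) *\<^sub>R g s)" for h :: "'k l1 Linf"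
      have gL': "(\<lambda>s. (1 / (y - x)) *\<^sub>R g s) \<in> L1_functions (c0_space J)"
      proof -
        have "(\<lambda>s. (1 / (y - x)) *\<^sub>R g s) = (\<lambda>s. \<Sum>j<N. c0_unit j ((1 / (y - x)) *\<^sub>R \<phi> j s))"
          by (simp add: g_def scaleR_sum_right linear_scale[OF bounded_linear.linear[OF bounded_linear_c0_unit]])
        also have "\<dots> \<in> L1_functions (c0_space J)"
        proof (rule L1_functions_sum_c0_unit)
          show "integrable unit_interval_measure (\<lambda>s. (1 / (y - x)) *\<^sub>R \<phi> j s)" for j
            by (intro integrable_scaleR_right \<phi>i)
        qed (simp add: \<phi>_def z_def)
        finally show ?thesis .
      qed
      have \<psi>: "\<psi> h = (1 / (y - x)) *\<^sub>R pairing h g" for h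
      proof -
        have "(\<Sum>j. coord h j s * apply_bcontfun ((1 / (y - x)) *\<^sub>R g s) j)
            = (1 / (y - x)) *\<^sub>R (\<Sum>j. coord h j s * apply_bcontfun (g s) j)" for s
          unfolding coord_def by (simp add: suminf_scaleR_right[OF summable_pairing])
        then show ?thesis unfolding \<psi>_def pairing_coord by simp
      qed
      have "\<psi> \<in> topological_dual Linf_scale (Linf_space (l1_space J)) (weak_star J)"
        unfolding \<psi>_def[abs_def] by (rule pairing_in_dual[OF gL'])
      moreover have "norm (\<psi> h) \<le> norm h" for h
        using pg[of h] lt by (simp add: \<psi> divide_le_eq mult.commute)
      ultimately have "norm (\<psi> f) \<le> ?S" by (intro upper) auto
      moreover have "norm (\<psi> f) = (\<Sum>j<N. norm (?d j)) / (y - x)"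
        unfolding \<psi> pf norm_scaleR norm_of_real using lt by (simp add: sum_nonneg abs_of_nonneg)
      ultimately show ?thesis using lt by (simp add: divide_le_eq)
    qed simp
  qed
qed

lemma weak_star_admissible:
  "bi_admissible_space (Linf_scale :: 'k::{real_normed_field, euclidean_space} \<Rightarrow> _)
     (Linf_space (l1_space J)) (weak_star J)"
proof (rule bi_admissible_space.intro[OF vector_space_Linf_scale], unfold_locales)
  let ?X = "Linf_space (l1_space J) :: 'k l1 Linf set"
  let ?\<tau> = "weak_star J :: 'k l1 Linf topology"
  show "Linf_scale (of_real r) x = r *\<^sub>R x" for r and x :: "'k l1 Linf"
    by (rule Linf_eqI_prim) (simp add: prim_scale prim_scaleR scaleR_conv_of_real)
  show "norm (Linf_scale a x) = norm a * norm x" for a and x :: "'k l1 Linf" by (rule norm_Linf_scale)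
  show "module.subspace Linf_scale ?X"
    using subspace_Linf_space_l1[where J = J and 'k = 'k]
    by (auto simp: module.subspace_def[OF vector_space_Linf_scale[folded module_iff_vector_space]]
        subspace_def Linf_scale_in_space)
  show "complete ?X" by (rule complete_Linf_space_l1)
  show "topspace ?\<tau> = ?X" by simp
  show "continuous_map (prod_topology ?\<tau> ?\<tau>) ?\<tau> (\<lambda>(x, y). x + y)"
    unfolding continuous_map_into_weak_star
  proof (intro conjI ballI)
    show "(\<lambda>(x, y). x + y) ` topspace (prod_topology ?\<tau> ?\<tau>) \<subseteq> ?X" by (auto simp: Linf_space_l1_add)
    fix g :: "real \<Rightarrow> (nat \<Rightarrow>\<^sub>C 'k)" assume g: "g \<in> L1_functions (c0_space J)"
    have "continuous_map (prod_topology ?\<tau> ?\<tau>) euclidean (\<lambda>z. pairing (fst z) g + pairing (snd z) g)"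
      using continuous_map_compose[OF continuous_map_fst continuous_map_pairing[OF g]]
        continuous_map_compose[OF continuous_map_snd continuous_map_pairing[OF g]]
      by (intro continuous_map_add) (auto simp: o_def)
    then show "continuous_map (prod_topology ?\<tau> ?\<tau>) euclidean (\<lambda>z. pairing (case z of (x, y) \<Rightarrow> x + y) g)"
      by (simp add: case_prod_beta pairing_add[OF g])
  qed
  show "continuous_map (prod_topology euclidean ?\<tau>) ?\<tau> (\<lambda>(a, x). Linf_scale a x)"
    unfolding continuous_map_into_weak_star
  proof (intro conjI ballI)
    show "(\<lambda>(a, x). Linf_scale a x) ` topspace (prod_topology euclidean ?\<tau>) \<subseteq> ?X" by (auto simp: Linf_scale_in_space)
    fix g :: "real \<Rightarrow> (nat \<Rightarrow>\<^sub>C 'k)" assume g: "g \<in> L1_functions (c0_space J)"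
    have "continuous_map (prod_topology (euclidean :: 'k topology) ?\<tau>) euclidean (\<lambda>z. fst z * pairing (snd z) g)"
      using continuous_map_compose[OF continuous_map_snd continuous_map_pairing[OF g], of "euclidean :: 'k topology"]
        continuous_map_fst[of "euclidean :: 'k topology" ?\<tau>]
      by (auto simp: o_def continuous_map_atin intro!: tendsto_mult)
    then show "continuous_map (prod_topology euclidean ?\<tau>) euclidean (\<lambda>z. pairing (case z of (a, x) \<Rightarrow> Linf_scale a x) g)"
      by (simp add: case_prod_beta pairing_scale[OF g])
  qed
  show "\<exists>V. openin ?\<tau> V \<and> 0 \<in> V \<and> convex V \<and> V \<subseteq> U" if U: "openin ?\<tau> U" "0 \<in> U" for U
  proof -
    obtain G e where G: "finite G" "G \<subseteq> L1_functions (c0_space J)" "e > 0"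
      "{f \<in> ?X. \<forall>g\<in>G. norm (pairing f g - pairing 0 g) < e} \<subseteq> U"
      using weak_star_neighbourhood[OF U] by blast
    let ?V = "{f \<in> ?X. \<forall>g\<in>G. norm (pairing f g) < e}"
    have "convex ?V"
    proof (rule convexI)
      fix x y and u v :: real assume x: "x \<in> ?V" and y: "y \<in> ?V" and uv: "0 \<le> u" "0 \<le> v" "u + v = 1"
      have "u *\<^sub>R x + v *\<^sub>R y \<in> ?X"
        using x y subspace_Linf_space_l1[where J = J and 'k = 'k] by (auto simp: subspace_def)
      moreover have "norm (pairing (u *\<^sub>R x + v *\<^sub>R y) g) < e" if "g \<in> G" for g
      proof -
        have g: "g \<in> L1_functions (c0_space J)" using G that by auto
        have sc: "pairing (r *\<^sub>R f) g = r *\<^sub>R pairing f g" for r and f :: "'k l1 Linf"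
        proof -
          have "r *\<^sub>R f = Linf_scale (of_real r) f"
            by (rule Linf_eqI_prim) (simp add: prim_scale prim_scaleR scaleR_conv_of_real)
          then show ?thesis by (simp add: pairing_scale[OF g] scaleR_conv_of_real)
        qed
        have "pairing (u *\<^sub>R x + v *\<^sub>R y) g = u *\<^sub>R pairing x g + v *\<^sub>R pairing y g"
          by (simp add: pairing_add[OF g] sc)
        moreover have "pairing x g \<in> ball 0 e" "pairing y g \<in> ball 0 e" using x y that by auto
        ultimately have "pairing (u *\<^sub>R x + v *\<^sub>R y) g \<in> ball 0 e"
          using convexD[OF convex_ball] uv by metis
        then show ?thesis by simp
      qed
      ultimately show "u *\<^sub>R x + v *\<^sub>R y \<in> ?V" by blast
    qed
    moreover have p0: "pairing 0 g = 0" if "g \<in> G" for g using pairing_zero[of g "c0_space J"] G(2) that by auto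
    have "0 \<in> ?V" using p0 G(3) subspace_0[OF subspace_Linf_space_l1] by auto
    moreover have "?V \<subseteq> U" using G(4) p0 by auto
    moreover have "openin ?\<tau> ?V" by (rule openin_weak_star_neighbourhood[OF G(1,2)])
    ultimately show ?thesis by blast
  qed
  show "Hausdorff_space ?\<tau>"
    unfolding Hausdorff_space_def
  proof (intro allI impI)
    fix f h assume fh: "f \<in> topspace ?\<tau> \<and> h \<in> topspace ?\<tau> \<and> f \<noteq> h"
    then obtain j x where j: "j \<in> J" "prim f j x \<noteq> prim h j x" using prim_differ[of f J h] by auto
    from hausdorff[OF j(2)] obtain U V where UV: "open U" "open V" "prim f j x \<in> U" "prim h j x \<in> V" "U \<inter> V = {}" by blast
    have c: "continuous_map ?\<tau> euclidean (\<lambda>f. prim f j x)"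
      unfolding prim_eq_pairing by (rule continuous_map_pairing[OF prim_test_in_L1[OF j(1)]])
    have "openin ?\<tau> {f \<in> topspace ?\<tau>. prim f j x \<in> U}" "openin ?\<tau> {f \<in> topspace ?\<tau>. prim f j x \<in> V}"
      using UV by (auto intro!: openin_continuous_map_preimage[OF c] simp del: topspace_weak_star)
    moreover have "disjnt {f \<in> topspace ?\<tau>. prim f j x \<in> U} {f \<in> topspace ?\<tau>. prim f j x \<in> V}"
      using UV(5) by (auto simp: disjnt_def)
    ultimately show "\<exists>U V. openin ?\<tau> U \<and> openin ?\<tau> V \<and> f \<in> U \<and> h \<in> V \<and> disjnt U V"
      using fh UV(3,4) by blast
  qed
  show "openin (top_of_set ?X) U" if U: "openin ?\<tau> U" for U
  proof -
    have "continuous_map (top_of_set ?X) ?\<tau> (\<lambda>f. f)"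
      unfolding continuous_map_into_weak_star
      using continuous_on_pairing by auto
    from openin_continuous_map_preimage[OF this U] have "openin (top_of_set ?X) {f \<in> ?X. f \<in> U}" by simp
    moreover have "{f \<in> ?X. f \<in> U} = U" using openin_subset[OF U] by auto
    ultimately show ?thesis by simp
  qed
  show "\<exists>l. limitin ?\<tau> f l sequentially"
    if X: "range f \<subseteq> ?X" and b: "bounded (range f)"
      and C: "\<And>U. openin ?\<tau> U \<Longrightarrow> 0 \<in> U \<Longrightarrow> \<exists>N. \<forall>m\<ge>N. \<forall>n\<ge>N. f m - f n \<in> U" for f
  proof -
    obtain K where K: "\<And>n. norm (f n) \<le> K" using b by (auto simp: bounded_iff)
    have "Cauchy (\<lambda>n. prim (f n) j x)" if "j \<in> J" for j x
    proof (rule CauchyI)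
      fix e :: real assume e: "e > 0"
      let ?g = "\<lambda>s. c0_unit j (of_real (indicator {..x} s) :: 'k)"
      have g: "{?g} \<subseteq> L1_functions (c0_space J)" using prim_test_in_L1[OF that] by auto
      have "prim 0 j x = (0 :: 'k)" by simp
      then have "0 \<in> {f \<in> ?X. \<forall>g\<in>{?g}. norm (pairing f g) < e}"
        unfolding prim_eq_pairing using subspace_0[OF subspace_Linf_space_l1] e by auto
      then obtain N where "\<forall>m\<ge>N. \<forall>n\<ge>N. f m - f n \<in> {f \<in> ?X. \<forall>g\<in>{?g}. norm (pairing f g) < e}"
        using C[OF openin_weak_star_neighbourhood[OF _ g]] by blast
      then show "\<exists>N. \<forall>m\<ge>N. \<forall>n\<ge>N. norm (prim (f m) j x - prim (f n) j x) < e"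
        unfolding prim_diff[symmetric] unfolding prim_eq_pairing by auto
    qed
    then obtain l where "l \<in> ?X" "\<And>j x. x \<in> {0..1} \<Longrightarrow> (\<lambda>n. prim (f n) j x) \<longlonglongrightarrow> prim l j x"
      using Linf_limit_if_prims_converge[of f J K] X K by (metis Cauchy_convergent rangeI subsetD)
    then have "limitin ?\<tau> f l sequentially"
      using X K by (intro limitin_weak_star_if_prim_tendsto[where K = K] always_eventually) auto
    then show ?thesis by blast
  qed
  show "norm x = (SUP \<phi>\<in>{\<phi> \<in> topological_dual Linf_scale ?X ?\<tau>. \<forall>y\<in>?X. norm (\<phi> y) \<le> norm y}. norm (\<phi> x))"
    if "x \<in> ?X" for x by (rule norm_le_SUP_dual[OF that])
qed

section \<open>Calculus of primitives\<close>

lemma constant_if_increments_small: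
  fixes D :: "real \<Rightarrow> 'b::real_normed_vector"
  assumes "\<And>x e. x \<in> {0..1} \<Longrightarrow> e > 0 \<Longrightarrow>
    \<exists>d>0. \<forall>y\<in>{0..1}. \<bar>y - x\<bar> < d \<longrightarrow> norm (D y - D x) \<le> e * \<bar>y - x\<bar>"
    and "x \<in> {0..1}"
  shows "D x = D 0"
proof -
  have "(D has_derivative (\<lambda>h. 0)) (at x within {0..1})" if x: "x \<in> {0..1}" for x
    unfolding has_derivative_iff_norm
  proof (intro conjI bounded_linear_zero)
    show "((\<lambda>y. norm (D y - D x - 0) / norm (y - x)) \<longlongrightarrow> 0) (at x within {0..1})"
    proof (rule tendstoI)
      fix e :: real assume e: "e > 0"
      then obtain d where d: "d > 0"
        "\<And>y. y \<in> {0..1} \<Longrightarrow> \<bar>y - x\<bar> < d \<Longrightarrow> norm (D y - D x) \<le> e / 2 * \<bar>y - x\<bar>"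
        using assms(1)[OF x, of "e / 2"] by auto
      show "\<forall>\<^sub>F y in at x within {0..1}. dist (norm (D y - D x - 0) / norm (y - x)) 0 < e"
        unfolding eventually_at
      proof (intro exI[of _ d] conjI ballI impI)
        fix y assume y: "y \<in> {0..1}" "y \<noteq> x \<and> dist y x < d"
        then have "norm (D y - D x) / \<bar>y - x\<bar> \<le> e / 2"
          using d(2)[of y] by (simp add: divide_le_eq dist_real_def)
        then have "norm (D y - D x) / \<bar>y - x\<bar> < e" using e by linarith
        then show "dist (norm (D y - D x - 0) / norm (y - x)) 0 < e" by simp
      qed (rule d)
    qed
  qed
  then have "\<exists>c. \<forall>x\<in>{0..1}. D x = c"
    by (intro has_derivative_zero_constant) auto
  then show ?thesis using assms(2) by (metis atLeastAtMost_iff order_refl zero_le_one)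
qed

lemma constant_if_increments_quadratic:
  fixes D :: "real \<Rightarrow> 'b::real_normed_vector"
  assumes "\<And>x y. x \<in> {0..1} \<Longrightarrow> y \<in> {0..1} \<Longrightarrow> x \<le> y \<Longrightarrow> norm (D y - D x) \<le> C * (y - x)\<^sup>2"
    and "x \<in> {0..1}"
  shows "D x = D 0"
proof (rule constant_if_increments_small[OF _ assms(2)])
  fix x e :: real assume x: "x \<in> {0..1}" and e: "e > 0"
  define d where "d = e / (\<bar>C\<bar> + 1)"
  have "d > 0" using e by (simp add: d_def)
  moreover have "norm (D y - D x) \<le> e * \<bar>y - x\<bar>" if y: "y \<in> {0..1}" "\<bar>y - x\<bar> < d" for y
  proof -
    have "norm (D y - D x) \<le> C * (y - x)\<^sup>2"
      using assms(1)[OF x y(1)] assms(1)[OF y(1) x]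
      by (cases "x \<le> y") (auto simp: norm_minus_commute power2_commute)
    also have "\<dots> \<le> (\<bar>C\<bar> + 1) * (y - x)\<^sup>2" by (rule mult_right_mono) auto
    also have "\<dots> = (\<bar>C\<bar> + 1) * \<bar>y - x\<bar> * \<bar>y - x\<bar>" by (simp add: power2_eq_square mult.assoc flip: abs_mult)
    also have "\<dots> \<le> e * \<bar>y - x\<bar>"
    proof (rule mult_right_mono)
      show "(\<bar>C\<bar> + 1) * \<bar>y - x\<bar> \<le> e" using y(2) pos_less_divide_eq[of "\<bar>C\<bar> + 1" "\<bar>y - x\<bar>" e] by (simp add: d_def mult.commute)
    qed simp
    finally show ?thesis .
  qed
  ultimately show "\<exists>d>0. \<forall>y\<in>{0..1}. \<bar>y - x\<bar> < d \<longrightarrow> norm (D y - D x) \<le> e * \<bar>y - x\<bar>" by blast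
qed

lemma primitive_eq_integral:
  fixes u :: "real \<Rightarrow> 'b::euclidean_space"
  assumes "integrable unit_interval_measure u" "x \<in> {0..1}"
  shows "primitive u x = integral {0..x} u"
proof -
  have i: "integrable unit_interval_measure (\<lambda>s. indicator {..x} s *\<^sub>R u s)"
    by (rule integrable_indicator_unit_interval[OF assms(1)]) simp
  have "primitive u x = integral {0..1} (\<lambda>s. indicator {..x} s *\<^sub>R u s)"
    unfolding primitive_def by (rule lebesgue_integral_eq_integral[OF i]) simp
  also have "\<dots> = integral {0..1} (\<lambda>s. if s \<in> {0..x} then u s else 0)"
    by (rule Henstock_Kurzweil_Integration.integral_cong) (auto simp: indicator_def)
  also have "\<dots> = integral {0..x} u"
    using assms(2)
    by (subst Henstock_Kurzweil_Integration.integral_restrict_Int) (simp add: Int_absorb2)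
  finally show ?thesis .
qed

lemma integrable_unit_interval_continuous:
  fixes u :: "real \<Rightarrow> 'b::euclidean_space"
  assumes "continuous_on {0..1} u"
  shows "integrable unit_interval_measure u" "u \<in> borel_measurable unit_interval_measure"
    "\<exists>K. \<forall>s\<in>{0..1}. norm (u s) \<le> K"
proof -
  show m: "u \<in> borel_measurable unit_interval_measure"
    by (rule continuous_imp_measurable_on_sets_lebesgue[OF assms]) simp
  have "compact (u ` {0..1})" by (rule compact_continuous_image[OF assms]) simp
  then show K: "\<exists>K. \<forall>s\<in>{0..1}. norm (u s) \<le> K"
    using compact_imp_bounded bounded_iff by (metis image_eqI)
  then obtain K where "\<forall>s\<in>{0..1}. norm (u s) \<le> K" by blast
  then show "integrable unit_interval_measure u"
    by (intro integrable_unit_interval_bounded[OF m, of K] AE_I2) simp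
qed

lemma primitive_of_derivative:
  fixes U :: "real \<Rightarrow> 'b::euclidean_space"
  assumes "\<And>x. x \<in> {0..1} \<Longrightarrow> (U has_vector_derivative u x) (at x within {0..1})"
    and "continuous_on {0..1} u" "x \<in> {0..1}"
  shows "primitive u x = U x - U 0"
proof -
  have "(u has_integral U x - U 0) {0..x}"
  proof (rule fundamental_theorem_of_calculus)
    show "(U has_vector_derivative u s) (at s within {0..x})" if "s \<in> {0..x}" for s
      by (rule has_vector_derivative_within_subset[OF assms(1)]) (use that assms(3) in auto)
  qed (use assms(3) in simp)
  then show ?thesis
    using primitive_eq_integral[OF integrable_unit_interval_continuous(1)[OF assms(2)] assms(3)]
    by (simp add: integral_unique)
qed

lemma primitive_has_vector_derivative:
  fixes u :: "real \<Rightarrow> 'b::euclidean_space"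
  assumes "continuous_on {0..1} u" "x \<in> {0..1}"
  shows "(primitive u has_vector_derivative u x) (at x within {0..1})"
proof -
  have "((\<lambda>x. integral {0..x} u) has_vector_derivative u x) (at x within {0..1})"
    by (rule integral_has_vector_derivative[OF assms])
  then show ?thesis
    by (rule has_vector_derivative_transform[OF assms(2), rotated])
      (rule primitive_eq_integral[OF integrable_unit_interval_continuous(1)[OF assms(1)]])
qed

lemma continuous_on_primitive:
  fixes u :: "real \<Rightarrow> 'b::{banach, second_countable_topology}"
  assumes "u \<in> borel_measurable unit_interval_measure" "AE s in unit_interval_measure. norm (u s) \<le> K"
  shows "continuous_on {0..1} (primitive u)"
proof (rule continuous_on_iff[THEN iffD2], intro ballI allI impI)
  fix x e :: real assume x: "x \<in> {0..1}" and e: "0 < e"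
  have "dist (primitive u y) (primitive u x) < e" if "y \<in> {0..1}" "dist y x < e / (\<bar>K\<bar> + 1)" for y
  proof -
    have "dist (primitive u y) (primitive u x) \<le> K * \<bar>y - x\<bar>"
      using norm_primitive_increment_le[OF assms x that(1)] by (simp add: dist_norm)
    also have "\<dots> \<le> (\<bar>K\<bar> + 1) * \<bar>y - x\<bar>" by (rule mult_right_mono) auto
    also have "\<dots> < e" using that(2) by (simp add: dist_real_def less_divide_eq mult.commute)
    finally show ?thesis .
  qed
  moreover have "e / (\<bar>K\<bar> + 1) > 0" using e by simp
  ultimately show "\<exists>d>0. \<forall>x'\<in>{0..1}. dist x' x < d \<longrightarrow> dist (primitive u x') (primitive u x) < e" by blast
qed

lemma norm_primitive_increment_le_local:
  fixes u :: "real \<Rightarrow> 'b::{banach, second_countable_topology}"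
  assumes "integrable unit_interval_measure u" "AE s in unit_interval_measure. s \<in> {x<..y} \<longrightarrow> norm (u s) \<le> K"
    and "x \<in> {0..1}" "y \<in> {0..1}" "x \<le> y"
  shows "norm (primitive u y - primitive u x) \<le> K * (y - x)"
proof -
  have "norm (primitive u y - primitive u x) \<le> (LINT s|unit_interval_measure. K * indicator {x<..y} s)"
    unfolding primitive_increment[OF assms(1,5)]
  proof (rule norm_integral_le_AE)
    show "integrable unit_interval_measure (\<lambda>s. indicator {x<..y} s *\<^sub>R u s)"
      by (rule integrable_indicator_unit_interval[OF assms(1)]) simp
    show "integrable unit_interval_measure (\<lambda>s. K * indicator {x<..y} s)"
      using integrable_indicator_unit_interval[of "\<lambda>_. K" "{x<..y}"] by (simp add: mult.commute)
    show "AE s in unit_interval_measure. norm (indicator {x<..y} s *\<^sub>R u s) \<le> K * indicator {x<..y} s"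
      using assms(2) by eventually_elim (auto simp: indicator_def)
  qed
  then show ?thesis using LINT_indicator_Ioc[OF assms(3-5)] by simp
qed

lemma AE_norm_le_imp_nonneg: "AE s in unit_interval_measure. norm (u s) \<le> K \<Longrightarrow> 0 \<le> K"
proof -
  assume "AE s in unit_interval_measure. norm (u s) \<le> K"
  then have "AE s in unit_interval_measure. 0 \<le> K"
    by eventually_elim (rule order_trans[OF norm_ge_zero])
  then show ?thesis by simp
qed

text \<open>
  Integration by parts.  The defect of the product formula has increments of second order, so it is
  constant.
\<close>

lemma primitive_mult_primitive:
  fixes u v :: "real \<Rightarrow> 'k::{real_normed_field, euclidean_space}"
  assumes u: "u \<in> borel_measurable unit_interval_measure" "AE s in unit_interval_measure. norm (u s) \<le> K"
    and v: "v \<in> borel_measurable unit_interval_measure" "AE s in unit_interval_measure. norm (v s) \<le> L"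
    and x: "x \<in> {0..1}"
  shows "primitive (\<lambda>s. u s * primitive v s + primitive u s * v s) x = primitive u x * primitive v x"
    and "integrable unit_interval_measure (\<lambda>s. u s * primitive v s)"
    and "integrable unit_interval_measure (\<lambda>s. primitive u s * v s)"
proof -
  let ?U = "primitive u" and ?V = "primitive v"
  have iu: "integrable unit_interval_measure u" and iv: "integrable unit_interval_measure v"
    using integrable_unit_interval_bounded u v by blast+
  have cU: "continuous_on {0..1} ?U" and cV: "continuous_on {0..1} ?V"
    using continuous_on_primitive u v by blast+
  note iU = integrable_unit_interval_continuous[OF cU] and iV = integrable_unit_interval_continuous[OF cV]
  obtain K' where K': "\<And>s. s \<in> {0..1} \<Longrightarrow> norm (?V s) \<le> K'" using iV(3) by blast
  show i1: "integrable unit_interval_measure (\<lambda>s. u s * ?V s)"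
    by (rule integrable_mult_ess_bounded[OF iV(2) _ iu, of K']) (rule AE_I2, simp add: K')
  show i2: "integrable unit_interval_measure (\<lambda>s. ?U s * v s)"
    by (rule integrable_mult_ess_bounded[OF v iU(1)])
  have KL: "0 \<le> K" "0 \<le> L" using AE_norm_le_imp_nonneg u(2) v(2) by blast+
  define D where "D x = ?U x * ?V x - primitive (\<lambda>s. u s * ?V s + ?U s * v s) x" for x
  have "D x = D 0"
  proof (rule constant_if_increments_quadratic[OF _ x])
    fix x y :: real assume xy: "x \<in> {0..1}" "y \<in> {0..1}" "x \<le> y"
    let ?w = "\<lambda>s. (u s * ?V x + ?U y * v s) - (u s * ?V s + ?U s * v s)"
    have iw: "integrable unit_interval_measure ?w"
      using iu iv i1 i2 by (intro Bochner_Integration.integrable_diff Bochner_Integration.integrable_add) auto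
    have "primitive ?w z = ?U z * ?V x + ?U y * ?V z - primitive (\<lambda>s. u s * ?V s + ?U s * v s) z" for z
      using iu iv i1 i2
      by (simp add: primitive_diff primitive_add primitive_linear[OF bounded_linear_mult_left iu]
          primitive_linear[OF bounded_linear_mult_right iv])
    then have "D y - D x = primitive ?w y - primitive ?w x"
      by (simp add: D_def algebra_simps)
    also have "norm \<dots> \<le> (2 * K * L * (y - x)) * (y - x)"
    proof (rule norm_primitive_increment_le_local[OF iw _ xy])
      show "AE s in unit_interval_measure. s \<in> {x<..y} \<longrightarrow> norm (?w s) \<le> 2 * K * L * (y - x)"
        using u(2) v(2)
      proof eventually_elim
        case (elim s)
        show ?case
        proof
          assume s: "s \<in> {x<..y}"
          then have s01: "s \<in> {0..1}" using xy by auto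
          have "norm (?V x - ?V s) \<le> L * \<bar>x - s\<bar>" by (rule norm_primitive_increment_le[OF v s01 xy(1)])
          also have "\<dots> \<le> L * (y - x)" using s KL by (intro mult_left_mono) auto
          finally have 1: "norm (u s * (?V x - ?V s)) \<le> K * (L * (y - x))"
            unfolding norm_mult by (rule mult_mono[OF elim(1) _ KL(1)]) simp
          have "norm (?U y - ?U s) \<le> K * \<bar>y - s\<bar>" by (rule norm_primitive_increment_le[OF u s01 xy(2)])
          also have "\<dots> \<le> K * (y - x)" using s KL by (intro mult_left_mono) auto
          finally have 2: "norm ((?U y - ?U s) * v s) \<le> (K * (y - x)) * L"
            unfolding norm_mult by (rule mult_mono[OF _ elim(2)]) (use KL xy in auto)
          have "?w s = u s * (?V x - ?V s) + (?U y - ?U s) * v s" by (simp add: algebra_simps)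
          also have "norm \<dots> \<le> K * (L * (y - x)) + (K * (y - x)) * L"
            by (rule order_trans[OF norm_triangle_ineq add_mono[OF 1 2]])
          finally show "norm (?w s) \<le> 2 * K * L * (y - x)" by (simp add: algebra_simps)
        qed
      qed
    qed
    finally show "norm (D y - D x) \<le> (2 * K * L) * (y - x)\<^sup>2" by (simp add: power2_eq_square mult.assoc)
  qed
  then show "primitive (\<lambda>s. u s * ?V s + ?U s * v s) x = ?U x * ?V x"
    by (simp add: D_def primitive_eq_0)
qed

text \<open>
  The chain rule for \<open>exp\<close>.  The defect of the formula has increments of order \<open>o(y - x)\<close> at every point \<open>x\<close>,
  so it is constant.
\<close>

lemma primitive_exp:
  fixes q :: "real \<Rightarrow> 'k::{real_normed_field, euclidean_space}"
  assumes q: "q \<in> borel_measurable unit_interval_measure" "AE s in unit_interval_measure. norm (q s) \<le> K"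
    and x: "x \<in> {0..1}"
  shows "primitive (\<lambda>s. q s * exp (primitive q s)) x = exp (primitive q x) - 1"
proof -
  let ?E = "\<lambda>s. exp (primitive q s)"
  have iq: "integrable unit_interval_measure q" by (rule integrable_unit_interval_bounded[OF q])
  have cE: "continuous_on {0..1} ?E"
    by (intro continuous_on_exp continuous_on_primitive[OF q])
  note iE = integrable_unit_interval_continuous[OF cE]
  obtain M where M: "\<And>s. s \<in> {0..1} \<Longrightarrow> norm (?E s) \<le> M" using iE(3) by blast
  have M0: "0 \<le> M" by (rule order_trans[OF norm_ge_zero M[of 0]]) simp
  have iqE: "integrable unit_interval_measure (\<lambda>s. q s * ?E s)"
    by (rule integrable_mult_ess_bounded[OF iE(2) _ iq, of M]) (rule AE_I2, simp add: M)
  have K0: "0 \<le> K" by (rule AE_norm_le_imp_nonneg[OF q(2)])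
  define A where "A = M + 1"
  define B where "B = K + 1"
  have AB: "0 < A" "M \<le> A" "0 < B" "K \<le> B" using M0 K0 by (auto simp: A_def B_def)
  define D where "D x = ?E x - primitive (\<lambda>s. q s * ?E s) x" for x
  have "D x = D 0"
  proof (rule constant_if_increments_small[OF _ x])
    fix x e :: real assume x: "x \<in> {0..1}" and e: "e > 0"
    define e1 where "e1 = e / (2 * A * B)"
    define e2 where "e2 = e / (2 * B)"
    have e1: "e1 > 0" and e2: "e2 > 0" using e AB by (auto simp: e1_def e2_def)
    have "(exp has_derivative (\<lambda>h. h)) (at (0::'k))"
    proof -
      have "(*) (1 :: 'k) = (\<lambda>h. h)" by (rule ext) simp
      then show ?thesis using DERIV_exp[of "0::'k"] by (simp only: has_field_derivative_def exp_zero)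
    qed
    then obtain d1 where d1: "d1 > 0" "\<And>z::'k. norm z < d1 \<Longrightarrow> norm (exp z - 1 - z) \<le> e1 * norm z"
      using e1 unfolding has_derivative_at_alt by force
    obtain d2 where d2: "d2 > 0" "\<And>s. s \<in> {0..1} \<Longrightarrow> \<bar>s - x\<bar> < d2 \<Longrightarrow> norm (?E s - ?E x) \<le> e2"
      using cE x e2 unfolding continuous_on_iff dist_norm by (force simp: less_imp_le)
    define d where "d = min (d1 / B) d2"
    have "d > 0" using d1 d2 AB by (simp add: d_def)
    moreover have "norm (D y - D x) \<le> e * \<bar>y - x\<bar>" if y: "y \<in> {0..1}" "\<bar>y - x\<bar> < d" for y
    proof -
      let ?\<Delta> = "primitive q y - primitive q x"
      have \<Delta>: "norm ?\<Delta> \<le> K * \<bar>y - x\<bar>" by (rule norm_primitive_increment_le[OF q x y(1)])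
      also have "\<dots> \<le> B * \<bar>y - x\<bar>" using AB by (intro mult_right_mono) auto
      also have "\<dots> < d1" using y(2) AB by (simp add: d_def less_divide_eq mult.commute)
      finally have "norm (exp ?\<Delta> - 1 - ?\<Delta>) \<le> e1 * norm ?\<Delta>" by (rule d1(2))
      also have "\<dots> \<le> e1 * (K * \<bar>y - x\<bar>)" using \<Delta> e1 by (intro mult_left_mono) auto
      finally have "norm (?E x) * norm (exp ?\<Delta> - 1 - ?\<Delta>) \<le> M * (e1 * (K * \<bar>y - x\<bar>))"
        using M[OF x] M0 by (intro mult_mono) auto
      also have "\<dots> \<le> A * (e1 * (B * \<bar>y - x\<bar>))"
        using M0 K0 e1 AB by (intro mult_mono) auto
      also have "\<dots> = e / 2 * \<bar>y - x\<bar>" using AB by (simp add: e1_def field_simps)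
      finally have 1: "norm (?E x * (exp ?\<Delta> - 1 - ?\<Delta>)) \<le> e / 2 * \<bar>y - x\<bar>" by (simp add: norm_mult)
      let ?w = "\<lambda>s. q s * ?E s - q s * ?E x"
      have iw: "integrable unit_interval_measure ?w" using iqE iq by auto
      have pw: "primitive ?w z = primitive (\<lambda>s. q s * ?E s) z - primitive q z * ?E x" for z
        by (simp add: primitive_diff[OF iqE] iq primitive_linear[OF bounded_linear_mult_left iq])
      have 2: "norm (primitive ?w y - primitive ?w x) \<le> (K * e2) * \<bar>y - x\<bar>"
      proof -
        have *: "norm (primitive ?w b - primitive ?w a) \<le> (K * e2) * (b - a)"
          if ab: "a \<in> {0..1}" "b \<in> {0..1}" "a \<le> b" and near: "\<And>s. s \<in> {a<..b} \<Longrightarrow> \<bar>s - x\<bar> < d2" for a b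
        proof (rule norm_primitive_increment_le_local[OF iw _ ab])
          show "AE s in unit_interval_measure. s \<in> {a<..b} \<longrightarrow> norm (?w s) \<le> K * e2"
            using q(2)
          proof eventually_elim
            case (elim s)
            show ?case
            proof
              assume s: "s \<in> {a<..b}"
              have "norm (?w s) = norm (q s) * norm (?E s - ?E x)"
                by (simp flip: norm_mult right_diff_distrib)
              also have "\<dots> \<le> K * e2" using elim d2(2)[of s] near[OF s] s ab K0 by (intro mult_mono) auto
              finally show "norm (?w s) \<le> K * e2" .
            qed
          qed
        qed
        have d2': "\<bar>y - x\<bar> < d2" using y(2) by (simp add: d_def)
        show ?thesis
        proof (cases "x \<le> y")
          case True
          then show ?thesis using *[OF x y(1)] d2' by auto
        next
          case False
          have "norm (primitive ?w x - primitive ?w y) \<le> (K * e2) * (x - y)"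
            by (rule *[OF y(1) x]) (use False d2' in auto)
          then show ?thesis using False by (simp add: norm_minus_commute)
        qed
      qed
      have "K * e2 \<le> B * e2" using e2 AB by (intro mult_right_mono) auto
      also have "\<dots> = e / 2" using AB by (simp add: e2_def)
      finally have "(K * e2) * \<bar>y - x\<bar> \<le> e / 2 * \<bar>y - x\<bar>" by (rule mult_right_mono) simp
      with 2 have 3: "norm (primitive ?w y - primitive ?w x) \<le> e / 2 * \<bar>y - x\<bar>" by linarith
      have "?E y = ?E x * exp ?\<Delta>" by (simp flip: exp_add)
      then have eq: "D y - D x = ?E x * (exp ?\<Delta> - 1 - ?\<Delta>) - (primitive ?w y - primitive ?w x)"
        unfolding D_def pw by (simp add: algebra_simps)
      have "norm (D y - D x) \<le> norm (?E x * (exp ?\<Delta> - 1 - ?\<Delta>)) + norm (primitive ?w y - primitive ?w x)"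
        unfolding eq by (rule norm_triangle_ineq4)
      then have "norm (D y - D x) \<le> e / 2 * \<bar>y - x\<bar> + e / 2 * \<bar>y - x\<bar>"
        using 1 3 by linarith
      then show ?thesis by simp
    qed
    ultimately show "\<exists>d>0. \<forall>y\<in>{0..1}. \<bar>y - x\<bar> < d \<longrightarrow> norm (D y - D x) \<le> e * \<bar>y - x\<bar>" by blast
  qed
  then show "primitive (\<lambda>s. q s * ?E s) x = ?E x - 1"
    by (simp add: D_def primitive_eq_0 algebra_simps)
qed

section \<open>Smooth functions with compact support and weak derivatives\<close>

text \<open>
  The functions \<open>p(x) / d(x)^k * exp (- e / d(x))\<close> on \<open>{a<..<b}\<close> with \<open>d(x) = (x - a) * (b - x)\<close>, and \<open>0\<close>
  elsewhere.  They are closed under differentiation, so that they are smooth.  For \<open>p = 1\<close> and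
  \<open>k = 0\<close> they tend to the indicator function of the open interval as \<open>e\<close> tends to \<open>0\<close>.
\<close>

definition bump_fun :: "real \<Rightarrow> real \<Rightarrow> real \<Rightarrow> real poly \<Rightarrow> nat \<Rightarrow> real \<Rightarrow> real" where
  "bump_fun a b e p k x = (if a < x \<and> x < b
     then poly p x * inverse ((x - a) * (b - x)) ^ k * exp (- e * inverse ((x - a) * (b - x))) else 0)"

text \<open>
  The polynomial factor of the derivative of \<open>bump_fun a b e p k\<close>, written with the denominator
  \<open>d = (x - a) * (b - x)\<close> to the power \<open>k + 2\<close>.
\<close>

definition bump_deriv_poly :: "real \<Rightarrow> real \<Rightarrow> real \<Rightarrow> real poly \<Rightarrow> nat \<Rightarrow> real poly" where
  "bump_deriv_poly a b e p k = (let d = [:- a * b, a + b, - 1:] in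
     pderiv p * d ^ 2 - smult (real k) (p * pderiv d * d) + smult e (p * pderiv d))"

lemma power_le_fact_exp: "0 \<le> y \<Longrightarrow> y ^ n \<le> fact n * exp y" for y :: real
proof -
  assume y: "0 \<le> y"
  have "(\<Sum>k\<in>{n}. y ^ k /\<^sub>R fact k) \<le> (\<Sum>k. y ^ k /\<^sub>R fact k)"
    using y by (intro sum_le_suminf summable_exp_generic) auto
  then have "y ^ n / fact n \<le> exp y" by (simp add: exp_def divide_inverse mult.commute)
  then show ?thesis by (simp add: divide_le_eq mult.commute)
qed

lemma bump_fun_quadratic_bound:
  assumes "a < b" "e > 0"
  obtains C where "\<And>x. \<bar>bump_fun a b e p k x\<bar> \<le> C * (x - a)\<^sup>2" "\<And>x. \<bar>bump_fun a b e p k x\<bar> \<le> C * (x - b)\<^sup>2"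
proof -
  have "compact (poly p ` {a..b})" by (intro compact_continuous_image continuous_intros) auto
  then obtain M where M: "\<And>x. x \<in> {a..b} \<Longrightarrow> \<bar>poly p x\<bar> \<le> M"
    using compact_imp_bounded bounded_iff by (metis image_eqI real_norm_def)
  have M0: "0 \<le> M" using M[of a] assms by force
  define C0 where "C0 = fact (k + 2) / e ^ (k + 2)"
  have C0: "0 \<le> C0" using assms by (simp add: C0_def)
  have key: "\<bar>bump_fun a b e p k x\<bar> \<le> M * C0 * ((x - a) * (b - x))\<^sup>2" for x
  proof (cases "a < x \<and> x < b")
    case True
    define D where "D = (x - a) * (b - x)"
    have D: "D > 0" using True by (simp add: D_def)
    have "(e * inverse D) ^ (k + 2) \<le> fact (k + 2) * exp (e * inverse D)"
      using assms D by (intro power_le_fact_exp) auto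
    then have "(e * inverse D) ^ (k + 2) * exp (- e * inverse D)
        \<le> (fact (k + 2) * exp (e * inverse D)) * exp (- e * inverse D)"
      by (rule mult_right_mono) simp
    also have "\<dots> = fact (k + 2)" by (simp add: mult.assoc flip: exp_add)
    finally have "(e * inverse D) ^ (k + 2) * exp (- e * inverse D) \<le> fact (k + 2)" .
    then have "(inverse D) ^ (k + 2) * exp (- e * inverse D) \<le> C0"
      using assms by (simp add: C0_def le_divide_eq power_mult_distrib algebra_simps)
    then have *: "D\<^sup>2 * ((inverse D) ^ (k + 2) * exp (- e * inverse D)) \<le> D\<^sup>2 * C0"
      by (rule mult_left_mono) simp
    have "inverse D ^ k * exp (- e * inverse D) = (D * inverse D)\<^sup>2 * (inverse D ^ k * exp (- e * inverse D))"
      using D by simp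
    also have "\<dots> = D\<^sup>2 * ((inverse D) ^ (k + 2) * exp (- e * inverse D))"
      by (simp only: power_add power_mult_distrib mult_ac)
    finally have le: "inverse D ^ k * exp (- e * inverse D) \<le> C0 * D\<^sup>2"
      using * by (simp only: mult.commute)
    have "\<bar>bump_fun a b e p k x\<bar> = \<bar>poly p x\<bar> * (inverse D ^ k * exp (- e * inverse D))"
      using True D by (simp add: bump_fun_def D_def[symmetric] abs_mult)
    also have "\<dots> \<le> M * (C0 * D\<^sup>2)"
      by (rule mult_mono[OF M le]) (use True D M0 in auto)
    finally show ?thesis by (simp add: D_def mult.assoc)
  next
    case False
    then show ?thesis using M0 C0 by (auto simp: bump_fun_def)
  qed
  define C where "C = M * C0 * (b - a)\<^sup>2"
  have "\<bar>bump_fun a b e p k x\<bar> \<le> C * (x - a)\<^sup>2 \<and> \<bar>bump_fun a b e p k x\<bar> \<le> C * (x - b)\<^sup>2" for x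
  proof (cases "a < x \<and> x < b")
    case True
    have "(b - x)\<^sup>2 \<le> (b - a)\<^sup>2" "(x - a)\<^sup>2 \<le> (b - a)\<^sup>2" using True by (auto intro: power_mono)
    then have "M * C0 * ((x - a)\<^sup>2 * (b - x)\<^sup>2) \<le> M * C0 * ((x - a)\<^sup>2 * (b - a)\<^sup>2)"
      "M * C0 * ((x - a)\<^sup>2 * (b - x)\<^sup>2) \<le> M * C0 * ((b - a)\<^sup>2 * (b - x)\<^sup>2)"
      using M0 C0 by (auto intro!: mult_left_mono mult_right_mono)
    moreover have "\<bar>bump_fun a b e p k x\<bar> \<le> M * C0 * ((x - a)\<^sup>2 * (b - x)\<^sup>2)"
      using key[of x] by (simp only: power_mult_distrib)
    moreover have "C * (x - a)\<^sup>2 = M * C0 * ((x - a)\<^sup>2 * (b - a)\<^sup>2)"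
      by (simp only: C_def mult_ac)
    moreover have "C * (x - b)\<^sup>2 = M * C0 * ((b - a)\<^sup>2 * (b - x)\<^sup>2)"
      by (simp only: C_def mult_ac power2_commute[of x b])
    ultimately show ?thesis by linarith
  next
    case False
    then show ?thesis using M0 C0 by (auto simp: bump_fun_def C_def)
  qed
  then show ?thesis using that by blast
qed

lemma DERIV_zero_if_quadratic:
  fixes F :: "real \<Rightarrow> real"
  assumes "\<And>x. \<bar>F x\<bar> \<le> C * (x - a)\<^sup>2"
  shows "(F has_real_derivative 0) (at a)"
proof -
  have Fa: "F a = 0" using assms[of a] by simp
  have "((\<lambda>x. C * \<bar>x - a\<bar>) \<longlongrightarrow> C * \<bar>a - a\<bar>) (at a)" by (intro tendsto_intros)
  then have lim: "((\<lambda>x. C * \<bar>x - a\<bar>) \<longlongrightarrow> 0) (at a)" by simp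
  have "((\<lambda>x. (F x - F a) / (x - a)) \<longlongrightarrow> 0) (at a)"
  proof (rule Lim_null_comparison[OF _ lim])
    show "\<forall>\<^sub>F x in at a. norm ((F x - F a) / (x - a)) \<le> C * \<bar>x - a\<bar>"
      unfolding eventually_at_filter
    proof (intro always_eventually allI impI)
      fix x assume "x \<noteq> a"
      then show "norm ((F x - F a) / (x - a)) \<le> C * \<bar>x - a\<bar>"
        using assms[of x] by (simp add: Fa divide_le_eq power2_eq_square mult.assoc flip: abs_mult)
    qed
  qed
  then show ?thesis by (simp add: has_field_derivative_iff)
qed

lemma DERIV_bump_fun:
  assumes ab: "a < b" "e > 0"
  shows "(bump_fun a b e p k has_real_derivative bump_fun a b e (bump_deriv_poly a b e p k) (k + 2) x) (at x)"
proof -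
  consider "a < x \<and> x < b" | "x = a" | "x = b" | "x < a" | "b < x" by linarith
  then show ?thesis
  proof cases
    case 1
    define D where "D = (\<lambda>x. (x - a) * (b - x))"
    define R where "R = (\<lambda>x. inverse (D x))"
    define D' where "D' = a + b - 2 * x"
    have D: "D x > 0" using 1 by (simp add: D_def)
    have dD: "(D has_real_derivative D') (at x)"
      unfolding D_def D'_def by (auto intro!: derivative_eq_intros simp: algebra_simps)
    have dR: "(R has_real_derivative - D' * (R x)\<^sup>2) (at x)"
      unfolding R_def using D
      by (auto intro!: derivative_eq_intros dD simp: power2_eq_square field_simps)
    let ?f = "\<lambda>x. poly p x * R x ^ k * exp (- e * R x)"
    have df: "(?f has_real_derivative
        poly (pderiv p) x * R x ^ k * exp (- e * R x)
        + poly p x * (real k * (R x ^ (k - 1) * (- D' * (R x)\<^sup>2))) * exp (- e * R x)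
        + poly p x * R x ^ k * (exp (- e * R x) * (- e * (- D' * (R x)\<^sup>2)))) (at x)"
      by (auto intro!: derivative_eq_intros dR poly_DERIV simp: algebra_simps)
    have RD: "R x * D x = 1" using D by (simp add: R_def)
    have k: "real k * (R x ^ (k - 1) * (R x)\<^sup>2) = real k * (R x ^ k * R x)"
      by (cases k) (auto simp: power2_eq_square algebra_simps)
    define d where "d = [:- a * b, a + b, - 1:]"
    have pd: "poly d x = D x" "poly (pderiv d) x = D'"
      by (simp_all add: d_def D_def D'_def pderiv_pCons algebra_simps)
    have bd: "bump_deriv_poly a b e p k = pderiv p * d ^ 2 - smult (real k) (p * pderiv d * d) + smult e (p * pderiv d)"
      by (simp only: bump_deriv_poly_def Let_def d_def)
    have "bump_fun a b e (bump_deriv_poly a b e p k) (k + 2) x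
        = (poly (pderiv p) x * (D x)\<^sup>2 - real k * (poly p x * D' * D x) + e * (poly p x * D')) * R x ^ (k + 2) * exp (- e * R x)"
      using 1 unfolding bump_fun_def bd by (simp add: pd) (simp add: R_def D_def)
    also have "\<dots> = poly (pderiv p) x * (R x ^ k * (R x * D x)\<^sup>2) * exp (- e * R x)
        - real k * (R x ^ k * R x) * (R x * D x) * poly p x * D' * exp (- e * R x)
        + poly p x * R x ^ k * (exp (- e * R x) * (e * (D' * (R x)\<^sup>2)))"
      by (simp add: power_add power2_eq_square algebra_simps)
    also have "\<dots> = poly (pderiv p) x * R x ^ k * exp (- e * R x)
        + poly p x * (real k * (R x ^ (k - 1) * (- D' * (R x)\<^sup>2))) * exp (- e * R x)
        + poly p x * R x ^ k * (exp (- e * R x) * (- e * (- D' * (R x)\<^sup>2)))"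
      unfolding RD k[symmetric] by (simp add: algebra_simps)
    finally have "(?f has_real_derivative bump_fun a b e (bump_deriv_poly a b e p k) (k + 2) x) (at x)"
      using df by simp
    then show ?thesis
      by (rule has_field_derivative_transform_within_open[where S = "{a<..<b}"])
        (use 1 in \<open>auto simp: bump_fun_def R_def D_def\<close>)
  next
    case 2
    obtain C where "\<And>x. \<bar>bump_fun a b e p k x\<bar> \<le> C * (x - a)\<^sup>2" using bump_fun_quadratic_bound[OF ab] by blast
    moreover have "bump_fun a b e (bump_deriv_poly a b e p k) (k + 2) x = 0" using 2 by (simp add: bump_fun_def)
    ultimately show ?thesis using DERIV_zero_if_quadratic 2 by metis
  next
    case 3
    obtain C where "\<And>x. \<bar>bump_fun a b e p k x\<bar> \<le> C * (x - b)\<^sup>2" using bump_fun_quadratic_bound[OF ab] by blast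
    moreover have "bump_fun a b e (bump_deriv_poly a b e p k) (k + 2) x = 0" using 3 by (simp add: bump_fun_def)
    ultimately show ?thesis using DERIV_zero_if_quadratic 3 by metis
  next
    case 4
    have "((\<lambda>_. 0) has_real_derivative 0) (at x)" by simp
    then have "(bump_fun a b e p k has_real_derivative 0) (at x)"
      by (rule has_field_derivative_transform_within_open[where S = "{..<a}"]) (use 4 in \<open>auto simp: bump_fun_def\<close>)
    then show ?thesis using 4 by (simp add: bump_fun_def)
  next
    case 5
    have "((\<lambda>_. 0) has_real_derivative 0) (at x)" by simp
    then have "(bump_fun a b e p k has_real_derivative 0) (at x)"
      by (rule has_field_derivative_transform_within_open[where S = "{b<..}"]) (use 5 in \<open>auto simp: bump_fun_def\<close>)
    then show ?thesis using 5 by (simp add: bump_fun_def)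
  qed
qed

lemma deriv_funpow_bump_fun:
  assumes "a < b" "e > 0"
  shows "\<exists>p' k'. (deriv ^^ n) (bump_fun a b e p k) = bump_fun a b e p' k'"
proof (induction n)
  case 0
  show ?case by auto
next
  case (Suc n)
  then obtain p' k' where "(deriv ^^ n) (bump_fun a b e p k) = bump_fun a b e p' k'" by blast
  moreover have "deriv (bump_fun a b e p' k') = bump_fun a b e (bump_deriv_poly a b e p' k') (k' + 2)"
    by (rule ext) (rule DERIV_imp_deriv[OF DERIV_bump_fun[OF assms]])
  ultimately show ?case by (intro exI) simp
qed

lemma bump_fun_differentiable:
  assumes "a < b" "e > 0"
  shows "(deriv ^^ n) (bump_fun a b e p k) field_differentiable (at x)"
proof -
  obtain p' k' where "(deriv ^^ n) (bump_fun a b e p k) = bump_fun a b e p' k'"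
    using deriv_funpow_bump_fun[OF assms] by blast
  then show ?thesis using DERIV_bump_fun[OF assms] field_differentiable_def by metis
qed

lemma continuous_on_bump_fun:
  assumes "a < b" "e > 0"
  shows "continuous_on A (bump_fun a b e p k)"
  using DERIV_isCont[OF DERIV_bump_fun[OF assms]] by (simp add: continuous_at_imp_continuous_on)

lemma deriv_funpow_linear:
  fixes F G :: "real \<Rightarrow> real"
  assumes "\<And>n x. (deriv ^^ n) F field_differentiable (at x)" "\<And>n x. (deriv ^^ n) G field_differentiable (at x)"
  shows "(deriv ^^ n) (\<lambda>x. \<alpha> * F x - \<beta> * G x) = (\<lambda>x. \<alpha> * (deriv ^^ n) F x - \<beta> * (deriv ^^ n) G x)"
proof (induction n)
  case (Suc n)
  have "deriv (\<lambda>x. \<alpha> * (deriv ^^ n) F x - \<beta> * (deriv ^^ n) G x) x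
      = \<alpha> * deriv ((deriv ^^ n) F) x - \<beta> * deriv ((deriv ^^ n) G) x" for x
    using assms[of n x]
    by (intro DERIV_imp_deriv DERIV_diff DERIV_cmult) (auto simp: field_differentiable_derivI)
  then show ?case by (simp add: Suc)
qed simp

text \<open>
  A combination of two such functions with integral zero is the derivative of a test function.
\<close>

lemma bump_difference_is_derivative:
  assumes ab: "0 < a" "a < b" "b < 1" "e > 0" and cd: "0 < c" "c < d" "d < 1" "e' > 0"
    and eq: "\<alpha> * primitive (bump_fun a b e 1 0) 1 = \<beta> * primitive (bump_fun c d e' 1 0) 1"
  obtains \<phi> where "\<phi> \<in> test_functions" "deriv \<phi> = (\<lambda>x. \<alpha> * bump_fun a b e 1 0 x - \<beta> * bump_fun c d e' 1 0 x)"
proof -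
  let ?F = "bump_fun a b e 1 0" and ?G = "bump_fun c d e' 1 0"
  define \<psi> where "\<psi> x = \<alpha> * ?F x - \<beta> * ?G x" for x
  have cF: "continuous_on A ?F" and cG: "continuous_on A ?G" for A
    using continuous_on_bump_fun ab cd by blast+
  have c\<psi>: "continuous_on A \<psi>" for A
    unfolding \<psi>_def using cF cG by (intro continuous_intros)
  then have "isCont \<psi> x" for x using continuous_on_eq_continuous_at[of UNIV \<psi>] by auto
  then obtain \<Phi> where \<Phi>: "\<And>x. (\<Phi> has_vector_derivative \<psi> x) (at x)"
    using einterval_antiderivative[of "-\<infinity>" "\<infinity>" \<psi>] by auto
  define \<phi> where "\<phi> x = \<Phi> x - \<Phi> 0" for x
  have \<phi>': "(\<phi> has_real_derivative \<psi> x) (at x)" for x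
    unfolding \<phi>_def has_real_derivative_iff_has_vector_derivative
    using has_vector_derivative_diff[OF \<Phi>[of x] has_vector_derivative_const[of "\<Phi> 0"]] by simp
  have d\<phi>: "deriv \<phi> = \<psi>" by (rule ext) (rule DERIV_imp_deriv[OF \<phi>'])
  have int: "integrable unit_interval_measure ?F" "integrable unit_interval_measure ?G"
    using integrable_unit_interval_continuous(1) cF cG by blast+
  have "primitive \<psi> 1 = \<alpha> * primitive ?F 1 - \<beta> * primitive ?G 1"
    unfolding \<psi>_def using int
    by (simp add: primitive_diff primitive_linear[OF bounded_linear_mult_right int(1)]
        primitive_linear[OF bounded_linear_mult_right int(2)])
  moreover have "primitive \<psi> 1 = \<Phi> 1 - \<Phi> 0"
    by (rule primitive_of_derivative[OF _ c\<psi>]) (use \<Phi> in \<open>auto intro: has_vector_derivative_at_within\<close>)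
  ultimately have \<phi>1: "\<phi> 1 = 0" using eq by (simp add: \<phi>_def)
  define m where "m = min a c"
  define M where "M = max b d"
  have \<psi>0: "\<psi> x = 0" if "x \<le> m \<or> M \<le> x" for x
    using that ab cd by (auto simp: \<psi>_def bump_fun_def m_def M_def)
  have \<phi>'0: "(\<phi> has_real_derivative 0) (at y within A)" if "y \<le> m \<or> M \<le> y" for y A
    using \<phi>'[of y] \<psi>0[OF that] by (auto intro: has_field_derivative_at_within)
  have zero: "\<phi> x = 0" if x: "x \<notin> {m..M}" for x
  proof (cases "x < m")
    case True
    have "\<exists>k. \<forall>y\<in>{..m}. \<phi> y = k"
      by (rule has_field_derivative_zero_constant)
        (use \<phi>'0 in auto)
    moreover have "0 \<in> {..m}" using ab cd by (simp add: m_def)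
    ultimately have "\<phi> x = \<phi> 0" using True by (metis atMost_iff less_imp_le)
    then show ?thesis by (simp add: \<phi>_def)
  next
    case False
    with x have "M < x" by auto
    have "\<exists>k. \<forall>y\<in>{M..}. \<phi> y = k"
      by (rule has_field_derivative_zero_constant)
        (use \<phi>'0 in auto)
    moreover have "1 \<in> {M..}" using ab cd by (simp add: M_def)
    ultimately have "\<phi> x = \<phi> 1" using \<open>M < x\<close> by (metis atLeast_iff less_imp_le)
    then show ?thesis by (simp add: \<phi>1)
  qed
  have "(deriv ^^ n) \<phi> field_differentiable (at x)" for n x
  proof (cases n)
    case 0
    then show ?thesis using \<phi>' field_differentiable_def by auto
  next
    case (Suc k)
    have "(deriv ^^ n) \<phi> = (deriv ^^ k) \<psi>" by (simp add: Suc funpow_Suc_right d\<phi> del: funpow.simps)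
    also have "\<dots> = (\<lambda>x. \<alpha> * (deriv ^^ k) ?F x - \<beta> * (deriv ^^ k) ?G x)"
      unfolding \<psi>_def
      by (rule deriv_funpow_linear) (use ab cd in \<open>auto intro: bump_fun_differentiable\<close>)
    finally have *: "(deriv ^^ n) \<phi> = (\<lambda>x. \<alpha> * (deriv ^^ k) ?F x - \<beta> * (deriv ^^ k) ?G x)" .
    show ?thesis
      unfolding * using ab cd
      by (intro field_differentiable_diff field_differentiable_mult field_differentiable_const bump_fun_differentiable)
  qed
  then have "\<phi> \<in> test_functions"
    unfolding test_functions_def differentiable_on_def
  proof (intro CollectI conjI allI ballI exI)
    show "0 < m" "M < 1" using ab cd by (simp_all add: m_def M_def)
  qed (use zero in \<open>auto intro: field_differentiable_imp_differentiable\<close>)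
  moreover have "deriv \<phi> = (\<lambda>x. \<alpha> * ?F x - \<beta> * ?G x)" by (simp add: d\<phi> \<psi>_def[abs_def])
  ultimately show ?thesis using that by blast
qed

lemma bump_fun_bounds: "0 \<le> bump_fun a b e 1 0 x" "e > 0 \<Longrightarrow> bump_fun a b e 1 0 x \<le> 1"
  by (auto simp: bump_fun_def)

lemma primitive_bump_fun_pos:
  assumes "0 < a" "a < b" "b < 1" "e > 0"
  shows "primitive (bump_fun a b e 1 0) 1 > 0"
proof -
  have c: "continuous_on {0..1} (bump_fun a b e 1 0)" by (rule continuous_on_bump_fun[OF assms(2,4)])
  have "primitive (bump_fun a b e 1 0) 1 = integral {0..1} (bump_fun a b e 1 0)"
    by (rule primitive_eq_integral[OF integrable_unit_interval_continuous(1)[OF c]]) simp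
  moreover have "integral {0..1} (bump_fun a b e 1 0) \<ge> 0"
    by (rule Henstock_Kurzweil_Integration.integral_nonneg[OF integrable_continuous_real[OF c]]) (simp add: bump_fun_bounds)
  moreover have "integral {0..1} (bump_fun a b e 1 0) \<noteq> 0"
  proof
    assume "integral {0..1} (bump_fun a b e 1 0) = 0"
    then have "(bump_fun a b e 1 0 has_integral 0) (cbox 0 1)"
      using integrable_integral[OF integrable_continuous_real[OF c]] by simp
    from has_integral_0_cbox_imp_0[OF _ _ this, of "(a + b) / 2"] c assms bump_fun_bounds(1)
    have "bump_fun a b e 1 0 ((a + b) / 2) = 0" by (auto simp: field_simps)
    then show False using assms by (simp add: bump_fun_def field_simps)
  qed
  ultimately show ?thesis by linarith
qed

lemma bump_fun_tendsto_indicator: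
  assumes "a < b"
  shows "(\<lambda>n. bump_fun a b (1 / Suc n) 1 0 x) \<longlonglongrightarrow> indicator {a<..<b} x"
proof (cases "a < x \<and> x < b")
  case True
  have "(\<lambda>n. exp (- (1 / real (Suc n)) * inverse ((x - a) * (b - x)))) \<longlonglongrightarrow> exp (- 0 * inverse ((x - a) * (b - x)))"
    by (intro tendsto_intros LIMSEQ_Suc[OF lim_1_over_n])
  then show ?thesis using True by (simp add: bump_fun_def)
qed (auto simp: bump_fun_def)

text \<open>
  As \<open>e\<close> tends to \<open>0\<close>, the bump functions give the integrals of \<open>v\<close> over all intervals inside \<open>(0,1)\<close>.
\<close>

lemma primitive_eq_0_if_bump_integrals_0:
  fixes v :: "real \<Rightarrow> 'k::{real_normed_field, euclidean_space}"
  assumes v: "v \<in> borel_measurable unit_interval_measure" "AE s in unit_interval_measure. norm (v s) \<le> K"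
    and zero: "\<And>a b e. 0 < a \<Longrightarrow> a < b \<Longrightarrow> b < 1 \<Longrightarrow> e > 0 \<Longrightarrow>
      (LINT s|unit_interval_measure. bump_fun a b e 1 0 s *\<^sub>R v s) = 0"
    and x: "x \<in> {0..1}"
  shows "primitive v x = 0"
proof -
  let ?V = "primitive v"
  have iv: "integrable unit_interval_measure v" by (rule integrable_unit_interval_bounded[OF v])
  have inner: "?V b = ?V a" if ab: "0 < a" "a < b" "b < 1" for a b
  proof -
    have meas: "(\<lambda>s. bump_fun a b e 1 0 s *\<^sub>R v s) \<in> borel_measurable unit_interval_measure" if "e > 0" for e
      using integrable_unit_interval_continuous(2)[OF continuous_on_bump_fun[OF ab(2) that]] v(1)
      by (intro borel_measurable_scaleR) auto
    have "(\<lambda>n. LINT s|unit_interval_measure. bump_fun a b (1 / Suc n) 1 0 s *\<^sub>R v s)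
        \<longlonglongrightarrow> (LINT s|unit_interval_measure. indicator {a<..<b} s *\<^sub>R v s)"
    proof (rule integral_dominated_convergence[where w = "\<lambda>s. norm (v s)"])
      show "(\<lambda>s. indicator {a<..<b} s *\<^sub>R v s) \<in> borel_measurable unit_interval_measure"
        using integrable_indicator_unit_interval[OF iv, of "{a<..<b}"] by auto
      show "(\<lambda>s. bump_fun a b (1 / Suc n) 1 0 s *\<^sub>R v s) \<in> borel_measurable unit_interval_measure" for n
        by (rule meas) simp
      show "integrable unit_interval_measure (\<lambda>s. norm (v s))" using iv by simp
      show "AE s in unit_interval_measure. (\<lambda>n. bump_fun a b (1 / Suc n) 1 0 s *\<^sub>R v s) \<longlonglongrightarrow> indicator {a<..<b} s *\<^sub>R v s"
        by (intro AE_I2 tendsto_scaleR bump_fun_tendsto_indicator ab tendsto_const)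
      show "AE s in unit_interval_measure. norm (bump_fun a b (1 / Suc n) 1 0 s *\<^sub>R v s) \<le> norm (v s)" for n
        by (intro AE_I2) (simp add: bump_fun_bounds mult_left_le_one_le)
    qed
    moreover have "(LINT s|unit_interval_measure. bump_fun a b (1 / Suc n) 1 0 s *\<^sub>R v s) = 0" for n
      by (rule zero[OF ab]) simp
    ultimately have "(LINT s|unit_interval_measure. indicator {a<..<b} s *\<^sub>R v s) = 0"
      by (simp add: LIMSEQ_const_iff)
    moreover have "(LINT s|unit_interval_measure. indicator {a<..<b} s *\<^sub>R v s)
        = (LINT s|unit_interval_measure. indicator {a<..b} s *\<^sub>R v s)"
    proof (rule integral_cong_AE)
      have "AE s in lebesgue. s \<notin> {b}" by (intro AE_not_in) auto
      then show "AE s in unit_interval_measure. indicator {a<..<b} s *\<^sub>R v s = indicator {a<..b} s *\<^sub>R v s"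
        unfolding AE_unit_interval_iff by eventually_elim (auto simp: indicator_def)
    qed (use integrable_indicator_unit_interval[OF iv] in auto)
    ultimately show ?thesis using primitive_increment[OF iv, of a b] ab by simp
  qed
  have cV: "continuous_on {0..1} ?V" by (rule continuous_on_primitive[OF v])
  have const: "?V y = ?V (1/2)" if "y \<in> {0<..<1}" for y
  proof -
    consider "y < 1/2" | "y = 1/2" | "1/2 < y" by linarith
    then show ?thesis
    proof cases
      case 1
      show ?thesis by (rule inner[symmetric]) (use 1 that in auto)
    next
      case 2
      show ?thesis unfolding 2 ..
    next
      case 3
      show ?thesis by (rule inner) (use 3 that in auto)
    qed
  qed
  have cl: "closure {0<..<1} = {0..1::real}" by (rule closure_greaterThanLessThan) simp
  have all: "?V y = ?V (1/2)" if "y \<in> {0..1}" for y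
  proof (rule continuous_constant_on_closure[of "{0<..<1}"])
    show "continuous_on (closure {0<..<1}) ?V" "y \<in> closure {0<..<1}"
      unfolding cl using cV that by blast+
  qed (rule const)
  have "?V x = ?V (1/2)" "?V 0 = ?V (1/2)" by (rule all, use x in simp)+
  then show ?thesis by (metis primitive_eq_0 order_refl)
qed

text \<open>
  The lemma of du Bois-Reymond: a function that is orthogonal to the derivatives of all test functions
  is constant almost everywhere.  Subtracting a multiple of a fixed bump function turns every bump
  function into such a derivative.
\<close>

lemma du_Bois_Reymond:
  fixes v :: "real \<Rightarrow> 'k::{real_normed_field, euclidean_space}"
  assumes v: "v \<in> borel_measurable unit_interval_measure" "AE s in unit_interval_measure. norm (v s) \<le> K"
    and zero: "\<And>\<phi>. \<phi> \<in> test_functions \<Longrightarrow> (LINT s|unit_interval_measure. deriv \<phi> s *\<^sub>R v s) = 0"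
  obtains m where "\<And>x. x \<in> {0..1} \<Longrightarrow> primitive v x = x *\<^sub>R m"
proof -
  let ?I = "\<lambda>F. LINT s|unit_interval_measure. F s *\<^sub>R v s"
  let ?G = "bump_fun (1/4) (3/4) 1 1 0"
  have G0: "primitive ?G 1 > 0" by (rule primitive_bump_fun_pos) auto
  define m where "m = (1 / primitive ?G 1) *\<^sub>R ?I ?G"
  have iv: "integrable unit_interval_measure v" by (rule integrable_unit_interval_bounded[OF v])
  have int: "integrable unit_interval_measure (\<lambda>s. bump_fun a b e 1 0 s *\<^sub>R v s)" if "a < b" "e > 0" for a b e
  proof (rule Bochner_Integration.integrable_bound[OF iv])
    show "(\<lambda>s. bump_fun a b e 1 0 s *\<^sub>R v s) \<in> borel_measurable unit_interval_measure"
      using integrable_unit_interval_continuous(2)[OF continuous_on_bump_fun[OF that]] v(1)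
      by (intro borel_measurable_scaleR) auto
    show "AE s in unit_interval_measure. norm (bump_fun a b e 1 0 s *\<^sub>R v s) \<le> norm (v s)"
      using that by (intro AE_I2) (simp add: bump_fun_bounds mult_left_le_one_le)
  qed
  have ibump: "integrable unit_interval_measure (bump_fun a b e 1 0)" if "a < b" "e > 0" for a b e
    by (rule integrable_unit_interval_continuous(1)[OF continuous_on_bump_fun[OF that]])
  have I: "?I (bump_fun a b e 1 0) = primitive (bump_fun a b e 1 0) 1 *\<^sub>R m"
    if ab: "0 < a" "a < b" "b < 1" "e > 0" for a b e
  proof -
    let ?F = "bump_fun a b e 1 0"
    obtain \<phi> where \<phi>: "\<phi> \<in> test_functions" "deriv \<phi> = (\<lambda>x. primitive ?G 1 * ?F x - primitive ?F 1 * ?G x)"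
      by (rule bump_difference_is_derivative[OF ab, of "1/4" "3/4" 1 "primitive ?G 1" "primitive ?F 1"]) auto
    have "0 = ?I (deriv \<phi>)" using zero[OF \<phi>(1)] by simp
    also have "\<dots> = (LINT s|unit_interval_measure. primitive ?G 1 *\<^sub>R (?F s *\<^sub>R v s) - primitive ?F 1 *\<^sub>R (?G s *\<^sub>R v s))"
      by (simp add: \<phi>(2) scaleR_diff_left)
    also have "\<dots> = primitive ?G 1 *\<^sub>R ?I ?F - primitive ?F 1 *\<^sub>R ?I ?G"
      using Bochner_Integration.integral_diff[OF integrable_scaleR_right[OF int[OF ab(2,4)], of "primitive ?G 1"]
          integrable_scaleR_right[OF int[of "1/4" "3/4" 1], of "primitive ?F 1"]]
      by (simp only: integral_scaleR_right)
    finally have "primitive ?G 1 *\<^sub>R ?I ?F = primitive ?F 1 *\<^sub>R ?I ?G" by simp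
    then have "(1 / primitive ?G 1) *\<^sub>R (primitive ?G 1 *\<^sub>R ?I ?F) = (1 / primitive ?G 1) *\<^sub>R (primitive ?F 1 *\<^sub>R ?I ?G)"
      by simp
    then show ?thesis using G0 by (simp add: m_def mult.commute)
  qed
  have "primitive (\<lambda>s. v s - m) x = 0" if x: "x \<in> {0..1}" for x
  proof (rule primitive_eq_0_if_bump_integrals_0[OF _ _ _ x])
    show "(\<lambda>s. v s - m) \<in> borel_measurable unit_interval_measure" using v(1) by auto
    show "AE s in unit_interval_measure. norm (v s - m) \<le> K + norm m"
      using v(2) by eventually_elim (rule order_trans[OF norm_triangle_ineq4], simp)
    fix a b e :: real assume ab: "0 < a" "a < b" "b < 1" "e > 0"
    let ?F = "bump_fun a b e 1 0"
    have "?I ?F - (LINT s|unit_interval_measure. ?F s *\<^sub>R m) = 0"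
    proof -
      have "(LINT s|unit_interval_measure. ?F s) = primitive ?F 1"
        unfolding primitive_def by (rule Bochner_Integration.integral_cong) (auto simp: indicator_def)
      then show ?thesis using I[OF ab] ibump[OF ab(2,4)] by simp
    qed
    then show "(LINT s|unit_interval_measure. ?F s *\<^sub>R (v s - m)) = 0"
      using Bochner_Integration.integral_diff[OF int[OF ab(2,4)] integrable_scaleR_left[OF ibump[OF ab(2,4)], of m]]
      by (simp add: scaleR_diff_right)
  qed
  then show ?thesis
    using that[of m] by (simp add: primitive_diff iv primitive_const)
qed

section \<open>Functions with a weak derivative\<close>

lemma borel_measurable_rep_Linf:
  fixes f :: "'k::euclidean_space l1 Linf"
  shows "rep_Linf f \<in> borel_measurable unit_interval_measure"
  by (rule borel_measurable_l1I) (rule borel_measurable_coord[unfolded coord_def[abs_def]])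

lemma test_functionD:
  assumes "\<phi> \<in> test_functions"
  shows "(\<phi> has_real_derivative deriv \<phi> x) (at x)" "continuous_on A \<phi>" "continuous_on A (deriv \<phi>)"
    "\<phi> 0 = 0" "\<phi> 1 = 0"
proof -
  have d: "(deriv ^^ n) \<phi> differentiable_on UNIV" for n using assms by (simp add: test_functions_def)
  show "(\<phi> has_real_derivative deriv \<phi> x) (at x)"
    using d[of 0] by (auto simp: differentiable_on_def real_differentiable_def DERIV_deriv_iff_real_differentiable)
  show "continuous_on A \<phi>" using differentiable_imp_continuous_on[OF d[of 0]] continuous_on_subset by fastforce
  show "continuous_on A (deriv \<phi>)" using differentiable_imp_continuous_on[OF d[of 1]] continuous_on_subset by fastforce
  show "\<phi> 0 = 0" "\<phi> 1 = 0" using assms by (force simp: test_functions_def)+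
qed

lemma integrable_continuous_scaleR:
  fixes v :: "real \<Rightarrow> 'b::{banach, second_countable_topology}" and \<psi> :: "real \<Rightarrow> real"
  assumes \<psi>: "continuous_on {0..1} \<psi>"
    and v: "v \<in> borel_measurable unit_interval_measure" "AE s in unit_interval_measure. norm (v s) \<le> K"
  shows "integrable unit_interval_measure (\<lambda>s. \<psi> s *\<^sub>R v s)"
proof -
  obtain M where M: "\<And>s. s \<in> {0..1} \<Longrightarrow> norm (\<psi> s) \<le> M" using integrable_unit_interval_continuous(3)[OF \<psi>] by blast
  have M0: "0 \<le> M" by (rule order_trans[OF norm_ge_zero M[of 0]]) simp
  show ?thesis
  proof (rule integrable_unit_interval_bounded)
    show "(\<lambda>s. \<psi> s *\<^sub>R v s) \<in> borel_measurable unit_interval_measure"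
      using integrable_unit_interval_continuous(2)[OF \<psi>] v(1) by (intro borel_measurable_scaleR) auto
    show "AE s in unit_interval_measure. norm (\<psi> s *\<^sub>R v s) \<le> M * K"
      using v(2) AE_unit_interval_mem
    proof eventually_elim
      case (elim s)
      show ?case unfolding norm_scaleR
        by (rule mult_mono[OF M[OF elim(2), unfolded real_norm_def] elim(1) M0]) simp
    qed
  qed
qed

lemma has_weak_derivative_coord:
  fixes f h :: "'k::euclidean_space l1 Linf"
  shows "has_weak_derivative f h \<longleftrightarrow> (\<forall>\<phi>\<in>test_functions. \<forall>j.
    (LINT s|unit_interval_measure. deriv \<phi> s *\<^sub>R coord f j s) = - (LINT s|unit_interval_measure. \<phi> s *\<^sub>R coord h j s))"
proof -
  have i: "integrable unit_interval_measure (\<lambda>s. \<psi> s *\<^sub>R rep_Linf g s)" if "continuous_on {0..1} \<psi>"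
    for \<psi> and g :: "'k l1 Linf"
    by (rule integrable_continuous_scaleR[OF that borel_measurable_rep_Linf AE_norm_rep_le])
  have n: "l1_nth (LINT s|unit_interval_measure. \<psi> s *\<^sub>R rep_Linf g s) j
      = (LINT s|unit_interval_measure. \<psi> s *\<^sub>R coord g j s)" if "continuous_on {0..1} \<psi>"
    for \<psi> j and g :: "'k l1 Linf"
    using integral_bounded_linear[OF bounded_linear_l1_nth[of j] i[OF that, of g]] by (simp add: coord_def)
  have "(LINT s|unit_interval_measure. deriv \<phi> s *\<^sub>R rep_Linf f s) = - (LINT s|unit_interval_measure. \<phi> s *\<^sub>R rep_Linf h s)
    \<longleftrightarrow> (\<forall>j. (LINT s|unit_interval_measure. deriv \<phi> s *\<^sub>R coord f j s) = - (LINT s|unit_interval_measure. \<phi> s *\<^sub>R coord h j s))"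
    (is "?l = ?r \<longleftrightarrow> _") if \<phi>: "\<phi> \<in> test_functions" for \<phi>
  proof -
    have "?l = ?r \<longleftrightarrow> (\<forall>j. l1_nth ?l j = l1_nth ?r j)" by (auto intro: l1_eqI)
    then show ?thesis by (simp add: n test_functionD(2,3)[OF \<phi>])
  qed
  then show ?thesis unfolding has_weak_derivative_def by blast
qed

lemma test_function_by_parts:
  fixes v :: "real \<Rightarrow> 'k::{real_normed_field, euclidean_space}"
  assumes \<phi>: "\<phi> \<in> test_functions"
    and v: "v \<in> borel_measurable unit_interval_measure" "AE s in unit_interval_measure. norm (v s) \<le> K"
  shows "(LINT s|unit_interval_measure. deriv \<phi> s *\<^sub>R primitive v s) = - (LINT s|unit_interval_measure. \<phi> s *\<^sub>R v s)"
proof -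
  let ?u = "\<lambda>s. of_real (deriv \<phi> s) :: 'k"
  have cu: "continuous_on {0..1} ?u" by (intro continuous_intros test_functionD[OF \<phi>])
  obtain M where M: "\<And>s. s \<in> {0..1} \<Longrightarrow> norm (?u s) \<le> M" using integrable_unit_interval_continuous(3)[OF cu] by blast
  have u: "?u \<in> borel_measurable unit_interval_measure" "AE s in unit_interval_measure. norm (?u s) \<le> M"
    using integrable_unit_interval_continuous(2)[OF cu] M by (auto intro: AE_I2)
  have pu: "primitive ?u x = of_real (\<phi> x)" if "x \<in> {0..1}" for x
  proof -
    have "primitive ?u x = of_real (\<phi> x) - of_real (\<phi> 0)"
    proof (rule primitive_of_derivative[OF _ cu that])
      fix x :: real
      have "(\<phi> has_vector_derivative deriv \<phi> x) (at x within {0..1})"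
        using test_functionD(1)[OF \<phi>, of x]
        by (simp add: has_real_derivative_iff_has_vector_derivative has_vector_derivative_at_within)
      then show "((\<lambda>x. of_real (\<phi> x) :: 'k) has_vector_derivative ?u x) (at x within {0..1})"
        by (rule bounded_linear.has_vector_derivative[OF bounded_linear_of_real])
    qed
    then show ?thesis by (simp add: test_functionD(4)[OF \<phi>])
  qed
  note P = primitive_mult_primitive[OF u v, of 1]
  have all: "primitive w 1 = (LINT s|unit_interval_measure. w s)" for w :: "real \<Rightarrow> 'k"
    unfolding primitive_def by (rule Bochner_Integration.integral_cong) (auto simp: indicator_def)
  have "(LINT s|unit_interval_measure. ?u s * primitive v s) + (LINT s|unit_interval_measure. primitive ?u s * v s) = 0"
    using P(1) all[of "\<lambda>s. ?u s * primitive v s + primitive ?u s * v s"]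
      Bochner_Integration.integral_add[OF P(2,3)] pu[of 1] test_functionD(5)[OF \<phi>] by simp
  moreover have "(LINT s|unit_interval_measure. primitive ?u s * v s) = (LINT s|unit_interval_measure. \<phi> s *\<^sub>R v s)"
    by (rule Bochner_Integration.integral_cong) (simp_all add: pu scaleR_conv_of_real)
  ultimately show ?thesis by (simp add: scaleR_conv_of_real eq_neg_iff_add_eq_0)
qed

lemma continuous_on_prim: "continuous_on {0..1} (prim h j)"
  unfolding prim_def by (rule continuous_on_primitive[OF borel_measurable_coord AE_norm_coord_le])

lemma continuous_eq_if_primitive_eq:
  fixes u v :: "real \<Rightarrow> 'b::euclidean_space"
  assumes "continuous_on {0..1} u" "continuous_on {0..1} v"
    and "\<And>x. x \<in> {0..1} \<Longrightarrow> primitive u x = primitive v x" and x: "x \<in> {0..1}"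
  shows "u x = v x"
proof -
  have "(primitive u has_vector_derivative v x) (at x within {0..1})"
    by (rule has_vector_derivative_transform[OF x assms(3) primitive_has_vector_derivative[OF assms(2) x]])
  then show ?thesis
    using primitive_has_vector_derivative[OF assms(1) x] x
    by (intro vector_derivative_unique_within_closed_interval[of 0 1 x "primitive u"]) auto
qed

text \<open>
  \<open>f\<close> is Lipschitz continuous with derivative \<open>h\<close> and with value \<open>a\<close> at \<open>0\<close>, stated for the primitive of \<open>f\<close>.
\<close>

definition is_lipschitz_with :: "'k::euclidean_space l1 Linf \<Rightarrow> (nat \<Rightarrow> 'k) \<Rightarrow> 'k l1 Linf \<Rightarrow> bool" where
  "is_lipschitz_with f a h \<longleftrightarrow> (\<forall>j. \<forall>x\<in>{0..1}. prim f j x = x *\<^sub>R a j + primitive (prim h j) x)"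

lemma primitive_affine:
  fixes h :: "'k::euclidean_space l1 Linf"
  assumes "x \<in> {0..1}"
  shows "primitive (\<lambda>s. a + prim h j s) x = x *\<^sub>R a + primitive (prim h j) x"
  using assms by (subst primitive_add)
    (auto simp: primitive_const intro: integrable_unit_interval_continuous(1)[OF continuous_on_prim])

lemma is_lipschitz_with_AE:
  fixes f h :: "'k::{real_normed_field, euclidean_space} l1 Linf"
  assumes "is_lipschitz_with f a h"
  shows "AE s in unit_interval_measure. \<forall>j. coord f j s = a j + prim h j s"
  unfolding AE_all_countable
proof
  fix j
  let ?p = "\<lambda>s. a j + prim h j s"
  have c: "continuous_on {0..1} ?p" by (intro continuous_intros continuous_on_prim)
  obtain M where M: "\<And>s. s \<in> {0..1} \<Longrightarrow> norm (?p s) \<le> M" using integrable_unit_interval_continuous(3)[OF c] by blast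
  have "AE s in unit_interval_measure. coord f j s - ?p s = 0"
  proof (rule AE_eq_0_if_primitive_eq_0)
    show "(\<lambda>s. coord f j s - ?p s) \<in> borel_measurable unit_interval_measure"
      using integrable_unit_interval_continuous(2)[OF c] by (intro borel_measurable_diff borel_measurable_coord)
    show "AE s in unit_interval_measure. norm (coord f j s - ?p s) \<le> norm f + M"
      using AE_norm_coord_le[of f j] AE_unit_interval_mem
      by eventually_elim (rule order_trans[OF norm_triangle_ineq4 add_mono[OF _ M]])
    fix x :: real assume "x \<in> {0..1}"
    then show "primitive (\<lambda>s. coord f j s - ?p s) x = 0"
      using assms integrable_unit_interval_continuous(1)[OF c]
      by (simp add: primitive_diff integrable_coord primitive_affine is_lipschitz_with_def flip: prim_def)
  qed
  then show "AE s in unit_interval_measure. coord f j s = ?p s" by simp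
qed

text \<open>
  A weak derivative in \<open>L\<^sup>\<infinity>([0,1], \<ell>\<^sup>1)\<close> makes \<open>f\<close> a Lipschitz function up to a null set.
\<close>

lemma has_weak_derivative_iff:
  fixes f h :: "'k::{real_normed_field, euclidean_space} l1 Linf"
  shows "has_weak_derivative f h \<longleftrightarrow> (\<exists>a. is_lipschitz_with f a h)"
proof
  assume wd: "has_weak_derivative f h"
  have "\<exists>m. \<forall>x\<in>{0..1}. prim f j x = x *\<^sub>R m + primitive (prim h j) x" for j
  proof -
    let ?v = "\<lambda>s. coord f j s - prim h j s"
    note c = continuous_on_prim[of h j]
    obtain M where M: "\<And>s. s \<in> {0..1} \<Longrightarrow> norm (prim h j s) \<le> M"
      using integrable_unit_interval_continuous(3)[OF c] by blast
    have vm: "?v \<in> borel_measurable unit_interval_measure"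
      using integrable_unit_interval_continuous(2)[OF c] by (intro borel_measurable_diff borel_measurable_coord)
    have vb: "AE s in unit_interval_measure. norm (?v s) \<le> norm f + M"
      using AE_norm_coord_le[of f j] AE_unit_interval_mem
      by eventually_elim (rule order_trans[OF norm_triangle_ineq4 add_mono[OF _ M]])
    have "(LINT s|unit_interval_measure. deriv \<phi> s *\<^sub>R ?v s) = 0" if \<phi>: "\<phi> \<in> test_functions" for \<phi>
    proof -
      have 1: "integrable unit_interval_measure (\<lambda>s. deriv \<phi> s *\<^sub>R coord f j s)"
        by (rule integrable_continuous_scaleR[OF test_functionD(3)[OF \<phi>] borel_measurable_coord AE_norm_coord_le])
      have 2: "integrable unit_interval_measure (\<lambda>s. deriv \<phi> s *\<^sub>R prim h j s)"
        by (rule integrable_unit_interval_continuous(1)) (intro continuous_intros test_functionD(3)[OF \<phi>] c)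
      have "(LINT s|unit_interval_measure. deriv \<phi> s *\<^sub>R ?v s)
          = (LINT s|unit_interval_measure. deriv \<phi> s *\<^sub>R coord f j s) - (LINT s|unit_interval_measure. deriv \<phi> s *\<^sub>R prim h j s)"
        using Bochner_Integration.integral_diff[OF 1 2] by (simp add: scaleR_diff_right)
      also have "\<dots> = 0"
        using wd \<phi> test_function_by_parts[OF \<phi> borel_measurable_coord AE_norm_coord_le, of h j]
        unfolding has_weak_derivative_coord by (simp add: prim_def)
      finally show ?thesis .
    qed
    then obtain m where m: "\<And>x. x \<in> {0..1} \<Longrightarrow> primitive ?v x = x *\<^sub>R m"
      using du_Bois_Reymond[OF vm vb] by blast
    have "prim f j x = x *\<^sub>R m + primitive (prim h j) x" if "x \<in> {0..1}" for x
      using m[OF that] primitive_diff[OF integrable_coord[of f j] integrable_unit_interval_continuous(1)[OF c], of x]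
      by (simp add: prim_def[of f j] diff_eq_eq)
    then show ?thesis by blast
  qed
  then obtain a where "\<And>j x. x \<in> {0..1} \<Longrightarrow> prim f j x = x *\<^sub>R a j + primitive (prim h j) x" by metis
  then show "\<exists>a. is_lipschitz_with f a h" unfolding is_lipschitz_with_def by blast
next
  assume "\<exists>a. is_lipschitz_with f a h"
  then obtain a where a: "is_lipschitz_with f a h" ..
  show "has_weak_derivative f h"
    unfolding has_weak_derivative_coord
  proof (intro ballI allI)
    fix \<phi> j assume \<phi>: "\<phi> \<in> test_functions"
    note c = continuous_on_prim[of h j]
    have 1: "integrable unit_interval_measure (\<lambda>s. deriv \<phi> s *\<^sub>R a j)"
      by (rule integrable_unit_interval_continuous(1)) (intro continuous_intros test_functionD(3)[OF \<phi>])
    have 2: "integrable unit_interval_measure (\<lambda>s. deriv \<phi> s *\<^sub>R prim h j s)"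
      by (rule integrable_unit_interval_continuous(1)) (intro continuous_intros test_functionD(3)[OF \<phi>] c)
    have "(LINT s|unit_interval_measure. deriv \<phi> s) = primitive (deriv \<phi>) 1"
      unfolding primitive_def by (rule Bochner_Integration.integral_cong) (auto simp: indicator_def)
    also have "\<dots> = \<phi> 1 - \<phi> 0"
      by (rule primitive_of_derivative[OF _ test_functionD(3)[OF \<phi>]])
        (use test_functionD(1)[OF \<phi>] in \<open>auto simp: has_real_derivative_iff_has_vector_derivative intro: has_vector_derivative_at_within\<close>)
    finally have 3: "(LINT s|unit_interval_measure. deriv \<phi> s) = 0" by (simp add: test_functionD[OF \<phi>])
    have "(LINT s|unit_interval_measure. deriv \<phi> s *\<^sub>R coord f j s)
        = (LINT s|unit_interval_measure. deriv \<phi> s *\<^sub>R a j + deriv \<phi> s *\<^sub>R prim h j s)"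
    proof (rule integral_cong_AE)
      show "AE s in unit_interval_measure. deriv \<phi> s *\<^sub>R coord f j s = deriv \<phi> s *\<^sub>R a j + deriv \<phi> s *\<^sub>R prim h j s"
        using is_lipschitz_with_AE[OF a] by eventually_elim (simp add: scaleR_add_right)
      show "(\<lambda>s. deriv \<phi> s *\<^sub>R coord f j s) \<in> borel_measurable unit_interval_measure"
        using integrable_continuous_scaleR[OF test_functionD(3)[OF \<phi>] borel_measurable_coord[of f j] AE_norm_coord_le] by auto
    qed (use 1 2 in auto)
    also have "\<dots> = (LINT s|unit_interval_measure. deriv \<phi> s *\<^sub>R a j) + (LINT s|unit_interval_measure. deriv \<phi> s *\<^sub>R prim h j s)"
      by (rule Bochner_Integration.integral_add[OF 1 2])
    also have "(LINT s|unit_interval_measure. deriv \<phi> s *\<^sub>R a j) = 0"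
      using 3 integrable_unit_interval_continuous(1)[OF test_functionD(3)[OF \<phi>]] by simp
    also have "0 + (LINT s|unit_interval_measure. deriv \<phi> s *\<^sub>R prim h j s) = - (LINT s|unit_interval_measure. \<phi> s *\<^sub>R coord h j s)"
      using test_function_by_parts[OF \<phi> borel_measurable_coord AE_norm_coord_le, of h j] by (simp add: prim_def)
    finally show "(LINT s|unit_interval_measure. deriv \<phi> s *\<^sub>R coord f j s) = - (LINT s|unit_interval_measure. \<phi> s *\<^sub>R coord h j s)" .
  qed
qed

lemma is_lipschitz_with_unique:
  fixes f h :: "'k::{real_normed_field, euclidean_space} l1 Linf"
  assumes "is_lipschitz_with f a h" "is_lipschitz_with f a' h'"
  shows "a = a'" "h = h'"
proof -
  have eq: "a j + prim h j x = a' j + prim h' j x" if x: "x \<in> {0..1}" for j x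
  proof (rule continuous_eq_if_primitive_eq[OF _ _ _ x])
    show "continuous_on {0..1} (\<lambda>x. a j + prim h j x)" "continuous_on {0..1} (\<lambda>x. a' j + prim h' j x)"
      by (intro continuous_intros continuous_on_prim)+
    show "primitive (\<lambda>x. a j + prim h j x) y = primitive (\<lambda>x. a' j + prim h' j x) y" if "y \<in> {0..1}" for y
      using assms that by (simp add: primitive_affine is_lipschitz_with_def)
  qed
  have aa: "a j = a' j" for j using eq[of 0 j] by (simp add: prim_eq_0)
  then show "a = a'" by (rule ext)
  show "h = h'" by (rule Linf_eqI_prim) (use eq aa in simp)
qed

lemma weak_derivative_eq:
  fixes f h :: "'k::{real_normed_field, euclidean_space} l1 Linf"
  assumes "is_lipschitz_with f a h"
  shows "weak_derivative f = h"
  unfolding weak_derivative_def has_weak_derivative_iff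
  using assms is_lipschitz_with_unique(2) by blast

lemma is_lipschitz_with_summable:
  fixes f h :: "'k::{real_normed_field, euclidean_space} l1 Linf"
  assumes "is_lipschitz_with f a h"
  shows "summable (\<lambda>j. norm (a j))"
proof -
  have sp: "summable (\<lambda>j. norm (prim h j x))" for x
  proof (rule l1_boundedI(1))
    show "(\<Sum>j<N. norm (prim h j x)) \<le> norm h * \<bar>x\<bar>" for N
      using sum_norm_prim_increment_le[of h x 0 N] by (simp add: prim_eq_0)
  qed
  have "AE s in unit_interval_measure. summable (\<lambda>j. norm (a j))"
    using is_lipschitz_with_AE[OF assms]
  proof eventually_elim
    case (elim s)
    have "a j = coord f j s - prim h j s" for j using elim by simp
    then show ?case
      using summable_norm_plus_minus(2)[OF summable_l1_nth[of "rep_Linf f s"] sp[of s]] by (simp add: coord_def)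
  qed
  then show ?thesis by simp
qed

text \<open>
  Evaluation at a point of \<open>[0,1]\<close> does not depend on the choice of the continuous representative.
\<close>

lemma continuous_rep_eq:
  fixes f h :: "'k::{real_normed_field, euclidean_space} l1 Linf"
  assumes lip: "is_lipschitz_with f a h" and x: "x \<in> {0..1}"
  shows "l1_nth (continuous_rep f x) j = a j + prim h j x"
proof -
  define r where "r = (\<lambda>x. Abs_l1 (\<lambda>j. a j + prim h j x))"
  have r: "l1_nth (r x) = (\<lambda>j. a j + prim h j x)" for x
    unfolding r_def
  proof (rule Abs_l1_inverse, rule CollectI, rule summable_norm_plus_minus(1))
    show "summable (\<lambda>j. norm (a j))" by (rule is_lipschitz_with_summable[OF lip])
    show "summable (\<lambda>j. norm (prim h j x))"
    proof (rule l1_boundedI(1))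
      show "(\<Sum>j<N. norm (prim h j x)) \<le> norm h * \<bar>x\<bar>" for N
        using sum_norm_prim_increment_le[of h x 0 N] by (simp add: prim_eq_0)
    qed
  qed
  have nr: "norm (r y - r x) \<le> norm h * \<bar>y - x\<bar>" for x y
    unfolding norm_l1.rep_eq
    by (rule l1_boundedI(2)) (simp add: r sum_norm_prim_increment_le)
  have "continuous_on {0..1} r"
  proof (rule continuous_on_iff[THEN iffD2], intro ballI allI impI)
    fix x e :: real assume e: "0 < e"
    have "dist (r y) (r x) < e" if "dist y x < e / (norm h + 1)" for y
    proof -
      have "dist (r y) (r x) \<le> norm h * \<bar>y - x\<bar>" using nr[of y x] by (simp add: dist_norm)
      also have "\<dots> \<le> (norm h + 1) * \<bar>y - x\<bar>" by (rule mult_right_mono) auto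
      also have "\<dots> < e" using that pos_less_divide_eq[of "norm h + 1" "\<bar>y - x\<bar>" e]
        by (simp add: dist_real_def mult.commute add_nonneg_pos)
      finally show ?thesis .
    qed
    moreover have "e / (norm h + 1) > 0" using e by (simp add: add_nonneg_pos)
    ultimately show "\<exists>d>0. \<forall>x'\<in>{0..1}. dist x' x < d \<longrightarrow> dist (r x') (r x) < e" by blast
  qed
  moreover have "AE s in unit_interval_measure. r s = rep_Linf f s"
    using is_lipschitz_with_AE[OF lip] by eventually_elim (auto intro!: l1_eqI simp: r coord_def)
  ultimately have ex: "\<exists>h. continuous_on {0..1} h \<and> (AE s in unit_interval_measure. h s = rep_Linf f s)" by blast
  have C: "continuous_on {0..1} (continuous_rep f)"
    and AE: "AE s in unit_interval_measure. continuous_rep f s = rep_Linf f s"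
    using someI_ex[OF ex] unfolding continuous_rep_def by blast+
  have Cj: "continuous_on {0..1} (\<lambda>s. l1_nth (continuous_rep f s) j)"
    by (rule bounded_linear.continuous_on[OF bounded_linear_l1_nth C])
  show ?thesis
  proof (rule continuous_eq_if_primitive_eq[OF Cj _ _ x])
    show "continuous_on {0..1} (\<lambda>x. a j + prim h j x)" by (intro continuous_intros continuous_on_prim)
    show "primitive (\<lambda>s. l1_nth (continuous_rep f s) j) y = primitive (\<lambda>x. a j + prim h j x) y" if y: "y \<in> {0..1}" for y
    proof -
      have "primitive (\<lambda>s. l1_nth (continuous_rep f s) j) y = prim f j y"
        unfolding prim_def
      proof (rule primitive_cong_AE[OF integrable_unit_interval_continuous(2)[OF Cj] borel_measurable_coord])
        show "AE s in unit_interval_measure. l1_nth (continuous_rep f s) j = coord f j s"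
          using AE by eventually_elim (simp add: coord_def)
      qed
      then show ?thesis using lip y by (simp add: primitive_affine is_lipschitz_with_def)
    qed
  qed
qed

lemma W1inf_space_iff:
  fixes f :: "'k::{real_normed_field, euclidean_space} l1 Linf"
  shows "f \<in> W1inf_space (l1_space J) \<longleftrightarrow> f \<in> Linf_space (l1_space J) \<and>
    (\<exists>h\<in>Linf_space (l1_space J). \<exists>a. is_lipschitz_with f a h)"
  unfolding W1inf_space_def has_weak_derivative_iff by blast

section \<open>Transport on the edges and the delay equation at the vertices\<close>

text \<open>
  The easy half of the Arzela--Ascoli theorem, on a grid of \<open>m\<close> points.
\<close>

lemma uniform_if_equilipschitz:
  fixes u :: "nat \<Rightarrow> real \<Rightarrow> 'b::real_normed_vector"
  assumes lip: "\<And>n x y. norm (u n y - u n x) \<le> K * \<bar>y - x\<bar>"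
    and lim: "\<And>x. x \<in> {0..1} \<Longrightarrow> (\<lambda>n. u n x) \<longlonglongrightarrow> 0" and e: "e > 0"
  shows "\<forall>\<^sub>F n in sequentially. \<forall>x\<in>{0..1}. norm (u n x) < e"
proof -
  have K0: "0 \<le> K" using order_trans[OF norm_ge_zero lip[of 0 1 0]] by simp
  obtain m :: nat where m: "2 * (K + 1) / e < m" using reals_Archimedean2 by blast
  have m0: "0 < real m" using m K0 e by (smt (verit) divide_nonneg_pos)
  have "\<forall>\<^sub>F n in sequentially. \<forall>i\<in>{..m}. norm (u n (real i / real m)) < e / 2"
  proof (rule eventually_ball_finite)
    show "\<forall>i\<in>{..m}. \<forall>\<^sub>F n in sequentially. norm (u n (real i / real m)) < e / 2"
    proof
      fix i assume "i \<in> {..m}"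
      then have "real i / real m \<in> {0..1}" using m0 by (simp add: divide_le_eq)
      from tendstoD[OF lim[OF this], of "e / 2"] e
      show "\<forall>\<^sub>F n in sequentially. norm (u n (real i / real m)) < e / 2" by simp
    qed
  qed simp
  then show ?thesis
  proof eventually_elim
    case (elim n)
    show ?case
    proof
      fix x :: real assume x: "x \<in> {0..1}"
      define i where "i = nat \<lfloor>x * m\<rfloor>"
      have "0 \<le> x * m" using x m0 by simp
      then have i: "real i \<le> x * m" "x * m < real i + 1" unfolding i_def by linarith+
      have "x * real m \<le> 1 * real m" using x m0 by (intro mult_right_mono) auto
      with i have "real i \<le> real m" by linarith
      then have iu: "norm (u n (real i / real m)) < e / 2" using elim by auto
      have "\<bar>x - real i / real m\<bar> = \<bar>x * m - real i\<bar> / m" using m0 by (simp add: field_simps abs_divide)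
      also have "\<dots> \<le> 1 / m" using i m0 by (intro divide_right_mono) auto
      finally have "K * \<bar>x - real i / real m\<bar> \<le> K * (1 / m)" using K0 by (rule mult_left_mono)
      also have "\<dots> \<le> e / 2" using m m0 e K0 by (simp add: field_simps)
      finally have "norm (u n x - u n (real i / real m)) \<le> e / 2" using lip[of n x "real i / real m"] by linarith
      then show "norm (u n x) < e"
        using iu norm_triangle_sub[of "u n x" "u n (real i / real m)"] by linarith
    qed
  qed
qed

lemma integral_average_tendsto:
  fixes u :: "real \<Rightarrow> 'b::banach"
  assumes u: "continuous_on UNIV u"
  shows "((\<lambda>t. integral {s..s + t} u /\<^sub>R t) \<longlongrightarrow> u s) (at_right 0)"
proof (rule tendstoI)
  fix e :: real assume e: "e > 0"
  have "isCont u s" using u by (simp add: continuous_on_eq_continuous_at)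
  then obtain d where d: "d > 0" "\<And>x. dist x s < d \<Longrightarrow> dist (u x) (u s) < e / 2"
    using e unfolding continuous_at_eps_delta by (meson half_gt_zero)
  have "\<forall>\<^sub>F t in at_right 0. t \<in> {0<..<d}" by (rule eventually_at_right_real) fact
  then show "\<forall>\<^sub>F t in at_right 0. dist (integral {s..s + t} u /\<^sub>R t) (u s) < e"
  proof eventually_elim
    case (elim t)
    then have t: "0 < t" "t < d" by auto
    have int: "u integrable_on {s..s + t}"
      by (rule integrable_continuous_real) (rule continuous_on_subset[OF u], simp)
    have "integral {s..s + t} u - t *\<^sub>R u s = integral {s..s + t} (\<lambda>x. u x - u s)"
      using Henstock_Kurzweil_Integration.integral_diff[OF int, of "\<lambda>_. u s"] t by (simp add: integrable_const_ivl)
    also have "norm \<dots> \<le> e / 2 * (s + t - s)"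
    proof (rule integral_bound)
      show "continuous_on {s..s + t} (\<lambda>x. u x - u s)"
        by (intro continuous_intros continuous_on_subset[OF u]) simp
      fix x assume "x \<in> {s..s + t}"
      then show "norm (u x - u s) \<le> e / 2" using d(2)[of x] t by (simp add: dist_norm dist_real_def less_imp_le)
    qed (use t in simp)
    finally have "norm (integral {s..s + t} u - t *\<^sub>R u s) \<le> e / 2 * t" by simp
    moreover have "integral {s..s + t} u /\<^sub>R t - u s = (integral {s..s + t} u - t *\<^sub>R u s) /\<^sub>R t"
      using t by (simp add: scaleR_diff_right)
    ultimately have "norm (integral {s..s + t} u /\<^sub>R t - u s) \<le> e / 2"
      using t by (simp add: divide_le_eq flip: divide_inverse_commute)
    then show "dist (integral {s..s + t} u /\<^sub>R t) (u s) < e" using e by (simp add: dist_norm)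
  qed
qed

lemma prim_outside: "prim f j x = prim f j (max 0 (min 1 x))"
  unfolding prim_def by (rule primitive_clamp[symmetric])

lemma continuous_on_prim_UNIV: "continuous_on A (prim f j)"
proof (rule continuous_on_subset[OF _ subset_UNIV])
  have "continuous_on UNIV (\<lambda>x. prim f j (max 0 (min 1 x)))"
    by (rule continuous_on_compose2[OF continuous_on_prim]) (auto intro!: continuous_intros)
  then show "continuous_on UNIV (prim f j)" by (simp flip: prim_outside)
qed

text \<open>
  Finitely many speeds, and coupling conditions at the vertices given by a matrix with finitely
  supported rows and uniformly summable columns.
\<close>

locale delay_network =
  fixes J :: "nat set" and c :: "nat \<Rightarrow> real" and M :: "nat \<Rightarrow> nat \<Rightarrow> 'k::{real_normed_field, euclidean_space}"
    and c_min \<beta> :: real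
  assumes c_min_pos: "0 < c_min" and c_min_le: "\<And>j. c_min \<le> c j" and finite_speeds: "finite (range c)"
    and M_off: "\<And>j l. j \<notin> J \<Longrightarrow> M j l = 0" and row_finite: "\<And>j. finite {l. M j l \<noteq> 0}"
    and column_bound: "\<And>S l. finite S \<Longrightarrow> (\<Sum>j\<in>S. norm (M j l)) \<le> \<beta>"
begin

lemma c_pos: "0 < c j" using c_min_pos c_min_le[of j] by simp

definition "c_max = Max (range c)"

lemma c_le_max: "c j \<le> c_max" unfolding c_max_def using finite_speeds by simp

lemma c_max_pos: "0 < c_max" using c_pos[of 0] c_le_max[of 0] by simp

lemma \<beta>_nonneg: "0 \<le> \<beta>" using column_bound[of "{}"] by simp

text \<open>
  Since \<open>f\<^sub>j\<close> moves to the left, it leaves its edge at \<open>0\<close>.  For the primitives \<open>P\<close> of an initial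
  distribution, \<open>flux P j t\<close> is the integral up to time \<open>t\<close> of the density that leaves edge \<open>j\<close>.  Before
  time \<open>1 / c j\<close> this density comes from the initial distribution on the edge; later, it is the density
  that entered at time \<open>t - 1 / c j\<close>, namely what then left the adjacent edges, weighted by \<open>M\<close>.
\<close>

function flux :: "(nat \<Rightarrow> real \<Rightarrow> 'k) \<Rightarrow> nat \<Rightarrow> real \<Rightarrow> 'k" where
  "flux P j t = (if t \<le> 0 then 0
     else (1 / c j) *\<^sub>R P j (c j * t) + (\<Sum>l\<in>{l. M j l \<noteq> 0}. M j l * flux P l (t - 1 / c j)))"
  by pat_completeness auto
termination
\<comment> \<open>every delay is at least \<open>1 / c_max\<close>\<close>
proof (relation "Wellfounded.measure (\<lambda>(P, j, t). nat \<lceil>t * c_max\<rceil>)")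
  fix P :: "nat \<Rightarrow> real \<Rightarrow> 'k" and j and t :: real and l
  assume t: "\<not> t \<le> 0"
  have "1 \<le> c_max / c j" using c_le_max[of j] c_pos[of j] by simp
  then have "(t - 1 / c j) * c_max \<le> t * c_max - 1" by (simp add: left_diff_distrib)
  then have "\<lceil>(t - 1 / c j) * c_max\<rceil> \<le> \<lceil>t * c_max\<rceil> - 1" by linarith
  moreover have "0 < \<lceil>t * c_max\<rceil>" using t c_max_pos by simp
  ultimately show "((P, l, t - 1 / c j), (P, j, t)) \<in> Wellfounded.measure (\<lambda>(P, j, t). nat \<lceil>t * c_max\<rceil>)" by auto
qed simp

declare flux.simps [simp del]

lemma flux_nonpos: "t \<le> 0 \<Longrightarrow> flux P j t = 0" by (subst flux.simps) simp

lemma flux_rec: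
  "flux (prim f) j t = (1 / c j) *\<^sub>R prim f j (c j * t) + (\<Sum>l\<in>{l. M j l \<noteq> 0}. M j l * flux (prim f) l (t - 1 / c j))"
proof (cases "t \<le> 0")
  case True
  then have "c j * t \<le> 0" using c_pos[of j] by (simp add: mult_le_0_iff)
  moreover have "t - 1 / c j \<le> 0" using True c_pos[of j] by (smt (verit) divide_pos_pos)
  ultimately show ?thesis using True by (simp add: flux_nonpos prim_eq_0)
qed (subst flux.simps, simp)

lemma flux_initial: "t \<le> 1 / c j \<Longrightarrow> flux (prim f) j t = (1 / c j) *\<^sub>R prim f j (c j * t)"
  by (subst flux_rec) (simp add: flux_nonpos)

lemma flux_increment:
  assumes "1 / c j \<le> s" "1 / c j \<le> t"
  shows "flux (prim f) j t - flux (prim f) j s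
    = (\<Sum>l\<in>{l. M j l \<noteq> 0}. M j l * (flux (prim f) l (t - 1 / c j) - flux (prim f) l (s - 1 / c j)))"
proof -
  have "1 \<le> c j * s" "1 \<le> c j * t" using assms c_pos[of j] by (simp_all add: divide_le_eq mult.commute)
  then have "prim f j (c j * t) = prim f j (c j * s)" using prim_ge_1 by metis
  then show ?thesis
    by (subst (1 2) flux_rec) (simp add: right_diff_distrib sum_subtractf)
qed

lemma flux_eq_prim: "x \<in> {0..1} \<Longrightarrow> prim f j x = c j *\<^sub>R flux (prim f) j (x / c j)"
  using c_pos[of j] flux_initial[of "x / c j" j f] by (simp add: divide_right_mono)

lemma flux_add: "flux (prim (f + g)) j t = flux (prim f) j t + flux (prim g) j t"
proof (induction "prim f" j t rule: flux.induct)
  case (1 j t)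
  show ?case
  proof (cases "t \<le> 0")
    case False
    then show ?thesis
      using 1[OF False]
      by (subst (1 2 3) flux_rec) (simp add: prim_add scaleR_add_right distrib_left sum.distrib)
  qed (simp add: flux_nonpos)
qed

lemma flux_scale: "flux (prim (Linf_scale a f)) j t = a * flux (prim f) j t"
proof (induction "prim f" j t rule: flux.induct)
  case (1 j t)
  show ?case
  proof (cases "t \<le> 0")
    case False
    then show ?thesis
      using 1[OF False]
      by (subst (1 2) flux_rec) (simp add: prim_scale distrib_left sum_distrib_left mult.left_commute)
  qed (simp add: flux_nonpos)
qed

text \<open>
  Estimates for each speed separately; this is where finitely many speeds are needed.  Edges with the
  same speed evaluate the flux at the same time, which allows the use of estimates for sums over edges.
\<close>

lemma sum_by_speeds:
  fixes g :: "nat \<Rightarrow> real" and B :: real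
  assumes "finite S" "0 \<le> B"
    and "\<And>v A. v > 0 \<Longrightarrow> finite A \<Longrightarrow> (\<And>j. j \<in> A \<Longrightarrow> c j = v) \<Longrightarrow> (\<Sum>j\<in>A. g j) \<le> B"
  shows "(\<Sum>j\<in>S. g j) \<le> card (range c) * B"
proof -
  have "(\<Sum>j\<in>S. g j) = (\<Sum>v\<in>c ` S. \<Sum>j\<in>{j \<in> S. c j = v}. g j)"
    by (rule sum.image_gen[OF assms(1)])
  also have "\<dots> \<le> (\<Sum>v\<in>c ` S. B)"
  proof (rule sum_mono)
    fix v assume "v \<in> c ` S"
    then have "v > 0" using c_pos by auto
    then show "(\<Sum>j\<in>{j \<in> S. c j = v}. g j) \<le> B" by (rule assms(3)) (use assms(1) in auto)
  qed
  also have "\<dots> = card (c ` S) * B" by simp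
  also have "\<dots> \<le> card (range c) * B"
    using finite_speeds assms(2) by (intro mult_right_mono of_nat_mono card_mono) auto
  finally show ?thesis .
qed

text \<open>
  A Lipschitz constant in \<open>\<ell>\<^sup>1\<close> for the flux of a normalised initial distribution up to time \<open>n / c_max\<close>.
\<close>

definition flux_lip :: "nat \<Rightarrow> real" where
  "flux_lip n = card (range c) * (1 + card (range c) * \<beta>) ^ n"

lemma flux_lip_nonneg: "0 \<le> flux_lip n" unfolding flux_lip_def using \<beta>_nonneg by simp

lemma sum_norm_prim_increment_le_finite:
  "finite S \<Longrightarrow> (\<Sum>j\<in>S. norm (prim f j y - prim f j x)) \<le> norm f * \<bar>y - x\<bar>"
proof -
  assume S: "finite S"
  then obtain N where "S \<subseteq> {..<N}" using finite_nat_iff_bounded by auto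
  then have "(\<Sum>j\<in>S. norm (prim f j y - prim f j x)) \<le> (\<Sum>j<N. norm (prim f j y - prim f j x))"
    by (intro sum_mono2) auto
  then show ?thesis using sum_norm_prim_increment_le order_trans by blast
qed

text \<open>
  By induction on the number of time steps of length \<open>1 / c_max\<close>.  One step adds the contribution of the
  initial distribution and, through the column sums of \<open>M\<close>, that of the previous steps; both are
  estimated separately for each of the finitely many speeds.
\<close>

lemma flux_lipschitz:
  assumes "finite S" "s \<le> n / c_max" "t \<le> n / c_max"
  shows "(\<Sum>j\<in>S. norm (flux (prim f) j t - flux (prim f) j s)) \<le> flux_lip n * norm f * \<bar>t - s\<bar>"
  using assms
proof (induction n arbitrary: S s t)
  case 0
  then show ?case using flux_lip_nonneg[of 0] by (simp add: flux_nonpos)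
next
  case (Suc n)
  let ?m = "real (card (range c))"
  have base: "(\<Sum>j\<in>S. norm ((1 / c j) *\<^sub>R prim f j (c j * t) - (1 / c j) *\<^sub>R prim f j (c j * s))) \<le> ?m * (norm f * \<bar>t - s\<bar>)"
  proof (rule sum_by_speeds[OF Suc.prems(1)])
    fix v A assume v: "v > 0" "finite A" "\<And>j. j \<in> A \<Longrightarrow> c j = v"
    have "(\<Sum>j\<in>A. norm ((1 / c j) *\<^sub>R prim f j (c j * t) - (1 / c j) *\<^sub>R prim f j (c j * s)))
        = (\<Sum>j\<in>A. (1 / v) * norm (prim f j (v * t) - prim f j (v * s)))"
      using v by (intro sum.cong refl) (simp flip: scaleR_diff_right)
    also have "\<dots> = (1 / v) * (\<Sum>j\<in>A. norm (prim f j (v * t) - prim f j (v * s)))"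
      by (simp only: sum_distrib_left)
    also have "\<dots> \<le> (1 / v) * (norm f * \<bar>v * t - v * s\<bar>)"
      using v by (intro mult_left_mono sum_norm_prim_increment_le_finite) auto
    also have "\<dots> = norm f * \<bar>t - s\<bar>" using v by (simp add: abs_mult flip: right_diff_distrib)
    finally show "(\<Sum>j\<in>A. norm ((1 / c j) *\<^sub>R prim f j (c j * t) - (1 / c j) *\<^sub>R prim f j (c j * s))) \<le> norm f * \<bar>t - s\<bar>" .
  qed simp
  let ?K = "flux_lip n * norm f * \<bar>t - s\<bar>"
  have K0: "0 \<le> ?K" using flux_lip_nonneg by simp
  let ?\<Delta> = "\<lambda>l r. norm (flux (prim f) l (t - r) - flux (prim f) l (s - r))"
  have later: "(\<Sum>j\<in>S. \<Sum>l\<in>{l. M j l \<noteq> 0}. norm (M j l) * ?\<Delta> l (1 / c j)) \<le> ?m * (\<beta> * ?K)"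
  proof (rule sum_by_speeds[OF Suc.prems(1)])
    fix v A assume v: "v > 0" "finite A" "\<And>j. j \<in> A \<Longrightarrow> c j = v"
    define U where "U = (\<Union>j\<in>A. {l. M j l \<noteq> 0})"
    have U: "finite U" unfolding U_def using v(2) row_finite by auto
    have "(\<Sum>j\<in>A. \<Sum>l\<in>{l. M j l \<noteq> 0}. norm (M j l) * ?\<Delta> l (1 / c j)) = (\<Sum>j\<in>A. \<Sum>l\<in>U. norm (M j l) * ?\<Delta> l (1 / v))"
    proof (rule sum.cong[OF refl])
      fix j assume j: "j \<in> A"
      show "(\<Sum>l\<in>{l. M j l \<noteq> 0}. norm (M j l) * ?\<Delta> l (1 / c j)) = (\<Sum>l\<in>U. norm (M j l) * ?\<Delta> l (1 / v))"
        using j U v(3) by (intro sum.mono_neutral_cong_left) (auto simp: U_def)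
    qed
    also have "\<dots> = (\<Sum>l\<in>U. (\<Sum>j\<in>A. norm (M j l)) * ?\<Delta> l (1 / v))"
      by (subst sum.swap) (simp only: sum_distrib_right)
    also have "\<dots> \<le> (\<Sum>l\<in>U. \<beta> * ?\<Delta> l (1 / v))"
      by (intro sum_mono mult_right_mono column_bound v(2)) simp
    also have "\<dots> = \<beta> * (\<Sum>l\<in>U. ?\<Delta> l (1 / v))" by (simp only: sum_distrib_left)
    also have "\<dots> \<le> \<beta> * ?K"
    proof (rule mult_left_mono[OF _ \<beta>_nonneg], cases "A = {}")
      case False
      then have "v \<le> c_max" using v(3) c_le_max by auto
      then have le: "1 / c_max \<le> 1 / v" using v(1) by (simp add: frac_le)
      have "t - 1 / v \<le> n / c_max" "s - 1 / v \<le> n / c_max"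
        using le Suc.prems by (auto simp: add_divide_distrib)
      from Suc.IH[OF U this(2,1)] show "(\<Sum>l\<in>U. ?\<Delta> l (1 / v)) \<le> ?K" by simp
    qed (use K0 in \<open>simp add: U_def\<close>)
    finally show "(\<Sum>j\<in>A. \<Sum>l\<in>{l. M j l \<noteq> 0}. norm (M j l) * ?\<Delta> l (1 / c j)) \<le> \<beta> * ?K" .
  qed (use \<beta>_nonneg K0 in simp)
  have "(\<Sum>j\<in>S. norm (flux (prim f) j t - flux (prim f) j s))
      \<le> (\<Sum>j\<in>S. norm ((1 / c j) *\<^sub>R prim f j (c j * t) - (1 / c j) *\<^sub>R prim f j (c j * s))
          + (\<Sum>l\<in>{l. M j l \<noteq> 0}. norm (M j l) * ?\<Delta> l (1 / c j)))"
  proof (rule sum_mono)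
    fix j
    have eq: "flux (prim f) j t - flux (prim f) j s
       = ((1 / c j) *\<^sub>R prim f j (c j * t) - (1 / c j) *\<^sub>R prim f j (c j * s))
         + (\<Sum>l\<in>{l. M j l \<noteq> 0}. M j l * (flux (prim f) l (t - 1 / c j) - flux (prim f) l (s - 1 / c j)))"
      by (subst (1 2) flux_rec) (simp add: right_diff_distrib sum_subtractf)
    show "norm (flux (prim f) j t - flux (prim f) j s)
        \<le> norm ((1 / c j) *\<^sub>R prim f j (c j * t) - (1 / c j) *\<^sub>R prim f j (c j * s))
          + (\<Sum>l\<in>{l. M j l \<noteq> 0}. norm (M j l) * ?\<Delta> l (1 / c j))"
      unfolding eq
      by (rule order_trans[OF norm_triangle_ineq add_left_mono])
        (rule order_trans[OF norm_sum], simp add: norm_mult)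
  qed
  also have "\<dots> \<le> ?m * (norm f * \<bar>t - s\<bar>) + ?m * (\<beta> * ?K)"
    unfolding sum.distrib by (rule add_mono[OF base later])
  also have "\<dots> = (?m + ?m * \<beta> * flux_lip n) * (norm f * \<bar>t - s\<bar>)" by (simp add: algebra_simps)
  also have "\<dots> \<le> flux_lip (Suc n) * (norm f * \<bar>t - s\<bar>)"
  proof (rule mult_right_mono)
    have "1 \<le> (1 + ?m * \<beta>) ^ n" using \<beta>_nonneg by simp
    then have "?m * 1 \<le> ?m * (1 + ?m * \<beta>) ^ n" by (intro mult_left_mono) auto
    then show "?m + ?m * \<beta> * flux_lip n \<le> flux_lip (Suc n)" by (simp add: flux_lip_def algebra_simps)
  qed simp
  finally show ?case by (simp add: mult.assoc)
qed

lemma flux_norm_increment_le: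
  assumes "s \<le> n / c_max" "t \<le> n / c_max"
  shows "norm (flux (prim f) j t - flux (prim f) j s) \<le> flux_lip n * norm f * \<bar>t - s\<bar>"
  using flux_lipschitz[of "{j}" s n t f] assms by simp

lemma continuous_flux: "continuous_on A (flux (prim f) j)"
proof (rule continuous_on_subset[OF _ subset_UNIV], rule continuous_at_imp_continuous_on, rule ballI)
  fix x :: real
  obtain n :: nat where n: "(x + 1) * c_max < n" using reals_Archimedean2 by blast
  then have xn: "x + 1 < n / c_max" using c_max_pos by (simp add: less_divide_eq)
  have "((\<lambda>y. flux_lip n * norm f * \<bar>y - x\<bar>) \<longlongrightarrow> flux_lip n * norm f * \<bar>x - x\<bar>) (at x)"
    by (intro tendsto_intros)
  then have lim: "((\<lambda>y. flux_lip n * norm f * \<bar>y - x\<bar>) \<longlongrightarrow> 0) (at x)" by simp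
  have "((\<lambda>y. flux (prim f) j y - flux (prim f) j x) \<longlongrightarrow> 0) (at x)"
  proof (rule Lim_null_comparison[OF _ lim])
    have "\<forall>\<^sub>F y in at x. dist y x < 1" by (rule eventually_at_ball[of 1 x UNIV, unfolded mem_ball dist_commute[of x], simplified])
    then show "\<forall>\<^sub>F y in at x. norm (flux (prim f) j y - flux (prim f) j x) \<le> flux_lip n * norm f * \<bar>y - x\<bar>"
    proof eventually_elim
      case (elim y)
      then show ?case using xn by (intro flux_norm_increment_le) (auto simp: dist_real_def)
    qed
  qed
  then show "isCont (flux (prim f) j) x" by (simp add: isCont_def LIM_zero_iff)
qed

text \<open>
  A number of time steps that suffices for all the times at which \<open>shift t\<close> needs the flux; an edge is
  crossed in a time of at most \<open>1 / c_min\<close>.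
\<close>

definition steps :: "real \<Rightarrow> nat" where "steps t = nat \<lceil>(t + 1 / c_min) * c_max\<rceil>"

lemma steps_bound:
  assumes "x \<le> 1" "0 \<le> t"
  shows "t + x / c j \<le> steps t / c_max"
proof -
  have "x / c j \<le> 1 / c j" using c_pos[of j] assms by (simp add: divide_right_mono)
  also have "\<dots> \<le> 1 / c_min" using c_min_pos c_min_le[of j] by (simp add: frac_le)
  finally have "t + x / c j \<le> t + 1 / c_min" by simp
  moreover have "(t + 1 / c_min) * c_max \<le> steps t" unfolding steps_def by linarith
  then have "t + 1 / c_min \<le> steps t / c_max" using c_max_pos by (simp add: le_divide_eq)
  ultimately show ?thesis by linarith
qed

text \<open>
  A bound for the operator norm of \<open>shift t\<close>.
\<close>

definition shift_bound :: "real \<Rightarrow> real" where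
  "shift_bound t = card (range c) * flux_lip (steps t)"

lemma shift_bound_nonneg: "0 \<le> shift_bound t"
  unfolding shift_bound_def using flux_lip_nonneg by simp

lemma shift_exists:
  assumes "0 \<le> t"
  shows "\<exists>g. norm g \<le> shift_bound t * norm f \<and>
    (\<forall>j. \<forall>x\<in>{0..1}. prim g j x = c j *\<^sub>R (flux (prim f) j (t + x / c j) - flux (prim f) j t))"
proof -
  let ?P = "\<lambda>j x. c j *\<^sub>R flux (prim f) j (t + x / c j)"
  have "(\<Sum>j<N. norm (?P j y - ?P j x)) \<le> shift_bound t * norm f * (y - x)"
    if xy: "x \<in> {0..1}" "y \<in> {0..1}" "x \<le> y" for N x y
  proof -
    have "(\<Sum>j<N. norm (?P j y - ?P j x)) \<le> card (range c) * (flux_lip (steps t) * norm f * (y - x))"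
    proof (rule sum_by_speeds)
      fix v A assume v: "v > 0" "finite A" "\<And>j. j \<in> A \<Longrightarrow> c j = v"
      show "(\<Sum>j\<in>A. norm (?P j y - ?P j x)) \<le> flux_lip (steps t) * norm f * (y - x)"
      proof (cases "A = {}")
        case False
        then obtain j0 where j0: "c j0 = v" using v(3) by auto
        have "(\<Sum>j\<in>A. norm (?P j y - ?P j x)) = (\<Sum>j\<in>A. v * norm (flux (prim f) j (t + y / v) - flux (prim f) j (t + x / v)))"
          using v by (intro sum.cong refl) (simp flip: scaleR_diff_right)
        also have "\<dots> = v * (\<Sum>j\<in>A. norm (flux (prim f) j (t + y / v) - flux (prim f) j (t + x / v)))"
          by (simp only: sum_distrib_left)
        also have "\<dots> \<le> v * (flux_lip (steps t) * norm f * \<bar>(t + y / v) - (t + x / v)\<bar>)"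
          using steps_bound[of x t j0] steps_bound[of y t j0] xy assms v(1) j0
          by (intro mult_left_mono flux_lipschitz v(2)) auto
        also have "(t + y / v) - (t + x / v) = (y - x) / v" by (simp add: diff_divide_distrib)
        also have "v * (flux_lip (steps t) * norm f * \<bar>(y - x) / v\<bar>) = flux_lip (steps t) * norm f * (y - x)"
          using v(1) xy by simp
        finally show ?thesis .
      qed (use xy flux_lip_nonneg in simp)
    qed (use xy flux_lip_nonneg in auto)
    then show ?thesis by (simp add: shift_bound_def mult.assoc)
  qed
  from lipschitz_is_prim[of ?P, OF this]
  obtain g where "\<And>j x. x \<in> {0..1} \<Longrightarrow> prim g j x = ?P j x - ?P j 0" "norm g \<le> shift_bound t * norm f"
    by blast
  then show ?thesis by (intro exI[of _ g]) (simp add: scaleR_diff_right)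
qed

text \<open>
  The semigroup shifts the flux in time and restricts it to the time that is needed to cross an edge.
  The condition on the primitives determines \<open>shift t f\<close>.
\<close>

definition shift :: "real \<Rightarrow> 'k l1 Linf \<Rightarrow> 'k l1 Linf" where
  "shift t f = (SOME g. norm g \<le> shift_bound t * norm f \<and>
    (\<forall>j. \<forall>x\<in>{0..1}. prim g j x = c j *\<^sub>R (flux (prim f) j (t + x / c j) - flux (prim f) j t)))"

lemma
  assumes "0 \<le> t"
  shows norm_shift_le: "norm (shift t f) \<le> shift_bound t * norm f"
    and prim_shift: "x \<in> {0..1} \<Longrightarrow> prim (shift t f) j x = c j *\<^sub>R (flux (prim f) j (t + x / c j) - flux (prim f) j t)"
  using someI_ex[OF shift_exists[OF assms, of f]] unfolding shift_def by blast+

lemma shift_in_space: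
  assumes "0 \<le> t" "f \<in> Linf_space (l1_space J)"
  shows "shift t f \<in> Linf_space (l1_space J)"
  unfolding Linf_space_l1_iff
proof (intro allI impI ballI)
  fix j and x :: real assume j: "j \<notin> J" and x: "x \<in> {0..1}"
  have "prim f j y = 0" for y
    using assms(2) j prim_outside[of f j y] by (simp add: Linf_space_l1_iff)
  then have "flux (prim f) j s = 0" for s by (subst flux_rec) (simp add: M_off[OF j])
  then show "prim (shift t f) j x = 0" using x assms(1) by (simp add: prim_shift)
qed

lemma shift_add: "0 \<le> t \<Longrightarrow> shift t (f + g) = shift t f + shift t g"
  by (rule Linf_eqI_prim) (simp add: prim_shift prim_add flux_add algebra_simps)

lemma shift_scale: "0 \<le> t \<Longrightarrow> shift t (Linf_scale a f) = Linf_scale a (shift t f)"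
  by (rule Linf_eqI_prim) (simp add: prim_shift prim_scale flux_scale flip: right_diff_distrib)

lemma shift_zero: "shift 0 f = f"
  by (rule Linf_eqI_prim) (simp add: prim_shift flux_nonpos flux_eq_prim[of _ f])

text \<open>
  The flux of the shifted distribution is the shifted flux, both starting at \<open>0\<close>.
\<close>

lemma flux_shift:
  assumes "0 \<le> s" "0 \<le> t"
  shows "flux (prim (shift s f)) j t = flux (prim f) j (s + t) - flux (prim f) j s"
  using assms(2)
proof (induction "prim f" j t rule: flux.induct)
  case (1 j t)
  show ?case
  proof (cases "t \<le> 0")
    case True
    then show ?thesis using 1(2) by (simp add: flux_nonpos)
  next
    case t: False
    show ?thesis
    proof (cases "t \<le> 1 / c j")
      case True
      then have "c j * t \<in> {0..1}" using t c_pos[of j] by (simp add: le_divide_eq mult.commute)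
      then show ?thesis using c_pos[of j] by (simp add: flux_initial[OF True] prim_shift[OF assms(1)])
    next
      case False
      then have "1 \<le> c j * t" using c_pos[of j] by (simp add: not_le divide_less_eq mult.commute)
      then have "prim (shift s f) j (c j * t) = prim (shift s f) j 1" by (rule prim_ge_1)
      also have "\<dots> = c j *\<^sub>R (flux (prim f) j (s + 1 / c j) - flux (prim f) j s)"
        by (rule prim_shift[OF assms(1)]) simp
      finally have p: "prim (shift s f) j (c j * t) = c j *\<^sub>R (flux (prim f) j (s + 1 / c j) - flux (prim f) j s)" .
      have IH: "flux (prim (shift s f)) l (t - 1 / c j) = flux (prim f) l (s + (t - 1 / c j)) - flux (prim f) l s"
        if "l \<in> {l. M j l \<noteq> 0}" for l
        using 1(1)[OF t that] False by simp
      have "flux (prim (shift s f)) j t = (flux (prim f) j (s + 1 / c j) - flux (prim f) j s)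
          + (\<Sum>l\<in>{l. M j l \<noteq> 0}. M j l * (flux (prim f) l (s + (t - 1 / c j)) - flux (prim f) l s))"
        using c_pos[of j] by (subst flux_rec) (simp add: p IH)
      moreover have "flux (prim f) j (s + t) - flux (prim f) j (s + 1 / c j)
          = (\<Sum>l\<in>{l. M j l \<noteq> 0}. M j l * (flux (prim f) l (s + (t - 1 / c j)) - flux (prim f) l s))"
        using flux_increment[of j "s + 1 / c j" "s + t" f] assms(1) False by (simp add: algebra_simps)
      ultimately show ?thesis by (simp add: diff_eq_eq)
    qed
  qed
qed

lemma shift_shift:
  assumes "0 \<le> s" "0 \<le> t"
  shows "shift (t + s) f = shift t (shift s f)"
proof (rule Linf_eqI_prim)
  fix j and x :: real assume x: "x \<in> {0..1}"
  then have "0 \<le> x / c j" using c_pos[of j] by simp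
  then show "prim (shift (t + s) f) j x = prim (shift t (shift s f)) j x"
    using x assms by (simp add: prim_shift flux_shift add_ac)
qed

lemma shift_bound_exponential:
  obtains K \<omega> where "K \<ge> 1" "\<And>t. 0 \<le> t \<Longrightarrow> shift_bound t \<le> K * exp (\<omega> * t)"
proof -
  define m where "m = real (card (range c))"
  define b where "b = 1 + m * \<beta>"
  have b: "1 \<le> b" unfolding b_def m_def using \<beta>_nonneg by simp
  define \<omega> where "\<omega> = ln b * c_max"
  define K where "K = m * m * exp (ln b * (c_max / c_min + 1)) + 1"
  have "shift_bound t \<le> K * exp (\<omega> * t)" if t: "0 \<le> t" for t
  proof -
    have "real (steps t) \<le> (t + 1 / c_min) * c_max + 1"
      unfolding steps_def using t c_min_pos c_max_pos by (auto intro!: of_int_ceiling_le_add_one)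
    then have "ln b * real (steps t) \<le> ln b * ((t + 1 / c_min) * c_max + 1)"
      using b by (intro mult_left_mono) auto
    also have "\<dots> = \<omega> * t + ln b * (c_max / c_min + 1)" by (simp add: \<omega>_def algebra_simps)
    finally have "exp (ln b * real (steps t)) \<le> exp (ln b * (c_max / c_min + 1)) * exp (\<omega> * t)"
      by (simp flip: exp_add add: add.commute)
    moreover have "b ^ steps t = exp (ln b * real (steps t))"
      using b by (simp add: exp_of_nat2_mult)
    ultimately have "b ^ steps t \<le> exp (ln b * (c_max / c_min + 1)) * exp (\<omega> * t)" by simp
    then have "(m * m) * b ^ steps t \<le> (m * m) * (exp (ln b * (c_max / c_min + 1)) * exp (\<omega> * t))"
      by (rule mult_left_mono) (simp add: m_def)
    also have "\<dots> \<le> K * exp (\<omega> * t)" by (simp add: K_def distrib_right mult.assoc)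
    finally show ?thesis by (simp add: shift_bound_def flux_lip_def b_def m_def mult.assoc)
  qed
  moreover have "K \<ge> 1" unfolding K_def m_def by simp
  ultimately show ?thesis using that by blast
qed

lemma shift_bound_mono: "s \<le> t \<Longrightarrow> shift_bound s \<le> shift_bound t"
proof -
  assume st: "s \<le> t"
  have "(s + 1 / c_min) * c_max \<le> (t + 1 / c_min) * c_max" using st c_max_pos by (intro mult_right_mono) auto
  then have "steps s \<le> steps t" unfolding steps_def by (intro nat_mono ceiling_mono)
  then have "flux_lip (steps s) \<le> flux_lip (steps t)"
    unfolding flux_lip_def using \<beta>_nonneg by (intro mult_left_mono power_increasing) auto
  then show ?thesis unfolding shift_bound_def by (rule mult_left_mono) simp
qed

lemma norm_shift_le_uniform: "0 \<le> s \<Longrightarrow> s \<le> t \<Longrightarrow> norm f \<le> K \<Longrightarrow> norm (shift s f) \<le> shift_bound t * K"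
  by (rule order_trans[OF norm_shift_le]) (auto intro!: mult_mono shift_bound_mono shift_bound_nonneg)

lemma shift_continuous:
  assumes f: "f \<in> Linf_space (l1_space J)" and t: "0 \<le> t"
  shows "limitin (weak_star J) (\<lambda>s. shift s f) (shift t f) (at t within {0..})"
proof (rule limitin_weak_star_if_prim_tendsto[where K = "shift_bound (t + 1) * norm f"])
  show "shift t f \<in> Linf_space (l1_space J)" by (rule shift_in_space[OF t f])
  have "\<forall>\<^sub>F s in at t within {0..}. s \<in> {0..} \<and> dist s t < 1"
    unfolding eventually_at by (intro exI[of _ 1]) auto
  then show "\<forall>\<^sub>F s in at t within {0..}. shift s f \<in> Linf_space (l1_space J) \<and> norm (shift s f) \<le> shift_bound (t + 1) * norm f"
    by eventually_elim (auto intro!: shift_in_space f norm_shift_le_uniform simp: dist_real_def)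
  fix j and x :: real assume x: "x \<in> {0..1}"
  have c: "continuous_on {0..} (\<lambda>s. c j *\<^sub>R (flux (prim f) j (s + x / c j) - flux (prim f) j s))"
    by (intro continuous_intros continuous_on_compose2[OF continuous_flux[of UNIV]] continuous_flux) auto
  have "((\<lambda>s. c j *\<^sub>R (flux (prim f) j (s + x / c j) - flux (prim f) j s)) \<longlongrightarrow> prim (shift t f) j x) (at t within {0..})"
    using c t x unfolding continuous_on_def by (simp add: prim_shift)
  then show "((\<lambda>s. prim (shift s f) j x) \<longlongrightarrow> prim (shift t f) j x) (at t within {0..})"
  proof (rule Lim_transform_eventually)
    have "\<forall>\<^sub>F s in at t within {0..}. s \<in> {0..}" by (simp add: eventually_at_filter)
    then show "\<forall>\<^sub>F s in at t within {0..}. c j *\<^sub>R (flux (prim f) j (s + x / c j) - flux (prim f) j s) = prim (shift s f) j x"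
      by eventually_elim (use x in \<open>simp add: prim_shift\<close>)
  qed
qed

text \<open>
  By the delay equation, pointwise convergence of the primitives to \<open>0\<close> carries over to the flux, uniformly
  on bounded time intervals.  Since every row of \<open>M\<close> is finite, each step involves only finitely many edges.
\<close>

lemma flux_uniform:
  assumes bd: "\<And>n. norm (f n) \<le> K" and lim: "\<And>j x. x \<in> {0..1} \<Longrightarrow> (\<lambda>n. prim (f n) j x) \<longlonglongrightarrow> 0"
    and e: "e > 0"
  shows "\<forall>\<^sub>F n in sequentially. \<forall>t\<le>real k / c_max. norm (flux (prim (f n)) j t) < e"
  using e
proof (induction k arbitrary: j e)
  case 0
  then show ?case by (simp add: flux_nonpos)
next
  case (Suc k)
  let ?A = "{l. M j l \<noteq> 0}"
  define B where "B = (\<Sum>l\<in>?A. norm (M j l)) + 1"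
  have B: "B > 0" unfolding B_def by (simp add: sum_nonneg add_nonneg_pos)
  have K0: "0 \<le> K" using bd norm_ge_zero order_trans by blast
  have "\<forall>\<^sub>F n in sequentially. \<forall>x\<in>{0..1}. norm (prim (f n) j x) < e / 2 * c j"
  proof (rule uniform_if_equilipschitz[where K = K])
    show "norm (prim (f n) j y - prim (f n) j x) \<le> K * \<bar>y - x\<bar>" for n x y
      by (rule order_trans[OF norm_prim_increment_le mult_right_mono[OF bd]]) simp
  qed (use lim Suc.prems c_pos in auto)
  moreover have "\<forall>\<^sub>F n in sequentially. \<forall>l\<in>?A. \<forall>t\<le>real k / c_max. norm (flux (prim (f n)) l t) < e / (2 * B)"
    by (rule eventually_ball_finite[OF row_finite]) (use Suc.IH Suc.prems B in auto)
  ultimately show ?case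
  proof eventually_elim
    case (elim n)
    show ?case
    proof (intro allI impI)
      fix t assume t: "t \<le> real (Suc k) / c_max"
      have p: "norm ((1 / c j) *\<^sub>R prim (f n) j (c j * t)) < e / 2"
      proof -
        have "norm (prim (f n) j (c j * t)) < e / 2 * c j"
          using elim(1) by (subst prim_outside) auto
        then show ?thesis using c_pos[of j] by (simp add: divide_less_eq)
      qed
      have "1 / c_max \<le> 1 / c j" using c_le_max[of j] c_pos[of j] by (simp add: frac_le)
      then have t': "t - 1 / c j \<le> k / c_max" using t by (simp add: add_divide_distrib)
      have "norm (\<Sum>l\<in>?A. M j l * flux (prim (f n)) l (t - 1 / c j)) \<le> (\<Sum>l\<in>?A. norm (M j l) * (e / (2 * B)))"
      proof (rule order_trans[OF norm_sum sum_mono])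
        fix l assume "l \<in> ?A"
        then have "norm (flux (prim (f n)) l (t - 1 / c j)) \<le> e / (2 * B)" using elim(2) t' less_imp_le by blast
        then show "norm (M j l * flux (prim (f n)) l (t - 1 / c j)) \<le> norm (M j l) * (e / (2 * B))"
          unfolding norm_mult by (rule mult_left_mono) simp
      qed
      also have "\<dots> = (B - 1) * (e / (2 * B))" unfolding sum_distrib_right[symmetric] by (simp add: B_def)
      also have "\<dots> \<le> B * (e / (2 * B))" using Suc.prems B by (intro mult_right_mono) auto
      also have "\<dots> = e / 2" using B by simp
      finally have "norm (\<Sum>l\<in>?A. M j l * flux (prim (f n)) l (t - 1 / c j)) \<le> e / 2" .
      with p have "norm ((1 / c j) *\<^sub>R prim (f n) j (c j * t)) + norm (\<Sum>l\<in>?A. M j l * flux (prim (f n)) l (t - 1 / c j)) < e"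
        by linarith
      then show "norm (flux (prim (f n)) j t) < e"
        by (subst flux_rec) (rule le_less_trans[OF norm_triangle_ineq])
    qed
  qed
qed

lemma shift_equicontinuous:
  assumes X: "\<And>n. f n \<in> Linf_space (l1_space J)" and bd: "\<And>n. norm (f n) \<le> K"
    and lim: "limitin (weak_star J) f 0 sequentially" and t0: "0 \<le> t0"
  shows "limitin (weak_star J) (\<lambda>(n, s). shift s (f n)) 0 (sequentially \<times>\<^sub>F principal {0..t0})"
proof (rule limitin_weak_star_if_prim_tendsto[where K = "shift_bound t0 * K"])
  show "(0 :: 'k l1 Linf) \<in> Linf_space (l1_space J)" by (simp add: Linf_space_l1_iff)
  have ev: "\<forall>\<^sub>F i in sequentially \<times>\<^sub>F principal {0..t0}. snd i \<in> {0..t0}"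
    unfolding eventually_prod_filter by (intro exI[of _ "\<lambda>_. True"] exI[of _ "\<lambda>s. s \<in> {0..t0}"]) (auto simp: eventually_principal)
  then show "\<forall>\<^sub>F i in sequentially \<times>\<^sub>F principal {0..t0}. (case i of (n, s) \<Rightarrow> shift s (f n)) \<in> Linf_space (l1_space J) \<and>
      norm (case i of (n, s) \<Rightarrow> shift s (f n)) \<le> shift_bound t0 * K"
    by eventually_elim (auto intro!: shift_in_space X norm_shift_le_uniform bd)
  fix j and x :: real assume x: "x \<in> {0..1}"
  have l0: "(\<lambda>n. prim (f n) i y) \<longlonglongrightarrow> 0" if "y \<in> {0..1}" for i y
  proof (cases "i \<in> J")
    case True
    then show ?thesis using prim_tendsto_if_limitin[OF lim, of i y] by simp
  next
    case False
    then have "prim (f n) i y = 0" for n using X[of n] that by (simp add: Linf_space_l1_iff)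
    then show ?thesis by simp
  qed
  show "((\<lambda>i. prim (case i of (n, s) \<Rightarrow> shift s (f n)) j x) \<longlongrightarrow> prim 0 j x) (sequentially \<times>\<^sub>F principal {0..t0})"
  proof (rule tendstoI)
    fix e :: real assume e: "e > 0"
    have "\<forall>\<^sub>F n in sequentially. \<forall>t\<le>steps t0 / c_max. norm (flux (prim (f n)) j t) < e / (2 * c j)"
      by (rule flux_uniform[OF bd l0]) (use e c_pos in auto)
    moreover have "dist (prim (shift s (f n)) j x) (prim 0 j x) < e"
      if small: "\<forall>t\<le>steps t0 / c_max. norm (flux (prim (f n)) j t) < e / (2 * c j)" and s: "s \<in> {0..t0}" for n s
    proof -
      have "s + x / c j \<le> steps t0 / c_max" "s \<le> steps t0 / c_max"
        using steps_bound[of x t0 j] steps_bound[of 0 t0 j] x s t0 by auto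
      then have "norm (flux (prim (f n)) j (s + x / c j)) < e / (2 * c j)" "norm (flux (prim (f n)) j s) < e / (2 * c j)"
        using small by blast+
      then have "norm (flux (prim (f n)) j (s + x / c j) - flux (prim (f n)) j s) < e / (2 * c j) + e / (2 * c j)"
        by (intro le_less_trans[OF norm_triangle_ineq4] add_strict_mono)
      also have "\<dots> = e / c j" by (simp add: field_simps)
      finally show ?thesis using c_pos[of j] x s by (simp add: prim_shift dist_norm less_divide_eq mult.commute)
    qed
    ultimately show "\<forall>\<^sub>F i in sequentially \<times>\<^sub>F principal {0..t0}. dist (prim (case i of (n, s) \<Rightarrow> shift s (f n)) j x) (prim 0 j x) < e"
      unfolding eventually_prod_filter
      by (intro exI[of _ "\<lambda>n. \<forall>t\<le>steps t0 / c_max. norm (flux (prim (f n)) j t) < e / (2 * c j)"] exI[of _ "\<lambda>s. s \<in> {0..t0}"])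
        (auto simp: eventually_principal)
  qed
qed

end

section \<open>The generator of the shift semigroup\<close>

lemma integral_difference_quotient_tendsto:
  fixes F :: "real \<Rightarrow> 'b::banach"
  assumes F: "continuous_on UNIV F" and b: "0 \<le> b"
  shows "((\<lambda>t. integral {0..b} (\<lambda>s. (F (s + t) - F s) /\<^sub>R t)) \<longlongrightarrow> F b - F 0) (at_right 0)"
proof (rule Lim_transform_eventually)
  show "((\<lambda>t. integral {b..b + t} F /\<^sub>R t - integral {0..0 + t} F /\<^sub>R t) \<longlongrightarrow> F b - F 0) (at_right 0)"
    by (intro tendsto_diff integral_average_tendsto F)
  have "\<forall>\<^sub>F t in at_right 0. t \<in> {0<..<(1::real)}" by (rule eventually_at_right_real) simp
  then show "\<forall>\<^sub>F t in at_right 0. integral {b..b + t} F /\<^sub>R t - integral {0..0 + t} F /\<^sub>R t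
      = integral {0..b} (\<lambda>s. (F (s + t) - F s) /\<^sub>R t)"
  proof eventually_elim
    case (elim t)
    then have t: "0 < t" by simp
    have int: "F integrable_on {x..y}" for x y
      by (rule integrable_continuous_real) (rule continuous_on_subset[OF F], simp)
    have "continuous_on {0..b} (\<lambda>s. F (s + t))"
      by (rule continuous_on_compose2[OF F]) (auto intro!: continuous_intros)
    then have i1: "(\<lambda>s. F (s + t)) integrable_on {0..b}" by (rule integrable_continuous_real)
    have "integral {0..b} (\<lambda>s. (F (s + t) - F s) /\<^sub>R t) = integral {0..b} (\<lambda>s. F (s + t) - F s) /\<^sub>R t"
      by simp
    also have "integral {0..b} (\<lambda>s. F (s + t) - F s) = integral {0..b} (\<lambda>s. F (s + t)) - integral {0..b} F"
      by (rule Henstock_Kurzweil_Integration.integral_diff[OF i1 int])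
    also have "integral {0..b} (\<lambda>s. F (s + t)) = integral {t..b + t} F"
      using integral_shift_real_ivl[of t t "b + t" F] by simp
    also have "integral {t..b + t} F - integral {0..b} F = integral {b..b + t} F - integral {0..t} F"
      using Henstock_Kurzweil_Integration.integral_combine[of 0 t "b + t" F, OF _ _ int]
        Henstock_Kurzweil_Integration.integral_combine[of 0 b "b + t" F, OF _ _ int] t b
      by (simp add: algebra_simps)
    finally show ?case by (simp add: scaleR_diff_right)
  qed
qed

lemma prim_all_if_prim_unit:
  assumes "\<And>x. x \<in> {0..1} \<Longrightarrow> prim g j x = r *\<^sub>R prim h j x"
  shows "prim g j x = r *\<^sub>R prim h j x"
proof -
  have "prim g j x = prim g j (max 0 (min 1 x))" by (rule prim_outside)
  also have "\<dots> = r *\<^sub>R prim h j (max 0 (min 1 x))" by (rule assms) auto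
  also have "\<dots> = r *\<^sub>R prim h j x" using prim_outside[of h j x] by simp
  finally show ?thesis .
qed

lemma integrable_prim: "prim h j integrable_on {x..y}"
  by (rule integrable_continuous_real[OF continuous_on_prim_UNIV])

lemma primitive_prim: "x \<in> {0..1} \<Longrightarrow> primitive (prim h j) x = integral {0..x} (prim h j)"
  by (rule primitive_eq_integral[OF integrable_unit_interval_continuous(1)[OF continuous_on_prim]])

lemma integral_prim_beyond:
  assumes "1 \<le> x"
  shows "integral {0..x} (prim h j) = integral {0..1} (prim h j) + (x - 1) *\<^sub>R prim h j 1"
proof -
  have "integral {1..x} (prim h j) = integral {1..x} (\<lambda>_. prim h j 1)"
    by (rule Henstock_Kurzweil_Integration.integral_cong) (rule prim_ge_1, simp)
  then show ?thesis
    using Henstock_Kurzweil_Integration.integral_combine[of 0 1 x "prim h j", OF _ assms integrable_prim] assms by simp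
qed

lemma has_integral_prim_stretch:
  assumes "0 < r" "0 \<le> t"
  shows "((\<lambda>s. prim h j (r * s)) has_integral (1 / r) *\<^sub>R integral {0..r * t} (prim h j)) {0..t}"
proof -
  have "((\<lambda>s. prim h j (r * s)) has_integral (1 / \<bar>r\<bar>) *\<^sub>R integral {0..r * t} (prim h j)) ((\<lambda>x. x / r) ` {0..r * t})"
    by (rule has_integral_stretch_real[OF integrable_integral[OF integrable_prim]]) (use assms in simp)
  moreover have "(\<lambda>x. x / r) ` {0..r * t} = {0..t}"
  proof (intro equalityI subsetI)
    fix x assume "x \<in> {0..t}"
    then show "x \<in> (\<lambda>x. x / r) ` {0..r * t}"
      using assms by (intro image_eqI[of _ _ "r * x"]) auto
  qed (use assms in \<open>auto simp: divide_le_eq mult.commute\<close>)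
  ultimately show ?thesis using assms by simp
qed

context delay_network
begin

lemma integral_flux_delayed:
  assumes "0 < d" "0 \<le> t"
  shows "integral {0..t} (\<lambda>s. flux (prim g) l (s - d)) = integral {0..t - d} (flux (prim g) l)"
proof -
  let ?w = "flux (prim g) l"
  have int: "?w integrable_on {x..y}" for x y by (rule integrable_continuous_real[OF continuous_flux])
  have shift: "integral {0..t} (\<lambda>s. ?w (s - d)) = integral {- d..t - d} ?w"
    using integral_shift_real_ivl[of "- d" "- d" "t - d" ?w] by simp
  have neg: "integral {- d..x} ?w = 0" if "x \<le> 0" for x
  proof -
    have "integral {- d..x} ?w = integral {- d..x} (\<lambda>_. 0)"
      by (rule Henstock_Kurzweil_Integration.integral_cong) (use that in \<open>auto intro: flux_nonpos\<close>)
    then show ?thesis by simp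
  qed
  show ?thesis
  proof (cases "t \<le> d")
    case True
    then have "integral {0..t - d} ?w = 0" by (cases "t = d") auto
    then show ?thesis using shift neg[of "t - d"] True by simp
  next
    case False
    then show ?thesis
      using shift neg[of 0] assms
        Henstock_Kurzweil_Integration.integral_combine[of "- d" 0 "t - d" ?w, OF _ _ int] by simp
  qed
qed

text \<open>
  Let the initial distribution \<open>f\<close> be Lipschitz continuous, with values \<open>a\<close> at \<open>0\<close>, and satisfy the coupling
  conditions.  Then the density leaving edge \<open>j\<close> at time \<open>t\<close> is \<open>a j\<close> plus the flux of the image \<open>g = c f'\<close> of
  \<open>f\<close> under the generator.
\<close>

lemma flux_eq_integral:
  assumes lip: "is_lipschitz_with f a h"
    and g: "\<And>j x. prim g j x = c j *\<^sub>R prim h j x"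
    and coupling: "\<And>j. a j + prim h j 1 = (\<Sum>l\<in>{l. M j l \<noteq> 0}. M j l * a l)"
    and "0 \<le> t"
  shows "flux (prim f) j t = t *\<^sub>R a j + integral {0..t} (flux (prim g) j)"
  using assms(4)
proof (induction "prim f" j t rule: flux.induct)
  case (1 j t)
  show ?case
  proof (cases "t \<le> 0")
    case True
    with 1(2) have "t = 0" by simp
    then show ?thesis by (simp add: flux_nonpos)
  next
    case t: False
    let ?A = "{l. M j l \<noteq> 0}"
    let ?I = "\<lambda>l t. integral {0..t} (flux (prim g) l)"
    have cj: "0 < c j" by (rule c_pos)
    have w: "flux (prim g) j s = prim h j (c j * s) + (\<Sum>l\<in>?A. M j l * flux (prim g) l (s - 1 / c j))" for s
      using cj by (subst flux_rec) (simp add: g)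
    have "((\<lambda>s. prim h j (c j * s) + (\<Sum>l\<in>?A. M j l * flux (prim g) l (s - 1 / c j)))
        has_integral (1 / c j) *\<^sub>R integral {0..c j * t} (prim h j) + (\<Sum>l\<in>?A. M j l * ?I l (t - 1 / c j))) {0..t}"
    proof (intro has_integral_add has_integral_sum has_integral_mult_right row_finite)
      show "((\<lambda>s. prim h j (c j * s)) has_integral (1 / c j) *\<^sub>R integral {0..c j * t} (prim h j)) {0..t}"
        by (rule has_integral_prim_stretch) (use cj t in auto)
      fix l
      have "continuous_on {0..t} (\<lambda>s. flux (prim g) l (s - 1 / c j))"
        by (rule continuous_on_compose2[OF continuous_flux[of UNIV]]) (auto intro!: continuous_intros)
      then have "((\<lambda>s. flux (prim g) l (s - 1 / c j)) has_integral integral {0..t} (\<lambda>s. flux (prim g) l (s - 1 / c j))) {0..t}"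
        by (rule integrable_integral[OF integrable_continuous_real])
      then show "((\<lambda>s. flux (prim g) l (s - 1 / c j)) has_integral ?I l (t - 1 / c j)) {0..t}"
        using t cj by (simp add: integral_flux_delayed)
    qed
    then have I: "?I j t = (1 / c j) *\<^sub>R integral {0..c j * t} (prim h j) + (\<Sum>l\<in>?A. M j l * ?I l (t - 1 / c j))"
      by (simp add: w[abs_def] integral_unique)
    have pf: "prim f j x = x *\<^sub>R a j + integral {0..x} (prim h j)" if "x \<in> {0..1}" for x
      using lip that primitive_prim[OF that, of h j] by (simp add: is_lipschitz_with_def)
    show ?thesis
    proof (cases "t \<le> 1 / c j")
      case True
      have "c j * t \<in> {0..1}" using True t cj by (simp add: le_divide_eq mult.commute)
      moreover have "?I l (t - 1 / c j) = 0" for l using True by (cases "t = 1 / c j") auto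
      ultimately show ?thesis
        using cj by (simp add: flux_initial[OF True] pf I scaleR_add_right)
    next
      case False
      then have ct: "1 \<le> c j * t" and d: "0 \<le> t - 1 / c j"
        using cj by (simp_all add: not_le divide_less_eq mult.commute less_imp_le)
      have IH: "flux (prim f) l (t - 1 / c j) = (t - 1 / c j) *\<^sub>R a l + ?I l (t - 1 / c j)" if "l \<in> ?A" for l
        by (rule 1(1)[OF t that d])
      have "flux (prim f) j t = (1 / c j) *\<^sub>R prim f j 1 + (\<Sum>l\<in>?A. M j l * flux (prim f) l (t - 1 / c j))"
        using prim_ge_1[OF ct, of f j] by (subst flux_rec) simp
      also have "(\<Sum>l\<in>?A. M j l * flux (prim f) l (t - 1 / c j))
          = (t - 1 / c j) *\<^sub>R (\<Sum>l\<in>?A. M j l * a l) + (\<Sum>l\<in>?A. M j l * ?I l (t - 1 / c j))"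
        by (simp add: IH distrib_left sum.distrib scaleR_sum_right)
      finally have L: "flux (prim f) j t = (1 / c j) *\<^sub>R (a j + integral {0..1} (prim h j))
          + (t - 1 / c j) *\<^sub>R (a j + prim h j 1) + (\<Sum>l\<in>?A. M j l * ?I l (t - 1 / c j))"
        by (simp add: pf coupling)
      have R: "?I j t = (1 / c j) *\<^sub>R integral {0..1} (prim h j) + (t - 1 / c j) *\<^sub>R prim h j 1
          + (\<Sum>l\<in>?A. M j l * ?I l (t - 1 / c j))"
      proof -
        have "(1 / c j) * (c j * t - 1) = t - 1 / c j" using cj by (simp add: right_diff_distrib)
        then show ?thesis unfolding I integral_prim_beyond[OF ct] scaleR_add_right scaleR_scaleR by simp
      qed
      have "(1 / c j) *\<^sub>R a j + (t - 1 / c j) *\<^sub>R a j = t *\<^sub>R a j" by (simp flip: scaleR_add_left)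
      then show ?thesis unfolding L R by (simp add: scaleR_add_right algebra_simps)
    qed
  qed
qed

lemma prim_shift_minus_eq_integral:
  assumes lip: "is_lipschitz_with f a h"
    and g: "\<And>j x. prim g j x = c j *\<^sub>R prim h j x"
    and coupling: "\<And>j. a j + prim h j 1 = (\<Sum>l\<in>{l. M j l \<noteq> 0}. M j l * a l)"
    and t: "0 \<le> t" and x: "x \<in> {0..1}"
  shows "prim (shift t f - f) j x
    = integral {0..t} (\<lambda>s. c j *\<^sub>R (flux (prim g) j (s + x / c j) - flux (prim g) j s))"
proof -
  let ?w = "flux (prim g) j" and ?d = "x / c j"
  have d: "0 \<le> ?d" using x c_pos[of j] by simp
  have int: "?w integrable_on {x..y}" for x y by (rule integrable_continuous_real[OF continuous_flux])
  have F: "flux (prim f) j r = r *\<^sub>R a j + integral {0..r} ?w" if "0 \<le> r" for r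
    by (rule flux_eq_integral[OF lip g coupling that])
  have "prim (shift t f - f) j x = c j *\<^sub>R (flux (prim f) j (t + ?d) - flux (prim f) j t - flux (prim f) j ?d)"
    using t x by (simp add: prim_diff prim_shift flux_eq_prim[OF x, of f] scaleR_diff_right)
  also have "flux (prim f) j (t + ?d) - flux (prim f) j t - flux (prim f) j ?d
      = integral {0..t + ?d} ?w - integral {0..?d} ?w - integral {0..t} ?w"
    using t d by (simp add: F algebra_simps)
  also have "\<dots> = integral {?d..t + ?d} ?w - integral {0..t} ?w"
    using Henstock_Kurzweil_Integration.integral_combine[of 0 ?d "t + ?d" ?w, OF _ _ int] d t
    by (simp add: algebra_simps flip: eq_diff_eq)
  also have "integral {?d..t + ?d} ?w = integral {0..t} (\<lambda>s. ?w (s + ?d))"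
    using integral_shift_real_ivl[of ?d ?d "t + ?d" ?w] by simp
  also have "integral {0..t} (\<lambda>s. ?w (s + ?d)) - integral {0..t} ?w = integral {0..t} (\<lambda>s. ?w (s + ?d) - ?w s)"
  proof (rule Henstock_Kurzweil_Integration.integral_diff[OF _ int, symmetric])
    have "continuous_on {0..t} (\<lambda>s. ?w (s + ?d))"
      by (rule continuous_on_compose2[OF continuous_flux[of UNIV]]) (auto intro!: continuous_intros)
    then show "(\<lambda>s. ?w (s + ?d)) integrable_on {0..t}" by (rule integrable_continuous_real)
  qed
  finally show ?thesis by simp
qed

lemma continuous_flux_difference:
  "continuous_on A (\<lambda>s. c j *\<^sub>R (flux (prim g) j (s + x / c j) - flux (prim g) j s))"
  by (intro continuous_intros continuous_on_compose2[OF continuous_flux[of UNIV]] continuous_flux) auto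

text \<open>
  The difference \<open>shift t f - f\<close> is the integral of \<open>shift s g\<close> over \<open>{0..t}\<close>.
\<close>

lemma norm_shift_minus_le:
  assumes lip: "is_lipschitz_with f a h"
    and g: "\<And>j x. prim g j x = c j *\<^sub>R prim h j x"
    and coupling: "\<And>j. a j + prim h j 1 = (\<Sum>l\<in>{l. M j l \<noteq> 0}. M j l * a l)"
    and t: "0 \<le> t" "t \<le> 1"
  shows "norm (shift t f - f) \<le> shift_bound 1 * norm g * t"
proof (rule norm_Linf_le_if_prim_increment_le)
  fix N and x y :: real assume xy: "x \<in> {0..1}" "y \<in> {0..1}" "x \<le> y"
  let ?u = "\<lambda>j x s. c j *\<^sub>R (flux (prim g) j (s + x / c j) - flux (prim g) j s)"
  have int: "?u j x integrable_on {0..t}" for j x by (rule integrable_continuous_real[OF continuous_flux_difference])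
  have intd: "(\<lambda>s. norm (?u j y s - ?u j x s)) integrable_on {0..t}" for j
    by (rule integrable_continuous_real) (intro continuous_on_norm continuous_on_diff continuous_flux_difference)
  have "(\<Sum>j<N. norm (prim (shift t f - f) j y - prim (shift t f - f) j x))
      \<le> (\<Sum>j<N. integral {0..t} (\<lambda>s. norm (?u j y s - ?u j x s)))"
  proof (rule sum_mono)
    fix j
    have "prim (shift t f - f) j y - prim (shift t f - f) j x = integral {0..t} (\<lambda>s. ?u j y s - ?u j x s)"
      unfolding prim_shift_minus_eq_integral[OF lip g coupling t(1) xy(1)] prim_shift_minus_eq_integral[OF lip g coupling t(1) xy(2)]
      by (rule Henstock_Kurzweil_Integration.integral_diff[OF int int, symmetric])
    then show "norm (prim (shift t f - f) j y - prim (shift t f - f) j x) \<le> integral {0..t} (\<lambda>s. norm (?u j y s - ?u j x s))"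
      using Henstock_Kurzweil_Integration.integral_norm_bound_integral[OF Henstock_Kurzweil_Integration.integrable_diff[OF int int] intd, of j y j x] by simp
  qed
  also have "\<dots> = integral {0..t} (\<lambda>s. \<Sum>j<N. norm (?u j y s - ?u j x s))"
    by (rule Henstock_Kurzweil_Integration.integral_sum[symmetric]) (auto intro: intd)
  also have "\<dots> \<le> integral {0..t} (\<lambda>s. shift_bound 1 * norm g * (y - x))"
  proof (rule integral_le)
    show "(\<lambda>s. \<Sum>j<N. norm (?u j y s - ?u j x s)) integrable_on {0..t}"
      by (rule integrable_sum) (auto intro: intd)
    fix s assume s: "s \<in> {0..t}"
    then have "(\<Sum>j<N. norm (?u j y s - ?u j x s)) = (\<Sum>j<N. norm (prim (shift s g) j y - prim (shift s g) j x))"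
      using xy by (intro sum.cong refl) (simp add: prim_shift)
    also have "\<dots> \<le> norm (shift s g) * (y - x)" using sum_norm_prim_increment_le[of "shift s g" y x N] xy by simp
    also have "\<dots> \<le> shift_bound 1 * norm g * (y - x)"
      using s t xy by (intro mult_right_mono norm_shift_le_uniform) auto
    finally show "(\<Sum>j<N. norm (?u j y s - ?u j x s)) \<le> shift_bound 1 * norm g * (y - x)" .
  qed (rule integrable_const_ivl)
  also have "\<dots> = shift_bound 1 * norm g * t * (y - x)" using t by (subst integral_const_real) simp
  finally show "(\<Sum>j<N. norm (prim (shift t f - f) j y - prim (shift t f - f) j x)) \<le> shift_bound 1 * norm g * t * (y - x)" .
qed

lemma shift_generator:
  assumes lip: "is_lipschitz_with f a h" and f: "f \<in> Linf_space (l1_space J)"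
    and g: "\<And>j x. prim g j x = c j *\<^sub>R prim h j x" and gX: "g \<in> Linf_space (l1_space J)"
    and coupling: "\<And>j. a j + prim h j 1 = (\<Sum>l\<in>{l. M j l \<noteq> 0}. M j l * a l)"
  shows "limitin (weak_star J) (\<lambda>t. (shift t f - f) /\<^sub>R t) g (at_right 0)"
proof (rule limitin_weak_star_if_prim_tendsto[where K = "shift_bound 1 * norm g", OF gX])
  have ev: "\<forall>\<^sub>F t in at_right 0. t \<in> {0<..<(1::real)}" by (rule eventually_at_right_real) simp
  then show "\<forall>\<^sub>F t in at_right 0. (shift t f - f) /\<^sub>R t \<in> Linf_space (l1_space J) \<and> norm ((shift t f - f) /\<^sub>R t) \<le> shift_bound 1 * norm g"
  proof eventually_elim
    case (elim t)
    have "shift t f - f \<in> Linf_space (l1_space J)" using elim f by (intro Linf_space_l1_diff shift_in_space) auto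
    then have "(shift t f - f) /\<^sub>R t \<in> Linf_space (l1_space J)" by (simp add: Linf_space_l1_iff prim_scaleR)
    moreover have "norm (shift t f - f) / t \<le> shift_bound 1 * norm g"
      using norm_shift_minus_le[OF lip g coupling, of t] elim by (simp add: divide_le_eq)
    ultimately show ?case using elim by (simp add: divide_inverse_commute)
  qed
  fix j and x :: real assume x: "x \<in> {0..1}"
  let ?u = "\<lambda>s. c j *\<^sub>R (flux (prim g) j (s + x / c j) - flux (prim g) j s)"
  have "((\<lambda>t. integral {0..0 + t} ?u /\<^sub>R t) \<longlongrightarrow> ?u 0) (at_right 0)"
    by (rule integral_average_tendsto[OF continuous_flux_difference])
  moreover have "?u 0 = prim g j x" by (simp add: flux_nonpos flux_eq_prim[OF x])
  ultimately have "((\<lambda>t. integral {0..t} ?u /\<^sub>R t) \<longlongrightarrow> prim g j x) (at_right 0)" by simp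
  then show "((\<lambda>t. prim ((shift t f - f) /\<^sub>R t) j x) \<longlongrightarrow> prim g j x) (at_right 0)"
  proof (rule Lim_transform_eventually)
    show "\<forall>\<^sub>F t in at_right 0. integral {0..t} ?u /\<^sub>R t = prim ((shift t f - f) /\<^sub>R t) j x"
      using ev by eventually_elim
        (use x in \<open>simp only: prim_scaleR prim_shift_minus_eq_integral[OF lip g coupling] greaterThanLessThan_iff less_imp_le\<close>)
  qed
qed

text \<open>
  Conversely, averaging the difference quotients over an edge shows that the flux at time \<open>0\<close> has a
  derivative \<open>a\<close>; then the flux is differentiable along the edge, and comparing both ends of
  the edges gives the coupling conditions.
\<close>

lemma shift_generator_converse:
  assumes f: "f \<in> Linf_space (l1_space J)"
    and lim: "limitin (weak_star J) (\<lambda>t. (shift t f - f) /\<^sub>R t) g (at_right 0)"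
    and bd: "\<And>t. 0 < t \<Longrightarrow> t \<le> 1 \<Longrightarrow> norm (shift t f - f) \<le> K * t"
  obtains a h where "is_lipschitz_with f a h" "h \<in> Linf_space (l1_space J)"
    "\<And>j x. prim g j x = c j *\<^sub>R prim h j x"
    "\<And>j. a j + prim h j 1 = (\<Sum>l\<in>{l. M j l \<noteq> 0}. M j l * a l)"
proof -
  have gX: "g \<in> Linf_space (l1_space J)" using lim unfolding limitin_weak_star_iff by blast
  define \<tau> where "\<tau> n = 1 / real (Suc n)" for n
  have \<tau>: "0 < \<tau> n" "\<tau> n \<le> 1" for n by (simp_all add: \<tau>_def)
  have \<tau>0: "filterlim \<tau> (at_right 0) sequentially"
    unfolding filterlim_at using LIMSEQ_inverse_real_of_nat \<tau>(1) by (auto simp: \<tau>_def[abs_def] inverse_eq_divide)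
  let ?F = "\<lambda>j. flux (prim f) j"
  define V where "V n j s = (?F j (s + \<tau> n) - ?F j s) /\<^sub>R \<tau> n" for n j s
  define v where "v j s = (1 / c j) *\<^sub>R prim g j (c j * s)" for j s
  have quot: "prim ((shift (\<tau> n) f - f) /\<^sub>R \<tau> n) j x = c j *\<^sub>R (V n j (x / c j) - V n j 0)" if "x \<in> {0..1}" for n j x
    using that \<tau>[of n]
    by (simp add: prim_scaleR prim_diff prim_shift less_imp_le V_def flux_nonpos flux_eq_prim[OF that, of f]
        scaleR_diff_right add.commute[of _ "\<tau> n"] mult.commute[of _ "c j"])
  have lim_prim: "(\<lambda>n. prim ((shift (\<tau> n) f - f) /\<^sub>R \<tau> n) j x) \<longlonglongrightarrow> prim g j x" if x: "x \<in> {0..1}" for j x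
  proof (cases "j \<in> J")
    case True
    from filterlim_compose[OF prim_tendsto_if_limitin[OF lim True] \<tau>0] show ?thesis .
  next
    case False
    have "shift (\<tau> n) f - f \<in> Linf_space (l1_space J)" for n
      using f \<tau>[of n] by (intro Linf_space_l1_diff shift_in_space) auto
    then have "prim ((shift (\<tau> n) f - f) /\<^sub>R \<tau> n) j x = 0" for n
      using False x by (simp add: Linf_space_l1_iff prim_scaleR)
    moreover have "prim g j x = 0" using gX False x by (simp add: Linf_space_l1_iff)
    ultimately show ?thesis by simp
  qed
  have on_edge: "c j * s \<in> {0..1}" "s = c j * s / c j" if "s \<in> {0..1 / c j}" for j s
    using that c_pos[of j] by (auto simp: le_divide_eq mult.commute)
  have V_lim: "(\<lambda>n. V n j s - V n j 0) \<longlonglongrightarrow> v j s" if s: "s \<in> {0..1 / c j}" for j s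
  proof -
    have "(\<lambda>n. (1 / c j) *\<^sub>R prim ((shift (\<tau> n) f - f) /\<^sub>R \<tau> n) j (c j * s)) \<longlonglongrightarrow> v j s"
      unfolding v_def by (intro tendsto_intros lim_prim on_edge(1)[OF s])
    then show ?thesis
      unfolding quot[OF on_edge(1)[OF s]] using c_pos[of j] by simp
  qed
  \<comment> \<open>the difference quotients are bounded by assumption, so dominated convergence applies below\<close>
  have V_bd: "norm (V n j s - V n j 0) \<le> K / c j" if s: "s \<in> {0..1 / c j}" for n j s
  proof -
    have "norm (c j *\<^sub>R (V n j s - V n j 0)) \<le> norm ((shift (\<tau> n) f - f) /\<^sub>R \<tau> n)"
      using norm_prim_le[OF on_edge(1)[OF s], of "(shift (\<tau> n) f - f) /\<^sub>R \<tau> n" j]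
      unfolding quot[OF on_edge(1)[OF s]] using c_pos[of j] by simp
    also have "\<dots> = norm (shift (\<tau> n) f - f) / \<tau> n" using \<tau>(1)[of n] by (simp add: divide_inverse_commute)
    also have "\<dots> \<le> K" using bd[OF \<tau>, of n] \<tau>(1)[of n] by (simp add: divide_le_eq)
    finally show ?thesis using c_pos[of j] by (simp add: le_divide_eq mult.commute)
  qed
  have Vc: "continuous_on A (V n j)" for A n j
    unfolding V_def
    by (intro continuous_intros continuous_on_compose2[OF continuous_flux[of UNIV]] continuous_flux) auto
  have Vi: "V n j integrable_on {x..y}" for n j x y by (rule integrable_continuous_real[OF Vc])
  have avg: "(\<lambda>n. integral {0..s} (V n j)) \<longlonglongrightarrow> ?F j s" if "0 \<le> s" for j s
    using filterlim_compose[OF integral_difference_quotient_tendsto[OF continuous_flux that] \<tau>0]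
    by (simp add: V_def[abs_def] flux_nonpos)
  have dc: "(\<lambda>n. integral {0..s} (V n j) - s *\<^sub>R V n j 0) \<longlonglongrightarrow> integral {0..s} (v j)" if s: "s \<in> {0..1 / c j}" for j s
  proof -
    have "(\<lambda>n. integral {0..s} (\<lambda>r. V n j r - V n j 0)) \<longlonglongrightarrow> integral {0..s} (v j)"
    proof (rule dominated_convergence(2)[where h = "\<lambda>_. K / c j"])
      show "(\<lambda>r. V n j r - V n j 0) integrable_on {0..s}" for n
        by (rule integrable_continuous_real) (intro continuous_intros Vc)
    qed (use s in \<open>auto intro: V_bd V_lim\<close>)
    moreover have "integral {0..s} (\<lambda>r. V n j r - V n j 0) = integral {0..s} (V n j) - s *\<^sub>R V n j 0" for n
      using s Henstock_Kurzweil_Integration.integral_diff[OF Vi[of n j 0 s], of "\<lambda>_. V n j 0"] by (simp add: integrable_const_ivl)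
    ultimately show ?thesis by simp
  qed
  \<comment> \<open>the averages of \<open>V n j\<close> and of \<open>V n j - V n j 0\<close> over the edge converge, hence so does \<open>V n j 0\<close>\<close>
  define a where "a j = c j *\<^sub>R (?F j (1 / c j) - integral {0..1 / c j} (v j))" for j
  have V0: "(\<lambda>n. V n j 0) \<longlonglongrightarrow> a j" for j
  proof -
    have "1 / c j \<in> {0..1 / c j}" using c_pos[of j] by simp
    from tendsto_diff[OF avg[of "1 / c j" j] dc[OF this]] this
    have "(\<lambda>n. c j *\<^sub>R ((1 / c j) *\<^sub>R V n j 0)) \<longlonglongrightarrow> a j"
      unfolding a_def by (intro tendsto_scaleR tendsto_const) simp
    then show ?thesis using c_pos[of j] by simp
  qed
  have F: "?F j s = s *\<^sub>R a j + integral {0..s} (v j)" if s: "s \<in> {0..1 / c j}" for j s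
  proof -
    have "(\<lambda>n. (integral {0..s} (V n j) - s *\<^sub>R V n j 0) + s *\<^sub>R V n j 0) \<longlonglongrightarrow> integral {0..s} (v j) + s *\<^sub>R a j"
      by (intro tendsto_intros dc[OF s] V0)
    then have "(\<lambda>n. integral {0..s} (V n j)) \<longlonglongrightarrow> integral {0..s} (v j) + s *\<^sub>R a j" by simp
    moreover have "(\<lambda>n. integral {0..s} (V n j)) \<longlonglongrightarrow> ?F j s" using s by (intro avg) simp
    ultimately show ?thesis using LIMSEQ_unique by (metis add.commute)
  qed
  have "(\<Sum>j<N. norm ((1 / c j) *\<^sub>R prim g j y - (1 / c j) *\<^sub>R prim g j x)) \<le> norm g / c_min * (y - x)"
    if xy: "x \<in> {0..1}" "y \<in> {0..1}" "x \<le> y" for N x y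
  proof -
    have "(\<Sum>j<N. norm ((1 / c j) *\<^sub>R prim g j y - (1 / c j) *\<^sub>R prim g j x)) \<le> (\<Sum>j<N. (1 / c_min) * norm (prim g j y - prim g j x))"
    proof (rule sum_mono)
      fix j
      have "norm ((1 / c j) *\<^sub>R prim g j y - (1 / c j) *\<^sub>R prim g j x) = (1 / c j) * norm (prim g j y - prim g j x)"
        using c_pos[of j] by (simp flip: scaleR_diff_right)
      also have "\<dots> \<le> (1 / c_min) * norm (prim g j y - prim g j x)"
        using c_min_pos c_min_le[of j] by (intro mult_right_mono) (auto simp: frac_le)
      finally show "norm ((1 / c j) *\<^sub>R prim g j y - (1 / c j) *\<^sub>R prim g j x) \<le> (1 / c_min) * norm (prim g j y - prim g j x)" .
    qed
    also have "\<dots> = (1 / c_min) * (\<Sum>j<N. norm (prim g j y - prim g j x))" by (simp only: sum_distrib_left)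
    also have "\<dots> \<le> (1 / c_min) * (norm g * (y - x))"
      using sum_norm_prim_increment_le[of g y x N] xy c_min_pos by (intro mult_left_mono) auto
    finally show ?thesis by simp
  qed
  from lipschitz_is_prim[of "\<lambda>j x. (1 / c j) *\<^sub>R prim g j x", OF this]
  obtain h where h0: "\<And>j x. x \<in> {0..1} \<Longrightarrow> prim h j x = (1 / c j) *\<^sub>R prim g j x - (1 / c j) *\<^sub>R prim g j 0"
    by metis
  then have h: "prim h j x = (1 / c j) *\<^sub>R prim g j x" if "x \<in> {0..1}" for j x
    using that by (simp add: prim_eq_0)
  have ha: "prim h j x = (1 / c j) *\<^sub>R prim g j x" for j x by (rule prim_all_if_prim_unit[OF h])
  show ?thesis
  proof (rule that[of a h])
    show "h \<in> Linf_space (l1_space J)" using gX h by (simp add: Linf_space_l1_iff)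
    show "prim g j x = c j *\<^sub>R prim h j x" for j x using c_pos[of j] by (simp add: ha)
    show "is_lipschitz_with f a h"
      unfolding is_lipschitz_with_def
    proof (intro allI ballI)
      fix j and x :: real assume x: "x \<in> {0..1}"
      have xc: "x / c j \<in> {0..1 / c j}" using x c_pos[of j] by (simp add: divide_right_mono)
      have "integral {0..x / c j} (v j) = (1 / c j) *\<^sub>R integral {0..x} (prim h j)"
      proof -
        have "((\<lambda>s. prim h j (c j * s)) has_integral (1 / c j) *\<^sub>R integral {0..c j * (x / c j)} (prim h j)) {0..x / c j}"
          by (rule has_integral_prim_stretch) (use c_pos[of j] x in auto)
        then show ?thesis using c_pos[of j] by (simp add: v_def[abs_def] integral_unique flip: ha)
      qed
      then show "prim f j x = x *\<^sub>R a j + primitive (prim h j) x"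
        using c_pos[of j] by (simp add: flux_eq_prim[OF x] F[OF xc] primitive_prim[OF x] scaleR_add_right)
    qed
    show "a j + prim h j 1 = (\<Sum>l\<in>{l. M j l \<noteq> 0}. M j l * a l)" for j
    proof -
      let ?d = "1 / c j"
      have d: "?d \<in> {0..?d}" using c_pos[of j] by simp
      have "(\<lambda>n. (V n j ?d - V n j 0) + V n j 0) \<longlonglongrightarrow> v j ?d + a j"
        by (intro tendsto_add V_lim[OF d] V0)
      moreover have "v j ?d = prim h j 1" using c_pos[of j] by (simp add: v_def ha)
      ultimately have 1: "(\<lambda>n. V n j ?d) \<longlonglongrightarrow> a j + prim h j 1" by (simp add: add.commute)
      have "V n j ?d = (\<Sum>l\<in>{l. M j l \<noteq> 0}. M j l * V n l 0)" for n
      proof -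
        have "?F j (?d + \<tau> n) - ?F j ?d = (\<Sum>l\<in>{l. M j l \<noteq> 0}. M j l * (?F l (\<tau> n) - ?F l 0))"
          using flux_increment[of j ?d "?d + \<tau> n" f] \<tau>(1)[of n] by simp
        then show ?thesis by (simp add: V_def scaleR_sum_right)
      qed
      moreover have "(\<lambda>n. \<Sum>l\<in>{l. M j l \<noteq> 0}. M j l * V n l 0) \<longlonglongrightarrow> (\<Sum>l\<in>{l. M j l \<noteq> 0}. M j l * a l)"
        by (intro tendsto_intros V0)
      ultimately show ?thesis using 1 LIMSEQ_unique by simp
    qed
  qed
qed

end

section \<open>Multiplication operators\<close>

text \<open>
  Multiplication of the coordinate \<open>j\<close> by the function \<open>e j\<close>.  The products are summable for almost every
  \<open>s\<close> if \<open>e\<close> is essentially bounded, uniformly in \<open>j\<close>.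
\<close>

definition mult_op :: "(nat \<Rightarrow> real \<Rightarrow> 'k::{real_normed_field, euclidean_space}) \<Rightarrow> 'k l1 Linf \<Rightarrow> 'k l1 Linf" where
  "mult_op e f = abs_Linf (\<lambda>s. Abs_l1 (\<lambda>j. e j s * coord f j s))"

lemma abs_Linf_eq_if_AE:
  assumes "AE s in unit_interval_measure. F s = rep_Linf g s"
  shows "abs_Linf F = g"
proof -
  obtain S where S: "\<And>n. simple_function unit_interval_measure (S n)"
      "AE s in unit_interval_measure. (\<lambda>n. S n s) \<longlonglongrightarrow> rep_Linf g s"
    using rep_Linf_in[of g] unfolding Linf_functions_def strongly_measurable_def by blast
  have "AE s in unit_interval_measure. (\<lambda>n. S n s) \<longlonglongrightarrow> F s"
    using S(2) assms by eventually_elim simp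
  moreover have "AE s in unit_interval_measure. norm (F s) \<le> norm g"
    using AE_norm_rep_le[of g] assms by eventually_elim simp
  ultimately have "F \<in> Linf_functions"
    using S(1) unfolding Linf_functions_def strongly_measurable_def by blast
  from abs_Linf_eqI[OF this rep_Linf_in[of g] assms] show ?thesis by simp
qed

lemma prim_eq_if_AE_coord:
  fixes f :: "'k::{real_normed_field, euclidean_space} l1 Linf"
  assumes "v \<in> borel_measurable unit_interval_measure" "AE s in unit_interval_measure. coord f j s = v s"
  shows "prim f j x = primitive v x"
  unfolding prim_def by (rule primitive_cong_AE[OF borel_measurable_coord assms])

lemma Linf_eqI_coord:
  fixes f g :: "'k::{real_normed_field, euclidean_space} l1 Linf"
  assumes "\<And>j. AE s in unit_interval_measure. coord f j s = coord g j s"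
  shows "f = g"
proof (rule Linf_eqI_prim)
  show "prim f j x = prim g j x" for j x
    using prim_eq_if_AE_coord[OF borel_measurable_coord assms] by (simp add: prim_def)
qed

lemma coord_plus: "AE s in unit_interval_measure. coord (f + g) j s = coord f j s + coord g j s"
  using rep_Linf_plus[of f g] by eventually_elim (simp add: coord_def)

lemma coord_scale: "AE s in unit_interval_measure. coord (Linf_scale a f) j s = a * coord f j s"
  using rep_Linf_scale[of a f] by eventually_elim (simp add: coord_def)

lemma coord_scaleR: "AE s in unit_interval_measure. coord (r *\<^sub>R f) j s = r *\<^sub>R coord f j s"
  using rep_Linf_scaleR[of r f] by eventually_elim (simp add: coord_def)

lemma coord_off:
  assumes "f \<in> Linf_space (l1_space J)" "j \<notin> J"
  shows "AE s in unit_interval_measure. coord f j s = 0"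
  using assms unfolding Linf_space_def by (auto simp: l1_space_def coord_def elim: eventually_mono)

lemma Linf_space_l1I:
  assumes "\<And>j. j \<notin> J \<Longrightarrow> AE s in unit_interval_measure. coord f j s = 0"
  shows "f \<in> Linf_space (l1_space J)"
proof -
  have "AE s in unit_interval_measure. \<forall>j. j \<notin> J \<longrightarrow> coord f j s = 0"
    unfolding AE_all_countable using assms by (metis (mono_tags, lifting) eventually_mono always_eventually)
  then show ?thesis by (simp add: Linf_space_def l1_space_def coord_def)
qed

text \<open>
  Measurable functions \<open>e j\<close> that are essentially bounded, uniformly in \<open>j\<close>.
\<close>

locale multiplier =
  fixes e :: "nat \<Rightarrow> real \<Rightarrow> 'k::{real_normed_field, euclidean_space}" and K :: real
  assumes measurable_multiplier: "\<And>j. e j \<in> borel_measurable unit_interval_measure"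
    and multiplier_bound: "AE s in unit_interval_measure. \<forall>j. norm (e j s) \<le> K"
begin

lemma
  shows coord_mult_op_all: "AE s in unit_interval_measure. \<forall>j. coord (mult_op e f) j s = e j s * coord f j s"
    and norm_mult_op_le: "norm (mult_op e f) \<le> K * norm f"
proof -
  let ?F = "\<lambda>s. Abs_l1 (\<lambda>j. e j s * coord f j s)"
  have F: "AE s in unit_interval_measure. l1_nth (?F s) = (\<lambda>j. e j s * coord f j s) \<and> norm (?F s) \<le> K * norm f"
    using multiplier_bound AE_norm_rep_le[of f]
  proof eventually_elim
    case (elim s)
    have K: "0 \<le> K" using elim(1) order_trans[OF norm_ge_zero] by blast
    have le: "(\<Sum>j<N. norm (e j s * coord f j s)) \<le> K * norm f" for N
    proof -
      have "(\<Sum>j<N. norm (e j s * coord f j s)) \<le> (\<Sum>j<N. K * norm (l1_nth (rep_Linf f s) j))"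
        using elim(1) by (intro sum_mono) (simp add: norm_mult coord_def mult_right_mono)
      also have "\<dots> \<le> K * norm (rep_Linf f s)"
        using sum_norm_l1_le[of "rep_Linf f s" N] K by (simp add: mult_left_mono flip: sum_distrib_left)
      also have "\<dots> \<le> K * norm f" using elim(2) K by (rule mult_left_mono)
      finally show ?thesis .
    qed
    have n: "l1_nth (?F s) = (\<lambda>j. e j s * coord f j s)"
      by (rule Abs_l1_inverse) (simp add: l1_boundedI(1)[OF le])
    have "norm (?F s) \<le> K * norm f"
      unfolding norm_l1.rep_eq n by (rule l1_boundedI(2)[OF le])
    with n show ?case by simp
  qed
  have in_L: "?F \<in> Linf_functions"
  proof (rule Linf_functions_l1I)
    fix j
    show "(\<lambda>s. l1_nth (?F s) j) \<in> borel_measurable unit_interval_measure"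
    proof (rule borel_measurable_LIMSEQ_AE_unit_interval)
      show "(\<lambda>s. e j s * coord f j s) \<in> borel_measurable unit_interval_measure"
        by (intro borel_measurable_times measurable_multiplier borel_measurable_coord)
      show "AE s in unit_interval_measure. (\<lambda>n. e j s * coord f j s) \<longlonglongrightarrow> l1_nth (?F s) j"
        using F by eventually_elim simp
    qed
    show "AE s in unit_interval_measure. norm (?F s) \<le> K * norm f"
      using F by eventually_elim simp
  qed
  note R = rep_abs_Linf[OF in_L, folded mult_op_def]
  show "AE s in unit_interval_measure. \<forall>j. coord (mult_op e f) j s = e j s * coord f j s"
    using R F by eventually_elim (simp add: coord_def)
  have "AE s in unit_interval_measure. norm (rep_Linf (mult_op e f) s) \<le> K * norm f"
    using R F by eventually_elim simp
  then show "norm (mult_op e f) \<le> K * norm f"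
    unfolding norm_Linf_eq[of "mult_op e f"] by (rule ess_norm_le[OF rep_Linf_in])
qed

lemma coord_mult_op: "AE s in unit_interval_measure. coord (mult_op e f) j s = e j s * coord f j s"
  using coord_mult_op_all[of f] by eventually_elim simp

lemma measurable_mult_coord: "(\<lambda>s. e j s * coord f j s) \<in> borel_measurable unit_interval_measure"
  by (intro borel_measurable_times measurable_multiplier borel_measurable_coord)

lemma prim_mult_op: "prim (mult_op e f) j x = primitive (\<lambda>s. e j s * coord f j s) x"
  by (rule prim_eq_if_AE_coord[OF measurable_mult_coord coord_mult_op])

lemma mult_op_add: "mult_op e (f + g) = mult_op e f + mult_op e g"
proof (rule Linf_eqI_coord)
  fix j
  show "AE s in unit_interval_measure. coord (mult_op e (f + g)) j s = coord (mult_op e f + mult_op e g) j s"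
    using coord_mult_op[of "f + g" j] coord_mult_op[of f j] coord_mult_op[of g j]
      coord_plus[of f g j] coord_plus[of "mult_op e f" "mult_op e g" j]
    by eventually_elim (simp add: distrib_left)
qed

lemma mult_op_scale: "mult_op e (Linf_scale a f) = Linf_scale a (mult_op e f)"
proof (rule Linf_eqI_coord)
  fix j
  show "AE s in unit_interval_measure. coord (mult_op e (Linf_scale a f)) j s = coord (Linf_scale a (mult_op e f)) j s"
    using coord_mult_op[of "Linf_scale a f" j] coord_mult_op[of f j]
      coord_scale[of a f j] coord_scale[of a "mult_op e f" j]
    by eventually_elim simp
qed

lemma mult_op_scaleR: "mult_op e (r *\<^sub>R f) = r *\<^sub>R mult_op e f"
proof (rule Linf_eqI_coord)
  fix j
  show "AE s in unit_interval_measure. coord (mult_op e (r *\<^sub>R f)) j s = coord (r *\<^sub>R mult_op e f) j s"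
    using coord_mult_op[of "r *\<^sub>R f" j] coord_mult_op[of f j]
      coord_scaleR[of r f j] coord_scaleR[of r "mult_op e f" j]
    by eventually_elim simp
qed

lemma mult_op_diff: "mult_op e (f - g) = mult_op e f - mult_op e g"
  using mult_op_add[of "f - g" g] by simp

lemma mult_op_0: "mult_op e 0 = 0"
  using mult_op_diff[of 0 0] by simp

lemma mult_op_in_space:
  assumes "f \<in> Linf_space (l1_space J)"
  shows "mult_op e f \<in> Linf_space (l1_space J)"
proof (rule Linf_space_l1I)
  fix j assume "j \<notin> J"
  from coord_off[OF assms this] coord_mult_op[of f j]
  show "AE s in unit_interval_measure. coord (mult_op e f) j s = 0" by eventually_elim simp
qed

lemma mult_op_inverse:
  assumes "multiplier e' K'" and inv: "\<And>j s. e j s * e' j s = 1"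
  shows "mult_op e (mult_op e' f) = f"
proof (rule Linf_eqI_coord)
  interpret e': multiplier e' K' by fact
  fix j
  show "AE s in unit_interval_measure. coord (mult_op e (mult_op e' f)) j s = coord f j s"
    using coord_mult_op[of "mult_op e' f" j] e'.coord_mult_op[of f j]
  proof eventually_elim
    case (elim s)
    then show ?case using inv[of j s] by (metis mult.assoc mult_1)
  qed
qed

text \<open>
  Weak-star continuity on bounded sets: multiplication by \<open>e\<^sub>j\<close> may be moved to the test function.
\<close>

lemma limitin_mult_op:
  assumes lim: "limitin (weak_star J) u l F"
    and bd: "\<forall>\<^sub>F i in F. u i \<in> Linf_space (l1_space J) \<and> norm (u i) \<le> B"
  shows "limitin (weak_star J) (\<lambda>i. mult_op e (u i)) (mult_op e l) F"
proof (rule limitin_weak_star_if_prim_tendsto)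
  have l: "l \<in> Linf_space (l1_space J)" using lim unfolding limitin_weak_star_iff by blast
  then show "mult_op e l \<in> Linf_space (l1_space J)" by (rule mult_op_in_space)
  have "AE s in unit_interval_measure. norm (e 0 s) \<le> K"
    using multiplier_bound by eventually_elim simp
  then have K: "0 \<le> K" by (rule AE_norm_le_imp_nonneg)
  show "\<forall>\<^sub>F i in F. mult_op e (u i) \<in> Linf_space (l1_space J) \<and> norm (mult_op e (u i)) \<le> K * B"
    using bd
  proof eventually_elim
    case (elim i)
    then have "norm (mult_op e (u i)) \<le> K * B"
      using K by (intro order_trans[OF norm_mult_op_le] mult_left_mono) auto
    with elim show ?case by (simp add: mult_op_in_space)
  qed
  fix j and x :: real assume j: "j \<in> J"
  let ?\<phi> = "\<lambda>s. indicator {..x} s *\<^sub>R e j s"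
  have "integrable unit_interval_measure (e j)"
    by (rule integrable_unit_interval_bounded[OF measurable_multiplier])
      (use multiplier_bound in \<open>auto elim: eventually_mono\<close>)
  then have int: "integrable unit_interval_measure ?\<phi>" by (rule integrable_indicator_unit_interval) simp
  have eq: "prim (mult_op e f) j x = pairing f (\<lambda>s. c0_unit j (?\<phi> s))" for f
    unfolding pairing_c0_unit[OF int] prim_mult_op primitive_def by simp
  show "((\<lambda>i. prim (mult_op e (u i)) j x) \<longlongrightarrow> prim (mult_op e l) j x) F"
    unfolding eq using lim L1_functions_c0_unit[OF int j] unfolding limitin_weak_star_iff by blast
qed

end

section \<open>The gauge transformation\<close>

text \<open>
  For a family \<open>u\<close> of potentials let \<open>E\<^sub>j(x) = exp (\<integral>\<^sub>0\<^sup>x u\<^sub>j)\<close>.  Since \<open>E\<^sub>j' = u\<^sub>j E\<^sub>j\<close>, multiplication by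
  \<open>E\<close> turns a derivative \<open>h\<close> into \<open>E (h + u f)\<close>.
\<close>

definition gauge_factor :: "(nat \<Rightarrow> real \<Rightarrow> 'k::{real_normed_field, euclidean_space}) \<Rightarrow> nat \<Rightarrow> real \<Rightarrow> 'k" where
  "gauge_factor u j s = exp (primitive (u j) s)"

text \<open>
  A multiplier in the role of a potential, to which \<open>gauge_factor\<close> is applied.
\<close>

locale potential = multiplier u \<kappa> for u :: "nat \<Rightarrow> real \<Rightarrow> 'k::{real_normed_field, euclidean_space}" and \<kappa>
begin

lemma AE_norm_potential_le: "AE s in unit_interval_measure. norm (u j s) \<le> \<kappa>"
  using multiplier_bound by eventually_elim simp

lemma norm_primitive_potential_le: "norm (primitive (u j) s) \<le> \<kappa>"
proof -
  let ?s = "max 0 (min 1 s)"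
  have \<kappa>: "0 \<le> \<kappa>" by (rule AE_norm_le_imp_nonneg[OF AE_norm_potential_le])
  have "norm (primitive (u j) ?s) \<le> \<kappa> * \<bar>?s - 0\<bar>"
    using norm_primitive_increment_le[OF measurable_multiplier AE_norm_potential_le, of 0 ?s j]
    by (simp add: primitive_eq_0)
  also have "\<dots> \<le> \<kappa>" using \<kappa> by (intro mult_left_le) auto
  finally show ?thesis by (simp add: primitive_clamp)
qed

lemma norm_gauge_factor_le: "norm (gauge_factor u j s) \<le> exp \<kappa>"
  unfolding gauge_factor_def
  by (rule order_trans[OF norm_exp]) (simp add: norm_primitive_potential_le)

lemma continuous_on_gauge_factor: "continuous_on {0..1} (gauge_factor u j)"
  unfolding gauge_factor_def
  by (intro continuous_on_exp continuous_on_primitive[OF measurable_multiplier AE_norm_potential_le])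

lemma multiplier_gauge_factor: "multiplier (gauge_factor u) (exp \<kappa>)"
  by standard (auto simp: norm_gauge_factor_le intro: integrable_unit_interval_continuous(2) continuous_on_gauge_factor)

sublocale gauge: multiplier "gauge_factor u" "exp \<kappa>" by (rule multiplier_gauge_factor)

lemma gauge_factor_nonzero: "gauge_factor u j s \<noteq> 0"
  by (simp add: gauge_factor_def)

lemma potential_uminus: "potential (\<lambda>j s. - u j s) \<kappa>"
  by (intro potential.intro multiplier.intro) (use measurable_multiplier multiplier_bound in simp_all)

lemma gauge_factor_uminus: "gauge_factor (\<lambda>j s. - u j s) j s = inverse (gauge_factor u j s)"
  unfolding gauge_factor_def
  by (subst primitive_linear[OF bounded_linear_minus[OF bounded_linear_ident]])
    (auto simp: exp_minus intro: integrable_unit_interval_bounded[OF measurable_multiplier AE_norm_potential_le])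

text \<open>
  The product rule.  The values at \<open>0\<close> are unchanged because the gauge factors are \<open>1\<close> there.
\<close>

lemma
  assumes lip: "is_lipschitz_with f a h"
    and h': "\<And>j. AE s in unit_interval_measure. coord h' j s = gauge_factor u j s * (coord h j s + u j s * coord f j s)"
  shows gauge_continuous_rep: "x \<in> {0..1} \<Longrightarrow> gauge_factor u j x * (a j + prim h j x) = a j + prim h' j x"
    and is_lipschitz_with_gauge: "is_lipschitz_with (mult_op (gauge_factor u) f) a h'"
proof -
  show rep: "gauge_factor u j x * (a j + prim h j x) = a j + prim h' j x" if x: "x \<in> {0..1}" for j x
  proof -
    let ?E = "gauge_factor u j"
    define v where "v s = u j s * ?E s" for s
    note u = measurable_multiplier[of j] AE_norm_potential_le[of j]
    have v: "v \<in> borel_measurable unit_interval_measure"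
      unfolding v_def by (intro borel_measurable_times measurable_multiplier gauge.measurable_multiplier)
    have v_bd: "AE s in unit_interval_measure. norm (v s) \<le> \<kappa> * exp \<kappa>"
      using AE_norm_potential_le[of j]
      by eventually_elim (auto simp: v_def norm_mult intro!: mult_mono norm_gauge_factor_le order_trans[OF norm_ge_zero])
    have E: "?E y = 1 + primitive v y" if "y \<in> {0..1}" for y
      using primitive_exp[OF u that] by (simp add: v_def[abs_def] gauge_factor_def)
    note hc = borel_measurable_coord[of h j] AE_norm_coord_le[of h j]
    note P = primitive_mult_primitive[OF v v_bd hc]
    have i: "integrable unit_interval_measure v" "integrable unit_interval_measure (coord h j)"
      by (rule integrable_unit_interval_bounded[OF v v_bd]) (rule integrable_coord)
    \<comment> \<open>with \<open>E = 1 + primitive v\<close>, this splits \<open>E f' + v f\<close> into its linear part and the derivative of a product\<close>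
    have "prim h' j x = primitive (\<lambda>s. (v s * a j + coord h j s) + (v s * primitive (coord h j) s + primitive v s * coord h j s)) x"
    proof (rule prim_eq_if_AE_coord)
      show "(\<lambda>s. (v s * a j + coord h j s) + (v s * primitive (coord h j) s + primitive v s * coord h j s))
          \<in> borel_measurable unit_interval_measure"
        using P(2,3)[OF x] i
        by (intro borel_measurable_integrable Bochner_Integration.integrable_add integrable_mult_left)
      have "AE s in unit_interval_measure. coord f j s = a j + prim h j s"
        using is_lipschitz_with_AE[OF lip] by eventually_elim simp
      then show "AE s in unit_interval_measure. coord h' j s
          = (v s * a j + coord h j s) + (v s * primitive (coord h j) s + primitive v s * coord h j s)"
        using h'[of j] AE_unit_interval_mem
      proof eventually_elim
        case (elim s)
        then have "coord h' j s = v s * (a j + prim h j s) + ?E s * coord h j s"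
          by (simp add: v_def algebra_simps)
        also have "\<dots> = v s * (a j + primitive (coord h j) s) + (1 + primitive v s) * coord h j s"
          by (simp add: E[OF elim(3)] prim_def)
        finally show ?case by (simp add: algebra_simps)
      qed
    qed
    also have "\<dots> = primitive (\<lambda>s. v s * a j + coord h j s) x
        + primitive (\<lambda>s. v s * primitive (coord h j) s + primitive v s * coord h j s) x"
      using P(2,3)[OF x] i by (intro primitive_add Bochner_Integration.integrable_add integrable_mult_left)
    also have "primitive (\<lambda>s. v s * a j + coord h j s) x = primitive v x * a j + primitive (coord h j) x"
      using i primitive_linear[OF bounded_linear_mult_left i(1)] by (subst primitive_add) auto
    finally show ?thesis
      by (simp add: P(1)[OF x] E[OF x] prim_def algebra_simps)
  qed
  show "is_lipschitz_with (mult_op (gauge_factor u) f) a h'"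
    unfolding is_lipschitz_with_def
  proof (intro allI ballI)
    fix j and x :: real assume x: "x \<in> {0..1}"
    have "prim (mult_op (gauge_factor u) f) j x = primitive (\<lambda>s. a j + prim h' j s) x"
    proof (rule prim_eq_if_AE_coord)
      show "(\<lambda>s. a j + prim h' j s) \<in> borel_measurable unit_interval_measure"
        by (rule integrable_unit_interval_continuous(2)) (intro continuous_intros continuous_on_prim)
      show "AE s in unit_interval_measure. coord (mult_op (gauge_factor u) f) j s = a j + prim h' j s"
        using gauge.coord_mult_op[of f j] is_lipschitz_with_AE[OF lip] AE_unit_interval_mem
        by eventually_elim (simp add: rep)
    qed
    then show "prim (mult_op (gauge_factor u) f) j x = x *\<^sub>R a j + primitive (prim h' j) x"
      by (simp add: primitive_affine[OF x])
  qed
qed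

lemma coord_gauge_derivative:
  "AE s in unit_interval_measure. coord (mult_op (gauge_factor u) (h + mult_op u f)) j s
    = gauge_factor u j s * (coord h j s + u j s * coord f j s)"
  using gauge.coord_mult_op[of "h + mult_op u f" j] coord_plus[of h "mult_op u f" j] coord_mult_op[of f j]
  by eventually_elim simp

end


section \<open>The flow semigroup\<close>

lemma norm_apply_bcontfun_le: "norm (apply_bcontfun y j) \<le> norm y"
  for y :: "nat \<Rightarrow>\<^sub>C 'k::real_normed_vector"
  by (rule norm_bounded)

text \<open>
  The coefficients \<open>B\<close> play the role of the conjugated adjacency matrix, whose columns are summable
  with sums bounded by \<open>\<beta>\<close>.  The speeds are indexed by all natural numbers, but only those in \<open>J\<close> matter.
\<close>

locale flow_network =
  fixes J :: "nat set" and c :: "nat \<Rightarrow> real" and B :: "nat \<Rightarrow> nat \<Rightarrow> 'k::{real_normed_field, euclidean_space}"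
    and c_min \<beta> :: real and q :: "(nat \<Rightarrow>\<^sub>C 'k) Linf"
  assumes c_min_pos: "0 < c_min" and c_min_le: "\<And>j. c_min \<le> c j" and finite_speeds: "finite (range c)"
    and B_off: "\<And>j l. j \<notin> J \<Longrightarrow> B j l = 0" and row_finite: "\<And>j. finite {l. B j l \<noteq> 0}"
    and column_bound: "\<And>S l. finite S \<Longrightarrow> (\<Sum>j\<in>S. norm (B j l)) \<le> \<beta>"
begin

text \<open>
  The coordinate \<open>q\<^sub>j\<close> of the potential.
\<close>

definition q_coord :: "nat \<Rightarrow> real \<Rightarrow> 'k" where
  "q_coord j s = apply_bcontfun (rep_Linf q s) j"

text \<open>
  The logarithmic derivative of the gauge factor.
\<close>

definition u :: "nat \<Rightarrow> real \<Rightarrow> 'k" where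
  "u j s = (1 / c j) *\<^sub>R q_coord j s"

lemma c_pos: "0 < c j" using c_min_pos c_min_le[of j] by simp

sublocale q: multiplier q_coord "norm q"
proof
  show "q_coord j \<in> borel_measurable unit_interval_measure" for j
    unfolding q_coord_def
    using strongly_measurable_imp_measurable[OF _ linear_continuous_on[OF bounded_linear_apply_bcontfun], of "rep_Linf q" j]
      rep_Linf_in[of q] by (simp add: Linf_functions_def)
  show "AE s in unit_interval_measure. \<forall>j. norm (q_coord j s) \<le> norm q"
    using AE_norm_rep_le[of q]
    by eventually_elim (auto simp: q_coord_def intro: order_trans[OF norm_apply_bcontfun_le])
qed

sublocale potential u "norm q / c_min"
proof (intro potential.intro multiplier.intro)
  show "u j \<in> borel_measurable unit_interval_measure" for j
    unfolding u_def by (intro borel_measurable_scaleR borel_measurable_const q.measurable_multiplier)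
  show "AE s in unit_interval_measure. \<forall>j. norm (u j s) \<le> norm q / c_min"
    using q.multiplier_bound
  proof eventually_elim
    case (elim s)
    have "norm (u j s) \<le> norm q / c_min" for j
    proof -
      have "norm (u j s) = norm (q_coord j s) / c j" using c_pos[of j] by (simp add: u_def)
      also have "\<dots> \<le> norm q / c_min" using elim c_min_pos c_min_le[of j] by (intro frac_le) auto
      finally show ?thesis .
    qed
    then show ?case by blast
  qed
qed

text \<open>
  Multiplication by \<open>E\<close> removes the potential, and multiplication by \<open>E'\<close> is its inverse.
\<close>

abbreviation E :: "nat \<Rightarrow> real \<Rightarrow> 'k" where "E \<equiv> gauge_factor u"

abbreviation E' :: "nat \<Rightarrow> real \<Rightarrow> 'k" where "E' \<equiv> gauge_factor (\<lambda>j s. - u j s)"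

sublocale neg: potential "\<lambda>j s. - u j s" "norm q / c_min" by (rule potential_uminus)

lemma E_inverse: "E j s * E' j s = 1" "E' j s * E j s = 1"
  using gauge_factor_nonzero[of j s] by (simp_all add: gauge_factor_uminus)

lemma gauge_ungauge: "mult_op E (mult_op E' f) = f"
  by (rule gauge.mult_op_inverse[OF neg.multiplier_gauge_factor E_inverse(1)])

lemma ungauge_gauge: "mult_op E' (mult_op E f) = f"
  by (rule neg.gauge.mult_op_inverse[OF multiplier_gauge_factor E_inverse(2)])

text \<open>
  The coupling matrix after the gauge transformation.  Only \<open>E j 1\<close> occurs, since \<open>E l 0 = 1\<close>.
\<close>

definition M :: "nat \<Rightarrow> nat \<Rightarrow> 'k" where "M j l = E j 1 * B j l"

lemma M_support: "{l. M j l \<noteq> 0} = {l. B j l \<noteq> 0}"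
  using gauge_factor_nonzero[of j 1] by (simp add: M_def)

sublocale delay_network J c M c_min "exp (norm q / c_min) * \<beta>"
proof
  show "0 < c_min" by (rule c_min_pos)
  show "c_min \<le> c j" for j by (rule c_min_le)
  show "finite (range c)" by (rule finite_speeds)
  show "j \<notin> J \<Longrightarrow> M j l = 0" for j l by (simp add: M_def B_off)
  show "finite {l. M j l \<noteq> 0}" for j unfolding M_support by (rule row_finite)
  show "(\<Sum>j\<in>S. norm (M j l)) \<le> exp (norm q / c_min) * \<beta>" if S: "finite S" for S l
  proof -
    have "(\<Sum>j\<in>S. norm (M j l)) \<le> (\<Sum>j\<in>S. exp (norm q / c_min) * norm (B j l))"
      unfolding M_def norm_mult by (intro sum_mono mult_right_mono norm_gauge_factor_le) simp
    also have "\<dots> = exp (norm q / c_min) * (\<Sum>j\<in>S. norm (B j l))" by (simp add: sum_distrib_left)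
    also have "\<dots> \<le> exp (norm q / c_min) * \<beta>" using column_bound[OF S] by (intro mult_left_mono) auto
    finally show ?thesis .
  qed
qed

sublocale c: multiplier "\<lambda>j s. of_real (c j)" c_max
  by standard (auto simp: abs_of_pos[OF c_pos] c_le_max)

text \<open>
  The semigroup with potential, conjugate to the shift semigroup for \<open>M\<close>.
\<close>

definition flow :: "real \<Rightarrow> 'k l1 Linf \<Rightarrow> 'k l1 Linf" where
  "flow t f = mult_op E' (shift t (mult_op E f))"

lemma flow_in_space: "0 \<le> t \<Longrightarrow> f \<in> Linf_space (l1_space J) \<Longrightarrow> flow t f \<in> Linf_space (l1_space J)"
  unfolding flow_def by (intro neg.gauge.mult_op_in_space shift_in_space gauge.mult_op_in_space)

lemma gauge_flow: "mult_op E (flow t f) = shift t (mult_op E f)"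
  by (simp add: flow_def gauge_ungauge)

lemma norm_flow_le:
  assumes "0 \<le> t"
  shows "norm (flow t f) \<le> exp (norm q / c_min) * (shift_bound t * (exp (norm q / c_min) * norm f))"
  unfolding flow_def
  by (rule order_trans[OF neg.gauge.norm_mult_op_le mult_left_mono], rule order_trans[OF norm_shift_le[OF assms] mult_left_mono])
    (auto intro: gauge.norm_mult_op_le shift_bound_nonneg)

lemma bi_continuous_semigroup_flow:
  "bi_continuous_semigroup Linf_scale (Linf_space (l1_space J)) (weak_star J) flow"
proof (intro bi_continuous_semigroup.intro weak_star_admissible bi_continuous_semigroup_axioms.intro)
  let ?X = "Linf_space (l1_space J) :: 'k l1 Linf set"
  let ?k = "exp (norm q / c_min)"
  show "flow t f \<in> ?X" if "0 \<le> t" "f \<in> ?X" for t f using that by (rule flow_in_space)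
  show "flow t (f + g) = flow t f + flow t g" if "0 \<le> t" for t f g
    using that by (simp add: flow_def gauge.mult_op_add shift_add neg.gauge.mult_op_add)
  show "flow t (Linf_scale a f) = Linf_scale a (flow t f)" if "0 \<le> t" for t a f
    using that by (simp add: flow_def gauge.mult_op_scale shift_scale neg.gauge.mult_op_scale)
  show "flow 0 f = f" for f by (simp add: flow_def shift_zero ungauge_gauge)
  show "flow (t + s) f = flow t (flow s f)" if "0 \<le> s" "0 \<le> t" for s t f
    using that by (simp add: flow_def shift_shift gauge_ungauge)
  show "continuous_map (top_of_set {0..}) (weak_star J) (\<lambda>t. flow t f)" if f: "f \<in> ?X" for f
  proof -
    have "continuous_on {0..} (\<lambda>t. pairing (flow t f) g)" if g: "g \<in> L1_functions (c0_space J)" for g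
      unfolding continuous_on_def
    proof
      fix t :: real assume t: "t \<in> {0..}"
      let ?G = "mult_op E f"
      have G: "?G \<in> ?X" by (rule gauge.mult_op_in_space[OF f])
      have ev: "\<forall>\<^sub>F s in at t within {0..}. s \<in> {0..} \<and> s \<le> t + 1"
        unfolding eventually_at by (intro exI[of _ 1]) (auto simp: dist_real_def)
      have "\<forall>\<^sub>F s in at t within {0..}. shift s ?G \<in> ?X \<and> norm (shift s ?G) \<le> shift_bound (t + 1) * norm ?G"
        using ev by eventually_elim (use shift_in_space[OF _ G] norm_shift_le_uniform[OF _ _ order_refl] in auto)
      from neg.gauge.limitin_mult_op[OF shift_continuous[OF G] this] t
      have "limitin (weak_star J) (\<lambda>s. flow s f) (flow t f) (at t within {0..})" by (simp add: flow_def)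
      with g show "((\<lambda>s. pairing (flow s f) g) \<longlongrightarrow> pairing (flow t f) g) (at t within {0..})"
        unfolding limitin_weak_star_iff by blast
    qed
    then show ?thesis unfolding continuous_map_into_weak_star using flow_in_space[OF _ f] by auto
  qed
  show "\<exists>K \<omega>. 1 \<le> K \<and> (\<forall>t\<ge>0. \<forall>f\<in>?X. norm (flow t f) \<le> K * exp (\<omega> * t) * norm f)"
  proof -
    obtain K \<omega> where K: "K \<ge> 1" "\<And>t. 0 \<le> t \<Longrightarrow> shift_bound t \<le> K * exp (\<omega> * t)"
      using shift_bound_exponential by blast
    have k: "1 \<le> ?k" using c_min_pos by simp
    have "norm (flow t f) \<le> (?k * K * ?k) * exp (\<omega> * t) * norm f" if t: "0 \<le> t" for t f
    proof -
      have "norm (flow t f) \<le> ?k * (shift_bound t * (?k * norm f))" by (rule norm_flow_le[OF t])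
      also have "\<dots> \<le> ?k * (K * exp (\<omega> * t) * (?k * norm f))"
        by (intro mult_left_mono mult_right_mono K t) auto
      finally show ?thesis by (simp add: mult_ac)
    qed
    moreover have "1 * 1 * 1 \<le> ?k * K * ?k" by (intro mult_mono) (use k K(1) in auto)
    then have "1 \<le> ?k * K * ?k" by simp
    ultimately show ?thesis by blast
  qed
  show "\<forall>\<^sub>F n in sequentially. \<forall>s\<in>{0..t0}. flow s (f n) \<in> U"
    if f: "range f \<subseteq> ?X" "bounded (range f)" "limitin (weak_star J) f 0 sequentially" and t0: "0 \<le> t0"
      and U: "openin (weak_star J) U" "0 \<in> U" for f :: "nat \<Rightarrow> 'k l1 Linf" and t0 U
  proof -
    obtain K where K: "\<And>n. norm (f n) \<le> K" using f(2) by (auto simp: bounded_iff)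
    let ?F = "\<lambda>n. mult_op E (f n)"
    have fX: "f n \<in> ?X" for n using f(1) by auto
    then have FX: "?F n \<in> ?X" for n by (rule gauge.mult_op_in_space)
    have Fb: "norm (?F n) \<le> ?k * K" for n
      by (rule order_trans[OF gauge.norm_mult_op_le mult_left_mono[OF K]]) simp
    have "limitin (weak_star J) ?F (mult_op E 0) sequentially"
      by (rule gauge.limitin_mult_op[OF f(3), where B = K]) (simp add: fX K)
    then have F0: "limitin (weak_star J) ?F 0 sequentially" by (simp add: gauge.mult_op_0)
    let ?P = "sequentially \<times>\<^sub>F principal {0..t0}"
    have "\<forall>\<^sub>F i in ?P. (case i of (n, s) \<Rightarrow> shift s (?F n)) \<in> ?X
        \<and> norm (case i of (n, s) \<Rightarrow> shift s (?F n)) \<le> shift_bound t0 * (?k * K)"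
      unfolding eventually_prod_filter
      by (intro exI[of _ "\<lambda>_. True"] exI[of _ "\<lambda>s. s \<in> {0..t0}"])
        (auto simp: eventually_principal intro: shift_in_space FX norm_shift_le_uniform Fb)
    from neg.gauge.limitin_mult_op[OF shift_equicontinuous[OF FX Fb F0 t0] this]
    have "limitin (weak_star J) (\<lambda>i. mult_op E' (case i of (n, s) \<Rightarrow> shift s (?F n))) 0 ?P"
      by (simp add: neg.gauge.mult_op_0)
    with U have "\<forall>\<^sub>F i in ?P. mult_op E' (case i of (n, s) \<Rightarrow> shift s (?F n)) \<in> U"
      unfolding limitin_def by blast
    then obtain P Q where "eventually P sequentially" "eventually Q (principal {0..t0})"
        "\<forall>n s. P n \<longrightarrow> Q s \<longrightarrow> flow s (f n) \<in> U"
      unfolding eventually_prod_filter by (auto simp: flow_def)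
    then show ?thesis by (auto simp: eventually_principal elim!: eventually_mono)
  qed
qed

text \<open>The value \<open>c f' + q f\<close> of the operator at a Lipschitz function \<open>f\<close> with derivative \<open>h\<close>.\<close>

definition flow_value :: "'k l1 Linf \<Rightarrow> 'k l1 Linf \<Rightarrow> 'k l1 Linf" where
  "flow_value f h = mult_op (\<lambda>j s. of_real (c j)) h + mult_op q_coord f"

lemma coord_flow_value:
  "AE s in unit_interval_measure. coord (flow_value f h) j s = of_real (c j) * coord h j s + q_coord j s * coord f j s"
  unfolding flow_value_def
  using coord_plus[of "mult_op (\<lambda>j s. of_real (c j)) h" "mult_op q_coord f" j] c.coord_mult_op[of h j] q.coord_mult_op[of f j]
  by eventually_elim simp

lemma flow_value_in_space:
  assumes "f \<in> Linf_space (l1_space J)" "h \<in> Linf_space (l1_space J)"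
  shows "flow_value f h \<in> Linf_space (l1_space J)"
  unfolding flow_value_def by (intro Linf_space_l1_add c.mult_op_in_space q.mult_op_in_space assms)

lemma flow_operator_eq_flow_value:
  assumes lip: "is_lipschitz_with f a h" and f: "f \<in> Linf_space (l1_space J)" and h: "h \<in> Linf_space (l1_space J)"
  shows "flow_operator J c q f = flow_value f h"
  unfolding flow_operator_def weak_derivative_eq[OF lip]
proof (rule abs_Linf_eq_if_AE)
  let ?y = "\<lambda>s. (\<lambda>j. if j \<in> J then of_real (c j) * l1_nth (rep_Linf h s) j
      + apply_bcontfun (rep_Linf q s) j * l1_nth (rep_Linf f s) j else 0)"
  have "AE s in unit_interval_measure. coord (flow_value f h) j s = ?y s j" for j
  proof (cases "j \<in> J")
    case True
    then show ?thesis using coord_flow_value[of f h j] by (simp add: coord_def q_coord_def)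
  next
    case False
    then show ?thesis using coord_off[OF flow_value_in_space[OF f h] False] by simp
  qed
  then have "AE s in unit_interval_measure. \<forall>j. l1_nth (rep_Linf (flow_value f h) s) j = ?y s j"
    unfolding AE_all_countable coord_def by blast
  then show "AE s in unit_interval_measure. Abs_l1 (?y s) = rep_Linf (flow_value f h) s"
  proof eventually_elim
    case (elim s)
    then have "?y s = l1_nth (rep_Linf (flow_value f h) s)" by (intro ext) simp
    then show ?case by (simp only: l1_nth_inverse)
  qed
qed

text \<open>The domain of the operator in terms of the initial values \<open>a\<close> and derivatives \<open>h\<close>.\<close>

definition flow_dom :: "'k l1 Linf set" where
  "flow_dom = {f \<in> Linf_space (l1_space J). \<exists>a. \<exists>h\<in>Linf_space (l1_space J). is_lipschitz_with f a h \<and>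
     (\<forall>j. a j + prim h j 1 = (\<Sum>l\<in>{l. B j l \<noteq> 0}. B j l * a l))}"

lemma gauge_difference_quotient:
  "mult_op E ((flow t f - f) /\<^sub>R r) = (shift t (mult_op E f) - mult_op E f) /\<^sub>R r"
  by (simp add: gauge.mult_op_scaleR gauge.mult_op_diff gauge_flow)

text \<open>
  If \<open>f\<close> satisfies the coupling conditions for \<open>B\<close>, then \<open>E f\<close> satisfies those for \<open>M\<close>, and \<open>E (c f' + q f) = c (E f)'\<close>.
\<close>

lemma flow_difference_quotient:
  assumes lip: "is_lipschitz_with f a h" and f: "f \<in> Linf_space (l1_space J)" and h: "h \<in> Linf_space (l1_space J)"
    and coupling: "\<And>j. a j + prim h j 1 = (\<Sum>l\<in>{l. B j l \<noteq> 0}. B j l * a l)"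
  shows "limitin (weak_star J) (\<lambda>t. (flow t f - f) /\<^sub>R t) (flow_value f h) (at_right 0)"
    and "bdd_above ((\<lambda>t. norm (flow t f - f) / t) ` {0<..1})"
proof -
  let ?k = "exp (norm q / c_min)"
  define h' where "h' = mult_op E (h + mult_op u f)"
  define g where "g = mult_op E (flow_value f h)"
  have h': "AE s in unit_interval_measure. coord h' j s = E j s * (coord h j s + u j s * coord f j s)" for j
    unfolding h'_def by (rule coord_gauge_derivative)
  have lip': "is_lipschitz_with (mult_op E f) a h'"
    by (rule is_lipschitz_with_gauge[OF lip h'])
  have gX: "g \<in> Linf_space (l1_space J)" and fX: "mult_op E f \<in> Linf_space (l1_space J)"
    unfolding g_def by (intro gauge.mult_op_in_space flow_value_in_space f h)+
  have g: "prim g j x = c j *\<^sub>R prim h' j x" for j x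
  proof -
    have "prim g j x = primitive (\<lambda>s. c j *\<^sub>R coord h' j s) x"
    proof (rule prim_eq_if_AE_coord)
      show "AE s in unit_interval_measure. coord g j s = c j *\<^sub>R coord h' j s"
        using gauge.coord_mult_op[of "flow_value f h" j] coord_flow_value[of f h j] h'[of j]
      proof eventually_elim
        case (elim s)
        have q: "q_coord j s = of_real (c j) * u j s"
          using c_pos[of j] by (simp add: u_def scaleR_conv_of_real)
        show ?case using elim by (simp add: g_def scaleR_conv_of_real q algebra_simps)
      qed
    qed simp
    then show ?thesis
      by (simp add: prim_def primitive_linear[OF bounded_linear_scaleR_right integrable_coord])
  qed
  have coupling': "a j + prim h' j 1 = (\<Sum>l\<in>{l. M j l \<noteq> 0}. M j l * a l)" for j
  proof -
    have "a j + prim h' j 1 = E j 1 * (a j + prim h j 1)"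
      using gauge_continuous_rep[OF lip h', of 1 j] by simp
    then show ?thesis unfolding coupling M_support by (simp add: M_def sum_distrib_left mult.assoc)
  qed
  note gen = shift_generator[OF lip' fX g gX coupling'] and le = norm_shift_minus_le[OF lip' g coupling']
  have quot: "(flow t f - f) /\<^sub>R t = mult_op E' ((shift t (mult_op E f) - mult_op E f) /\<^sub>R t)" for t
    by (metis gauge_difference_quotient ungauge_gauge)
  have ev: "\<forall>\<^sub>F t in at_right 0. t \<in> {0<..<(1::real)}" by (rule eventually_at_right_real) simp
  then have "\<forall>\<^sub>F t in at_right 0. (shift t (mult_op E f) - mult_op E f) /\<^sub>R t \<in> Linf_space (l1_space J)
      \<and> norm ((shift t (mult_op E f) - mult_op E f) /\<^sub>R t) \<le> shift_bound 1 * norm g"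
  proof eventually_elim
    case (elim t)
    have "shift t (mult_op E f) - mult_op E f \<in> Linf_space (l1_space J)"
      using elim fX by (intro Linf_space_l1_diff shift_in_space) auto
    then have "(shift t (mult_op E f) - mult_op E f) /\<^sub>R t \<in> Linf_space (l1_space J)"
      by (rule subspace_scale[OF subspace_Linf_space_l1])
    moreover have "norm (shift t (mult_op E f) - mult_op E f) / t \<le> shift_bound 1 * norm g"
      using le[of t] elim by (simp add: divide_le_eq)
    ultimately show ?case using elim by (simp add: divide_inverse_commute)
  qed
  from neg.gauge.limitin_mult_op[OF gen this]
  show "limitin (weak_star J) (\<lambda>t. (flow t f - f) /\<^sub>R t) (flow_value f h) (at_right 0)"
    unfolding quot by (simp add: g_def ungauge_gauge)
  show "bdd_above ((\<lambda>t. norm (flow t f - f) / t) ` {0<..1})"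
  proof (rule bdd_aboveI2)
    fix t :: real assume t: "t \<in> {0<..1}"
    have "flow t f - f = mult_op E' (shift t (mult_op E f) - mult_op E f)"
      by (simp add: neg.gauge.mult_op_diff flow_def ungauge_gauge)
    then have "norm (flow t f - f) \<le> ?k * norm (shift t (mult_op E f) - mult_op E f)"
      by (simp add: neg.gauge.norm_mult_op_le)
    also have "\<dots> \<le> ?k * (shift_bound 1 * norm g * t)" using t by (intro mult_left_mono le) auto
    finally show "norm (flow t f - f) / t \<le> ?k * (shift_bound 1 * norm g)"
      using t by (simp add: divide_le_eq mult.assoc)
  qed
qed

lemma flow_difference_quotient_converse:
  assumes f: "f \<in> Linf_space (l1_space J)"
    and lim: "limitin (weak_star J) (\<lambda>t. (flow t f - f) /\<^sub>R t) g (at_right 0)"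
    and bdd: "bdd_above ((\<lambda>t. norm (flow t f - f) / t) ` {0<..1})"
  shows "f \<in> flow_dom"
proof -
  let ?k = "exp (norm q / c_min)"
  let ?f = "mult_op E f"
  have "\<exists>K. \<forall>t\<in>{0<..1}. norm (flow t f - f) / t \<le> K" using bdd by (simp add: bdd_above_def)
  then obtain K where K: "\<And>t. t \<in> {0<..1} \<Longrightarrow> norm (flow t f - f) / t \<le> K" by blast
  have fX: "?f \<in> Linf_space (l1_space J)" by (rule gauge.mult_op_in_space[OF f])
  have ev: "\<forall>\<^sub>F t in at_right 0. t \<in> {0<..<(1::real)}" by (rule eventually_at_right_real) simp
  then have "\<forall>\<^sub>F t in at_right 0. (flow t f - f) /\<^sub>R t \<in> Linf_space (l1_space J) \<and> norm ((flow t f - f) /\<^sub>R t) \<le> K"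
  proof eventually_elim
    case (elim t)
    have "flow t f - f \<in> Linf_space (l1_space J)"
      using elim f by (intro Linf_space_l1_diff flow_in_space) auto
    then have "(flow t f - f) /\<^sub>R t \<in> Linf_space (l1_space J)"
      by (rule subspace_scale[OF subspace_Linf_space_l1])
    then show ?case using K[of t] elim by (simp add: divide_inverse_commute)
  qed
  from gauge.limitin_mult_op[OF lim this]
  have lim': "limitin (weak_star J) (\<lambda>t. (shift t ?f - ?f) /\<^sub>R t) (mult_op E g) (at_right 0)"
    by (simp only: gauge_difference_quotient)
  have bd': "norm (shift t ?f - ?f) \<le> (?k * K) * t" if t: "0 < t" "t \<le> 1" for t
  proof -
    have "shift t ?f - ?f = mult_op E (flow t f - f)" by (simp add: gauge.mult_op_diff gauge_flow)
    then have "norm (shift t ?f - ?f) \<le> ?k * norm (flow t f - f)" by (simp add: gauge.norm_mult_op_le)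
    also have "\<dots> \<le> ?k * (K * t)" using K[of t] t by (intro mult_left_mono) (auto simp: divide_le_eq)
    finally show ?thesis by (simp add: mult.assoc)
  qed
  obtain a h' where lip': "is_lipschitz_with ?f a h'" and h'X: "h' \<in> Linf_space (l1_space J)"
    and "\<And>j x. prim (mult_op E g) j x = c j *\<^sub>R prim h' j x"
    and coupling': "\<And>j. a j + prim h' j 1 = (\<Sum>l\<in>{l. M j l \<noteq> 0}. M j l * a l)"
    by - (rule shift_generator_converse[OF fX lim' bd'], assumption+, rule that)
  define h where "h = mult_op E' (h' + mult_op (\<lambda>j s. - u j s) ?f)"
  have h: "AE s in unit_interval_measure. coord h j s = E' j s * (coord h' j s + - u j s * coord ?f j s)" for j
    unfolding h_def by (rule neg.coord_gauge_derivative)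
  have hX: "h \<in> Linf_space (l1_space J)"
    unfolding h_def by (intro neg.gauge.mult_op_in_space Linf_space_l1_add h'X neg.mult_op_in_space fX)
  have lip: "is_lipschitz_with f a h"
    using neg.is_lipschitz_with_gauge[OF lip' h] by (simp add: ungauge_gauge)
  have "a j + prim h j 1 = (\<Sum>l\<in>{l. B j l \<noteq> 0}. B j l * a l)" for j
  proof -
    have "a j + prim h j 1 = E' j 1 * (a j + prim h' j 1)"
      using neg.gauge_continuous_rep[OF lip' h, of 1 j] by simp
    also have "\<dots> = (\<Sum>l\<in>{l. B j l \<noteq> 0}. (E' j 1 * E j 1) * B j l * a l)"
      unfolding coupling' M_support by (simp add: M_def sum_distrib_left mult.assoc)
    finally show ?thesis by (simp add: E_inverse)
  qed
  with f hX lip show ?thesis unfolding flow_dom_def by blast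
qed

theorem generates_flow:
  "generates_bi_continuous_semigroup Linf_scale (Linf_space (l1_space J)) (weak_star J) (flow_operator J c q) flow_dom"
  unfolding generates_bi_continuous_semigroup_def
proof (intro exI[of _ flow] conjI ballI)
  show "bi_continuous_semigroup Linf_scale (Linf_space (l1_space J)) (weak_star J) flow"
    by (rule bi_continuous_semigroup_flow)
  show "generator_domain (Linf_space (l1_space J)) (weak_star J) flow = flow_dom"
  proof (intro equalityI subsetI)
    fix f assume "f \<in> generator_domain (Linf_space (l1_space J)) (weak_star J) flow"
    then show "f \<in> flow_dom"
      unfolding generator_domain_def using flow_difference_quotient_converse by blast
  next
    fix f assume "f \<in> flow_dom"
    then obtain a h where f: "f \<in> Linf_space (l1_space J)" and h: "h \<in> Linf_space (l1_space J)"
      and lip: "is_lipschitz_with f a h" and coupling: "\<And>j. a j + prim h j 1 = (\<Sum>l\<in>{l. B j l \<noteq> 0}. B j l * a l)"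
      unfolding flow_dom_def by blast
    show "f \<in> generator_domain (Linf_space (l1_space J)) (weak_star J) flow"
      unfolding generator_domain_def using f flow_difference_quotient[OF lip f h coupling] by blast
  qed
  fix f assume "f \<in> flow_dom"
  then obtain a h where f: "f \<in> Linf_space (l1_space J)" and h: "h \<in> Linf_space (l1_space J)"
    and lip: "is_lipschitz_with f a h" and coupling: "\<And>j. a j + prim h j 1 = (\<Sum>l\<in>{l. B j l \<noteq> 0}. B j l * a l)"
    unfolding flow_dom_def by blast
  have Hd: "Hausdorff_space (weak_star J :: 'k l1 Linf topology)"
    by (rule bi_admissible_space.Hausdorff[OF weak_star_admissible])
  note lim = flow_difference_quotient(1)[OF lip f h coupling]
  have "generator (weak_star J) flow f = flow_value f h"
    unfolding generator_def
  proof (rule the_equality)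
    show "limitin (weak_star J) (\<lambda>t. (flow t f - f) /\<^sub>R t) (flow_value f h) (at_right 0)" by (rule lim)
    fix g assume "limitin (weak_star J) (\<lambda>t. (flow t f - f) /\<^sub>R t) g (at_right 0)"
    from limitin_Hausdorff_unique[OF this lim _ Hd] show "g = flow_value f h" by simp
  qed
  then show "generator (weak_star J) flow f = flow_operator J c q f"
    by (simp add: flow_operator_eq_flow_value[OF lip f h])
qed

end


lemma finite_speeds_if_commensurable:
  fixes c :: "'a \<Rightarrow> real"
  assumes "0 < c_min" "\<And>j. j \<in> J \<Longrightarrow> c_min \<le> c j" "0 < d" "\<And>j. j \<in> J \<Longrightarrow> d / c j \<in> \<nat>"
  shows "finite (c ` J)"
proof (rule finite_subset)
  show "c ` J \<subseteq> (\<lambda>n. d / real n) ` {..nat \<lfloor>d / c_min\<rfloor>}"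
  proof
    fix x assume "x \<in> c ` J"
    then obtain j where j: "j \<in> J" "x = c j" by blast
    obtain n where n: "d / c j = real n" using assms(4)[OF j(1)] by (auto elim: Nats_cases)
    have c: "0 < c j" using assms(1,2) j(1) by fastforce
    have "real n \<le> d / c_min" unfolding n[symmetric] using assms(1-3) j(1) c by (intro divide_left_mono) auto
    then have "n \<le> nat \<lfloor>d / c_min\<rfloor>" by linarith
    moreover have "c j = d / real n" using c assms(3) by (simp flip: n)
    ultimately show "x \<in> (\<lambda>n. d / real n) ` {..nat \<lfloor>d / c_min\<rfloor>}" using j(2) by blast
  qed
qed simp

theorem theorem3p10:
  fixes G :: "('v, nat) pre_digraph" and w :: "nat \<Rightarrow> nat \<Rightarrow> real"
    and c :: "nat \<Rightarrow> real" and c_min c_max :: real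
    and q :: "(nat \<Rightarrow>\<^sub>C 'k::{real_normed_field, euclidean_space}) Linf"
  assumes "weighted_graph G w"
    and "0 < c_min" and "\<forall>j\<in>arcs G. c_min \<le> c j \<and> c j \<le> c_max"
    and "\<exists>d::real. 0 < d \<and> (\<forall>j\<in>arcs G. d / c j \<in> \<nat>)"
    and "q \<in> Linf_space (linf_space (arcs G))"
  shows "generates_bi_continuous_semigroup
           (Linf_scale :: 'k \<Rightarrow> 'k l1 Linf \<Rightarrow> 'k l1 Linf)
           (Linf_space (l1_space (arcs G)))
           (weak_star (arcs G))
           (flow_operator (arcs G) c q)
           (flow_domain G w c)"
proof -
  interpret G: weighted_graph G w by fact
  define J where "J = arcs G"
  have c_bounds: "c_min \<le> c j" "c j \<le> c_max" if "j \<in> J" for j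
    using assms(3) that by (auto simp: J_def)
  \<comment> \<open>outside \<open>J\<close> any value of at least \<open>c_min\<close> will do\<close>
  define c' where "c' j = (if j \<in> J then c j else c_min)" for j
  define B :: "nat \<Rightarrow> nat \<Rightarrow> 'k" where
    "B j l = (if j \<in> J \<and> l \<in> J then of_real (diag_conjugate c (line_graph_matrix G w) j l) else 0)" for j l
  interpret F: flow_network J c' B c_min "\<bar>c_max / c_min\<bar>" q
  proof
    show "0 < c_min" by fact
    show "c_min \<le> c' j" for j using c_bounds(1) by (simp add: c'_def)
    obtain d where "0 < d" "\<And>j. j \<in> J \<Longrightarrow> d / c j \<in> \<nat>" using assms(4) by (auto simp: J_def)
    with assms(2) c_bounds(1) have "finite (c ` J)" by (rule finite_speeds_if_commensurable)
    then show "finite (range c')"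
      by (rule finite_subset[rotated, OF finite_insert[THEN iffD2]]) (auto simp: c'_def)
    show "j \<notin> J \<Longrightarrow> B j l = 0" for j l by (simp add: B_def)
    show "finite {l. B j l \<noteq> 0}" for j
    proof (cases "j \<in> J")
      case True
      have "{l. B j l \<noteq> 0} \<subseteq> in_arcs G (tail G j)"
        by (auto simp: B_def J_def diag_conjugate_def line_graph_matrix_def split: if_splits)
      moreover have "finite (in_arcs G (tail G j))"
        using G.locally_finite[of "tail G j"] True by (simp add: J_def)
      ultimately show ?thesis by (rule finite_subset)
    qed (simp add: B_def)
    show "(\<Sum>j\<in>S. norm (B j l)) \<le> \<bar>c_max / c_min\<bar>" if S: "finite S" for S l
    proof (cases "l \<in> J")
      case True
      have le: "norm (B j l) \<le> \<bar>c_max / c_min\<bar> * w j l" if j: "j \<in> J" for j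
      proof -
        have w: "0 \<le> w j l" using G.weight_bounds j True by (simp add: J_def)
        have cj: "0 < c j" and cl: "0 < c l" using c_bounds(1) j True assms(2) by fastforce+
        have "norm (B j l) = \<bar>diag_conjugate c (line_graph_matrix G w) j l\<bar>" using j True by (simp add: B_def)
        also have "\<dots> \<le> (c l / c j) * w j l"
          using w cj cl by (simp add: diag_conjugate_def line_graph_matrix_def abs_mult field_simps)
        also have "\<dots> \<le> (c_max / c_min) * w j l"
          using c_bounds[OF j] c_bounds[OF True] cl assms(2) w by (intro mult_right_mono frac_le) auto
        also have "\<dots> \<le> \<bar>c_max / c_min\<bar> * w j l" using w by (intro mult_right_mono abs_ge_self)
        finally show ?thesis .
      qed
      have "(\<Sum>j\<in>S. norm (B j l)) = (\<Sum>j\<in>S \<inter> J. norm (B j l))"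
        using S by (intro sum.mono_neutral_right) (auto simp: B_def)
      also have "\<dots> \<le> (\<Sum>j\<in>S \<inter> J. \<bar>c_max / c_min\<bar> * w j l)" by (intro sum_mono le) auto
      also have "\<dots> = \<bar>c_max / c_min\<bar> * (\<Sum>j\<in>S \<inter> J. w j l)" by (simp add: sum_distrib_left)
      also have "\<dots> \<le> \<bar>c_max / c_min\<bar> * 1"
        using finite_sum_le_has_sum[OF G.weight_sum[of l], of "S \<inter> J"] S True G.weight_bounds
        by (intro mult_left_mono) (simp_all add: J_def)
      finally show ?thesis by simp
    qed (simp add: B_def)
  qed
  have "flow_operator J c' q = flow_operator J c q"
    unfolding flow_operator_def c'_def by (simp cong: if_cong)
  moreover have "F.flow_dom = flow_domain G w c"
  proof -
    have coupling: "(l1_nth (continuous_rep f 1) = matrix_apply J (diag_conjugate c (line_graph_matrix G w)) (l1_nth (continuous_rep f 0)))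
        \<longleftrightarrow> (\<forall>j. a j + prim h j 1 = (\<Sum>l\<in>{l. B j l \<noteq> 0}. B j l * a l))"
      if lip: "is_lipschitz_with f a h" for f h :: "'k l1 Linf" and a
    proof -
      have "matrix_apply J (diag_conjugate c (line_graph_matrix G w)) (l1_nth (continuous_rep f 0)) j
          = (\<Sum>l\<in>{l. B j l \<noteq> 0}. B j l * a l)" for j
      proof (cases "j \<in> J")
        case True
        have a: "l1_nth (continuous_rep f 0) l = a l" for l
          using continuous_rep_eq[OF lip, of 0 l] by (simp add: prim_eq_0)
        have "(\<Sum>\<^sub>\<infinity>l\<in>J. of_real (diag_conjugate c (line_graph_matrix G w) j l) * a l)
            = (\<Sum>\<^sub>\<infinity>l\<in>{l. B j l \<noteq> 0}. B j l * a l)"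
          by (rule infsum_cong_neutral) (use True in \<open>auto simp: B_def split: if_splits\<close>)
        then show ?thesis using True F.row_finite by (simp add: matrix_apply_def a)
      qed (simp add: matrix_apply_def B_def)
      then show ?thesis by (simp add: fun_eq_iff continuous_rep_eq[OF lip])
    qed
    show ?thesis
      unfolding F.flow_dom_def flow_domain_def W1inf_space_iff J_def[symmetric] using coupling by blast
  qed
  ultimately show ?thesis using F.generates_flow by (simp add: J_def)
qed

end
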